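(* Let $H$ be the Hilbert function of $K[x,y,z]/I$, where $I$ is a saturated homogeneous ideal defining a zero-dimensional subscheme of $\mathbb{P}^2$, and let $h_i=H_i-H_{i-1}$ (with $H_{-1}=0$). Let $K$ be a field of characteristic $p>\max\{j: h_j\neq0\}$ or of characteristic $0$. Denote by $\mathrm{Lex}(h)$ the lex-segment ideal of $R=K[x,y]$ with Hilbert function $h$ (i.e. $\dim_K(R/\mathrm{Lex}(h))_i=h_i$ for all $i$), by $n=\dim_K(R/\mathrm{Lex}(h))$, and by $t=\mu(\mathrm{Lex}(h))-1$ the number of minimal generators of $\mathrm{Lex}(h)$ minus $1$. For $n\ge2$ we have $$\max\{n+t,\ n+2\}\ \le\ \dim \mathrm{Hilb}^H(\mathbb{P}^2)\ \le\ 2n.$$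
   Context: $\mathrm{Hilb}^H(\mathbb{P}^2)$ denotes the Hilbert function stratum of the Hilbert scheme $\mathrm{Hilb}^n(\mathbb{P}^2)$ of $n$ points: it parametrizes the zero-dimensional subschemes of $\mathbb{P}^2$ over $K$ whose saturated homogeneous ideal $I\subset K[x,y,z]$ has $\dim_K(K[x,y,z]/I)_i=H_i$ for all $i$. A monomial ideal of $R$ is a lex-segment ideal if for every monomial $u$ of degree $d$ in it, all monomials $v$ of degree $d$ with $v>_{\mathrm{Lex}}u$ (where $x>y$) also lie in it. *)

theory Defs
  imports
    "HOL-Analysis.Analysis"
    "HOL-Algebra.Algebraic_Closure_Type"
    "HOL-Library.Poly_Mapping"
    "HOL-Library.Numeral_Type"
    "HOL-Library.Extended_Nat"
begin

section \<open>Polynomials and ideals\<close>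

text \<open>
  \<open>('v, 'k) mpoly\<close> is the polynomial ring over \<open>'k\<close> in variables indexed by \<open>'v\<close>.
  Throughout, \<open>R = K[x,y]\<close> is \<open>(2, 'k) mpoly\<close> with \<open>x, y\<close> the variables \<open>0, 1\<close>, and
  \<open>K[x,y,z]\<close> is \<open>(3, 'k) mpoly\<close>.
\<close>

type_synonym 'v exps = "'v \<Rightarrow>\<^sub>0 nat"
type_synonym ('v, 'k) mpoly = "'v exps \<Rightarrow>\<^sub>0 'k"

definition monom :: "'v exps \<Rightarrow> ('v, 'k::comm_ring_1) mpoly" where
  "monom m = Poly_Mapping.single m 1"

definition scale :: "'k::comm_ring_1 \<Rightarrow> ('v, 'k) mpoly \<Rightarrow> ('v, 'k) mpoly" where
  "scale c f = Poly_Mapping.single 0 c * f"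

global_interpretation kvec: vector_space "scale :: 'k::field \<Rightarrow> ('v, 'k) mpoly \<Rightarrow> ('v, 'k) mpoly"
proof
  fix a b :: 'k and f g :: "('v, 'k) mpoly"
  show "scale a (f + g) = scale a f + scale a g"
    by (simp add: scale_def distrib_left)
  show "scale (a + b) f = scale a f + scale b f"
    by (simp add: scale_def single_add distrib_right)
  show "scale a (scale b f) = scale (a * b) f"
    by (simp add: scale_def mult.assoc [symmetric] mult_single)
  show "scale 1 f = f"
    by (simp add: scale_def)
qed

text \<open>The subspaces of a commutative ring as a module over itself are its ideals.\<close>

global_interpretation self_module: Modules.module "(*) :: 'a::comm_ring_1 \<Rightarrow> 'a \<Rightarrow> 'a"
  by standard (simp_all add: algebra_simps)

abbreviation is_ideal :: "'a::comm_ring_1 set \<Rightarrow> bool" where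
  "is_ideal \<equiv> self_module.subspace"

abbreviation ideal_generated :: "'a::comm_ring_1 set \<Rightarrow> 'a set" where
  "ideal_generated \<equiv> self_module.span"

definition prime_ideal :: "'a::comm_ring_1 set \<Rightarrow> bool" where
  "prime_ideal P \<longleftrightarrow> is_ideal P \<and> P \<noteq> UNIV \<and> (\<forall>f g. f * g \<in> P \<longrightarrow> f \<in> P \<or> g \<in> P)"

text \<open>The number of minimal generators of a homogeneous ideal, as the least size of a
  generating set.\<close>

definition num_generators :: "'a::comm_ring_1 set \<Rightarrow> nat" where
  "num_generators I = (LEAST k. \<exists>G. finite G \<and> card G = k \<and> ideal_generated G = I)"


section \<open>Grading and Hilbert functions\<close>

definition mdeg :: "'v exps \<Rightarrow> nat" where
  "mdeg m = (\<Sum>x\<in>Poly_Mapping.keys m. Poly_Mapping.lookup m x)"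

definition forms :: "nat \<Rightarrow> ('v, 'k::comm_ring_1) mpoly set" where
  "forms d = {f. \<forall>m\<in>Poly_Mapping.keys f. mdeg m = d}"

definition hom_component :: "nat \<Rightarrow> ('v, 'k::comm_ring_1) mpoly \<Rightarrow> ('v, 'k) mpoly" where
  "hom_component d f =
     (\<Sum>m\<in>{m \<in> Poly_Mapping.keys f. mdeg m = d}. Poly_Mapping.single m (Poly_Mapping.lookup f m))"

definition homogeneous_ideal :: "('v, 'k::comm_ring_1) mpoly set \<Rightarrow> bool" where
  "homogeneous_ideal I \<longleftrightarrow> is_ideal I \<and> (\<forall>f\<in>I. \<forall>d. hom_component d f \<in> I)"

text \<open>\<open>I\<close> contains \<open>(I : \<mm>\<^sup>k)\<close> for all \<open>k\<close>, where \<open>\<mm>\<close> is the ideal generated by the variables;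
  \<open>\<mm>\<^sup>k\<close> is generated by the forms of degree \<open>k\<close>.\<close>

definition saturated_ideal :: "('v, 'k::comm_ring_1) mpoly set \<Rightarrow> bool" where
  "saturated_ideal I \<longleftrightarrow> (\<forall>f. (\<exists>k. \<forall>g\<in>forms k. g * f \<in> I) \<longrightarrow> f \<in> I)"

text \<open>For subspaces \<open>W \<subseteq> V\<close>: the residue classes of \<open>B \<subseteq> V\<close> are pairwise distinct and form a
  basis of \<open>V / W\<close>.\<close>

definition quot_basis ::
  "('v, 'k::field) mpoly set \<Rightarrow> ('v, 'k) mpoly set \<Rightarrow> ('v, 'k) mpoly set \<Rightarrow> bool" where
  "quot_basis V W B \<longleftrightarrow>
     B \<subseteq> V \<and> kvec.independent B \<and> kvec.span B \<inter> W = {0} \<and> V \<subseteq> kvec.span (B \<union> W)"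

text \<open>\<open>dim\<^sub>K (V / W)\<close>; as for \<^const>\<open>vector_space.dim\<close>, the value is \<open>0\<close> in the infinite-dimensional case.\<close>

definition quot_dim :: "('v, 'k::field) mpoly set \<Rightarrow> ('v, 'k) mpoly set \<Rightarrow> nat" where
  "quot_dim V W = card (SOME B. quot_basis V W B)"

definition hilbert_function :: "('v, 'k::field) mpoly set \<Rightarrow> nat \<Rightarrow> nat" where
  "hilbert_function I i = quot_dim (forms i) (I \<inter> forms i)"

definition first_difference :: "(nat \<Rightarrow> nat) \<Rightarrow> nat \<Rightarrow> int" where
  "first_difference H i = int (H i) - (if i = 0 then 0 else int (H (i - 1)))"


section \<open>Lex-segment ideals\<close>

definition monomial_ideal :: "('v, 'k::comm_ring_1) mpoly set \<Rightarrow> bool" where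
  "monomial_ideal I \<longleftrightarrow> (\<exists>A. I = ideal_generated (monom ` A))"

text \<open>The order \<open><\<close> on exponent vectors is the lexicographic one, decided at the first variable
  with different exponents; hence \<open>u < v\<close> is \<open>v >\<^bsub>Lex\<^esub> u\<close> for \<open>x > y\<close>.\<close>

definition lex_segment_ideal :: "(2, 'k::comm_ring_1) mpoly set \<Rightarrow> bool" where
  "lex_segment_ideal I \<longleftrightarrow> monomial_ideal I \<and>
     (\<forall>u v. monom u \<in> I \<and> mdeg v = mdeg u \<and> u < v \<longrightarrow> monom v \<in> I)"

definition Lex :: "(nat \<Rightarrow> int) \<Rightarrow> (2, 'k::field) mpoly set" where
  "Lex h = (THE L. lex_segment_ideal L \<and> (\<forall>i. int (hilbert_function L i) = h i))"


section \<open>Krull dimension and projective schemes\<close>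

definition irreducible_closedin :: "'a topology \<Rightarrow> 'a set \<Rightarrow> bool" where
  "irreducible_closedin T C \<longleftrightarrow> closedin T C \<and> C \<noteq> {} \<and>
     (\<forall>A B. closedin T A \<and> closedin T B \<and> C = A \<union> B \<longrightarrow> C = A \<or> C = B)"

text \<open>The empty space gets dimension \<open>0\<close>.\<close>

definition krull_dim :: "'a topology \<Rightarrow> enat" where
  "krull_dim T = Sup {enat k | k C.
     (\<forall>i\<le>k. irreducible_closedin T (C i)) \<and> (\<forall>i<k. C i \<subset> C (Suc i))}"

text \<open>The underlying space of \<open>Proj(K[x,y,z] / I)\<close>, the subscheme of the projective plane
  defined by \<open>I\<close>: the homogeneous primes containing \<open>I\<close> but not all variables.\<close>

definition proj_points :: "('v, 'k::field) mpoly set \<Rightarrow> ('v, 'k) mpoly set set" where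
  "proj_points I = {P. prime_ideal P \<and> homogeneous_ideal P \<and> I \<subseteq> P \<and>
     (\<exists>x. monom (Poly_Mapping.single x 1) \<notin> P)}"

definition proj_space :: "('v, 'k::field) mpoly set \<Rightarrow> ('v, 'k) mpoly set topology" where
  "proj_space I = topology_generated_by {{P \<in> proj_points I. f \<notin> P} | f d. f \<in> forms d}"

definition defines_zero_dimensional :: "('v, 'k::field) mpoly set \<Rightarrow> bool" where
  "defines_zero_dimensional I \<longleftrightarrow> proj_points I \<noteq> {} \<and> krull_dim (proj_space I) = 0"


section \<open>The Hilbert scheme of points of the projective plane\<close>

text \<open>
  The Hilbert scheme of \<open>n\<close> points of the projective plane over \<open>K\<close> is a \<open>K\<close>-scheme of finite
  type. Its topological space is represented by its geometric points (subschemes over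
  the algebraic closure of \<open>K\<close>, given by their saturated ideals) with the topology whose closed
  sets are those defined over \<open>K\<close>. The closed sets of this space correspond bijectively, with
  inclusions and unions, to those of the \<open>K\<close>-scheme (the closed points of the scheme are the Galois
  orbits of geometric points), so both spaces have the same Krull dimension; the same holds for
  locally closed subsets.
\<close>

definition hilb_points :: "nat \<Rightarrow> (3, 'k::field alg_closure) mpoly set set" where
  "hilb_points n = {J. homogeneous_ideal J \<and> saturated_ideal J \<and>
     (\<forall>\<^sub>F i in sequentially. hilbert_function J i = n)}"

text \<open>
  The topology is that of the standard embedding \<open>J \<mapsto> J\<^sub>n\<close> into the Grassmannian of subspaces of
  codimension \<open>n\<close> of the space of forms of degree \<open>n\<close> (\<open>n\<close> is the Gotzmann number of the constant
  Hilbert polynomial \<open>n\<close>). An affine chart of the Grassmannian is given by a set \<open>B\<close> of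
  monomials of degree \<open>n\<close>, and consists of the subspaces modulo which \<open>B\<close> is a basis; the
  coordinates on it are the coefficients in the expansions, modulo the subspace, of the monomials
  \<open>m\<close> of degree \<open>n\<close> in terms of the \<open>b \<in> B\<close>.
\<close>

definition hilb_chart :: "nat \<Rightarrow> 3 exps set \<Rightarrow> (3, 'k::field alg_closure) mpoly set set" where
  "hilb_chart n B = {J \<in> hilb_points n. quot_basis (forms n) (J \<inter> forms n) (monom ` B)}"

definition chart_coord ::
  "nat \<Rightarrow> 3 exps set \<Rightarrow> (3, 'k::field alg_closure) mpoly set \<Rightarrow> 3 exps \<times> 3 exps \<Rightarrow> 'k alg_closure" where
  "chart_coord n B J = (\<lambda>(m, b). if mdeg m = n \<and> b \<in> B
     then (THE c. (\<forall>b'. b' \<notin> B \<longrightarrow> c b' = 0) \<and> monom m - (\<Sum>b'\<in>B. scale (c b') (monom b')) \<in> J) b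
     else 0)"

definition eval_over :: "('v, 'k::field) mpoly \<Rightarrow> ('v \<Rightarrow> 'k alg_closure) \<Rightarrow> 'k alg_closure" where
  "eval_over f a = (\<Sum>m\<in>Poly_Mapping.keys f. to_ac (Poly_Mapping.lookup f m) *
     (\<Prod>v\<in>Poly_Mapping.keys m. a v ^ Poly_Mapping.lookup m v))"

definition hilb_space :: "nat \<Rightarrow> (3, 'k::field alg_closure) mpoly set topology" where
  "hilb_space n = topology_generated_by
     {{J \<in> hilb_chart n B. eval_over f (chart_coord n B J) \<noteq> 0} | B f.
        f \<in> (UNIV :: (3 exps \<times> 3 exps, 'k) mpoly set)}"

definition num_points :: "(nat \<Rightarrow> nat) \<Rightarrow> nat" where
  "num_points H = (THE n. \<forall>\<^sub>F i in sequentially. H i = n)"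

definition hilb_stratum :: "(nat \<Rightarrow> nat) \<Rightarrow> (3, 'k::field alg_closure) mpoly set topology" where
  "hilb_stratum H = subtopology (hilb_space (num_points H)) {J. hilbert_function J = H}"

definition dim_hilb_stratum :: "'k::field itself \<Rightarrow> (nat \<Rightarrow> nat) \<Rightarrow> enat" where
  "dim_hilb_stratum _ H = krull_dim (hilb_stratum H :: (3, 'k alg_closure) mpoly set topology)"

end

theory Submission
  imports "Jordan_Normal_Form.Determinant" "HOL-Library.Function_Algebras" Defs
begin

text \<open>
  Let h be the first difference of H and let d be the least index with h_d \<le> d. The proof describes all
  ideals of finite colength in k[u,v], where k is the algebraic closure of K, by explicit parameters, and
  counts these.

  An ideal I that defines a zero-dimensional scheme has bounded Hilbert function
  (\<open>zero_dimensional_bounded\<close>). After extension of scalars to k, which does not change H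
  (\<open>hilbert_function_ext_ideal\<close>), some linear form a is a nonzerodivisor modulo I
  (\<open>exists_nonzerodivisor\<close>). So h is the Hilbert function of I + (a), hence of a quotient of a polynomial
  ring in two variables, and therefore h_i \<le> i + 1, and h decreases weakly from d on
  (\<open>hf_hyperplane_shape\<close>). Consequently Lex(h) is spanned by the monomials x^i y^j with i \<ge> h_{i+j}
  (\<open>Lex_eq\<close>); it has colength n and is generated by d + 1 monomials, so that t \<le> d.

  Now let J be an ideal of finite colength in k[u][v]. The coefficients of v^l in the elements of v-degree at most l
  form an ideal of k[u], with monic generator Q_l, say, and Q_{l+1} divides Q_l. Put
  \<beta>_l = deg Q_l and q_l = Q_l / Q_{l+1}. Then J is generated over k[u] by the Q_l h_l for suitable monic
  h_l of degree l in v, where h_0 = 1 and h_{i+1} = v h_i - (sum over l \<le> i of a_{il} q_l ... q_{i-1} h_l)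
  with deg a_{il} < deg q_i (\<open>cell_exists\<close>). The parameters of J are the coefficients of the q_i and
  a_{il}; their number is the sum of the (i + 2) (\<beta>_i - \<beta>_{i+1}), which is (sum of the \<beta>_l) + \<beta>_0
  (\<open>card_cell_indices\<close>). Conversely, all values of the parameters occur (\<open>cell_cell_ideal\<close>).

  For the upper bound, among 2n + 1 fixed linear forms there is one that is a nonzerodivisor modulo a given
  point of the stratum. Setting it to 1 puts the point into a cell with (sum of the \<beta>_l) \<le> n, so finitely
  many cells with at most 2n parameters each cover the stratum. On a cell the Grassmann coordinates are
  rational functions of the parameters. Given a chain C_0, ..., C_k of irreducible closed sets, choose
  functions that vanish on C_i but not on C_{i+1}; these are algebraically independent over K on C_k, hence
  on some cell, and counting monomials gives k \<le> 2n (\<open>krull_chain_bound\<close>, \<open>dim_hilb_stratum_le\<close>).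

  For the lower bound, those parameters that let every h_l have total degree at most l yield homogeneous
  ideals with one common Hilbert function, which counts the boxes (l, s), s < \<beta>_l, by their degree l + s
  (\<open>hilbert_function_cell_proj\<close>). The parameters can be recovered as polynomials in the Grassmann
  coordinates (\<open>param_in\<close>). Hence the coordinate subspaces of the parameter space have strictly
  increasing irreducible closures in the stratum, whose dimension is thus at least the number of such
  parameters (\<open>dim_hilb_stratum_ge\<close>). If \<beta>_l is the least s with h_{l+s} \<le> s, the Hilbert function is H
  and all n + \<beta>_0 = n + d parameters are admissible. This suffices if d \<ge> 2. If d = 1, then t \<le> 1, the scheme
  lies on a line, and \<beta> = (n, 0, 0, ...) has n + 2 admissible parameters.
\<close>

hide_const (open) up_ring.coeff Polynomials.degree Polynomials.lead_coeff up_ring.monom UnivPoly.bound Polynomial.monom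
  Finite_Cartesian_Product.mat Finite_Cartesian_Product.vec Determinants.det
no_notation Finite_Cartesian_Product.vec_nth (infixl \<open>$\<close> 90)

declare self_module.scale_scale [simp del]

abbreviation "lookup \<equiv> Poly_Mapping.lookup"
abbreviation "keys \<equiv> Poly_Mapping.keys"
abbreviation "single \<equiv> Poly_Mapping.single"
abbreviation "pmonom \<equiv> Polynomial.monom"

type_synonym 'k ac_ideal = "(3, 'k alg_closure) mpoly set"

section \<open>Polynomials as finitely supported functions\<close>

lemma mpoly_expand: "(\<Sum>m\<in>keys f. single m (lookup f m)) = f"
proof (rule poly_mapping_eqI)
  fix k
  have "lookup (\<Sum>m\<in>keys f. single m (lookup f m)) k = (\<Sum>m\<in>keys f. if m = k then lookup f m else 0)"
    by (simp add: lookup_sum lookup_single when_def)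
  also have "\<dots> = lookup f k"
    by (subst sum.delta) (auto simp: in_keys_iff)
  finally show "lookup (\<Sum>m\<in>keys f. single m (lookup f m)) k = lookup f k" .
qed

definition pp :: "('v \<Rightarrow> 'a::comm_ring_1) \<Rightarrow> 'v exps \<Rightarrow> 'a" where
  "pp g m = (\<Prod>v\<in>keys m. g v ^ lookup m v)"

lemma pp_superset: "finite S \<Longrightarrow> keys m \<subseteq> S \<Longrightarrow> pp g m = (\<Prod>v\<in>S. g v ^ lookup m v)"
  unfolding pp_def by (rule prod.mono_neutral_left) (auto simp: in_keys_iff)

lemma pp_add: "pp g (m + m') = pp g m * pp g m'"
proof -
  let ?S = "keys m \<union> keys m'"
  have "keys (m + m') \<subseteq> ?S" by (rule Poly_Mapping.keys_add)
  then show ?thesis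
    by (simp add: pp_superset[of ?S] lookup_add power_add prod.distrib)
qed

lemma pp_0 [simp]: "pp g 0 = 1"
  by (simp add: pp_def)

lemma pp_single [simp]: "pp g (single v n) = g v ^ n"
  by (simp add: pp_def)

text \<open>The homomorphism that is \<open>\<phi>\<close> on constants and maps the variable
  \<open>v\<close> to \<open>g v\<close>.\<close>

definition evalh :: "('k::comm_ring_1 \<Rightarrow> 'a::comm_ring_1) \<Rightarrow> ('v \<Rightarrow> 'a) \<Rightarrow> ('v, 'k) mpoly \<Rightarrow> 'a" where
  "evalh \<phi> g f = (\<Sum>m\<in>keys f. \<phi> (lookup f m) * pp g m)"

lemma eval_over_evalh: "eval_over f a = evalh to_ac a f"
  by (simp add: eval_over_def evalh_def pp_def)

locale rhom =
  fixes hom :: "'k::comm_ring_1 \<Rightarrow> 'a::comm_ring_1"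
  assumes hom_zero [simp]: "hom 0 = 0" and hom_one [simp]: "hom 1 = 1"
    and hom_add: "hom (x + y) = hom x + hom y" and hom_mult: "hom (x * y) = hom x * hom y"
begin

lemma hom_sum: "hom (\<Sum>i\<in>A. F i) = (\<Sum>i\<in>A. hom (F i))"
  by (induction A rule: infinite_finite_induct) (simp_all add: hom_add)

lemma hom_uminus: "hom (- x) = - hom x"
  using hom_add[of x "- x"] by (simp add: eq_neg_iff_add_eq_0 add.commute)

lemma hom_diff: "hom (x - y) = hom x - hom y"
  using hom_add[of x "- y"] by (simp add: hom_uminus)

lemma hom_power: "hom (x ^ n) = hom x ^ n"
  by (induction n) (simp_all add: hom_mult)

lemma evalh_superset: "finite S \<Longrightarrow> keys f \<subseteq> S \<Longrightarrow> evalh hom g f = (\<Sum>m\<in>S. hom (lookup f m) * pp g m)"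
  unfolding evalh_def by (rule sum.mono_neutral_left) (auto simp: in_keys_iff)

lemma evalh_add: "evalh hom g (f + f') = evalh hom g f + evalh hom g f'"
proof -
  let ?S = "keys f \<union> keys f'"
  have "keys (f + f') \<subseteq> ?S" by (rule Poly_Mapping.keys_add)
  then show ?thesis
    by (simp add: evalh_superset[of ?S] lookup_add hom_add algebra_simps sum.distrib)
qed

lemma evalh_zero [simp]: "evalh hom g 0 = 0"
  by (simp add: evalh_def)

lemma evalh_single [simp]: "evalh hom g (single m c) = hom c * pp g m"
  by (cases "c = 0") (simp_all add: evalh_def)

lemma evalh_sum: "evalh hom g (\<Sum>i\<in>A. F i) = (\<Sum>i\<in>A. evalh hom g (F i))"
  by (induction A rule: infinite_finite_induct) (simp_all add: evalh_add)

lemma evalh_mult: "evalh hom g (f * f') = evalh hom g f * evalh hom g f'"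
proof -
  have "f * f' = (\<Sum>m\<in>keys f. single m (lookup f m)) * (\<Sum>m'\<in>keys f'. single m' (lookup f' m'))"
    by (simp only: mpoly_expand)
  also have "\<dots> = (\<Sum>m\<in>keys f. \<Sum>m'\<in>keys f'. single (m + m') (lookup f m * lookup f' m'))"
    by (simp only: sum_product mult_single)
  finally have "evalh hom g (f * f') = (\<Sum>m\<in>keys f. \<Sum>m'\<in>keys f'. (hom (lookup f m) * pp g m) * (hom (lookup f' m') * pp g m'))"
    by (simp only: evalh_sum hom_mult pp_add evalh_single mult.assoc mult.left_commute)
  then show ?thesis by (simp only: evalh_def sum_product)
qed

lemma evalh_one [simp]: "evalh hom g 1 = 1"
  using evalh_single[of g 0 1] by simp

lemma evalh_hom: "rhom (evalh hom g)"
  by (rule rhom.intro) (simp_all add: evalh_add evalh_mult)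

end

lemma rhom_to_ac: "rhom to_ac"
  by (rule rhom.intro) simp_all

lemma rhom_comp: "rhom f \<Longrightarrow> rhom g \<Longrightarrow> rhom (\<lambda>x. f (g x))"
  by (auto simp: rhom_def)

lemma hom_eq_evalh:
  assumes "rhom H" and "\<And>c. H (single 0 c) = \<phi> c" and "\<And>v. H (monom (single v 1)) = g v"
  shows "H f = evalh \<phi> g f"
proof -
  interpret H: rhom H by fact
  have pw: "H (monom (single v e)) = g v ^ e" for v e
  proof (induction e)
    case (Suc e)
    have "monom (single v (Suc e)) = (monom (single v 1) * monom (single v e) :: ('a, 'b) mpoly)"
      by (simp add: monom_def mult_single flip: single_add)
    then show ?case using assms(3) Suc by (simp add: H.hom_mult)
  qed (simp add: monom_def)
  have fin: "H (monom (\<Sum>v\<in>S. single v (lookup m v))) = (\<Prod>v\<in>S. g v ^ lookup m v)" if "finite S" for S m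
    using that
  proof induction
    case (insert v S)
    have "monom (single v (lookup m v) + M) = (monom (single v (lookup m v)) * monom M :: ('a, 'b) mpoly)" for M
      by (simp add: monom_def mult_single)
    then show ?case using insert by (simp add: H.hom_mult pw)
  qed (simp add: monom_def)
  have mon: "H (monom m) = pp g m" for m
    using fin[of "keys m" m] by (simp add: mpoly_expand pp_def)
  have "H (single m c) = \<phi> c * pp g m" for m c
  proof -
    have "single m c = single 0 c * monom m" by (simp add: monom_def mult_single)
    then show ?thesis by (simp add: H.hom_mult assms mon)
  qed
  then have "H (\<Sum>m\<in>keys f. single m (lookup f m)) = evalh \<phi> g f"
    by (simp add: H.hom_sum evalh_def)
  then show ?thesis by (simp add: mpoly_expand)
qed

section \<open>Degrees, forms and coefficients\<close>

lemma mdeg_superset: "finite S \<Longrightarrow> keys m \<subseteq> S \<Longrightarrow> mdeg m = (\<Sum>v\<in>S. lookup m v)"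
  unfolding mdeg_def by (rule sum.mono_neutral_left) (auto simp: in_keys_iff)

lemma mdeg_UNIV: "mdeg (m :: 'v::finite exps) = (\<Sum>v\<in>UNIV. lookup m v)"
  by (rule mdeg_superset) auto

lemma mdeg_add: "mdeg (m + m') = mdeg m + mdeg m'"
proof -
  let ?S = "keys m \<union> keys m'"
  have "keys (m + m') \<subseteq> ?S" by (rule Poly_Mapping.keys_add)
  then show ?thesis by (simp add: mdeg_superset[of ?S] lookup_add sum.distrib)
qed

lemma mdeg_0 [simp]: "mdeg 0 = 0" by (simp add: mdeg_def)
lemma mdeg_single [simp]: "mdeg (single v n) = n" by (simp add: mdeg_def)

lemma lookup_le_mdeg: "lookup m v \<le> mdeg m"
proof (cases "v \<in> keys m")
  case True
  then show ?thesis unfolding mdeg_def by (rule member_le_sum) auto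
qed (simp add: in_keys_iff)

lemma lookup_scale [simp]: "lookup (scale c f) m = c * lookup f m"
  unfolding scale_def mult_map_scale_conv_mult[symmetric] by (simp add: Poly_Mapping.map.rep_eq when_def)

lemma lookup_monom: "lookup (monom u) m = (if u = m then 1 else 0)"
  by (simp add: monom_def lookup_single when_def)

lemma scale_monom: "scale c (monom m) = single m c"
  by (simp add: scale_def monom_def mult_single)

lemma monom_mult: "monom u * monom v = (monom (u + v) :: ('v, 'k::comm_ring_1) mpoly)"
  by (simp add: monom_def mult_single)

lemma monom_zero_exps [simp]: "monom 0 = 1"
  by (simp add: monom_def)

lemma inj_monom: "inj (monom :: 'v exps \<Rightarrow> ('v, 'k::comm_ring_1) mpoly)"
  by (rule injI) (metis lookup_monom zero_neq_one)

lemma monom_eq_iff [simp]: "monom u = (monom v :: ('v, 'k::comm_ring_1) mpoly) \<longleftrightarrow> u = v"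
  using inj_monom by (auto dest: injD)

lemma monom_neq_0 [simp]: "monom u \<noteq> (0 :: ('v, 'k::comm_ring_1) mpoly)"
  by (metis lookup_monom lookup_zero zero_neq_one)

lemma mpoly_expand_monom: "(\<Sum>m\<in>keys f. scale (lookup f m) (monom m)) = f"
  by (simp add: scale_monom mpoly_expand)

lemma lookup_monom_mult [simp]: "lookup (monom u * f) (u + m) = lookup f m"
proof -
  have "monom u * f = (\<Sum>m'\<in>keys f. monom u * single m' (lookup f m'))"
    by (simp only: mpoly_expand flip: sum_distrib_left)
  also have "\<dots> = (\<Sum>m'\<in>keys f. single (u + m') (lookup f m'))"
    by (simp only: monom_def mult_single mult_1)
  finally have "lookup (monom u * f) (u + m) = (\<Sum>m'\<in>keys f. if m' = m then lookup f m' else 0)"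
    by (simp add: lookup_sum lookup_single when_def)
  also have "\<dots> = lookup f m" by (subst sum.delta) (auto simp: in_keys_iff)
  finally show ?thesis .
qed

lemma keys_monom_mult: "keys (monom u * f) = (+) u ` keys f"
proof
  show "keys (monom u * f) \<subseteq> (+) u ` keys f"
    using Poly_Mapping.keys_mult[of "monom u" f] by (auto simp: monom_def split: if_splits)
qed (auto simp: in_keys_iff)

lemma keys_monom [simp]: "keys (monom u :: ('v, 'k::comm_ring_1) mpoly) = {u}"
  by (simp add: monom_def)

lemma formsD: "f \<in> forms d \<Longrightarrow> m \<in> keys f \<Longrightarrow> mdeg m = d"
  by (simp add: forms_def)

lemma monom_in_forms_iff [simp]: "(monom m :: ('v, 'k::comm_ring_1) mpoly) \<in> forms d \<longleftrightarrow> mdeg m = d"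
  by (simp add: forms_def)

lemma forms_zero [simp]: "0 \<in> forms d" by (simp add: forms_def)

lemma forms_add: "f \<in> forms d \<Longrightarrow> g \<in> forms d \<Longrightarrow> f + g \<in> forms d"
  using Poly_Mapping.keys_add[of f g] by (auto simp: forms_def)

lemma forms_scale: "f \<in> forms d \<Longrightarrow> scale c f \<in> forms d"
  by (auto simp: forms_def in_keys_iff)

lemma forms_subspace: "kvec.subspace (forms d)"
  by (rule kvec.subspaceI) (auto intro: forms_add forms_scale)

lemma forms_mult: "f \<in> forms d \<Longrightarrow> g \<in> forms e \<Longrightarrow> f * g \<in> forms (d + e)"
  using Poly_Mapping.keys_mult[of f g] by (auto simp: forms_def mdeg_add)

lemma forms_uminus: "f \<in> forms d \<Longrightarrow> - f \<in> forms d"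
  by (auto simp: forms_def in_keys_iff)

lemma forms_diff: "f \<in> forms d \<Longrightarrow> g \<in> forms d \<Longrightarrow> f - g \<in> forms d"
  using forms_add[OF _ forms_uminus, of f d g] by simp

lemma forms_sum: "(\<And>i. i \<in> A \<Longrightarrow> F i \<in> forms d) \<Longrightarrow> (\<Sum>i\<in>A. F i) \<in> forms d"
  by (induction A rule: infinite_finite_induct) (auto intro: forms_add)

lemma forms_power: "f \<in> forms d \<Longrightarrow> f ^ k \<in> forms (k * d)"
proof (induction k)
  case (Suc k)
  then show ?case using forms_mult[of f d "f ^ k" "k * d"] by simp
qed (simp add: forms_def)

lemma lookup_hom_component: "lookup (hom_component d f) m = (if mdeg m = d then lookup f m else 0)"
proof -
  have "lookup (hom_component d f) m = (\<Sum>m'\<in>{m \<in> keys f. mdeg m = d}. if m' = m then lookup f m' else 0)"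
    by (simp add: hom_component_def lookup_sum lookup_single when_def)
  also have "\<dots> = (if m \<in> {m \<in> keys f. mdeg m = d} then lookup f m else 0)" by (subst sum.delta) simp_all
  also have "\<dots> = (if mdeg m = d then lookup f m else 0)" by (auto simp: in_keys_iff)
  finally show ?thesis .
qed

lemma hom_component_in_forms: "hom_component d f \<in> forms d"
  by (auto simp: forms_def in_keys_iff lookup_hom_component split: if_splits)

lemma hom_component_forms: "f \<in> forms d \<Longrightarrow> hom_component e f = (if e = d then f else 0)"
  by (rule poly_mapping_eqI) (auto simp: lookup_hom_component forms_def in_keys_iff)

lemma hom_component_add: "hom_component d (f + g) = hom_component d f + hom_component d g"
  by (rule poly_mapping_eqI) (simp add: lookup_hom_component lookup_add)

lemma hom_component_0 [simp]: "hom_component d 0 = 0"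
  by (rule poly_mapping_eqI) (simp add: lookup_hom_component)

lemma hom_component_sum: "hom_component d (\<Sum>i\<in>A. F i) = (\<Sum>i\<in>A. hom_component d (F i))"
  by (induction A rule: infinite_finite_induct) (simp_all add: hom_component_add)

lemma sum_hom_components: "finite D \<Longrightarrow> mdeg ` keys f \<subseteq> D \<Longrightarrow> (\<Sum>d\<in>D. hom_component d f) = f"
  by (rule poly_mapping_eqI) (fastforce simp: lookup_sum lookup_hom_component in_keys_iff)

lemma hom_component_form_mult: 
  assumes "g \<in> forms e"
  shows "hom_component (e + d) (g * f) = g * hom_component d f"
proof -
  let ?D = "insert d (mdeg ` keys f)"
  have "g * f = (\<Sum>i\<in>?D. g * hom_component i f)"
    by (subst sum_distrib_left[symmetric], subst sum_hom_components) auto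
  then have "hom_component (e + d) (g * f) = (\<Sum>i\<in>?D. hom_component (e + d) (g * hom_component i f))"
    by (simp only: hom_component_sum)
  also have "\<dots> = (\<Sum>i\<in>?D. if i = d then g * hom_component i f else 0)"
    by (intro sum.cong refl) (auto simp: hom_component_forms[OF forms_mult[OF assms hom_component_in_forms]])
  also have "\<dots> = g * hom_component d f" by (subst sum.delta) auto
  finally show ?thesis .
qed

lemma hom_component_form_mult_less: 
  assumes "g \<in> forms e" "d < e"
  shows "hom_component d (g * f) = 0"
proof (rule poly_mapping_eqI)
  fix m
  have "mdeg m \<noteq> d" if "m \<in> keys (g * f)"
    using Poly_Mapping.keys_mult[of g f] that assms by (auto simp: forms_def mdeg_add)
  then show "lookup (hom_component d (g * f)) m = lookup 0 m"
    by (auto simp: lookup_hom_component in_keys_iff)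
qed

lemma finite_mdeg: "finite {m :: 'v::finite exps. mdeg m = d}"
proof -
  have "lookup m \<in> PiE UNIV (\<lambda>_. {..mdeg m})" for m :: "'v exps"
    unfolding PiE_UNIV_domain by (intro Pi_I) (simp only: atMost_iff lookup_le_mdeg)
  then have "lookup ` {m :: 'v exps. mdeg m = d} \<subseteq> PiE UNIV (\<lambda>_. {..d})"
    by blast
  moreover have "finite (PiE (UNIV :: 'v set) (\<lambda>_. {..d}))"
    by (rule finite_PiE) (rule finite, rule finite_atMost)
  ultimately have "finite (lookup ` {m :: 'v exps. mdeg m = d})"
    by (rule finite_subset)
  moreover have "inj_on lookup {m :: 'v exps. mdeg m = d}"
    by (rule inj_onI) (simp only: poly_mapping_eq_iff)
  ultimately show ?thesis by (rule finite_imageD)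
qed

abbreviation lincomb :: "('v exps \<Rightarrow> 'k::comm_ring_1) \<Rightarrow> 'v exps set \<Rightarrow> ('v, 'k) mpoly" where
  "lincomb c B \<equiv> \<Sum>b\<in>B. scale (c b) (monom b)"

lemma lookup_sum_scale_monom:
  assumes "finite B"
  shows "lookup (lincomb c B) m = (if m \<in> B then c m else 0)"
proof -
  have "lookup (lincomb c B) m = (\<Sum>b\<in>B. if b = m then c b else 0)"
    by (simp add: lookup_sum lookup_monom) (intro sum.cong refl, auto)
  then show ?thesis using assms by (simp add: sum.delta)
qed

lemma form_expand:
  fixes f :: "('v::finite, 'k::field) mpoly"
  assumes "f \<in> forms n"
  shows "(\<Sum>m\<in>{m. mdeg m = n}. scale (lookup f m) (monom m)) = f"
proof -
  have "(\<Sum>m\<in>{m. mdeg m = n}. scale (lookup f m) (monom m)) = (\<Sum>m\<in>keys f. scale (lookup f m) (monom m))"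
    using assms by (intro sum.mono_neutral_right finite_mdeg) (auto simp: forms_def in_keys_iff)
  then show ?thesis by (simp add: mpoly_expand_monom)
qed

subsection \<open>Ideals\<close>

lemma ideal_zero: "is_ideal I \<Longrightarrow> 0 \<in> I" by (rule self_module.subspace_0)
lemma ideal_add: "is_ideal I \<Longrightarrow> f \<in> I \<Longrightarrow> g \<in> I \<Longrightarrow> f + g \<in> I" by (rule self_module.subspace_add)
lemma ideal_mult: "is_ideal I \<Longrightarrow> f \<in> I \<Longrightarrow> g * f \<in> I" by (rule self_module.subspace_scale)
lemma ideal_mult2: "is_ideal I \<Longrightarrow> f \<in> I \<Longrightarrow> f * g \<in> I" by (metis ideal_mult mult.commute)
lemma ideal_diff: "is_ideal I \<Longrightarrow> f \<in> I \<Longrightarrow> g \<in> I \<Longrightarrow> f - g \<in> I" by (rule self_module.subspace_diff)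
lemma ideal_sum: "is_ideal I \<Longrightarrow> (\<And>i. i \<in> A \<Longrightarrow> F i \<in> I) \<Longrightarrow> (\<Sum>i\<in>A. F i) \<in> I"
  by (rule self_module.subspace_sum)
lemma is_idealI: "0 \<in> I \<Longrightarrow> (\<And>f g. f \<in> I \<Longrightarrow> g \<in> I \<Longrightarrow> f + g \<in> I) \<Longrightarrow> (\<And>f g. f \<in> I \<Longrightarrow> g * f \<in> I) \<Longrightarrow> is_ideal I"
  by (rule self_module.subspaceI)

lemma ideal_subspace: "is_ideal I \<Longrightarrow> kvec.subspace I"
  by (rule kvec.subspaceI) (auto simp: scale_def ideal_zero ideal_add ideal_mult)

lemma subspace_Int_forms: "is_ideal I \<Longrightarrow> kvec.subspace (I \<inter> forms d)"
  by (rule kvec.subspace_inter[OF ideal_subspace forms_subspace])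

lemma homogeneous_ideal_ideal: "homogeneous_ideal I \<Longrightarrow> is_ideal I"
  by (simp add: homogeneous_ideal_def)

lemma homogeneous_ideal_mem_iff: 
  assumes "homogeneous_ideal I"
  shows "f \<in> I \<longleftrightarrow> (\<forall>d. hom_component d f \<in> I)"
proof
  assume *: "\<forall>d. hom_component d f \<in> I"
  have "(\<Sum>d\<in>mdeg ` keys f. hom_component d f) \<in> I"
    using assms * by (intro ideal_sum) (auto simp: homogeneous_ideal_def)
  then show "f \<in> I" by (subst (asm) sum_hom_components) auto
qed (use assms in \<open>auto simp: homogeneous_ideal_def\<close>)

abbreviation deg_exps :: "nat \<Rightarrow> 3 exps set" where
  "deg_exps n \<equiv> {m. mdeg m = n}"

section \<open>Dimensions of quotient spaces\<close>

text \<open>Indexed families are used instead of sets of vectors, so that bases can be compared by counting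
  indices.\<close>

definition indep_mod :: "('v, 'k::field) mpoly set \<Rightarrow> 'i set \<Rightarrow> ('i \<Rightarrow> ('v, 'k) mpoly) \<Rightarrow> bool" where
  "indep_mod W A u \<longleftrightarrow> finite A \<and> (\<forall>c. (\<Sum>x\<in>A. scale (c x) (u x)) \<in> W \<longrightarrow> (\<forall>x\<in>A. c x = 0))"

definition span_mod :: "('v, 'k::field) mpoly set \<Rightarrow> ('v, 'k) mpoly set \<Rightarrow> 'i set \<Rightarrow> ('i \<Rightarrow> ('v, 'k) mpoly) \<Rightarrow> bool" where
  "span_mod V W A u \<longleftrightarrow> finite A \<and> (\<forall>f\<in>V. \<exists>c. f - (\<Sum>x\<in>A. scale (c x) (u x)) \<in> W)"

lemma independent_Un_mod:
  assumes "finite C" "kvec.independent C" "kvec.independent W'" "W' \<subseteq> W" "kvec.subspace W" "kvec.span C \<inter> W = {0}"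
  shows "kvec.independent (C \<union> W') \<and> C \<inter> W' = {}"
  using assms(1,2,6)
proof (induction C)
  case empty
  then show ?case using assms by simp
next
  case (insert c C)
  have sub: "kvec.span C \<subseteq> kvec.span (insert c C)" by (rule kvec.span_mono) auto
  have "kvec.span C \<inter> W = {0}"
    using sub insert.prems(2) kvec.span_zero[of C] kvec.subspace_0[OF assms(5)] by auto
  moreover have "kvec.independent C"
    using insert.prems(1) by (rule kvec.independent_mono) auto
  ultimately have IH: "kvec.independent (C \<union> W')" "C \<inter> W' = {}"
    using insert.IH by auto
  have nin: "c \<notin> kvec.span (C \<union> W')"
  proof
    assume "c \<in> kvec.span (C \<union> W')"
    then obtain a w where aw: "c = a + w" "a \<in> kvec.span C" "w \<in> kvec.span W'"
      unfolding kvec.span_Un by blast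
    then have "w \<in> W" using kvec.span_minimal[OF assms(4,5)] by blast
    moreover have "w = c - a" using aw by simp
    then have "w \<in> kvec.span (insert c C)"
      using aw(2) sub by (auto intro: kvec.span_diff kvec.span_base)
    ultimately have "w = 0" using insert.prems by blast
    then have "c \<in> kvec.span C" using aw by simp
    then show False using insert.prems(1) insert.hyps(2) by (simp add: kvec.independent_insert)
  qed
  have "c \<notin> W'" using nin kvec.span_base[of c "C \<union> W'"] by auto
  then have "insert c C \<inter> W' = {}" using IH(2) by blast
  with kvec.independent_insertI[OF nin IH(1)] show ?case unfolding Un_insert_left by (rule conjI)
qed

text \<open>Steinitz exchange modulo \<open>W\<close>: the finitely many elements of \<open>W\<close> that
  occur in the expansions of a finite part of \<open>C\<close> have a finite basis, which is added to both sides
  of the ordinary exchange lemma.\<close>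

lemma quot_exchange:
  assumes W: "kvec.subspace W" and B: "finite B" and C: "C \<subseteq> kvec.span (B \<union> W)" "kvec.independent C" "kvec.span C \<inter> W = {0}"
  shows "finite C \<and> card C \<le> card B"
proof -
  have *: "card C' \<le> card B" if C': "C' \<subseteq> C" "finite C'" for C'
  proof -
    have "\<exists>W'. finite W' \<and> W' \<subseteq> W \<and> c \<in> kvec.span (B \<union> W')" if c: "c \<in> C'" for c
    proof -
      obtain t r where t: "finite t" "t \<subseteq> B \<union> W" "c = (\<Sum>a\<in>t. scale (r a) a)"
      proof -
        have "c \<in> kvec.span (B \<union> W)" using c C'(1) C(1) by (rule_tac subsetD, rule_tac subset_trans)
        then show thesis unfolding kvec.span_explicit mem_Collect_eq
          by (elim exE conjE) (rule that, assumption+)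
      qed
      have "c \<in> kvec.span (B \<union> (t \<inter> W))"
        unfolding t(3) using t(2) by (intro kvec.span_sum kvec.span_scale kvec.span_base) auto
      then show ?thesis using t(1) by (intro exI[of _ "t \<inter> W"]) auto
    qed
    then obtain Wf where Wf: "\<And>c. c \<in> C' \<Longrightarrow> finite (Wf c) \<and> Wf c \<subseteq> W \<and> c \<in> kvec.span (B \<union> Wf c)"
      by metis
    define W1 where "W1 = (\<Union>c\<in>C'. Wf c)"
    have W1: "finite W1" "W1 \<subseteq> W" using Wf C' by (auto simp: W1_def)
    obtain W2 where W2: "W2 \<subseteq> W1" "kvec.independent W2" "W1 \<subseteq> kvec.span W2"
      using kvec.maximal_independent_subset by blast
    have fin2: "finite W2" using W2 W1 finite_subset by blast
    have "B \<union> Wf c \<subseteq> kvec.span (B \<union> W2)" if "c \<in> C'" for c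
    proof -
      have "kvec.span W2 \<subseteq> kvec.span (B \<union> W2)" by (rule kvec.span_mono) auto
      then show ?thesis using W2(3) that kvec.span_superset[of "B \<union> W2"] by (auto simp: W1_def)
    qed
    then have "kvec.span (B \<union> Wf c) \<subseteq> kvec.span (B \<union> W2)" if "c \<in> C'" for c
      using that by (intro kvec.span_minimal kvec.subspace_span)
    then have "C' \<subseteq> kvec.span (B \<union> W2)" using Wf by blast
    moreover have "W2 \<subseteq> kvec.span (B \<union> W2)" using kvec.span_superset[of "B \<union> W2"] by auto
    ultimately have sub: "C' \<union> W2 \<subseteq> kvec.span (B \<union> W2)" by auto
    have ic: "kvec.independent C'" by (rule kvec.independent_mono[OF C(2) C'(1)])
    have "kvec.span C' \<inter> W = {0}"
      using C(3) kvec.span_mono[OF C'(1)] kvec.span_zero[of C'] kvec.subspace_0[OF W] by auto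
    then have I: "kvec.independent (C' \<union> W2)" "C' \<inter> W2 = {}"
      using independent_Un_mod[OF C'(2) ic W2(2) _ W] W2(1) W1(2) by auto
    then have "card (C' \<union> W2) \<le> card (B \<union> W2)"
      using kvec.independent_span_bound[OF _ I(1) sub] B fin2 by auto
    then have "card C' + card W2 \<le> card (B \<union> W2)" using I(2) C'(2) fin2 by (simp add: card_Un_disjoint)
    also have "\<dots> \<le> card B + card W2" by (rule card_Un_le)
    finally show ?thesis by simp
  qed
  have "finite C"
  proof (rule ccontr)
    assume "infinite C"
    then obtain C' where "C' \<subseteq> C" "finite C'" "card C' = Suc (card B)"
      using infinite_arbitrarily_large by metis
    then show False using *[of C'] by simp
  qed
  then show ?thesis using * by blast
qed

lemma quot_basis_dim:
  assumes "kvec.subspace W" "quot_basis V W B" "finite B"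
  shows "quot_dim V W = card B"
proof -
  define B' where "B' = (SOME B. quot_basis V W B)"
  have B': "quot_basis V W B'" unfolding B'_def using assms(2) by (rule someI)
  have B: "B \<subseteq> V" "kvec.independent B" "kvec.span B \<inter> W = {0}" "V \<subseteq> kvec.span (B \<union> W)"
    and B2: "B' \<subseteq> V" "kvec.independent B'" "kvec.span B' \<inter> W = {0}" "V \<subseteq> kvec.span (B' \<union> W)"
    using assms(2) B' unfolding quot_basis_def by simp_all
  have "finite B' \<and> card B' \<le> card B"
    by (rule quot_exchange[OF assms(1,3) subset_trans[OF B2(1) B(4)] B2(2,3)])
  moreover from this have "card B \<le> card B'"
    using quot_exchange[OF assms(1) _ subset_trans[OF B(1) B2(4)] B(2,3)] by simp
  ultimately show ?thesis by (simp add: quot_dim_def flip: B'_def)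
qed

lemma quot_basis_exists:
  assumes W: "kvec.subspace W" and B0: "finite B0" "B0 \<subseteq> V" "V \<subseteq> kvec.span (B0 \<union> W)"
  shows "\<exists>B\<subseteq>B0. quot_basis V W B"
proof -
  define P where "P B \<longleftrightarrow> B \<subseteq> B0 \<and> kvec.independent B \<and> kvec.span B \<inter> W = {0}" for B
  have "P {}" using kvec.subspace_0[OF W] by (auto simp: P_def kvec.independent_empty)
  moreover have "\<forall>B. P B \<longrightarrow> card B < Suc (card B0)" using B0 by (auto simp: P_def less_Suc_eq_le intro: card_mono)
  ultimately have "\<exists>B. P B \<and> (\<forall>B'. P B' \<longrightarrow> card B' \<le> card B)"
    by (rule ex_has_greatest_nat)
  then obtain B where B: "P B" "\<And>B'. P B' \<Longrightarrow> card B' \<le> card B" by blast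
  have finB: "finite B" by (rule finite_subset[of B B0]) (use B(1) B0(1) in \<open>simp_all add: P_def\<close>)
  have "b \<in> kvec.span (B \<union> W)" if b: "b \<in> B0" for b
  proof (rule ccontr)
    assume nb: "b \<notin> kvec.span (B \<union> W)"
    then have bB: "b \<notin> kvec.span B" using kvec.span_mono[of B "B \<union> W"] by auto
    then have "b \<notin> B" using kvec.span_base[of b B] by auto
    have "kvec.span (insert b B) \<inter> W \<subseteq> {0}"
    proof clarify
      fix x assume x: "x \<in> kvec.span (insert b B)" "x \<in> W"
      then obtain k where k: "x - scale k b \<in> kvec.span B" unfolding kvec.span_insert by blast
      have "k = 0"
      proof (rule ccontr)
        assume k0: "k \<noteq> 0"
        have "x \<in> kvec.span (B \<union> W)" using x by (intro kvec.span_base) simp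
        moreover have "x - scale k b \<in> kvec.span (B \<union> W)" using k kvec.span_mono[of B "B \<union> W"] by auto
        ultimately have "x - (x - scale k b) \<in> kvec.span (B \<union> W)" by (rule kvec.span_diff)
        then have "scale k b \<in> kvec.span (B \<union> W)" by simp
        from kvec.span_scale[OF this, of "inverse k"] show False using k0 nb by simp
      qed
      then show "x = 0" using k x B(1) by (auto simp: P_def)
    qed
    then have "kvec.span (insert b B) \<inter> W = {0}"
      using kvec.subspace_0[OF W] kvec.span_zero[of "insert b B"] by auto
    moreover have "kvec.independent (insert b B)"
      using B(1) by (intro kvec.independent_insertI[OF bB]) (simp add: P_def)
    ultimately have "P (insert b B)"
      using b B(1) by (simp add: P_def)
    then show False using B(2)[of "insert b B"] \<open>b \<notin> B\<close> finB by simp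
  qed
  then have "B0 \<union> W \<subseteq> kvec.span (B \<union> W)" using kvec.span_superset[of "B \<union> W"] by auto
  then have "kvec.span (B0 \<union> W) \<subseteq> kvec.span (B \<union> W)" by (rule kvec.span_minimal[OF _ kvec.subspace_span])
  then have "V \<subseteq> kvec.span (B \<union> W)" using B0(3) by (rule subset_trans[rotated])
  moreover have "B \<subseteq> V" using B(1) B0(2) unfolding P_def by (elim conjE) (rule subset_trans)
  ultimately have "quot_basis V W B" using B(1) unfolding P_def quot_basis_def by simp
  then show ?thesis using B(1) unfolding P_def by blast
qed

lemma indep_modD:
  assumes "indep_mod W A u" "kvec.subspace W"
  shows "inj_on u A" "kvec.independent (u ` A)" "kvec.span (u ` A) \<inter> W = {0}"
proof -
  have fin: "finite A" and ind: "\<And>c x. (\<Sum>x\<in>A. scale (c x) (u x)) \<in> W \<Longrightarrow> x \<in> A \<Longrightarrow> c x = 0"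
    using assms by (auto simp: indep_mod_def)
  show inj: "inj_on u A"
  proof (rule inj_onI, rule ccontr)
    fix x y assume xy: "x \<in> A" "y \<in> A" "u x = u y" "x \<noteq> y"
    let ?c = "\<lambda>z. if z = x then 1 else if z = y then -1 else 0"
    have "(\<Sum>z\<in>A. scale (?c z) (u z)) = (\<Sum>z\<in>{x, y}. scale (?c z) (u z))"
      using fin xy by (intro sum.mono_neutral_right) auto
    also have "\<dots> = 0" using xy by (simp add: kvec.scale_minus_left)
    finally show False using ind[of ?c x] xy kvec.subspace_0[OF assms(2)] by simp
  qed
  have tr: "(\<Sum>v\<in>u ` A. scale (d v) v) = (\<Sum>x\<in>A. scale (d (u x)) (u x))" for d
    using inj by (simp add: sum.reindex)
  show "kvec.independent (u ` A)"
  proof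
    assume "kvec.dependent (u ` A)"
    then obtain d where d: "\<exists>v\<in>u ` A. d v \<noteq> 0" "(\<Sum>v\<in>u ` A. scale (d v) v) = 0"
      using kvec.dependent_finite[of "u ` A"] fin by auto
    then have "(\<Sum>x\<in>A. scale (d (u x)) (u x)) \<in> W" using tr kvec.subspace_0[OF assms(2)] by simp
    then show False using ind[of "\<lambda>x. d (u x)"] d(1) by auto
  qed
  show "kvec.span (u ` A) \<inter> W = {0}"
  proof (intro equalityI subsetI)
    fix f assume f: "f \<in> kvec.span (u ` A) \<inter> W"
    then obtain d where d: "f = (\<Sum>v\<in>u ` A. scale (d v) v)" using fin by (auto simp: kvec.span_finite)
    then have "d (u x) = 0" if "x \<in> A" for x
      using f tr ind[of "\<lambda>x. d (u x)" x] that by simp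
    then show "f \<in> {0}" using d tr by simp
  qed (use kvec.span_zero kvec.subspace_0[OF assms(2)] in auto)
qed

lemma span_modD:
  assumes "span_mod V W A u"
  shows "V \<subseteq> kvec.span (u ` A \<union> W)"
proof
  fix f assume "f \<in> V"
  then obtain c where c: "f - (\<Sum>x\<in>A. scale (c x) (u x)) \<in> W" using assms by (auto simp: span_mod_def)
  have "(f - (\<Sum>x\<in>A. scale (c x) (u x))) + (\<Sum>x\<in>A. scale (c x) (u x)) \<in> kvec.span (u ` A \<union> W)"
    using c by (intro kvec.span_add kvec.span_sum kvec.span_scale) (auto intro: kvec.span_base)
  then show "f \<in> kvec.span (u ` A \<union> W)" by simp
qed

lemma quot_dim_le:
  assumes "kvec.subspace W" "u ` A \<subseteq> V" "span_mod V W A u"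
  shows "quot_dim V W \<le> card A"
proof -
  have fin: "finite A" using assms by (simp add: span_mod_def)
  obtain B where B: "B \<subseteq> u ` A" "quot_basis V W B"
    using quot_basis_exists[OF assms(1) finite_imageI[OF fin] assms(2) span_modD[OF assms(3)]] by blast
  then have "finite B" using finite_subset[OF B(1) finite_imageI[OF fin]] by simp
  then have "quot_dim V W = card B" using quot_basis_dim[OF assms(1) B(2)] by simp
  also have "\<dots> \<le> card (u ` A)" using B fin by (intro card_mono) auto
  also have "\<dots> \<le> card A" using fin by (rule card_image_le)
  finally show ?thesis .
qed

lemma quot_dim_ge:
  assumes "kvec.subspace W" "u' ` A' \<subseteq> V" "span_mod V W A' u'" "u ` A \<subseteq> V" "indep_mod W A u"
  shows "card A \<le> quot_dim V W"
proof -
  have fin: "finite A'" using assms by (simp add: span_mod_def)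
  obtain B where B: "B \<subseteq> u' ` A'" "quot_basis V W B"
    using quot_basis_exists[OF assms(1) finite_imageI[OF fin] assms(2) span_modD[OF assms(3)]] by blast
  then have "finite B" using finite_subset[OF B(1) finite_imageI[OF fin]] by simp
  then have *: "quot_dim V W = card B" using quot_basis_dim[OF assms(1) B(2)] by simp
  have "u ` A \<subseteq> kvec.span (B \<union> W)" using B(2) assms(4) by (auto simp: quot_basis_def)
  then have "card (u ` A) \<le> card B"
    using quot_exchange[OF assms(1) \<open>finite B\<close> _ indep_modD(2)[OF assms(5,1)] indep_modD(3)[OF assms(5,1)]] by auto
  then show ?thesis using * card_image[OF indep_modD(1)[OF assms(5,1)]] by simp
qed

lemma quot_basisI:
  assumes "kvec.subspace W" "u ` A \<subseteq> V" "indep_mod W A u" "span_mod V W A u"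
  shows "quot_basis V W (u ` A)"
  using indep_modD[OF assms(3,1)] span_modD[OF assms(4)] assms(2) by (auto simp: quot_basis_def)

lemma quot_dim_eqI:
  assumes "kvec.subspace W" "u ` A \<subseteq> V" "indep_mod W A u" "span_mod V W A u"
  shows "quot_dim V W = card A"
  using quot_dim_le[OF assms(1,2,4)] quot_dim_ge[OF assms(1,2,4,2,3)] by simp

lemma quot_basisD:
  assumes W: "kvec.subspace W" and B: "quot_basis V W B" "finite B"
  shows "indep_mod W B (\<lambda>b. b)" "span_mod V W B (\<lambda>b. b)"
proof -
  show "indep_mod W B (\<lambda>b. b)"
    unfolding indep_mod_def
  proof (intro conjI B allI impI ballI)
    fix c b assume c: "(\<Sum>x\<in>B. scale (c x) x) \<in> W" and b: "b \<in> B"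
    have "(\<Sum>x\<in>B. scale (c x) x) \<in> kvec.span B" by (intro kvec.span_sum kvec.span_scale kvec.span_base)
    then have "(\<Sum>x\<in>B. scale (c x) x) = 0" using c B by (auto simp: quot_basis_def)
    then show "c b = 0" using kvec.independentD[of B B c b] B b by (auto simp: quot_basis_def)
  qed
  show "span_mod V W B (\<lambda>b. b)"
    unfolding span_mod_def
  proof (intro conjI B ballI)
    fix f assume "f \<in> V"
    then have "f \<in> kvec.span (B \<union> W)" using B by (auto simp: quot_basis_def)
    then obtain a w where aw: "f = a + w" "a \<in> kvec.span B" "w \<in> kvec.span W"
      unfolding kvec.span_Un by blast
    moreover have "kvec.span W = W" using W by (simp add: kvec.span_eq_iff)
    moreover obtain c where "a = (\<Sum>x\<in>B. scale (c x) x)" using aw(2) B(2) by (auto simp: kvec.span_finite)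
    ultimately have "f - (\<Sum>x\<in>B. scale (c x) x) \<in> W" by simp
    then show "\<exists>c. f - (\<Sum>x\<in>B. scale (c x) x) \<in> W" by blast
  qed
qed

subsection \<open>Hilbert functions\<close>

lemma monoms_span_mod: "is_ideal J \<Longrightarrow> span_mod (forms i) (J \<inter> forms i) {m :: 'v::finite exps. mdeg m = i} (monom :: _ \<Rightarrow> ('v, 'k::field) mpoly)"
  unfolding span_mod_def
proof (intro conjI finite_mdeg ballI)
  fix f :: "('v, 'k) mpoly" assume f: "f \<in> forms i" and J: "is_ideal J"
  have "f - (\<Sum>m\<in>{m. mdeg m = i}. scale (lookup f m) (monom m)) = 0" by (simp add: form_expand[OF f])
  then show "\<exists>c. f - (\<Sum>m\<in>{m. mdeg m = i}. scale (c m) (monom m)) \<in> J \<inter> forms i"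
    using J by (intro exI[of _ "lookup f"]) (simp add: ideal_zero)
qed

lemma hf_le:
  fixes u :: "'i \<Rightarrow> ('v, 'k::field) mpoly"
  assumes "is_ideal J" "finite A" "\<And>x. x \<in> A \<Longrightarrow> u x \<in> forms i"
    and "\<And>f. f \<in> forms i \<Longrightarrow> \<exists>c. f - (\<Sum>x\<in>A. scale (c x) (u x)) \<in> J"
  shows "hilbert_function J i \<le> card A"
  unfolding hilbert_function_def
proof (rule quot_dim_le[OF subspace_Int_forms[OF assms(1)]])
  show "u ` A \<subseteq> forms i" using assms(3) by auto
  have "f - (\<Sum>x\<in>A. scale (c x) (u x)) \<in> forms i" if "f \<in> forms i" for f c
    using that assms(3) by (intro forms_diff forms_sum forms_scale)
  then show "span_mod (forms i) (J \<inter> forms i) A u"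
    using assms unfolding span_mod_def by blast
qed

lemma hf_ge:
  fixes u :: "'i \<Rightarrow> ('v::finite, 'k::field) mpoly"
  assumes "is_ideal J" "finite A" "\<And>x. x \<in> A \<Longrightarrow> u x \<in> forms i"
    and "\<And>c x. (\<Sum>x\<in>A. scale (c x) (u x)) \<in> J \<Longrightarrow> x \<in> A \<Longrightarrow> c x = 0"
  shows "card A \<le> hilbert_function J i"
  unfolding hilbert_function_def
proof (rule quot_dim_ge[OF subspace_Int_forms[OF assms(1)] _ monoms_span_mod[OF assms(1)]])
  show "monom ` {m. mdeg m = i} \<subseteq> (forms i :: ('v, 'k) mpoly set)" by auto
  show "u ` A \<subseteq> forms i" using assms(3) by auto
  show "indep_mod (J \<inter> forms i) A u" using assms unfolding indep_mod_def by blast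
qed

lemma hf_basis_exists:
  fixes J :: "('v::finite, 'k::field) mpoly set"
  assumes "is_ideal J"
  shows "\<exists>B\<subseteq>{m. mdeg m = i}. quot_basis (forms i) (J \<inter> forms i) (monom ` B)"
proof -
  have "\<exists>B\<subseteq>monom ` {m. mdeg m = i}. quot_basis (forms i) (J \<inter> forms i) B"
    using span_modD[OF monoms_span_mod[OF assms]] finite_mdeg
    by (intro quot_basis_exists subspace_Int_forms assms) auto
  then show ?thesis by (metis subset_imageE)
qed

lemma monom_quot_basis_iff:
  fixes J :: "('v::finite, 'k::field) mpoly set"
  assumes J: "is_ideal J"
  shows "quot_basis (forms i) (J \<inter> forms i) (monom ` B) \<longleftrightarrow>
    B \<subseteq> {m. mdeg m = i} \<and> (\<forall>c. lincomb c B \<in> J \<longrightarrow> (\<forall>b\<in>B. c b = 0)) \<and>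
    (\<forall>f\<in>forms i. \<exists>c. f - lincomb c B \<in> J)" (is "?L \<longleftrightarrow> ?R")
proof
  assume L: ?L
  then have B: "B \<subseteq> {m. mdeg m = i}" by (auto simp: quot_basis_def)
  then have fB: "finite B" using finite_subset[OF _ finite_mdeg] by auto
  have inj: "inj_on (monom :: _ \<Rightarrow> ('v, 'k) mpoly) B" using inj_monom by (rule inj_on_subset) simp
  have tr: "(\<Sum>b\<in>monom ` B. scale (c b) b) = (\<Sum>b\<in>B. scale (c (monom b)) (monom b))" for c :: "('v, 'k) mpoly \<Rightarrow> 'k"
    using inj by (simp add: sum.reindex)
  define mi where "mi = inv_into B (monom :: _ \<Rightarrow> ('v, 'k) mpoly)"
  have mi: "mi (monom b) = b" if "b \<in> B" for b
    unfolding mi_def using inj that by (rule inv_into_f_f)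
  have tr2: "lincomb c B = (\<Sum>b\<in>monom ` B. scale (c (mi b)) b)" for c :: "'v exps \<Rightarrow> 'k"
    unfolding tr by (intro sum.cong refl) (simp only: mi)
  note D = quot_basisD[OF subspace_Int_forms[OF J] L finite_imageI[OF fB]]
  show ?R
  proof (intro conjI allI impI ballI)
    fix c b assume c: "lincomb c B \<in> J" and b: "b \<in> B"
    have "lincomb c B \<in> forms i" using B by (intro forms_sum forms_scale) auto
    then have "\<forall>b\<in>(monom ` B :: ('v, 'k) mpoly set). c (mi b) = 0"
      using D(1)[unfolded indep_mod_def, THEN conjunct2, THEN spec[of _ "\<lambda>b. c (mi b)"]] c
      unfolding tr2[of c] by simp
    then show "c b = 0" using b mi[OF b] by auto
  next
    fix f :: "('v, 'k) mpoly" assume "f \<in> forms i"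
    then obtain c where "f - (\<Sum>b\<in>monom ` B. scale (c b) b) \<in> J" using D(2) by (auto simp: span_mod_def)
    then show "\<exists>c. f - lincomb c B \<in> J"
      unfolding tr by (intro exI[of _ "\<lambda>b. c (monom b)"])
  qed (use B in auto)
next
  assume R: ?R
  then have fB: "finite B" using finite_subset[OF _ finite_mdeg] by auto
  have fm: "f - lincomb c B \<in> forms i" if "f \<in> forms i" for f and c :: "'v exps \<Rightarrow> 'k"
    using that R by (intro forms_diff forms_sum forms_scale) auto
  show ?L
    using R fB fm by (intro quot_basisI subspace_Int_forms J) (auto simp: indep_mod_def span_mod_def)
qed

lemma hf_eq_card:
  fixes J :: "('v::finite, 'k::field) mpoly set"
  assumes J: "is_ideal J" and "quot_basis (forms i) (J \<inter> forms i) (monom ` B)"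
  shows "hilbert_function J i = card B"
proof -
  have "B \<subseteq> {m. mdeg m = i}" using assms by (simp add: monom_quot_basis_iff)
  then have "finite (monom ` B :: ('v, 'k) mpoly set)" using finite_subset[OF _ finite_mdeg] by auto
  then have "quot_dim (forms i) (J \<inter> forms i) = card (monom ` B :: ('v, 'k) mpoly set)"
    by (rule quot_basis_dim[OF subspace_Int_forms[OF J] assms(2)])
  also have "\<dots> = card B" by (rule card_image[OF inj_on_subset[OF inj_monom]]) simp
  finally show ?thesis by (simp add: hilbert_function_def)
qed

lemma hf_eqI:
  fixes u :: "'i \<Rightarrow> ('v::finite, 'k::field) mpoly"
  assumes "is_ideal J" "finite A" "\<And>x. x \<in> A \<Longrightarrow> u x \<in> forms i"
    and "\<And>c x. (\<Sum>x\<in>A. scale (c x) (u x)) \<in> J \<Longrightarrow> x \<in> A \<Longrightarrow> c x = 0"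
    and "\<And>f. f \<in> forms i \<Longrightarrow> \<exists>c. f - (\<Sum>x\<in>A. scale (c x) (u x)) \<in> J"
  shows "hilbert_function J i = card A"
proof (rule antisym)
  show "hilbert_function J i \<le> card A" by (rule hf_le) (fact assms)+
  show "card A \<le> hilbert_function J i" by (rule hf_ge) (fact assms)+
qed

section \<open>Rings of functions and Cramer's rule\<close>

text \<open>A ring of functions on a parameter set. It stands for the coordinate ring of the parameter
  space.\<close>

locale fun_ring =
  fixes A :: "('e \<Rightarrow> 'k::field) set"
  assumes zero_in [simp]: "(\<lambda>_. 0) \<in> A" and one_in [simp]: "(\<lambda>_. 1) \<in> A"
    and add_in: "f \<in> A \<Longrightarrow> g \<in> A \<Longrightarrow> (\<lambda>e. f e + g e) \<in> A"
    and mult_in: "f \<in> A \<Longrightarrow> g \<in> A \<Longrightarrow> (\<lambda>e. f e * g e) \<in> A"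
    and uminus_in: "f \<in> A \<Longrightarrow> (\<lambda>e. - f e) \<in> A"
begin

lemma sum_in: "(\<And>i. i \<in> S \<Longrightarrow> (\<lambda>e. F e i) \<in> A) \<Longrightarrow> (\<lambda>e. \<Sum>i\<in>S. F e i) \<in> A"
  by (induction S rule: infinite_finite_induct) (auto intro: add_in)

lemma prod_in: "(\<And>i. i \<in> S \<Longrightarrow> (\<lambda>e. F e i) \<in> A) \<Longrightarrow> (\<lambda>e. \<Prod>i\<in>S. F e i) \<in> A"
  by (induction S rule: infinite_finite_induct) (auto intro: mult_in)

lemma power_in: "f \<in> A \<Longrightarrow> (\<lambda>e. f e ^ n) \<in> A"
  by (induction n) (auto intro: mult_in)

lemma sign_in: "(\<lambda>_. (-1) ^ n) \<in> A"
  using power_in[OF uminus_in[OF one_in], of n] by simp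

lemma signof_in: "(\<lambda>_. signof p) \<in> A"
  by (cases "evenperm p") (use uminus_in[OF one_in] in \<open>simp_all add: sign_def\<close>)

lemma det_in:
  assumes "\<And>i j. i < n \<Longrightarrow> j < n \<Longrightarrow> (\<lambda>e. M e i j) \<in> A"
  shows "(\<lambda>e. det (mat n n (\<lambda>(i, j). M e i j))) \<in> A"
proof -
  have "det (mat n n (\<lambda>(i, j). M e i j)) = (\<Sum>p\<in>{p. p permutes {0..<n}}. signof p * (\<Prod>i = 0..<n. M e i (p i)))" for e
  proof -
    have "(\<Prod>i = 0..<n. mat n n (\<lambda>(i, j). M e i j) $$ (i, p i)) = (\<Prod>i = 0..<n. M e i (p i))"
      if "p permutes {0..<n}" for p
      using permutes_in_image[OF that] by (intro prod.cong refl) simp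
    then show ?thesis by (subst det_def'[of _ n]) (auto intro!: sum.cong)
  qed
  moreover have "(\<lambda>e. \<Sum>p\<in>{p. p permutes {0..<n}}. signof p * (\<Prod>i = 0..<n. M e i (p i))) \<in> A"
    by (intro sum_in mult_in signof_in prod_in assms) (use permutes_in_image in fastforce)+
  ultimately show ?thesis by simp
qed

lemma adj_in:
  assumes "\<And>i j. i < n \<Longrightarrow> j < n \<Longrightarrow> (\<lambda>e. M e i j) \<in> A" and ij: "i < n" "j < n"
  shows "(\<lambda>e. adj_mat (mat n n (\<lambda>(i, j). M e i j)) $$ (i, j)) \<in> A"
proof -
  let ?s = "\<lambda>k l::nat. if l < k then l else Suc l"
  have "mat_delete (mat n n (\<lambda>(i, j). M e i j)) j i = mat (n - 1) (n - 1) (\<lambda>(k, l). M e (?s j k) (?s i l))" for e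
    by (rule eq_matI) (auto simp: mat_delete_def)
  then have "adj_mat (mat n n (\<lambda>(i, j). M e i j)) $$ (i, j)
      = (-1) ^ (j + i) * det (mat (n - 1) (n - 1) (\<lambda>(k, l). M e (?s j k) (?s i l)))" for e
    using ij by (simp add: adj_mat_def cofactor_def)
  moreover have "(\<lambda>e. (-1) ^ (j + i) * det (mat (n - 1) (n - 1) (\<lambda>(k, l). M e (?s j k) (?s i l)))) \<in> A"
    by (intro mult_in sign_in det_in assms) auto
  ultimately show ?thesis by simp
qed

text \<open>A linear system of \<open>card U\<close> equations in \<open>card B\<close> unknowns, padded
  with zero rows to a square system. Its determinant \<open>D\<close> decides unique solvability, and by
  Cramer's rule the solution times \<open>D\<close> is given by functions of the ring.\<close>

lemma cramer:
  fixes M :: "'e \<Rightarrow> 'x \<Rightarrow> 'b \<Rightarrow> 'k"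
  assumes fin: "finite U" "finite B" "card U \<le> card B"
    and M0: "\<forall>x\<in>U. \<forall>b\<in>B. (\<lambda>e. M e x b) \<in> A"
  shows "\<exists>D\<in>A. (\<forall>e. D e \<noteq> 0 \<longleftrightarrow> (\<forall>c. (\<forall>x\<in>U. (\<Sum>b\<in>B. M e x b * c b) = 0) \<longrightarrow> (\<forall>b\<in>B. c b = 0))) \<and>
    (\<forall>w. (\<forall>x\<in>U. (\<lambda>e. w e x) \<in> A) \<longrightarrow>
      (\<forall>b\<in>B. \<exists>N\<in>A. \<forall>e c. (\<forall>x\<in>U. (\<Sum>b\<in>B. M e x b * c b) = w e x) \<longrightarrow> c b * D e = N e)) \<and>
    (\<forall>e. D e \<noteq> 0 \<longrightarrow> (\<forall>w. \<exists>c. \<forall>x\<in>U. (\<Sum>b\<in>B. M e x b * c b) = w x))"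
proof -
  have M: "(\<lambda>e. M e x b) \<in> A" if "x \<in> U" "b \<in> B" for x b using M0 that by blast
  define n where "n = card B"
  obtain \<xi> where \<xi>: "bij_betw \<xi> {0..<card U} U" using ex_bij_betw_nat_finite[OF fin(1)] by blast
  obtain \<beta> where \<beta>: "bij_betw \<beta> {0..<n} B" using ex_bij_betw_nat_finite[OF fin(2)] by (auto simp: n_def)
  have \<xi>U: "\<xi> i \<in> U" if "i < card U" for i using bij_betwE[OF \<xi>] that by simp
  have ex\<xi>: "\<exists>i<card U. x = \<xi> i" if "x \<in> U" for x
  proof -
    have "x \<in> \<xi> ` {0..<card U}" using bij_betw_imp_surj_on[OF \<xi>] that by simp
    then show ?thesis by auto
  qed
  have \<beta>B: "\<beta> i \<in> B" if "i < n" for i using bij_betwE[OF \<beta>] that by simp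
  have le: "card U \<le> n" using fin by (simp add: n_def)
  define T where "T e i j = (if i < card U then M e (\<xi> i) (\<beta> j) else 0)" for e i j
  have T: "(\<lambda>e. T e i j) \<in> A" if "i < n" "j < n" for i j
    using M[OF \<xi>U \<beta>B] that by (cases "i < card U") (simp_all add: T_def)
  define m where "m e = mat n n (\<lambda>(i, j). T e i j)" for e
  define D where "D e = det (m e)" for e
  define a where "a e i j = adj_mat (m e) $$ (i, j)" for e i j
  have m: "m e \<in> carrier_mat n n" for e by (simp add: m_def)
  have adjc: "adj_mat (m e) \<in> carrier_mat n n" for e using adj_mat(1)[OF m] .
  have a1: "(\<Sum>k = 0..<n. T e i k * a e k j) = (if i = j then D e else 0)" if "i < n" "j < n" for e i j
  proof -
    have "(m e * adj_mat (m e)) $$ (i, j) = (\<Sum>k = 0..<n. T e i k * a e k j)"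
      using that m[of e] adjc[of e] by (simp add: scalar_prod_def a_def m_def)
    then show ?thesis using that adj_mat(2)[OF m[of e]] by (auto simp: D_def split: if_splits)
  qed
  have a2: "(\<Sum>k = 0..<n. a e i k * T e k j) = (if i = j then D e else 0)" if "i < n" "j < n" for e i j
  proof -
    have "(adj_mat (m e) * m e) $$ (i, j) = (\<Sum>k = 0..<n. a e i k * T e k j)"
      using that m[of e] adjc[of e] by (simp add: scalar_prod_def a_def m_def)
    then show ?thesis using that adj_mat(3)[OF m[of e]] by (auto simp: D_def split: if_splits)
  qed
  have reB: "(\<Sum>b\<in>B. F b) = (\<Sum>j = 0..<n. F (\<beta> j))" for F :: "'b \<Rightarrow> 'k"
    using sum.reindex_bij_betw[OF \<beta>, of F] by (rule sym)
  have sys: "(\<forall>x\<in>U. (\<Sum>b\<in>B. M e x b * c b) = w x) \<longleftrightarrow>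
      (\<forall>i<card U. (\<Sum>j = 0..<n. T e i j * c (\<beta> j)) = w (\<xi> i))" for e c and w :: "'x \<Rightarrow> 'k"
  proof -
    have "(\<forall>x\<in>U. (\<Sum>b\<in>B. M e x b * c b) = w x) \<longleftrightarrow> (\<forall>i<card U. (\<Sum>b\<in>B. M e (\<xi> i) b * c b) = w (\<xi> i))"
      using ex\<xi> \<xi>U by metis
    then show ?thesis by (simp add: reB T_def)
  qed
  have key: "c (\<beta> j) * D e = (\<Sum>i = 0..<n. a e j i * (if i < card U then w (\<xi> i) else 0))"
    if "\<forall>x\<in>U. (\<Sum>b\<in>B. M e x b * c b) = w x" "j < n" for e c j and w :: "'x \<Rightarrow> 'k"
  proof -
    have "(\<Sum>i = 0..<n. a e j i * (if i < card U then w (\<xi> i) else 0)) = (\<Sum>i = 0..<n. a e j i * (\<Sum>k = 0..<n. T e i k * c (\<beta> k)))"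
      using that(1)[unfolded sys] by (intro sum.cong refl) (auto simp: T_def)
    also have "\<dots> = (\<Sum>k = 0..<n. (\<Sum>i = 0..<n. a e j i * T e i k) * c (\<beta> k))"
      by (simp only: sum_distrib_left sum_distrib_right mult.assoc) (rule sum.swap)
    also have "\<dots> = (\<Sum>k = 0..<n. if k = j then D e * c (\<beta> k) else 0)"
      using a2[OF that(2)] by (intro sum.cong refl) auto
    also have "\<dots> = D e * c (\<beta> j)" using that(2) by (simp add: sum.delta)
    finally show ?thesis by (simp add: mult.commute)
  qed
  have c1: "D \<in> A" unfolding D_def[abs_def] m_def using T by (rule det_in)
  have c2: "D e \<noteq> 0 \<longleftrightarrow> (\<forall>c. (\<forall>x\<in>U. (\<Sum>b\<in>B. M e x b * c b) = 0) \<longrightarrow> (\<forall>b\<in>B. c b = 0))" for e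
    proof (intro iffI allI impI ballI)
      fix c b assume D: "D e \<noteq> 0" and c: "\<forall>x\<in>U. (\<Sum>b\<in>B. M e x b * c b) = 0" and b: "b \<in> B"
      obtain j where j: "j < n" "b = \<beta> j" using \<beta> b by (auto simp: bij_betw_def)
      have "c (\<beta> j) * D e = (\<Sum>i = 0..<n. a e j i * (if i < card U then (\<lambda>_. 0) (\<xi> i) else 0))"
        by (rule key) (use c j in auto)
      then show "c b = 0" using D j by simp
    next
      assume *: "\<forall>c. (\<forall>x\<in>U. (\<Sum>b\<in>B. M e x b * c b) = 0) \<longrightarrow> (\<forall>b\<in>B. c b = 0)"
      show "D e \<noteq> 0"
      proof
        assume "D e = 0"
        then obtain v where v: "v \<in> carrier_vec n" "v \<noteq> 0\<^sub>v n" "m e *\<^sub>v v = 0\<^sub>v n"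
          using det_0_iff_vec_prod_zero_field[OF m[of e]] by (auto simp: D_def)
        define c where "c b = v $ (the_inv_into {0..<n} \<beta> b)" for b
        have c\<beta>: "c (\<beta> j) = v $ j" if "j < n" for j
          using \<beta> that by (simp add: c_def bij_betw_def the_inv_into_f_f)
        have "(\<Sum>j = 0..<n. T e i j * c (\<beta> j)) = 0" if "i < card U" for i
        proof -
          have "i < n" using that le by simp
          then have "(m e *\<^sub>v v) $ i = (\<Sum>j = 0..<n. T e i j * v $ j)"
            using v(1) by (simp add: m_def scalar_prod_def)
          then show ?thesis using v(3) \<open>i < n\<close> by (simp add: c\<beta>)
        qed
        then have "\<forall>b\<in>B. c b = 0" using *[rule_format, of c] sys[of e c "\<lambda>_. 0"] by auto
        then have "v $ j = 0" if "j < n" for j using c\<beta>[OF that] \<beta>B[OF that] by simp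
        then have "v = 0\<^sub>v n" using v(1) by (intro eq_vecI) auto
        then show False using v(2) by simp
      qed
    qed
  have c3: "\<exists>N\<in>A. \<forall>e c. (\<forall>x\<in>U. (\<Sum>b\<in>B. M e x b * c b) = w e x) \<longrightarrow> c b * D e = N e"
      if w: "\<And>x. x \<in> U \<Longrightarrow> (\<lambda>e. w e x) \<in> A" and b: "b \<in> B" for w b
    proof -
      obtain j where j: "j < n" "b = \<beta> j" using \<beta> b by (auto simp: bij_betw_def)
      have "(\<lambda>e. if i < card U then w e (\<xi> i) else 0) \<in> A" for i
        using w[OF \<xi>U] by (cases "i < card U") auto
      then have "(\<lambda>e. \<Sum>i = 0..<n. a e j i * (if i < card U then w e (\<xi> i) else 0)) \<in> A"
        unfolding a_def m_def by (intro sum_in mult_in adj_in T j) auto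
      then show ?thesis by (rule bexI[rotated]) (use key j in blast)
    qed
  have c4: "\<exists>c. \<forall>x\<in>U. (\<Sum>b\<in>B. M e x b * c b) = w x" if D: "D e \<noteq> 0" for e and w :: "'x \<Rightarrow> 'k"
    proof -
      define w' where "w' i = (if i < card U then w (\<xi> i) else 0)" for i
      define c where "c b = (\<Sum>i = 0..<n. a e (the_inv_into {0..<n} \<beta> b) i * w' i) / D e" for b
      have c\<beta>: "c (\<beta> j) = (\<Sum>i = 0..<n. a e j i * w' i) / D e" if "j < n" for j
        using \<beta> that by (simp add: c_def bij_betw_def the_inv_into_f_f)
      have "(\<Sum>j = 0..<n. T e i j * c (\<beta> j)) = w (\<xi> i)" if i: "i < card U" for i
      proof -
        have "i < n" using i le by simp
        have "(\<Sum>j = 0..<n. T e i j * c (\<beta> j)) = (\<Sum>j = 0..<n. T e i j * (\<Sum>l = 0..<n. a e j l * w' l)) / D e"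
          unfolding sum_divide_distrib by (intro sum.cong refl) (simp only: c\<beta> atLeastLessThan_iff times_divide_eq_right)
        also have "(\<Sum>j = 0..<n. T e i j * (\<Sum>l = 0..<n. a e j l * w' l)) = (\<Sum>l = 0..<n. (\<Sum>j = 0..<n. T e i j * a e j l) * w' l)"
          by (simp only: sum_distrib_left sum_distrib_right mult.assoc) (rule sum.swap)
        also have "\<dots> = (\<Sum>l = 0..<n. if l = i then D e * w' l else 0)"
          using a1[OF \<open>i < n\<close>] by (intro sum.cong refl) auto
        also have "\<dots> = D e * w' i" using \<open>i < n\<close> by (simp add: sum.delta)
        finally show ?thesis using D i by (simp add: w'_def)
      qed
      then show ?thesis unfolding sys by blast
    qed
  show ?thesis
    by (rule bexI[OF _ c1], intro conjI allI impI ballI c2 c3 c4) auto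
qed

end

section \<open>Families of polynomials over a ring of functions\<close>

context fun_ring
begin

definition pfam :: "('e \<Rightarrow> 'k poly) \<Rightarrow> bool" where
  "pfam F \<longleftrightarrow> (\<forall>j. (\<lambda>e. coeff (F e) j) \<in> A) \<and> (\<exists>D. \<forall>e. degree (F e) \<le> D)"

lemma pfam_coeff: "pfam F \<Longrightarrow> (\<lambda>e. coeff (F e) j) \<in> A"
  by (simp add: pfam_def)

lemma pfamI: "(\<And>j. (\<lambda>e. coeff (F e) j) \<in> A) \<Longrightarrow> (\<And>e. degree (F e) \<le> D) \<Longrightarrow> pfam F"
  by (auto simp: pfam_def)

lemma if_in: "f \<in> A \<Longrightarrow> (\<lambda>e. if b then f e else 0) \<in> A"
  by (cases b) simp_all

lemma pfam_monom: "f \<in> A \<Longrightarrow> pfam (\<lambda>e. pmonom (f e) n)"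
  by (rule pfamI[of _ n]) (auto simp: degree_monom_le coeff_monom if_distrib if_in)

lemma pfam_0 [simp]: "pfam (\<lambda>_. 0)"
  by (rule pfamI[of _ 0]) auto

lemma pfam_1 [simp]: "pfam (\<lambda>_. 1)"
  using pfam_monom[OF one_in, of 0] by simp

lemma pfam_add: assumes "pfam F" "pfam G" shows "pfam (\<lambda>e. F e + G e)"
proof -
  obtain D1 D2 where "\<And>e. degree (F e) \<le> D1" "\<And>e. degree (G e) \<le> D2"
    using assms unfolding pfam_def by auto
  then have "degree (F e + G e) \<le> max D1 D2" for e
    by (meson degree_add_le max.coboundedI1 max.coboundedI2)
  then show ?thesis using assms by (intro pfamI) (simp_all add: add_in pfam_coeff)
qed

lemma pfam_uminus: assumes "pfam F" shows "pfam (\<lambda>e. - F e)"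
  using assms unfolding pfam_def by (auto intro: uminus_in)

lemma pfam_diff: assumes "pfam F" "pfam G" shows "pfam (\<lambda>e. F e - G e)"
  using pfam_add[OF assms(1) pfam_uminus[OF assms(2)]] by simp

lemma pfam_mult: assumes "pfam F" "pfam G" shows "pfam (\<lambda>e. F e * G e)"
proof -
  obtain D1 D2 where "\<And>e. degree (F e) \<le> D1" "\<And>e. degree (G e) \<le> D2"
    using assms unfolding pfam_def by auto
  then have "degree (F e * G e) \<le> D1 + D2" for e
    by (meson degree_mult_le add_mono order_trans)
  then show ?thesis using assms
    by (intro pfamI) (simp_all add: coeff_mult sum_in mult_in pfam_coeff)
qed

lemma pfam_sum: "(\<And>i. i \<in> S \<Longrightarrow> pfam (\<lambda>e. F e i)) \<Longrightarrow> pfam (\<lambda>e. \<Sum>i\<in>S. F e i)"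
  by (induction S rule: infinite_finite_induct) (auto intro: pfam_add)

lemma pfam_prod: "(\<And>i. i \<in> S \<Longrightarrow> pfam (\<lambda>e. F e i)) \<Longrightarrow> pfam (\<lambda>e. \<Prod>i\<in>S. F e i)"
  by (induction S rule: infinite_finite_induct) (auto intro: pfam_mult)

text \<open>Long division by a monic polynomial uses no division in the coefficient ring.\<close>

lemma pfam_divmod_aux:
  assumes Q: "pfam Q" "\<And>e. lead_coeff (Q e) = 1" "\<And>e. degree (Q e) = \<beta>"
  shows "pfam F \<Longrightarrow> (\<And>e. degree (F e) < D) \<Longrightarrow> pfam (\<lambda>e. F e mod Q e) \<and> pfam (\<lambda>e. F e div Q e)"
proof (induction D arbitrary: F)
  case (Suc D)
  have Q0: "Q e \<noteq> 0" for e using Q(2)[of e] by auto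
  show ?case
  proof (cases "D < \<beta>")
    case True
    then have "degree (F e) < degree (Q e)" for e using Suc.prems(2)[of e] Q(3)[of e] by simp
    then have "F e mod Q e = F e" "F e div Q e = 0" for e by (simp_all add: mod_poly_less div_poly_less)
    then show ?thesis using Suc.prems by simp
  next
    case False
    define m where "m e = pmonom (coeff (F e) D) (D - \<beta>)" for e
    define F' where "F' e = F e - m e * Q e" for e
    have m: "pfam m" unfolding m_def using Suc.prems by (intro pfam_monom pfam_coeff)
    have F': "pfam F'" unfolding F'_def using Suc.prems m Q by (intro pfam_diff pfam_mult)
    have deg: "degree (F' e) < D \<or> F' e = 0" for e
    proof -
      have "coeff (F' e) i = 0" if "i \<ge> D" for i
      proof (cases "i = D")
        case True
        have "coeff (m e * Q e) D = coeff (F e) D * coeff (Q e) (D - (D - \<beta>))"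
          unfolding m_def using False by (simp add: coeff_monom_mult)
        then show ?thesis using True False Q(2)[of e] Q(3)[of e] by (simp add: F'_def)
      next
        case False
        then have "i > D" using that by simp
        moreover have "degree (m e * Q e) \<le> D"
          using degree_mult_le[of "m e" "Q e"] degree_monom_le[of "coeff (F e) D" "D - \<beta>"] Q(3)[of e] \<open>\<not> D < \<beta>\<close>
          by (simp add: m_def)
        ultimately show ?thesis using Suc.prems(2)[of e]
          by (simp add: F'_def coeff_eq_0)
      qed
      then show ?thesis by (metis leading_coeff_0_iff linorder_not_less)
    qed
    show ?thesis
    proof (cases "D = 0")
      case True
      then have "F' e = 0" for e using deg[of e] by simp
      then have "F e = m e * Q e" for e by (simp add: F'_def)
      then show ?thesis using m Q0 by simp
    next
      case D: False
      then have "degree (F' e) < D" for e using deg[of e] by auto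
      from Suc.IH[OF F' this] have IH: "pfam (\<lambda>e. F' e mod Q e)" "pfam (\<lambda>e. F' e div Q e)" by auto
      have eq: "F e = F' e + m e * Q e" for e by (simp add: F'_def)
      have "F e mod Q e = F' e mod Q e" for e unfolding eq by simp
      moreover have "F e div Q e = F' e div Q e + m e" for e unfolding eq using Q0[of e] by simp
      ultimately show ?thesis using IH m by (simp add: pfam_add)
    qed
  qed
qed simp

lemma pfam_divmod:
  assumes "pfam F" "pfam Q" "\<And>e. lead_coeff (Q e) = 1" "\<And>e. degree (Q e) = \<beta>"
  shows "pfam (\<lambda>e. F e mod Q e)" "pfam (\<lambda>e. F e div Q e)"
proof -
  obtain D where "\<And>e. degree (F e) \<le> D" using assms(1) unfolding pfam_def by auto
  then have "\<And>e. degree (F e) < Suc D" by (simp add: le_imp_less_Suc)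
  from pfam_divmod_aux[OF assms(2-4,1) this] show "pfam (\<lambda>e. F e mod Q e)" "pfam (\<lambda>e. F e div Q e)" by auto
qed

definition pfam2 :: "('e \<Rightarrow> 'k poly poly) \<Rightarrow> bool" where
  "pfam2 F \<longleftrightarrow> (\<forall>i. pfam (\<lambda>e. coeff (F e) i)) \<and> (\<exists>D. \<forall>e. degree (F e) \<le> D)"

lemma pfam2I: "(\<And>i. pfam (\<lambda>e. coeff (F e) i)) \<Longrightarrow> (\<And>e. degree (F e) \<le> D) \<Longrightarrow> pfam2 F"
  by (auto simp: pfam2_def)

lemma pfam2_coeff: "pfam2 F \<Longrightarrow> pfam (\<lambda>e. coeff (F e) i)"
  by (simp add: pfam2_def)

lemma pfam_if: "pfam f \<Longrightarrow> pfam (\<lambda>e. if b then f e else 0)"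
  by (cases b) simp_all

lemma pfam2_monom: "pfam f \<Longrightarrow> pfam2 (\<lambda>e. pmonom (f e) n)"
  by (rule pfam2I[of _ n]) (simp_all add: degree_monom_le coeff_monom pfam_if)

lemma pfam2_0 [simp]: "pfam2 (\<lambda>_. 0)"
  by (rule pfam2I[of _ 0]) auto

lemma pfam2_1 [simp]: "pfam2 (\<lambda>_. 1)"
  using pfam2_monom[OF pfam_1, of 0] by (simp add: monom_eq_1)

lemma pfam2_v: "pfam2 (\<lambda>_. [:0, 1:])"
  using pfam2_monom[OF pfam_1, of 1] by (simp add: monom_altdef)

lemma pfam2_add: assumes "pfam2 F" "pfam2 G" shows "pfam2 (\<lambda>e. F e + G e)"
proof -
  obtain D1 D2 where "\<And>e. degree (F e) \<le> D1" "\<And>e. degree (G e) \<le> D2"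
    using assms unfolding pfam2_def by auto
  then have "degree (F e + G e) \<le> max D1 D2" for e
    by (meson degree_add_le max.coboundedI1 max.coboundedI2)
  then show ?thesis using assms by (intro pfam2I) (simp_all add: pfam_add pfam2_coeff)
qed

lemma pfam2_uminus: assumes "pfam2 F" shows "pfam2 (\<lambda>e. - F e)"
  using assms unfolding pfam2_def by (auto intro: pfam_uminus)

lemma pfam2_diff: assumes "pfam2 F" "pfam2 G" shows "pfam2 (\<lambda>e. F e - G e)"
  using pfam2_add[OF assms(1) pfam2_uminus[OF assms(2)]] by simp

lemma pfam2_mult: assumes "pfam2 F" "pfam2 G" shows "pfam2 (\<lambda>e. F e * G e)"
proof -
  obtain D1 D2 where "\<And>e. degree (F e) \<le> D1" "\<And>e. degree (G e) \<le> D2"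
    using assms unfolding pfam2_def by auto
  then have "degree (F e * G e) \<le> D1 + D2" for e
    by (meson degree_mult_le add_mono order_trans)
  then show ?thesis using assms
    by (intro pfam2I) (simp_all add: coeff_mult pfam_sum pfam_mult pfam2_coeff)
qed

lemma pfam2_smult: assumes "pfam f" "pfam2 F" shows "pfam2 (\<lambda>e. smult (f e) (F e))"
  using pfam2_mult[OF pfam2_monom[OF assms(1), of 0] assms(2)] by (simp add: monom_0)

lemma pfam2_sum: "(\<And>i. i \<in> S \<Longrightarrow> pfam2 (\<lambda>e. F e i)) \<Longrightarrow> pfam2 (\<lambda>e. \<Sum>i\<in>S. F e i)"
  by (induction S rule: infinite_finite_induct) (auto intro: pfam2_add)

text \<open>Subtracting the leading coefficient of \<open>F\<close> times \<open>H D\<close> lowers the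
  degree and stays inside the ring.\<close>

lemma pfam2_expand_aux:
  assumes H: "\<And>l. pfam2 (H l)" "\<And>l e. lead_coeff (H l e) = 1" "\<And>l e. degree (H l e) = l"
  shows "pfam2 F \<Longrightarrow> (\<And>e. degree (F e) \<le> D) \<Longrightarrow>
    \<exists>G. (\<forall>l. pfam (G l)) \<and> (\<forall>e. F e = (\<Sum>l\<le>D. smult (G l e) (H l e)))"
proof (induction D arbitrary: F)
  case 0
  have H0: "H 0 e = 1" for e
    using H(2,3)[of 0 e] by (metis degree_0_id one_pCons)
  have F0: "F e = [:coeff (F e) 0:]" for e using 0(2)[of e] by (simp add: degree_0_id)
  show ?case
  proof (intro exI[of _ "\<lambda>_ e. coeff (F e) 0"] conjI allI)
    fix e
    have "smult (coeff (F e) 0) 1 = F e" using F0[of e] by simp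
    then show "F e = (\<Sum>l\<le>0. smult (coeff (F e) 0) (H l e))" by (simp add: H0)
  qed (use 0 in \<open>simp add: pfam2_coeff\<close>)
next
  case (Suc D)
  define c where "c e = coeff (F e) (Suc D)" for e
  define F' where "F' e = F e - smult (c e) (H (Suc D) e)" for e
  have c: "pfam c" unfolding c_def using Suc.prems by (simp add: pfam2_coeff)
  have F': "pfam2 F'" unfolding F'_def using Suc.prems c H by (intro pfam2_diff pfam2_smult)
  have "degree (F' e) \<le> D" for e
  proof (rule degree_le, intro allI impI)
    fix i assume i: "i > D"
    show "coeff (F' e) i = 0"
    proof (cases "i = Suc D")
      case True
      then show ?thesis using H(2)[of "Suc D" e] H(3)[of "Suc D" e] by (simp add: F'_def c_def)
    next
      case False
      then have "coeff (F e) i = 0" "coeff (H (Suc D) e) i = 0"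
        using i Suc.prems(2)[of e] H(3)[of "Suc D" e] by (auto intro!: coeff_eq_0)
      then show ?thesis by (simp add: F'_def)
    qed
  qed
  from Suc.IH[OF F' this] obtain G where G: "\<And>l. pfam (G l)" "\<And>e. F' e = (\<Sum>l\<le>D. smult (G l e) (H l e))" by blast
  show ?case
  proof (intro exI[of _ "G(Suc D := c)"] conjI allI)
    show "pfam ((G(Suc D := c)) l)" for l using G c by simp
    show "F e = (\<Sum>l\<le>Suc D. smult ((G(Suc D := c)) l e) (H l e))" for e
    proof -
      have "(\<Sum>l\<le>D. smult ((G(Suc D := c)) l e) (H l e)) = F' e"
        unfolding G(2) by (intro sum.cong refl) auto
      then show ?thesis by (simp add: F'_def)
    qed
  qed
qed

lemma pfam2_expand:
  assumes "\<And>l. pfam2 (H l)" "\<And>l e. lead_coeff (H l e) = 1" "\<And>l e. degree (H l e) = l" "pfam2 F"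
  obtains D G where "\<And>l. pfam (G l)" "\<And>e. F e = (\<Sum>l\<le>D. smult (G l e) (H l e))" "\<And>e. degree (F e) \<le> D"
proof -
  obtain D where D: "\<And>e. degree (F e) \<le> D" using assms(4) unfolding pfam2_def by auto
  show ?thesis using pfam2_expand_aux[of H F D, OF assms(1-3) assms(4) D] that D by blast
qed

end

text \<open>A single polynomial is a family over a one-point parameter set.\<close>

lemma expand_monic:
  fixes H :: "nat \<Rightarrow> 'k::field poly poly"
  assumes "\<And>l. lead_coeff (H l) = 1" "\<And>l. degree (H l) = l" "degree F \<le> D"
  shows "\<exists>G. F = (\<Sum>l\<le>D. smult (G l) (H l))"
proof -
  interpret fun_ring "UNIV :: (unit \<Rightarrow> 'k) set" by (rule fun_ring.intro) auto
  have p: "pfam f" for f by (rule pfamI[of _ "degree (f ())"]) auto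
  have p2: "pfam2 f" for f by (rule pfam2I[of _ "degree (f ())"]) (auto simp: p)
  show ?thesis
    using pfam2_expand_aux[of "\<lambda>l _. H l" "\<lambda>_. F" D] p2 assms by auto
qed

lemma expand_monic_unique:
  fixes H :: "nat \<Rightarrow> 'k::field poly poly"
  assumes H: "\<And>l. lead_coeff (H l) = 1" "\<And>l. degree (H l) = l"
  shows "(\<Sum>l<D. smult (G l) (H l)) = (0 :: 'k poly poly) \<Longrightarrow> l < D \<Longrightarrow> G l = 0"
proof (induction D arbitrary: l)
  case (Suc D)
  have "coeff (\<Sum>l<Suc D. smult (G l) (H l)) D = (\<Sum>l<Suc D. if l = D then G D else 0)"
    unfolding coeff_sum
  proof (intro sum.cong refl)
    fix l assume "l \<in> {..<Suc D}"
    then show "coeff (smult (G l) (H l)) D = (if l = D then G D else 0)"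
      using H(1)[of D] H(2)[of l] H(2)[of D] by (auto simp: coeff_eq_0)
  qed
  also have "\<dots> = G D" by simp
  finally have "G D = 0" unfolding Suc.prems(1) by simp
  then show ?case using Suc by (cases "l = D") auto
qed simp

section \<open>Cells of ideals of the affine plane\<close>

text \<open>Polynomials over \<open>k[u]\<close> in a variable \<open>v\<close>, which is
  \<open>[:0, 1:]\<close>. The factor \<open>q\<^sub>l \<cdots> q\<^sub>i\<^sub>-\<^sub>1\<close> makes
  \<open>Q\<^sub>i\<close> times the subtracted terms multiples of \<open>Q\<^sub>l h\<^sub>l\<close>, so that
  the ideal generated by the \<open>Q\<^sub>l h\<^sub>l\<close> over \<open>k[u]\<close> is closed under
  multiplication by \<open>v\<close>.\<close>

fun cell_h :: "(nat \<Rightarrow> 'k::field poly) \<Rightarrow> (nat \<Rightarrow> nat \<Rightarrow> 'k poly) \<Rightarrow> nat \<Rightarrow> 'k poly poly" where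
  "cell_h q a 0 = 1"
| "cell_h q a (Suc i) = [:0, 1:] * cell_h q a i - (\<Sum>l\<in>{..i}. smult (a i l * (\<Prod>j\<in>{l..<i}. q j)) (cell_h q a l))"

declare cell_h.simps(2) [simp del]

lemma cell_h_monic: "degree (cell_h q a l) = l \<and> lead_coeff (cell_h q a l) = 1"
proof (induction l rule: less_induct)
  case (less l)
  show ?case
  proof (cases l)
    case (Suc i)
    let ?S = "\<Sum>l\<in>{..i}. smult (a i l * (\<Prod>j\<in>{l..<i}. q j)) (cell_h q a l)"
    have IH: "degree (cell_h q a i) = i" "coeff (cell_h q a i) i = 1"
      using less.IH[of i] Suc by auto
    have "degree ?S \<le> i"
      by (intro degree_sum_le) (use less.IH Suc in \<open>auto intro!: order_trans[OF degree_smult_le]\<close>)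
    then have S: "coeff ?S j = 0" if "j > i" for j using that by (simp add: coeff_eq_0)
    have c: "coeff (cell_h q a (Suc i)) (Suc j) = coeff (cell_h q a i) j" if "j \<ge> i" for j
      using S[of "Suc j"] that by (simp add: cell_h.simps(2))
    have "degree (cell_h q a (Suc i)) \<le> Suc i"
    proof (rule degree_le, intro allI impI)
      fix j assume "j > Suc i"
      then obtain j' where "j = Suc j'" "j' > i" by (cases j) auto
      then show "coeff (cell_h q a (Suc i)) j = 0" using c[of j'] IH by (simp add: coeff_eq_0)
    qed
    moreover have "coeff (cell_h q a (Suc i)) (Suc i) = 1" using c[of i] IH by simp
    ultimately have "degree (cell_h q a (Suc i)) = Suc i"
      by (metis le_degree order_antisym zero_neq_one)
    then show ?thesis using \<open>coeff (cell_h q a (Suc i)) (Suc i) = 1\<close> Suc by simp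
  qed simp
qed

lemmas degree_cell_h [simp] = cell_h_monic[THEN conjunct1]

lemma lead_coeff_cell_h [simp]: "coeff (cell_h q a l) l = 1"
  using cell_h_monic[of q a l] by simp

lemma cell_h_cong:
  assumes "\<And>i l. i < m \<Longrightarrow> l \<le> i \<Longrightarrow> a i l = a' i l"
  shows "j \<le> m \<Longrightarrow> cell_h q a j = cell_h q a' j"
proof (induction j rule: less_induct)
  case (less j)
  show ?case
  proof (cases j)
    case (Suc i)
    have "(\<Sum>l\<in>{..i}. smult (a i l * (\<Prod>j\<in>{l..<i}. q j)) (cell_h q a l)) = (\<Sum>l\<in>{..i}. smult (a' i l * (\<Prod>j\<in>{l..<i}. q j)) (cell_h q a' l))"
      using less Suc assms by (intro sum.cong refl) auto
    then show ?thesis using less Suc by (simp add: cell_h.simps(2))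
  qed simp
qed

text \<open>The index \<open>(i, l, s)\<close> names the coefficient of \<open>u\<^sup>s\<close> in
  \<open>a\<^sub>i\<^sub>l\<close> if \<open>l \<le> i\<close>, and in \<open>q\<^sub>i\<close> if
  \<open>l = i + 1\<close>.\<close>

type_synonym cell_index = "nat \<times> nat \<times> nat"
type_synonym 'k params = "cell_index \<Rightarrow> 'k alg_closure"

definition cell_q :: "(nat \<Rightarrow> nat) \<Rightarrow> (cell_index \<Rightarrow> 'k::field) \<Rightarrow> nat \<Rightarrow> 'k poly" where
  "cell_q \<beta> p i = pmonom 1 (\<beta> i - \<beta> (Suc i)) + (\<Sum>s<\<beta> i - \<beta> (Suc i). pmonom (p (i, Suc i, s)) s)"

definition cell_a :: "(nat \<Rightarrow> nat) \<Rightarrow> (cell_index \<Rightarrow> 'k::field) \<Rightarrow> nat \<Rightarrow> nat \<Rightarrow> 'k poly" where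
  "cell_a \<beta> p i l = (\<Sum>s<\<beta> i - \<beta> (Suc i). pmonom (p (i, l, s)) s)"

abbreviation "cellh \<beta> p \<equiv> cell_h (cell_q \<beta> p) (cell_a \<beta> p)"

definition cell_Q :: "nat \<Rightarrow> (nat \<Rightarrow> nat) \<Rightarrow> (cell_index \<Rightarrow> 'k::field) \<Rightarrow> nat \<Rightarrow> 'k poly" where
  "cell_Q n \<beta> p l = (\<Prod>i\<in>{l..<n}. cell_q \<beta> p i)"

definition cell_shape :: "nat \<Rightarrow> (nat \<Rightarrow> nat) \<Rightarrow> bool" where
  "cell_shape n \<beta> \<longleftrightarrow> (\<forall>m. \<beta> (Suc m) \<le> \<beta> m) \<and> (\<forall>l\<ge>n. \<beta> l = 0)"

lemma cell_shape_Suc: "cell_shape n \<beta> \<Longrightarrow> \<beta> (Suc m) \<le> \<beta> m"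
  by (simp add: cell_shape_def)

lemma coeff_low_sum: "coeff (\<Sum>s<m. pmonom (f s) s) j = (if j < m then f j else 0)"
proof -
  have "coeff (\<Sum>s<m. pmonom (f s) s) j = (\<Sum>s<m. if s = j then f s else 0)"
    by (simp add: coeff_sum coeff_monom)
  then show ?thesis by (simp add: sum.delta)
qed

lemma cell_q_monic: "degree (cell_q \<beta> p i) = \<beta> i - \<beta> (Suc i) \<and> lead_coeff (cell_q \<beta> p i) = 1"
proof -
  let ?m = "\<beta> i - \<beta> (Suc i)"
  have c: "coeff (cell_q \<beta> p i) j = (if j = ?m then 1 else if j < ?m then p (i, Suc i, j) else 0)" for j
    by (auto simp: cell_q_def coeff_low_sum coeff_monom)
  then have "degree (cell_q \<beta> p i) \<le> ?m" by (intro degree_le) auto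
  moreover have "coeff (cell_q \<beta> p i) ?m \<noteq> 0" by (simp add: c)
  ultimately have "degree (cell_q \<beta> p i) = ?m" by (metis le_degree order_antisym)
  then show ?thesis using c[of ?m] by simp
qed

lemma cell_q_neq_0: "cell_q \<beta> p i \<noteq> 0"
  using cell_q_monic[of \<beta> p i] by auto

lemma cell_q_prod_monic:
  assumes sh: "cell_shape n \<beta>" and l: "l \<le> m"
  shows "degree (\<Prod>i\<in>{l..<m}. cell_q \<beta> p i) = \<beta> l - \<beta> m \<and> lead_coeff (\<Prod>i\<in>{l..<m}. cell_q \<beta> p i) = 1"
proof -
  have "degree (\<Prod>i\<in>{l..<m}. cell_q \<beta> p i) = (\<Sum>i\<in>{l..<m}. \<beta> i - \<beta> (Suc i))"
    by (simp add: degree_prod_eq_sum_degree cell_q_neq_0 cell_q_monic)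
  also have "\<dots> = \<beta> l - \<beta> m \<and> \<beta> m \<le> \<beta> l"
    using l
  proof (induction rule: inc_induct)
    case (step j)
    have "{j..<m} = insert j {Suc j..<m}" using step by auto
    then show ?case using step cell_shape_Suc[OF sh, of j] by simp
  qed simp
  finally have "degree (\<Prod>i\<in>{l..<m}. cell_q \<beta> p i) = \<beta> l - \<beta> m" by simp
  moreover have "lead_coeff (\<Prod>i\<in>{l..<m}. cell_q \<beta> p i) = 1"
    unfolding lead_coeff_prod by (intro prod.neutral ballI cell_q_monic[THEN conjunct2])
  ultimately show ?thesis ..
qed

lemma cell_Q_monic:
  assumes sh: "cell_shape n \<beta>"
  shows "degree (cell_Q n \<beta> p l) = \<beta> l \<and> lead_coeff (cell_Q n \<beta> p l) = 1"
proof (cases "l \<le> n")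
  case True
  have "\<beta> n = 0" using sh by (simp add: cell_shape_def)
  from cell_q_prod_monic[OF sh True, of p, unfolded this diff_zero] show ?thesis unfolding cell_Q_def .
next
  case False
  then show ?thesis using sh by (simp add: cell_Q_def cell_shape_def)
qed

lemma cell_Q_neq_0 [simp]: "cell_Q n \<beta> p l \<noteq> 0"
  by (simp add: cell_Q_def cell_q_neq_0)

lemma cell_Q_split: "l \<le> i \<Longrightarrow> i \<le> n \<Longrightarrow> cell_Q n \<beta> p l = (\<Prod>j\<in>{l..<i}. cell_q \<beta> p j) * cell_Q n \<beta> p i"
  unfolding cell_Q_def by (rule prod.atLeastLessThan_concat[symmetric])

lemma cell_Q_ge: "n \<le> l \<Longrightarrow> cell_Q n \<beta> p l = 1"
  by (simp add: cell_Q_def)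

text \<open>The ideals \<open>I\<close> of \<open>k[u][v]\<close> with generators
  \<open>Q\<^sub>l h\<^sub>l\<close> given by the parameters \<open>p\<close>, such that the
  \<open>u\<^sup>s h\<^sub>l\<close> with \<open>s < \<beta>\<^sub>l\<close> are a basis of the
  quotient.\<close>

definition cell :: "nat \<Rightarrow> (nat \<Rightarrow> nat) \<Rightarrow> (cell_index \<Rightarrow> 'k::field) \<Rightarrow> 'k poly poly set \<Rightarrow> bool" where
  "cell n \<beta> p I \<longleftrightarrow> is_ideal I \<and> (\<forall>l. smult (cell_Q n \<beta> p l) (cellh \<beta> p l) \<in> I) \<and>
    (\<forall>N. (\<forall>l. N l = 0 \<or> degree (N l) < \<beta> l) \<longrightarrow> (\<Sum>l<n. smult (N l) (cellh \<beta> p l)) \<in> I \<longrightarrow> (\<forall>l<n. N l = 0))"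

lemma cellD:
  assumes "cell n \<beta> p I"
  shows "is_ideal I" "smult (cell_Q n \<beta> p l) (cellh \<beta> p l) \<in> I"
    "\<lbrakk>\<And>l. N l = 0 \<or> degree (N l) < \<beta> l; (\<Sum>l<n. smult (N l) (cellh \<beta> p l)) \<in> I; l < n\<rbrakk> \<Longrightarrow> N l = 0"
  using assms unfolding cell_def by blast+

lemma ideal_smult:
  fixes I :: "'k::field poly poly set"
  assumes "is_ideal I" "F \<in> I" shows "smult c F \<in> I"
  using ideal_mult[OF assms, of "[:c:]"] by simp

context fun_ring
begin

lemma cell_families:
  assumes p: "\<And>x. (\<lambda>e. p e x) \<in> A"
  shows "pfam (\<lambda>e. cell_q \<beta> (p e) i)" "pfam (\<lambda>e. cell_a \<beta> (p e) i l)" "pfam (\<lambda>e. cell_Q n \<beta> (p e) i)"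
    "pfam2 (\<lambda>e. cellh \<beta> (p e) l)"
proof -
  show q: "pfam (\<lambda>e. cell_q \<beta> (p e) i)" for i
    unfolding cell_q_def by (intro pfam_add pfam_sum pfam_monom p one_in)
  show a: "pfam (\<lambda>e. cell_a \<beta> (p e) i l)" for i l
    unfolding cell_a_def by (intro pfam_sum pfam_monom p)
  show "pfam (\<lambda>e. cell_Q n \<beta> (p e) i)"
    unfolding cell_Q_def by (intro pfam_prod q)
  show "pfam2 (\<lambda>e. cellh \<beta> (p e) l)"
  proof (induction l rule: less_induct)
    case (less l)
    show ?case
    proof (cases l)
      case (Suc i)
      show ?thesis unfolding Suc cell_h.simps(2) using less Suc
        by (intro pfam2_diff pfam2_mult pfam2_sum pfam2_smult pfam_mult pfam_prod q a pfam2_v) auto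
    qed simp
  qed
qed

text \<open>Normal forms are computed by expanding along the monic \<open>h\<^sub>l\<close> and reducing the
  coefficients modulo the monic \<open>Q\<^sub>l\<close>; both operations stay inside the ring of functions of
  the parameters.\<close>

lemma cell_normal_form:
  assumes sh: "cell_shape n \<beta>" and p: "\<And>x. (\<lambda>e. p e x) \<in> A" and F: "pfam2 F"
  obtains N where "\<And>l. pfam (N l)" "\<And>l e. N l e = 0 \<or> degree (N l e) < \<beta> l"
    "\<And>e I. cell n \<beta> (p e) I \<Longrightarrow> F e - (\<Sum>l<n. smult (N l e) (cellh \<beta> (p e) l)) \<in> I"
    "\<And>l e. n \<le> l \<Longrightarrow> N l e = 0"
proof -
  note fam = cell_families[where p = p, OF p]
  have lc: "lead_coeff (cellh \<beta> (p e) l) = 1" and dg: "degree (cellh \<beta> (p e) l) = l" for e l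
    by simp_all
  have "\<exists>D G. (\<forall>l. pfam (G l)) \<and> (\<forall>e. F e = (\<Sum>l\<le>D. smult (G l e) (cellh \<beta> (p e) l)))"
    by (rule pfam2_expand[where H = "\<lambda>l e. cellh \<beta> (p e) l", OF fam(4) lc dg F]) blast
  then obtain D G where G: "\<And>l. pfam (G l)" "\<And>e. F e = (\<Sum>l\<le>D. smult (G l e) (cellh \<beta> (p e) l))"
    by blast
  define G' where "G' l e = (if l \<le> D then G l e else 0)" for l e
  have G': "pfam (G' l)" for l using G(1) by (cases "l \<le> D") (simp_all add: G'_def[abs_def])
  define N where "N l e = G' l e mod cell_Q n \<beta> (p e) l" for l e
  show ?thesis
  proof (rule that)
    show "pfam (N l)" for l
      unfolding N_def using cell_Q_monic[OF sh] by (intro pfam_divmod[OF G' fam(3)]) auto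
    show "N l e = 0 \<or> degree (N l e) < \<beta> l" for l e
      using degree_mod_less[of "cell_Q n \<beta> (p e) l" "G' l e"] cell_Q_monic[OF sh, of "p e" l] by (auto simp: N_def)
    show "N l e = 0" if "n \<le> l" for l e using that by (simp add: N_def cell_Q_ge)
    then have N0: "N l e = 0" if "l \<notin> {..<n}" for l e using that by simp
    show "F e - (\<Sum>l<n. smult (N l e) (cellh \<beta> (p e) l)) \<in> I" if I: "cell n \<beta> (p e) I" for e I
    proof -
      let ?T = "{..max D n}"
      have "F e = (\<Sum>l\<in>?T. smult (G' l e) (cellh \<beta> (p e) l))"
        unfolding G(2) by (rule sum.mono_neutral_cong_left) (auto simp: G'_def)
      moreover have "(\<Sum>l<n. smult (N l e) (cellh \<beta> (p e) l)) = (\<Sum>l\<in>?T. smult (N l e) (cellh \<beta> (p e) l))"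
        by (rule sum.mono_neutral_left) (auto simp: N0)
      ultimately have "F e - (\<Sum>l<n. smult (N l e) (cellh \<beta> (p e) l))
          = (\<Sum>l\<in>?T. smult (G' l e - N l e) (cellh \<beta> (p e) l))"
        by (simp add: smult_diff_left sum_subtractf)
      also have "\<dots> = (\<Sum>l\<in>?T. smult (G' l e div cell_Q n \<beta> (p e) l) (smult (cell_Q n \<beta> (p e) l) (cellh \<beta> (p e) l)))"
        by (simp add: N_def minus_mod_eq_div_mult)
      also have "\<dots> \<in> I" by (intro ideal_sum[OF cellD(1)[OF I]] ideal_smult[OF cellD(1)[OF I] cellD(2)[OF I]])
      finally show ?thesis .
    qed
  qed
qed

end

section \<open>Coordinates of families of ideals in the charts of the Grassmannian\<close>

text \<open>A family of points of the Hilbert scheme over \<open>E\<close> whose spaces of forms of degree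
  \<open>n\<close> are cut out by at most \<open>n\<close> linear equations with coefficients in
  \<open>A\<close>. The locale serves for cells, with normal form coefficients as equations, and for changes of
  chart, with the coordinates of the first chart as equations.\<close>

locale chart_family = fun_ring A for A :: "('e \<Rightarrow> 'k::field alg_closure) set" +
  fixes n :: nat and J :: "'e \<Rightarrow> 'k ac_ideal" and E :: "'e set"
    and U :: "'x set" and w :: "3 exps \<Rightarrow> 'e \<Rightarrow> 'x \<Rightarrow> 'k alg_closure"
  assumes base_in: "(\<lambda>_. to_ac (b :: 'k)) \<in> A"
    and U: "finite U" "card U \<le> n"
    and w_in: "mdeg m = n \<Longrightarrow> x \<in> U \<Longrightarrow> (\<lambda>e. w m e x) \<in> A"
    and J_hilb: "e \<in> E \<Longrightarrow> J e \<in> hilb_points n"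
    and J_n: "e \<in> E \<Longrightarrow> hilbert_function (J e) n = n"
    and J_iff: "e \<in> E \<Longrightarrow> (lincomb c (deg_exps n)) \<in> J e \<longleftrightarrow> (\<forall>x\<in>U. (\<Sum>m\<in>deg_exps n. c m * w m e x) = 0)"
begin

lemma J_ideal: "e \<in> E \<Longrightarrow> is_ideal (J e)"
  using J_hilb by (auto simp: hilb_points_def homogeneous_ideal_def)

text \<open>Restricting the equations to the span of \<open>B\<close> gives a square linear system: its
  determinant says whether \<open>B\<close> is a basis of the quotient, and Cramer's rule gives the
  coordinates.\<close>

lemma chart_coordinates:
  "\<exists>D\<in>A. (\<forall>e\<in>E. J e \<in> hilb_chart n B \<longleftrightarrow> D e \<noteq> 0) \<and>
    (\<forall>m b. \<exists>N\<in>A. \<forall>e\<in>E. D e \<noteq> 0 \<longrightarrow> chart_coord n B (J e) (m, b) * D e = N e)"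
proof (cases "B \<subseteq> deg_exps n \<and> card B = n")
  case False
  have "J e \<notin> hilb_chart n B" if e: "e \<in> E" for e
  proof
    assume "J e \<in> hilb_chart n B"
    then have qb: "quot_basis (forms n) (J e \<inter> forms n) (monom ` B)" by (simp add: hilb_chart_def)
    then show False
      using False monom_quot_basis_iff[OF J_ideal[OF e]] hf_eq_card[OF J_ideal[OF e] qb] J_n[OF e] by auto
  qed
  then show ?thesis by (intro bexI[OF _ zero_in] conjI ballI allI) auto
next
  case True
  then have B: "B \<subseteq> deg_exps n" "card B = n" by auto
  have fB: "finite B" using finite_subset[OF B(1) finite_mdeg] .
  have cU: "card U \<le> card B" using U B by simp
  have wB: "\<forall>x\<in>U. \<forall>b\<in>B. (\<lambda>e. w b e x) \<in> A" using w_in B by blast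
  from cramer[where M = "\<lambda>e x b. w b e x", OF U(1) fB cU wB]
  obtain D where D: "D \<in> A"
    "\<And>e. D e \<noteq> 0 \<longleftrightarrow> (\<forall>c. (\<forall>x\<in>U. (\<Sum>b\<in>B. w b e x * c b) = 0) \<longrightarrow> (\<forall>b\<in>B. c b = 0))"
    and D3: "\<forall>v. (\<forall>x\<in>U. (\<lambda>e. v e x) \<in> A) \<longrightarrow> (\<forall>b\<in>B. \<exists>N\<in>A. \<forall>e c.
      (\<forall>x\<in>U. (\<Sum>b\<in>B. w b e x * c b) = v e x) \<longrightarrow> c b * D e = N e)"
    and D4: "\<And>e v. D e \<noteq> 0 \<Longrightarrow> \<exists>c. \<forall>x\<in>U. (\<Sum>b\<in>B. w b e x * c b) = v x"
    by (elim bexE conjE) auto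
  have sys: "f - lincomb c B \<in> J e \<longleftrightarrow>
      (\<forall>x\<in>U. (\<Sum>b\<in>B. w b e x * c b) = (\<Sum>m\<in>deg_exps n. lookup f m * w m e x))"
    if e: "e \<in> E" and f: "f \<in> forms n" for e c and f :: "(3, 'k alg_closure) mpoly"
  proof -
    let ?c = "\<lambda>m. lookup f m - (if m \<in> B then c m else 0)"
    have f1: "f = lincomb (lookup f) (deg_exps n)" by (rule form_expand[OF f, symmetric])
    have ex: "(\<Sum>b\<in>B. F b) = (\<Sum>m\<in>deg_exps n. if m \<in> B then F m else 0)" for F :: "3 exps \<Rightarrow> 'z::comm_monoid_add"
      using B(1) by (intro sum.mono_neutral_cong_left finite_mdeg) auto
    have "lincomb c B = (\<Sum>m\<in>deg_exps n. scale (if m \<in> B then c m else 0) (monom m :: (3, 'k alg_closure) mpoly))"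
      unfolding ex by (intro sum.cong refl) auto
    then have "f - lincomb c B = lincomb (lookup f) (deg_exps n) - (\<Sum>m\<in>deg_exps n. scale (if m \<in> B then c m else 0) (monom m))"
      using f1 by simp
    also have "\<dots> = lincomb ?c (deg_exps n)"
      by (simp only: kvec.scale_left_diff_distrib sum_subtractf)
    finally have "f - lincomb c B \<in> J e \<longleftrightarrow> (\<forall>x\<in>U. (\<Sum>m\<in>deg_exps n. ?c m * w m e x) = 0)"
      using J_iff[OF e] by simp
    moreover have "(\<Sum>m\<in>deg_exps n. ?c m * w m e x) = (\<Sum>m\<in>deg_exps n. lookup f m * w m e x) - (\<Sum>b\<in>B. w b e x * c b)" for x
    proof -
      have "(\<Sum>b\<in>B. w b e x * c b) = (\<Sum>m\<in>deg_exps n. (if m \<in> B then c m else 0) * w m e x)"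
        unfolding ex by (intro sum.cong refl) auto
      then show ?thesis by (simp add: left_diff_distrib sum_subtractf)
    qed
    ultimately show ?thesis by auto
  qed
  have sys0: "lincomb c B \<in> J e \<longleftrightarrow> (\<forall>x\<in>U. (\<Sum>b\<in>B. w b e x * c b) = 0)" if e: "e \<in> E" for e c
  proof -
    have "lincomb c B \<in> J e \<longleftrightarrow> 0 - (\<Sum>b\<in>B. scale (- c b) (monom b)) \<in> J e"
      by (simp add: kvec.scale_minus_left sum_negf)
    also have "\<dots> \<longleftrightarrow> (\<forall>x\<in>U. (\<Sum>b\<in>B. w b e x * - c b) = (\<Sum>m\<in>deg_exps n. lookup 0 m * w m e x))"
      by (rule sys[OF e]) simp
    also have "\<dots> \<longleftrightarrow> (\<forall>x\<in>U. (\<Sum>b\<in>B. w b e x * c b) = 0)" by (simp add: sum_negf)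
    finally show ?thesis .
  qed
  have chart: "J e \<in> hilb_chart n B \<longleftrightarrow> D e \<noteq> 0" if e: "e \<in> E" for e
  proof
    assume "J e \<in> hilb_chart n B"
    then have "\<forall>c. lincomb c B \<in> J e \<longrightarrow> (\<forall>b\<in>B. c b = 0)"
      using monom_quot_basis_iff[OF J_ideal[OF e]] by (simp add: hilb_chart_def)
    then show "D e \<noteq> 0" using D(2) sys0[OF e] by auto
  next
    assume De: "D e \<noteq> 0"
    have "\<exists>c. f - lincomb c B \<in> J e" if "f \<in> forms n" for f
      using D4[OF De, of "\<lambda>x. \<Sum>m\<in>deg_exps n. lookup f m * w m e x"] sys[OF e that] by auto
    moreover have "\<forall>c. lincomb c B \<in> J e \<longrightarrow> (\<forall>b\<in>B. c b = 0)"
      using D(2)[of e] De sys0[OF e] by auto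
    ultimately show "J e \<in> hilb_chart n B"
      using monom_quot_basis_iff[OF J_ideal[OF e], of n B] B J_hilb[OF e] by (auto simp: hilb_chart_def)
  qed
  have coord: "\<exists>N\<in>A. \<forall>e\<in>E. D e \<noteq> 0 \<longrightarrow> chart_coord n B (J e) (m, b) * D e = N e" for m b
  proof (cases "mdeg m = n \<and> b \<in> B")
    case True
    then have m: "(monom m :: (3, 'k alg_closure) mpoly) \<in> forms n" by simp
    have lm: "(\<Sum>m'\<in>deg_exps n. lookup (monom m) m' * w m' e x) = w m e x" for e x
    proof -
      have "(\<Sum>m'\<in>deg_exps n. lookup (monom m) m' * w m' e x) = (\<Sum>m'\<in>deg_exps n. if m' = m then w m' e x else 0)"
        by (intro sum.cong refl) (auto simp: lookup_monom)
      then show ?thesis using True by (simp add: sum.delta finite_mdeg)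
    qed
    obtain N where N: "N \<in> A" "\<And>e c. (\<forall>x\<in>U. (\<Sum>b\<in>B. w b e x * c b) = w m e x) \<Longrightarrow> c b * D e = N e"
      using D3[rule_format, of "w m" b] w_in True by blast
    have "chart_coord n B (J e) (m, b) * D e = N e" if e: "e \<in> E" and De: "D e \<noteq> 0" for e
    proof -
      let ?P = "\<lambda>c. (\<forall>b'. b' \<notin> B \<longrightarrow> c b' = 0) \<and> monom m - lincomb c B \<in> J e"
      obtain c where c: "\<forall>x\<in>U. (\<Sum>b\<in>B. w b e x * c b) = w m e x" using D4[OF De] by blast
      define c' where "c' b = (if b \<in> B then c b else 0)" for b
      have c': "\<forall>x\<in>U. (\<Sum>b\<in>B. w b e x * c' b) = w m e x" using c by (simp add: c'_def cong: sum.cong)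
      have P: "?P c'" using sys[OF e m, of c'] c' lm by (simp add: c'_def)
      have "d = c'" if d: "?P d" for d
      proof
        fix b'
        have "\<forall>x\<in>U. (\<Sum>b\<in>B. w b e x * d b) = w m e x" using sys[OF e m, of d] d lm by simp
        then have "\<forall>x\<in>U. (\<Sum>b\<in>B. w b e x * (d b - c' b)) = 0" using c' by (simp add: right_diff_distrib sum_subtractf)
        then have "\<forall>b\<in>B. d b - c' b = 0" using iffD1[OF D(2) De, rule_format, of "\<lambda>b. d b - c' b"] by blast
        then show "d b' = c' b'" using d P by (cases "b' \<in> B") auto
      qed
      with P have "(THE c. ?P c) = c'" by (rule the_equality[of ?P])
      then have "chart_coord n B (J e) (m, b) = c' b" using True by (simp add: chart_coord_def)
      then show ?thesis using N(2)[OF c'] by simp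
    qed
    then show ?thesis using N(1) by blast
  next
    case False
    then show ?thesis by (intro bexI[OF _ zero_in]) (auto simp: chart_coord_def)
  qed
  show ?thesis using D(1) chart coord by blast
qed

text \<open>A power of \<open>D\<close> clears the denominators of a polynomial in the coordinates.\<close>

lemma chart_functions:
  "\<exists>D\<in>A. (\<forall>e\<in>E. J e \<in> hilb_chart n B \<longleftrightarrow> D e \<noteq> 0) \<and>
    (\<forall>f :: (3 exps \<times> 3 exps, 'k) mpoly. \<exists>k. \<exists>N\<in>A. \<forall>e\<in>E. D e \<noteq> 0 \<longrightarrow> eval_over f (chart_coord n B (J e)) * D e ^ k = N e)"
proof -
  obtain D where D: "D \<in> A" "\<And>e. e \<in> E \<Longrightarrow> J e \<in> hilb_chart n B \<longleftrightarrow> D e \<noteq> 0"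
    and "\<forall>z. \<exists>N\<in>A. \<forall>e\<in>E. D e \<noteq> 0 \<longrightarrow> chart_coord n B (J e) z * D e = N e"
    using chart_coordinates[of B] by fast
  then obtain N where N: "\<And>z. N z \<in> A" "\<And>z e. e \<in> E \<Longrightarrow> D e \<noteq> 0 \<Longrightarrow> chart_coord n B (J e) z * D e = N z e"
    by metis
  have "\<exists>k. \<exists>N\<in>A. \<forall>e\<in>E. D e \<noteq> 0 \<longrightarrow> eval_over f (chart_coord n B (J e)) * D e ^ k = N e" for f :: "(3 exps \<times> 3 exps, 'k) mpoly"
  proof -
    define k where "k = (\<Sum>\<mu>\<in>keys f. mdeg \<mu>)"
    have le: "mdeg \<mu> \<le> k" if "\<mu> \<in> keys f" for \<mu>
      unfolding k_def using that by (intro member_le_sum) auto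
    define F where "F e = (\<Sum>\<mu>\<in>keys f. to_ac (lookup f \<mu>) * (\<Prod>z\<in>keys \<mu>. N z e ^ lookup \<mu> z) * D e ^ (k - mdeg \<mu>))" for e
    have "F \<in> A" unfolding F_def[abs_def] by (intro sum_in mult_in prod_in power_in base_in N D)
    moreover have "eval_over f (chart_coord n B (J e)) * D e ^ k = F e" if "e \<in> E" "D e \<noteq> 0" for e
    proof -
      have "pp (chart_coord n B (J e)) \<mu> * D e ^ k = (\<Prod>z\<in>keys \<mu>. N z e ^ lookup \<mu> z) * D e ^ (k - mdeg \<mu>)"
        if \<mu>: "\<mu> \<in> keys f" for \<mu>
      proof -
        have "D e ^ k = D e ^ mdeg \<mu> * D e ^ (k - mdeg \<mu>)" using le[OF \<mu>] by (simp flip: power_add)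
        moreover have "pp (chart_coord n B (J e)) \<mu> * D e ^ mdeg \<mu> = (\<Prod>z\<in>keys \<mu>. (chart_coord n B (J e) z * D e) ^ lookup \<mu> z)"
          by (simp add: pp_def mdeg_def power_sum power_mult_distrib prod.distrib)
        ultimately show ?thesis using N(2)[OF \<open>e \<in> E\<close> \<open>D e \<noteq> 0\<close>] by (simp add: mult.assoc[symmetric])
      qed
      note monomial = this
      have "eval_over f (chart_coord n B (J e)) * D e ^ k = (\<Sum>\<mu>\<in>keys f. to_ac (lookup f \<mu>) * (pp (chart_coord n B (J e)) \<mu> * D e ^ k))"
        by (simp only: eval_over_evalh evalh_def sum_distrib_right mult.assoc)
      also have "\<dots> = F e" unfolding F_def by (intro sum.cong refl) (simp only: monomial mult.assoc)
      finally show ?thesis .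
    qed
    ultimately show ?thesis by blast
  qed
  then show ?thesis using D by blast
qed

lemma chart_open:
  fixes f :: "(3 exps \<times> 3 exps, 'k) mpoly"
  shows "\<exists>G\<in>A. \<forall>e\<in>E. (J e \<in> hilb_chart n B \<and> eval_over f (chart_coord n B (J e)) \<noteq> 0) \<longleftrightarrow> G e \<noteq> 0"
proof -
  obtain D where D: "D \<in> A" "\<forall>e\<in>E. J e \<in> hilb_chart n B \<longleftrightarrow> D e \<noteq> 0"
    and f: "\<forall>f :: (3 exps \<times> 3 exps, 'k) mpoly. \<exists>k. \<exists>N\<in>A. \<forall>e\<in>E. D e \<noteq> 0 \<longrightarrow> eval_over f (chart_coord n B (J e)) * D e ^ k = N e"
    using chart_functions[of B] by (elim bexE conjE)
  obtain k N where N: "N \<in> A" "\<forall>e\<in>E. D e \<noteq> 0 \<longrightarrow> eval_over f (chart_coord n B (J e)) * D e ^ k = N e"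
    using f[rule_format, of f] by (elim exE bexE)
  note * = D(1) N(1) D(2)[rule_format] N(2)[rule_format]
  have "(J e \<in> hilb_chart n B \<and> eval_over f (chart_coord n B (J e)) \<noteq> 0) \<longleftrightarrow> D e * N e \<noteq> 0" if "e \<in> E" for e
  proof (cases "D e = 0")
    case False
    then have "N e = 0 \<longleftrightarrow> eval_over f (chart_coord n B (J e)) = 0"
      unfolding *(4)[OF that False, symmetric] by simp
    then show ?thesis using *(3)[OF that] False by simp
  qed (use *(3)[OF that] in simp)
  then show ?thesis by (intro bexI[OF _ mult_in[OF *(1,2)]] ballI)
qed

end

section \<open>Polynomial functions and algebraic dependence\<close>

inductive_set polyfun :: "(('i \<Rightarrow> 'k::field) \<Rightarrow> 'k) set" where
  const: "(\<lambda>_. c) \<in> polyfun"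
| var: "(\<lambda>e. e i) \<in> polyfun"
| add: "f \<in> polyfun \<Longrightarrow> g \<in> polyfun \<Longrightarrow> (\<lambda>e. f e + g e) \<in> polyfun"
| mult: "f \<in> polyfun \<Longrightarrow> g \<in> polyfun \<Longrightarrow> (\<lambda>e. f e * g e) \<in> polyfun"

lemma fun_ring_polyfun: "fun_ring (polyfun :: (('i \<Rightarrow> 'k::field) \<Rightarrow> 'k) set)"
proof (rule fun_ring.intro)
  show "(\<lambda>e. - f e) \<in> polyfun" if "f \<in> polyfun" for f :: "('i \<Rightarrow> 'k) \<Rightarrow> 'k"
    using polyfun.mult[OF polyfun.const[of "-1"] that] by simp
qed (auto intro: polyfun.intros)

text \<open>On a line, polynomial functions are polynomials in one variable, which over an infinite field have
  common nonzeros; this makes affine spaces irreducible.\<close>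

lemma polyfun_line:
  assumes "G \<in> polyfun"
  shows "\<exists>P. \<forall>t. G (\<lambda>i. p i + t * d i) = poly P t"
  using assms
proof induction
  case (const c)
  then show ?case by (intro exI[of _ "[:c:]"]) simp
next
  case (var i)
  then show ?case by (intro exI[of _ "[:p i, d i:]"]) simp
next
  case (add f g)
  then obtain P Q where "\<forall>t. f (\<lambda>i. p i + t * d i) = poly P t" "\<forall>t. g (\<lambda>i. p i + t * d i) = poly Q t" by blast
  then show ?case by (intro exI[of _ "P + Q"]) simp
next
  case (mult f g)
  then obtain P Q where "\<forall>t. f (\<lambda>i. p i + t * d i) = poly P t" "\<forall>t. g (\<lambda>i. p i + t * d i) = poly Q t" by blast
  then show ?case by (intro exI[of _ "P * Q"]) simp
qed

lemma (in vector_space) indexed_independent_card: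
  assumes "finite S" "\<And>c x. (\<Sum>x\<in>S. scale (c x) (u x)) = 0 \<Longrightarrow> x \<in> S \<Longrightarrow> c x = 0" "u ` S \<subseteq> span B" "finite B"
  shows "card S \<le> card B"
proof -
  have inj: "inj_on u S"
  proof (rule inj_onI, rule ccontr)
    fix x y assume xy: "x \<in> S" "y \<in> S" "u x = u y" "x \<noteq> y"
    let ?c = "\<lambda>z. if z = x then 1 else if z = y then -1 else 0"
    have "(\<Sum>z\<in>S. scale (?c z) (u z)) = (\<Sum>z\<in>{x, y}. scale (?c z) (u z))"
      using assms(1) xy by (intro sum.mono_neutral_right) auto
    also have "\<dots> = 0" using xy by simp
    finally show False using assms(2)[of ?c x] xy by simp
  qed
  have "independent (u ` S)"
  proof
    assume "dependent (u ` S)"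
    then obtain d where d: "\<exists>v\<in>u ` S. d v \<noteq> 0" "(\<Sum>v\<in>u ` S. scale (d v) v) = 0"
      using dependent_finite[of "u ` S"] assms(1) by auto
    then have "(\<Sum>x\<in>S. scale (d (u x)) (u x)) = 0" using inj by (simp add: sum.reindex)
    then show False using assms(2)[of "\<lambda>x. d (u x)"] d(1) by auto
  qed
  then have "card (u ` S) \<le> card B"
    using independent_span_bound[OF assms(4) _ assms(3)] by simp
  then show ?thesis using card_image[OF inj] by simp
qed

subsection \<open>Finite extensions inside the algebraic closure\<close>

definition ac_scale :: "'k::field \<Rightarrow> 'k alg_closure \<Rightarrow> 'k alg_closure" where
  "ac_scale c x = to_ac c * x"

interpretation acv: vector_space ac_scale
  by (rule vector_space.intro)
    (simp_all only: ac_scale_def to_ac_add to_ac_mult to_ac_1 distrib_left distrib_right mult.assoc mult_1)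

lemma (in vector_space) span_bilinear:
  fixes mul :: "'b \<Rightarrow> 'b \<Rightarrow> 'b"
  assumes mul: "\<And>x y z. mul (x + y) z = mul x z + mul y z" "\<And>x y z. mul x (y + z) = mul x y + mul x z"
      "\<And>c x y. mul (scale c x) y = scale c (mul x y)" "\<And>c x y. mul x (scale c y) = scale c (mul x y)"
    and x: "x \<in> span S" and y: "y \<in> span T" and gen: "\<And>s t. s \<in> S \<Longrightarrow> t \<in> T \<Longrightarrow> mul s t \<in> span M"
  shows "mul x y \<in> span M"
proof -
  have zero: "mul 0 z = 0" "mul z 0 = 0" for z using mul(3)[of 0 0 z] mul(4)[of z 0 0] by simp_all
  show ?thesis
    using x
  proof (induction rule: span_induct_alt)
    case base
    show ?case by (simp add: zero span_zero)
  next
    case (step c s z)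
    have "mul s y \<in> span M"
      using y
    proof (induction rule: span_induct_alt)
      case base
      show ?case by (simp add: zero span_zero)
    next
      case (step c' t z')
      then show ?case using gen[of s t] \<open>s \<in> S\<close> by (simp add: mul span_add span_scale)
    qed
    then show ?case using step by (simp add: mul span_add span_scale)
  qed
qed

lemma acv_span_mult:
  assumes "x \<in> acv.span S" "y \<in> acv.span T" "\<And>s t. s \<in> S \<Longrightarrow> t \<in> T \<Longrightarrow> s * t \<in> acv.span M"
  shows "x * y \<in> acv.span M"
  by (rule acv.span_bilinear[OF _ _ _ _ assms]) (simp_all add: ac_scale_def algebra_simps)

text \<open>\<open>W\<close> spans a subalgebra of finite dimension over the base field. Finitely many
  algebraic elements lie in one, so polynomials with coefficients in the algebraic closure can be counted over
  the base field.\<close>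

definition subalg_basis :: "'k::field alg_closure set \<Rightarrow> bool" where
  "subalg_basis W \<longleftrightarrow> finite W \<and> 1 \<in> acv.span W \<and> (\<forall>x\<in>W. \<forall>y\<in>W. x * y \<in> acv.span W)"

lemma power_in_span:
  fixes \<omega> :: "'k::field alg_closure"
  obtains d where "\<And>s. \<omega> ^ s \<in> acv.span ((\<lambda>i. \<omega> ^ i) ` {..<d})"
proof -
  obtain p :: "'k poly" where p: "p \<noteq> 0" "poly (map_poly to_ac p) \<omega> = 0"
    using alg_closure_algebraic by blast
  define d where "d = degree p"
  let ?S = "(\<lambda>i. \<omega> ^ i) ` {..<d}"
  have lc: "coeff p d \<noteq> 0" using p by (simp add: d_def)
  have "degree (map_poly to_ac p) = d" by (simp add: d_def degree_map_poly)
  then have "(\<Sum>i\<le>d. ac_scale (coeff p i) (\<omega> ^ i)) = 0"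
    using p(2) by (simp add: poly_altdef coeff_map_poly ac_scale_def)
  then have "ac_scale (coeff p d) (\<omega> ^ d) = - (\<Sum>i<d. ac_scale (coeff p i) (\<omega> ^ i))"
    unfolding lessThan_Suc_atMost[symmetric] sum.lessThan_Suc
    by (simp add: eq_neg_iff_add_eq_0 add.commute)
  moreover have "- (\<Sum>i<d. ac_scale (coeff p i) (\<omega> ^ i)) \<in> acv.span ?S"
    by (intro acv.span_neg acv.span_sum acv.span_scale acv.span_base) auto
  ultimately have "ac_scale (coeff p d) (\<omega> ^ d) \<in> acv.span ?S" by simp
  from acv.span_scale[OF this, of "inverse (coeff p d)"] have top: "\<omega> ^ d \<in> acv.span ?S"
    using lc by (simp add: acv.scale_scale)
  have "\<omega> ^ s \<in> acv.span ?S" for s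
  proof (induction s)
    case 0
    show ?case
    proof (cases "d = 0")
      case False
      then show ?thesis by (intro acv.span_base) (auto intro!: image_eqI[of _ _ 0])
    qed (use top in simp)
  next
    case (Suc s)
    have "\<omega> ^ s * \<omega> \<in> acv.span ?S"
    proof (rule acv_span_mult[OF Suc acv.span_base[of \<omega> "{\<omega>}"]])
      show "x * y \<in> acv.span ?S" if xy: "x \<in> ?S" "y \<in> {\<omega>}" for x y
      proof -
        obtain i where i: "i < d" "x = \<omega> ^ i" using xy by auto
        show ?thesis
        proof (cases "Suc i = d")
          case True
          then have "x * y = \<omega> ^ d" using xy i by (simp flip: True)
          then show ?thesis using top by simp
        next
          case False
          then show ?thesis using xy i by (intro acv.span_base) (auto intro!: image_eqI[of _ _ "Suc i"])
        qed
      qed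
    qed simp
    then show ?case by (simp add: mult.commute)
  qed
  then show ?thesis by (rule that)
qed

lemma subalg_basis_exists:
  fixes \<Omega> :: "'k::field alg_closure set"
  assumes "finite \<Omega>"
  shows "\<exists>W. subalg_basis W \<and> \<Omega> \<subseteq> acv.span W"
  using assms
proof induction
  case empty
  have "subalg_basis {1 :: 'k alg_closure}" by (auto simp: subalg_basis_def acv.span_base)
  then show ?case by blast
next
  case (insert \<omega> \<Omega>)
  then obtain W where W: "subalg_basis W" "\<Omega> \<subseteq> acv.span W" by blast
  obtain d where d: "\<And>s. \<omega> ^ s \<in> acv.span ((\<lambda>i. \<omega> ^ i) ` {..<d})" using power_in_span by blast
  let ?P = "(\<lambda>i. \<omega> ^ i) ` {..<d}"
  define M where "M = (\<lambda>(w, i). w * \<omega> ^ i) ` (W \<times> {..<d})"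
  have prod: "x * y \<in> acv.span M" if "x \<in> acv.span W" "y \<in> acv.span ?P" for x y
  proof (rule acv_span_mult[OF that])
    fix s t assume "s \<in> W" "t \<in> ?P"
    then have "s * t \<in> M" by (auto simp: M_def)
    then show "s * t \<in> acv.span M" by (rule acv.span_base)
  qed
  have one: "1 \<in> acv.span W" using W by (simp add: subalg_basis_def)
  have fin: "finite M" using W by (simp add: M_def subalg_basis_def)
  have inW: "x \<in> acv.span M" if "x \<in> acv.span W" for x
    using prod[OF that d[of 0]] by simp
  have "subalg_basis M"
    unfolding subalg_basis_def
  proof (intro conjI ballI fin)
    show "1 \<in> acv.span M" using inW[OF one] .
    fix x y assume "x \<in> M" "y \<in> M"
    then obtain w i w' j where xy: "w \<in> W" "w' \<in> W" "x = w * \<omega> ^ i" "y = w' * \<omega> ^ j" by (auto simp: M_def)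
    have "x * y = (w * w') * \<omega> ^ (i + j)" using xy by (simp add: power_add algebra_simps)
    moreover have "w * w' \<in> acv.span W" using W xy by (simp add: subalg_basis_def)
    ultimately show "x * y \<in> acv.span M" using prod d by simp
  qed
  moreover have "\<omega> \<in> acv.span M" using prod[OF one d[of 1]] by simp
  moreover have "\<Omega> \<subseteq> acv.span M" using W(2) inW by auto
  ultimately show ?case by blast
qed

subsection \<open>Counting monomials\<close>

definition fun_scale :: "'k::field \<Rightarrow> ('y \<Rightarrow> 'k alg_closure) \<Rightarrow> 'y \<Rightarrow> 'k alg_closure" where
  "fun_scale c f = (\<lambda>y. to_ac c * f y)"

interpretation funv: vector_space fun_scale
  by (rule vector_space.intro)
    (simp_all only: fun_scale_def fun_eq_iff plus_fun_apply to_ac_add to_ac_mult to_ac_1 distrib_left distrib_right mult.assoc mult_1 simp_thms)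

lemma sum_fun_apply': "(\<Sum>x\<in>S. F x) y = (\<Sum>x\<in>S. F x y)" for F :: "'x \<Rightarrow> 'y \<Rightarrow> 'a::comm_monoid_add"
  by (induction S rule: infinite_finite_induct) simp_all

lemma funv_span_mult:
  assumes "f \<in> funv.span S" "g \<in> funv.span T" "\<And>s t. s \<in> S \<Longrightarrow> t \<in> T \<Longrightarrow> (\<lambda>y. s y * t y) \<in> funv.span M"
  shows "(\<lambda>y. f y * g y) \<in> funv.span M"
  by (rule funv.span_bilinear[where mul = "\<lambda>f g y. f y * g y", OF _ _ _ _ assms])
    (auto simp: fun_scale_def algebra_simps)

text \<open>Generators, over the base field, of the polynomial functions of the parameters \<open>e\<close>
  that have degree at most \<open>c\<close> in each parameter and coefficients in the span of
  \<open>W\<close>.\<close>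

definition filt_gen :: "'k::field alg_closure set \<Rightarrow> 'i set \<Rightarrow> ('y \<Rightarrow> 'i \<Rightarrow> 'k alg_closure) \<Rightarrow> nat \<Rightarrow> ('y \<Rightarrow> 'k alg_closure) set" where
  "filt_gen W V e c = (\<lambda>(w, \<gamma>) y. w * (\<Prod>i\<in>V. e y i ^ \<gamma> i)) ` (W \<times> PiE V (\<lambda>_. {..c}))"

lemma filt_gen_card:
  assumes "finite W" "finite V"
  shows "finite (filt_gen W V e c)" "card (filt_gen W V e c) \<le> card W * Suc c ^ card V"
proof -
  have f: "finite (W \<times> PiE V (\<lambda>_. {..c}))" using assms by (intro finite_cartesian_product finite_PiE) auto
  show "finite (filt_gen W V e c)" unfolding filt_gen_def using f by (rule finite_imageI)
  have "card (filt_gen W V e c) \<le> card (W \<times> PiE V (\<lambda>_. {..c}))"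
    unfolding filt_gen_def using f by (rule card_image_le)
  then show "card (filt_gen W V e c) \<le> card W * Suc c ^ card V"
    using assms by (simp add: card_cartesian_product card_PiE)
qed

lemma filt_genI:
  assumes "w \<in> acv.span W" "finite V" "\<And>i. i \<in> V \<Longrightarrow> \<gamma> i \<le> c"
  shows "(\<lambda>y. w * (\<Prod>i\<in>V. e y i ^ \<gamma> i)) \<in> funv.span (filt_gen W V e c)"
  using assms(1)
proof (induction rule: acv.span_induct_alt)
  case base
  then show ?case using funv.span_zero[of "filt_gen W V e c"] by (simp add: zero_fun_def)
next
  case (step a w z)
  have "(\<lambda>y. w * (\<Prod>i\<in>V. e y i ^ \<gamma> i)) = (\<lambda>y. w * (\<Prod>i\<in>V. e y i ^ restrict \<gamma> V i))"
    by (intro ext arg_cong[of _ _ "\<lambda>x. w * x"] prod.cong refl) simp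
  also have "\<dots> = (\<lambda>(w, \<gamma>) y. w * (\<Prod>i\<in>V. e y i ^ \<gamma> i)) (w, restrict \<gamma> V)" by simp
  also have "\<dots> \<in> filt_gen W V e c"
    unfolding filt_gen_def by (rule imageI) (use step assms(3) in auto)
  finally have "(\<lambda>y. w * (\<Prod>i\<in>V. e y i ^ \<gamma> i)) \<in> funv.span (filt_gen W V e c)" by (rule funv.span_base)
  moreover have "(\<lambda>y. (ac_scale a w + z) * (\<Prod>i\<in>V. e y i ^ \<gamma> i)) = fun_scale a (\<lambda>y. w * (\<Prod>i\<in>V. e y i ^ \<gamma> i)) + (\<lambda>y. z * (\<Prod>i\<in>V. e y i ^ \<gamma> i))"
    by (auto simp: ac_scale_def fun_scale_def algebra_simps)
  ultimately show ?case using step by (simp add: funv.span_add funv.span_scale)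
qed

lemma filt_mult:
  assumes W: "subalg_basis W" and V: "finite V"
    and "f \<in> funv.span (filt_gen W V e c)" "g \<in> funv.span (filt_gen W V e d)"
  shows "(\<lambda>y. f y * g y) \<in> funv.span (filt_gen W V e (c + d))"
proof (rule funv_span_mult[OF assms(3,4)])
  fix s t assume "s \<in> filt_gen W V e c" "t \<in> filt_gen W V e d"
  then obtain w \<gamma> w' \<gamma>' where st: "w \<in> W" "w' \<in> W" "\<gamma> \<in> PiE V (\<lambda>_. {..c})" "\<gamma>' \<in> PiE V (\<lambda>_. {..d})"
    "s = (\<lambda>y. w * (\<Prod>i\<in>V. e y i ^ \<gamma> i))" "t = (\<lambda>y. w' * (\<Prod>i\<in>V. e y i ^ \<gamma>' i))"
    by (auto simp: filt_gen_def)
  have "(\<lambda>y. s y * t y) = (\<lambda>y. (w * w') * (\<Prod>i\<in>V. e y i ^ (\<gamma> i + \<gamma>' i)))"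
    using st by (simp add: power_add prod.distrib mult_ac)
  also have "\<dots> \<in> funv.span (filt_gen W V e (c + d))"
    using st W by (intro filt_genI V) (auto simp: subalg_basis_def PiE_iff intro!: add_mono)
  finally show "(\<lambda>y. s y * t y) \<in> funv.span (filt_gen W V e (c + d))" .
qed

lemma filt_mono:
  assumes V: "finite V" and "c \<le> d" "f \<in> funv.span (filt_gen W V e c)"
  shows "f \<in> funv.span (filt_gen W V e d)"
proof -
  have "filt_gen W V e c \<subseteq> filt_gen W V e d"
    unfolding filt_gen_def using assms by (intro image_mono Sigma_mono PiE_mono) auto
  then show ?thesis using funv.span_mono assms(3) by blast
qed

lemma filt_const: 
  assumes "w \<in> acv.span W" "finite V" shows "(\<lambda>y. w) \<in> funv.span (filt_gen W V e c)"
  using filt_genI[OF assms, of "\<lambda>_. 0"] by simp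

lemma filt_power:
  assumes W: "subalg_basis W" and V: "finite V" and "f \<in> funv.span (filt_gen W V e c)"
  shows "(\<lambda>y. f y ^ k) \<in> funv.span (filt_gen W V e (k * c))"
proof (induction k)
  case 0
  then show ?case using filt_const[of 1 W V e] W V by (simp add: subalg_basis_def)
next
  case (Suc k)
  then show ?case using filt_mult[OF W V assms(3) Suc] by simp
qed

lemma filt_prod:
  assumes W: "subalg_basis W" and V: "finite V" and "finite T" "\<And>i. i \<in> T \<Longrightarrow> (\<lambda>y. F y i) \<in> funv.span (filt_gen W V e c)"
  shows "(\<lambda>y. \<Prod>i\<in>T. F y i) \<in> funv.span (filt_gen W V e (card T * c))"
  using assms(3,4)
proof (induction)
  case empty
  then show ?case using filt_const[of 1 W V e] W V by (simp add: subalg_basis_def)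
next
  case (insert x T)
  then show ?case using filt_mult[OF W V insert.prems[of x] insert.IH] by simp
qed

text \<open>\<open>\<Omega>\<close> collects the finitely many coefficients of \<open>G\<close>. It is
  independent of \<open>W\<close> because several functions will have to share one \<open>W\<close>.\<close>

lemma polyfun_filt:
  fixes e :: "'y \<Rightarrow> 'i \<Rightarrow> 'k::field alg_closure"
  assumes "G \<in> polyfun" and V: "finite V" "\<forall>y i. i \<notin> V \<longrightarrow> e y i = 0"
  shows "\<exists>\<Omega> c. finite \<Omega> \<and> (\<forall>W. subalg_basis W \<and> \<Omega> \<subseteq> acv.span W \<longrightarrow> (\<lambda>y. G (e y)) \<in> funv.span (filt_gen W V e c))"
  using assms(1)
proof induction
  case (const a)
  then show ?case using V filt_const by (intro exI[of _ "{a}"] exI[of _ 0]) auto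
next
  case (var i)
  show ?case
  proof (intro exI[of _ "{0}"] exI[of _ 1] conjI allI impI)
    fix W :: "'k alg_closure set" assume W: "subalg_basis W \<and> {0} \<subseteq> acv.span W"
    show "(\<lambda>y. e y i) \<in> funv.span (filt_gen W V e 1)"
    proof (cases "i \<in> V")
      case True
      have "(\<Prod>j\<in>V. e y j ^ (if j = i then 1 else 0)) = e y i" for y
      proof -
        have "(\<Prod>j\<in>V. e y j ^ (if j = i then 1 else 0)) = (\<Prod>j\<in>V. if j = i then e y j else 1)"
          by (intro prod.cong refl) simp
        then show ?thesis using True V(1) by (simp add: prod.delta)
      qed
      moreover have "(\<lambda>y. 1 * (\<Prod>j\<in>V. e y j ^ (if j = i then 1 else 0))) \<in> funv.span (filt_gen W V e 1)"
        using W by (intro filt_genI V) (auto simp: subalg_basis_def)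
      ultimately show ?thesis by simp
    next
      case False
      then show ?thesis using V(2) funv.span_zero[of "filt_gen W V e 1"] by (simp add: zero_fun_def)
    qed
  qed simp
next
  case (add f g)
  then obtain \<Omega> c \<Omega>' c' where *: "finite \<Omega>" "finite \<Omega>'"
    "\<And>W. subalg_basis W \<Longrightarrow> \<Omega> \<subseteq> acv.span W \<Longrightarrow> (\<lambda>y. f (e y)) \<in> funv.span (filt_gen W V e c)"
    "\<And>W. subalg_basis W \<Longrightarrow> \<Omega>' \<subseteq> acv.span W \<Longrightarrow> (\<lambda>y. g (e y)) \<in> funv.span (filt_gen W V e c')" by blast
  show ?case
  proof (intro exI[of _ "\<Omega> \<union> \<Omega>'"] exI[of _ "max c c'"] conjI allI impI)
    fix W :: "'k alg_closure set" assume W: "subalg_basis W \<and> \<Omega> \<union> \<Omega>' \<subseteq> acv.span W"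
    have "(\<lambda>y. f (e y)) \<in> funv.span (filt_gen W V e (max c c'))"
      using W *(3) by (intro filt_mono[OF V(1), of c "max c c'"]) auto
    moreover have "(\<lambda>y. g (e y)) \<in> funv.span (filt_gen W V e (max c c'))"
      using W *(4) by (intro filt_mono[OF V(1), of c' "max c c'"]) auto
    ultimately have "(\<lambda>y. f (e y)) + (\<lambda>y. g (e y)) \<in> funv.span (filt_gen W V e (max c c'))" by (rule funv.span_add)
    then show "(\<lambda>y. f (e y) + g (e y)) \<in> funv.span (filt_gen W V e (max c c'))" by (simp add: plus_fun_def)
  qed (use * in simp)
next
  case (mult f g)
  then obtain \<Omega> c \<Omega>' c' where *: "finite \<Omega>" "finite \<Omega>'"
    "\<And>W. subalg_basis W \<Longrightarrow> \<Omega> \<subseteq> acv.span W \<Longrightarrow> (\<lambda>y. f (e y)) \<in> funv.span (filt_gen W V e c)"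
    "\<And>W. subalg_basis W \<Longrightarrow> \<Omega>' \<subseteq> acv.span W \<Longrightarrow> (\<lambda>y. g (e y)) \<in> funv.span (filt_gen W V e c')" by blast
  show ?case
  proof (intro exI[of _ "\<Omega> \<union> \<Omega>'"] exI[of _ "c + c'"] conjI allI impI)
    fix W :: "'k alg_closure set" assume W: "subalg_basis W \<and> \<Omega> \<union> \<Omega>' \<subseteq> acv.span W"
    then show "(\<lambda>y. f (e y) * g (e y)) \<in> funv.span (filt_gen W V e (c + c'))"
      using *(3,4)[of W] by (intro filt_mult[OF _ V(1)]) auto
  qed (use * in simp)
qed

text \<open>Comparison of growth rates in \<open>N\<close>.\<close>

lemma exponent_bound:
  assumes "\<And>N. Suc N ^ r \<le> w * Suc (r * (N * c)) ^ m"
  shows "r \<le> (m :: nat)"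
proof (rule ccontr)
  assume "\<not> r \<le> m"
  define N where "N = w * Suc (r * c) ^ m"
  have "Suc N ^ Suc m \<le> Suc N ^ r" using \<open>\<not> r \<le> m\<close> by (intro power_increasing) auto
  also have "\<dots> \<le> w * Suc (r * (N * c)) ^ m" by (rule assms)
  also have "\<dots> \<le> w * (Suc (r * c) * Suc N) ^ m"
    by (intro mult_le_mono2 power_mono) (auto simp: algebra_simps)
  also have "\<dots> = N * Suc N ^ m" by (simp only: N_def power_mult_distrib mult.assoc)
  finally show False by simp
qed

text \<open>After multiplication by a common denominator, the \<open>(N + 1)\<^sup>r\<close> monomials in
  the \<open>g\<^sub>i\<close> with exponents at most \<open>N\<close> become polynomials of degree at most
  \<open>r N c\<close> in each of the \<open>card V\<close> parameters. The space of these has dimension at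
  most \<open>card W\<close> times the \<open>card V\<close>-th power of \<open>r N c + 1\<close>, so for
  \<open>r > card V\<close> the monomials would be dependent over the base field.\<close>

lemma algebraic_dependence_bound:
  fixes e :: "'y \<Rightarrow> 'i \<Rightarrow> 'k::field alg_closure" and g :: "nat \<Rightarrow> 'y \<Rightarrow> 'k alg_closure"
  assumes V: "finite V" "\<forall>y i. i \<notin> V \<longrightarrow> e y i = 0"
    and D: "D \<in> polyfun" "\<And>y. y \<in> Y \<Longrightarrow> D (e y) \<noteq> 0"
    and g: "\<And>i. i < r \<Longrightarrow> \<exists>N\<in>polyfun. \<exists>k. \<forall>y\<in>Y. g i y * D (e y) ^ k = N (e y)"
    and ind: "\<And>N c \<alpha>. (\<forall>y\<in>Y. (\<Sum>\<alpha>\<in>PiE {..<r} (\<lambda>_. {..N}). to_ac (c \<alpha>) * (\<Prod>i<r. g i y ^ \<alpha> i)) = 0) \<Longrightarrow>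
      \<alpha> \<in> PiE {..<r} (\<lambda>_. {..N}) \<Longrightarrow> (c \<alpha> :: 'k) = 0"
  shows "r \<le> card V"
proof -
  interpret pf: fun_ring "polyfun :: (('i \<Rightarrow> 'k alg_closure) \<Rightarrow> 'k alg_closure) set" by (rule fun_ring_polyfun)
  obtain Nf kf where Nf: "\<And>i. i < r \<Longrightarrow> Nf i \<in> polyfun" "\<And>i y. i < r \<Longrightarrow> y \<in> Y \<Longrightarrow> g i y * D (e y) ^ kf i = Nf i (e y)"
    using g by metis
  define k where "k = (\<Sum>i<r. kf i)"
  have kf: "kf i \<le> k" if "i < r" for i unfolding k_def using that by (intro member_le_sum) auto
  define N' where "N' i x = Nf i x * D x ^ (k - kf i)" for i x
  define D' where "D' x = D x ^ k" for x
  have N': "N' i \<in> polyfun" if "i < r" for i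
    unfolding N'_def[abs_def] using Nf(1)[OF that] D(1) by (intro pf.mult_in pf.power_in)
  have D': "D' \<in> polyfun" unfolding D'_def[abs_def] using D(1) by (intro pf.power_in)
  have gN: "g i y * D' (e y) = N' i (e y)" if "i < r" "y \<in> Y" for i y
  proof -
    have "D (e y) ^ k = D (e y) ^ kf i * D (e y) ^ (k - kf i)" using kf[OF that(1)] by (simp flip: power_add)
    then show ?thesis using Nf(2)[OF that] by (simp add: D'_def N'_def mult.assoc[symmetric])
  qed
  have "\<exists>\<Omega> c. finite \<Omega> \<and> (\<forall>W. subalg_basis W \<and> \<Omega> \<subseteq> acv.span W \<longrightarrow> (\<lambda>y. N' i (e y)) \<in> funv.span (filt_gen W V e c))"
    if "i < r" for i
    using polyfun_filt[where e = e, OF N'[OF that] V] .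
  then obtain \<Omega>f cf where \<Omega>f: "\<And>i. i < r \<Longrightarrow> finite (\<Omega>f i)"
    "\<And>i W. i < r \<Longrightarrow> subalg_basis W \<Longrightarrow> \<Omega>f i \<subseteq> acv.span W \<Longrightarrow> (\<lambda>y. N' i (e y)) \<in> funv.span (filt_gen W V e (cf i))"
    by metis
  from polyfun_filt[where e = e, OF D' V] obtain \<Omega>0 c0 where fin0: "finite \<Omega>0"
    and \<Omega>0: "\<forall>W. subalg_basis W \<and> \<Omega>0 \<subseteq> acv.span W \<longrightarrow> (\<lambda>y. D' (e y)) \<in> funv.span (filt_gen W V e c0)"
    by (elim exE conjE)
  have "finite (\<Omega>0 \<union> (\<Union>i<r. \<Omega>f i))" using fin0 \<Omega>f(1) by auto
  then obtain W where W: "subalg_basis W" "\<Omega>0 \<union> (\<Union>i<r. \<Omega>f i) \<subseteq> acv.span W"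
    using subalg_basis_exists by blast
  define c where "c = c0 + (\<Sum>i<r. cf i)"
  have cf: "cf i \<le> c" if "i < r" for i
  proof -
    have "cf i \<le> (\<Sum>i<r. cf i)" using that by (intro member_le_sum) auto
    then show ?thesis by (simp add: c_def)
  qed
  have fN: "(\<lambda>y. N' i (e y)) \<in> funv.span (filt_gen W V e c)" if "i < r" for i
    using \<Omega>f(2)[OF that W(1)] W(2) that by (intro filt_mono[OF V(1) cf[OF that]]) auto
  have fD: "(\<lambda>y. D' (e y)) \<in> funv.span (filt_gen W V e c)"
    using \<Omega>0 W by (intro filt_mono[OF V(1), of c0 c]) (auto simp: c_def)
  have "Suc N ^ r \<le> card W * Suc (r * (N * c)) ^ card V" for N
  proof -
    let ?A = "PiE {..<r} (\<lambda>_. {..N})"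
    define F where "F \<alpha> y = (\<Prod>i<r. N' i (e y) ^ \<alpha> i * D' (e y) ^ (N - \<alpha> i))" for \<alpha> :: "nat \<Rightarrow> nat" and y
    have finA: "finite ?A" by (rule finite_PiE) auto
    have "F \<alpha> \<in> funv.span (filt_gen W V e (r * (N * c)))" if \<alpha>: "\<alpha> \<in> ?A" for \<alpha>
    proof -
      have "(\<lambda>y. N' i (e y) ^ \<alpha> i * D' (e y) ^ (N - \<alpha> i)) \<in> funv.span (filt_gen W V e (N * c))" if "i < r" for i
      proof -
        have "\<alpha> i \<le> N" using \<alpha> that by (auto simp: PiE_iff)
        then have "\<alpha> i * c + (N - \<alpha> i) * c = N * c" by (simp flip: distrib_right)
        then show ?thesis
          using filt_mult[OF W(1) V(1) filt_power[OF W(1) V(1) fN[OF that], of "\<alpha> i"] filt_power[OF W(1) V(1) fD, of "N - \<alpha> i"]]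
          by simp
      qed
      then have "(\<lambda>y. \<Prod>i\<in>{..<r}. N' i (e y) ^ \<alpha> i * D' (e y) ^ (N - \<alpha> i)) \<in> funv.span (filt_gen W V e (card {..<r} * (N * c)))"
        by (intro filt_prod[OF W(1) V(1)]) auto
      then show ?thesis by (simp add: F_def[abs_def])
    qed
    then have sub: "F ` ?A \<subseteq> funv.span (filt_gen W V e (r * (N * c)))" by blast
    have Fg: "F \<alpha> y = (\<Prod>i<r. g i y ^ \<alpha> i) * (D' (e y) ^ N) ^ r" if "\<alpha> \<in> ?A" "y \<in> Y" for \<alpha> y
    proof -
      have "N' i (e y) ^ \<alpha> i * D' (e y) ^ (N - \<alpha> i) = g i y ^ \<alpha> i * D' (e y) ^ N" if "i < r" for i
      proof -
        have "\<alpha> i \<le> N" using \<open>\<alpha> \<in> ?A\<close> that by (auto simp: PiE_iff)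
        then have "D' (e y) ^ N = D' (e y) ^ \<alpha> i * D' (e y) ^ (N - \<alpha> i)" by (simp flip: power_add)
        then show ?thesis unfolding gN[OF that \<open>y \<in> Y\<close>, symmetric] by (simp add: power_mult_distrib mult.assoc)
      qed
      then show ?thesis by (simp add: F_def prod.distrib)
    qed
    have "card ?A \<le> card (filt_gen W V e (r * (N * c)))"
    proof (rule funv.indexed_independent_card[OF finA _ sub])
      fix a \<alpha> assume a: "(\<Sum>\<alpha>\<in>?A. fun_scale (a \<alpha>) (F \<alpha>)) = 0" and \<alpha>: "\<alpha> \<in> ?A"
      have "(\<Sum>\<alpha>\<in>?A. to_ac (a \<alpha>) * (\<Prod>i<r. g i y ^ \<alpha> i)) = 0" if y: "y \<in> Y" for y
      proof -
        have "(\<Sum>\<alpha>\<in>?A. fun_scale (a \<alpha>) (F \<alpha>)) y = (\<Sum>\<alpha>\<in>?A. to_ac (a \<alpha>) * F \<alpha> y)"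
          by (simp add: fun_scale_def sum_fun_apply')
        then have "0 = (\<Sum>\<alpha>\<in>?A. to_ac (a \<alpha>) * F \<alpha> y)" using a by simp
        also have "\<dots> = (\<Sum>\<alpha>\<in>?A. to_ac (a \<alpha>) * (\<Prod>i<r. g i y ^ \<alpha> i)) * (D' (e y) ^ N) ^ r"
          unfolding sum_distrib_right using Fg[OF _ y] by (intro sum.cong refl) (simp add: mult.assoc)
        finally show ?thesis using D(2)[OF y] by (simp add: D'_def)
      qed
      then show "a \<alpha> = 0" by (intro ind[where N = N and c = a and \<alpha> = \<alpha>] ballI \<alpha>)
    qed (use filt_gen_card[of W V] W V in \<open>simp add: subalg_basis_def\<close>)
    also have "\<dots> \<le> card W * Suc (r * (N * c)) ^ card V"
      using filt_gen_card(2)[of W V] W V by (simp add: subalg_basis_def)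
    finally show ?thesis by (simp add: card_PiE)
  qed
  then show ?thesis by (rule exponent_bound)
qed

section \<open>An upper bound for the length of chains of irreducible closed sets\<close>

lemma irreducible_closedD:
  assumes "irreducible_closedin T C"
  shows "closedin T C" "C \<noteq> {}" "C \<subseteq> topspace T"
    "closedin T A \<Longrightarrow> closedin T B \<Longrightarrow> C = A \<union> B \<Longrightarrow> C = A \<or> C = B"
  using assms closedin_subset unfolding irreducible_closedin_def by blast+

text \<open>The open set \<open>U\<close> stands for a chart that meets \<open>C 0\<close>, and
  \<open>Fs\<close> for its ring of functions; the sets \<open>P \<phi>\<close> are pieces on which these
  functions are rational functions of at most \<open>m\<close> parameters. A chain yields \<open>k\<close>
  functions in \<open>Fs\<close> that are algebraically independent on its top member, whereas \<open>m\<close>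
  parameters do not carry more than \<open>m\<close> such functions.\<close>

lemma krull_chain_bound:
  fixes T :: "'x topology" and Fs :: "('x \<Rightarrow> 'k::field alg_closure) set" and P :: "'\<phi> \<Rightarrow> 'x set"
  assumes Fs: "fun_ring Fs" and const_in: "\<And>c :: 'k. (\<lambda>_. to_ac c) \<in> Fs"
    and open_D: "\<And>g. g \<in> Fs \<Longrightarrow> openin T {x \<in> topspace T \<inter> U. g x \<noteq> 0}"
    and basis: "\<And>W x. openin T W \<Longrightarrow> x \<in> W \<Longrightarrow> x \<in> U \<Longrightarrow> \<exists>g\<in>Fs. g x \<noteq> 0 \<and> {y \<in> topspace T \<inter> U. g y \<noteq> 0} \<subseteq> W"
    and C: "\<And>i. i \<le> k \<Longrightarrow> irreducible_closedin T (C i)" "\<And>i. i < k \<Longrightarrow> C i \<subset> C (Suc i)" "C 0 \<inter> U \<noteq> {}"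
    and cover: "finite \<Phi>" "topspace T \<inter> U \<subseteq> (\<Union>\<phi>\<in>\<Phi>. P \<phi>)"
    and param: "\<And>\<phi>. \<phi> \<in> \<Phi> \<Longrightarrow> \<exists>(e :: 'x \<Rightarrow> 'i \<Rightarrow> 'k alg_closure) D V. finite V \<and> card V \<le> m \<and>
      (\<forall>y i. i \<notin> V \<longrightarrow> e y i = 0) \<and> D \<in> polyfun \<and> (\<forall>y\<in>P \<phi> \<inter> (topspace T \<inter> U). D (e y) \<noteq> 0) \<and>
      (\<forall>g\<in>Fs. \<exists>N\<in>polyfun. \<exists>j. \<forall>y\<in>P \<phi> \<inter> (topspace T \<inter> U). g y * D (e y) ^ j = N (e y))"
  shows "k \<le> m"
proof -
  interpret fun_ring Fs by fact
  let ?Z = "\<lambda>i. C i \<inter> U"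
  have mono: "C i \<subseteq> C j" if "i \<le> j" "j \<le> k" for i j
    using that by (induction rule: dec_induct) (use C(2) in \<open>auto simp: less_eq_Suc_le\<close>)
  have sub: "?Z i \<subseteq> topspace T \<inter> U" if "i \<le> k" for i
    using irreducible_closedD(3)[OF C(1)[OF that]] by auto
  have ne: "?Z i \<noteq> {}" if "i \<le> k" for i
    using mono[of 0 i] that C(3) by auto
  \<comment> \<open>By irreducibility, the functions vanishing on a member of the chain form a prime
    ideal.\<close>
  have prime: "(\<forall>y\<in>?Z i. g y = 0) \<or> (\<forall>y\<in>?Z i. h y = 0)"
    if i: "i \<le> k" and gh: "g \<in> Fs" "h \<in> Fs" "\<forall>y\<in>?Z i. g y * h y = 0" for i g h
  proof -
    let ?D = "\<lambda>g :: 'x \<Rightarrow> 'k alg_closure. {x \<in> topspace T \<inter> U. g x \<noteq> 0}"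
    have cl: "closedin T (C i - ?D g)" if "g \<in> Fs" for g
      using closedin_diff[OF irreducible_closedD(1)[OF C(1)[OF i]] open_D[OF that]] .
    have "C i = (C i - ?D g) \<union> (C i - ?D h)" using gh(3) by auto
    then have "C i = C i - ?D g \<or> C i = C i - ?D h"
      using irreducible_closedD(4)[OF C(1)[OF i] cl[OF gh(1)] cl[OF gh(2)]] by blast
    then show ?thesis using sub[OF i] by blast
  qed
  \<comment> \<open>The chain stays strict on \<open>U\<close>, because \<open>U\<close> meets every member in
    a dense subset.\<close>
  have strict: "\<exists>g\<in>Fs. (\<forall>y\<in>?Z i. g y = 0) \<and> \<not> (\<forall>y\<in>?Z (Suc i). g y = 0)" if i: "i < k" for i
  proof -
    have ik: "i \<le> k" "Suc i \<le> k" using i by auto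
    have oU: "openin T {x \<in> topspace T \<inter> U. (1 :: 'k alg_closure) \<noteq> 0}" by (rule open_D[OF one_in])
    then have oU: "openin T (topspace T \<inter> U)" by (simp add: Int_def)
    have "\<not> ?Z (Suc i) \<subseteq> C i"
    proof
      assume "?Z (Suc i) \<subseteq> C i"
      then have "C (Suc i) = C i \<union> (C (Suc i) - topspace T \<inter> U)"
        using C(2)[OF i] irreducible_closedD(3)[OF C(1)[OF ik(2)]] by auto
      moreover have "closedin T (C (Suc i) - topspace T \<inter> U)"
        using closedin_diff[OF irreducible_closedD(1)[OF C(1)[OF ik(2)]] oU] .
      ultimately have "C (Suc i) = C i \<or> C (Suc i) = C (Suc i) - topspace T \<inter> U"
        using irreducible_closedD(4)[OF C(1)[OF ik(2)] irreducible_closedD(1)[OF C(1)[OF ik(1)]]] by blast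
      then show False using C(2)[OF i] ne[OF ik(2)] sub[OF ik(2)] by blast
    qed
    then obtain x where x: "x \<in> ?Z (Suc i)" "x \<notin> C i" by blast
    have "openin T (topspace T - C i)" using irreducible_closedD(1)[OF C(1)[OF ik(1)]] by (simp add: closedin_def)
    moreover have "x \<in> topspace T - C i" using x sub[OF ik(2)] by blast
    ultimately obtain g where g: "g \<in> Fs" "g x \<noteq> 0" "{y \<in> topspace T \<inter> U. g y \<noteq> 0} \<subseteq> topspace T - C i"
      using basis[of "topspace T - C i" x] x by blast
    moreover have "g y = 0" if "y \<in> ?Z i" for y using g(3) that sub[OF ik(1)] by blast
    ultimately show ?thesis using x by blast
  qed
  then obtain g where g: "\<And>i. i < k \<Longrightarrow> g i \<in> Fs" "\<And>i y. i < k \<Longrightarrow> y \<in> ?Z i \<Longrightarrow> g i y = 0"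
    "\<And>i. i < k \<Longrightarrow> \<not> (\<forall>y\<in>?Z (Suc i). g i y = 0)"
    by metis
  let ?A = "\<lambda>r N. PiE {..<r} (\<lambda>_. {..N::nat})"
  \<comment> \<open>Order a relation on \<open>C\<^sub>r\<^sub>+\<^sub>1\<close> by powers of
    \<open>g\<^sub>r\<close>. As \<open>g\<^sub>r\<close> is not zero there, the lowest power can be cancelled
    by primality; restricting to \<open>C\<^sub>r\<close>, where \<open>g\<^sub>r\<close> vanishes, leaves a
    relation between the previous functions.\<close>
  have indep: "(\<forall>y\<in>?Z r. (\<Sum>\<alpha>\<in>?A r N. to_ac (c \<alpha>) * (\<Prod>i<r. g i y ^ \<alpha> i)) = 0) \<Longrightarrow> \<forall>\<alpha>\<in>?A r N. (c \<alpha> :: 'k) = 0"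
    if "r \<le> k" for r N c
    using that
  proof (induction r arbitrary: c)
    case 0
    then show ?case using ne[of 0] by auto
  next
    case (Suc r)
    then have rk: "r < k" "r \<le> k" by auto
    define S where "S e y = (\<Sum>\<beta>\<in>?A r N. to_ac (c (\<beta>(r := e))) * (\<Prod>i<r. g i y ^ \<beta> i))" for e y
    have S_in: "S e \<in> Fs" for e
      unfolding S_def using rk(1) by (intro sum_in mult_in prod_in power_in const_in g(1)) auto
    have inj: "inj_on (\<lambda>(e, \<beta>). \<beta>(r := e)) ({..N} \<times> ?A r N)"
      using inj_combinator[of r "{..<r}" "\<lambda>_. {..N}"] by simp
    have split: "(\<Sum>\<alpha>\<in>?A (Suc r) N. to_ac (c \<alpha>) * (\<Prod>i<Suc r. g i y ^ \<alpha> i)) = (\<Sum>e\<le>N. S e y * g r y ^ e)" for y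
    proof -
      have "(\<Sum>\<alpha>\<in>?A (Suc r) N. to_ac (c \<alpha>) * (\<Prod>i<Suc r. g i y ^ \<alpha> i))
          = (\<Sum>(e, \<beta>)\<in>{..N} \<times> ?A r N. to_ac (c (\<beta>(r := e))) * (\<Prod>i<Suc r. g i y ^ (\<beta>(r := e)) i))"
        unfolding lessThan_Suc PiE_insert_eq
        by (subst sum.reindex[OF inj]) (simp add: case_prod_unfold comp_def)
      also have "\<dots> = (\<Sum>e\<le>N. \<Sum>\<beta>\<in>?A r N. to_ac (c (\<beta>(r := e))) * (\<Prod>i<Suc r. g i y ^ (\<beta>(r := e)) i))"
        by (simp only: sum.cartesian_product)
      also have "\<dots> = (\<Sum>e\<le>N. S e y * g r y ^ e)"
        unfolding S_def sum_distrib_right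
      proof (intro sum.cong refl)
        fix e \<beta>
        have "(\<Prod>i<r. g i y ^ (\<beta>(r := e)) i) = (\<Prod>i<r. g i y ^ \<beta> i)" by (intro prod.cong refl) auto
        then show "to_ac (c (\<beta>(r := e))) * (\<Prod>i<Suc r. g i y ^ (\<beta>(r := e)) i) = to_ac (c (\<beta>(r := e))) * (\<Prod>i<r. g i y ^ \<beta> i) * g r y ^ e"
          by (simp add: mult.assoc)
      qed
      finally show ?thesis .
    qed
    have zero: "e \<le> N \<longrightarrow> (\<forall>\<beta>\<in>?A r N. c (\<beta>(r := e)) = 0)" for e
    proof (induction e rule: less_induct)
      case (less e)
      show ?case
      proof
        assume e: "e \<le> N"
        define R where "R y = (\<Sum>e'\<in>{e..N}. S e' y * g r y ^ (e' - e))" for y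
        have R_in: "R \<in> Fs" unfolding R_def[abs_def] by (intro sum_in mult_in power_in S_in g(1) rk)
        have S0: "S e' y = 0" if "e' < e" for e' y
        proof -
          have "\<forall>\<beta>\<in>?A r N. c (\<beta>(r := e')) = 0" by (rule less.IH[OF that, THEN mp]) (use that e in linarith)
          then show ?thesis unfolding S_def by (intro sum.neutral ballI) (simp del: fun_upd_apply)
        qed
        have "g r y ^ e * R y = 0" if y: "y \<in> ?Z (Suc r)" for y
        proof -
          have "g r y ^ e * R y = (\<Sum>e'\<in>{e..N}. S e' y * g r y ^ e')"
            unfolding R_def sum_distrib_left
          proof (intro sum.cong refl)
            fix e' assume "e' \<in> {e..N}"
            then have "g r y ^ e' = g r y ^ e * g r y ^ (e' - e)" by (simp flip: power_add)
            then show "g r y ^ e * (S e' y * g r y ^ (e' - e)) = S e' y * g r y ^ e'" by simp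
          qed
          also have "\<dots> = (\<Sum>e'\<le>N. S e' y * g r y ^ e')"
            using S0 by (intro sum.mono_neutral_left) auto
          also have "\<dots> = 0" using Suc.prems(1) y split[of y] by simp
          finally show ?thesis .
        qed
        then have "(\<forall>y\<in>?Z (Suc r). g r y ^ e = 0) \<or> (\<forall>y\<in>?Z (Suc r). R y = 0)"
          by (intro prime[of "Suc r" "\<lambda>y. g r y ^ e" R] Suc.prems(2) power_in g(1) rk R_in) auto
        then have R0: "\<forall>y\<in>?Z (Suc r). R y = 0"
        proof
          assume "\<forall>y\<in>?Z (Suc r). g r y ^ e = 0"
          then have "\<forall>y\<in>?Z (Suc r). g r y = 0" by simp
          then show ?thesis using g(3)[OF rk(1)] by simp
        qed
        have "S e y = 0" if y: "y \<in> ?Z r" for y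
        proof -
          have "y \<in> ?Z (Suc r)" using y mono[of r "Suc r"] Suc.prems by auto
          then have "R y = 0" using R0 by blast
          moreover have "R y = (\<Sum>e'\<in>{e..N}. if e' = e then S e y else 0)"
            unfolding R_def using g(2)[OF rk(1) y] by (intro sum.cong refl) auto
          ultimately show ?thesis using e by simp
        qed
        then show "\<forall>\<beta>\<in>?A r N. c (\<beta>(r := e)) = 0"
          by (intro Suc.IH[of "\<lambda>\<beta>. c (\<beta>(r := e))"] rk) (auto simp: S_def)
      qed
    qed
    show ?case
    proof
      fix \<alpha> assume "\<alpha> \<in> ?A (Suc r) N"
      then obtain e \<beta> where "e \<le> N" "\<beta> \<in> ?A r N" "\<alpha> = \<beta>(r := e)"
        unfolding lessThan_Suc PiE_insert_eq by auto
      then show "c \<alpha> = 0" using zero by blast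
    qed
  qed
  \<comment> \<open>One piece is dense in \<open>C\<^sub>k\<close>: otherwise multiply functions vanishing on
    the single pieces but not on \<open>C\<^sub>k\<close>.\<close>
  have "\<exists>\<phi>\<in>\<Phi>. \<forall>h\<in>Fs. (\<forall>y\<in>?Z k \<inter> P \<phi>. h y = 0) \<longrightarrow> (\<forall>y\<in>?Z k. h y = 0)"
  proof (rule ccontr)
    assume "\<not> ?thesis"
    then have "\<forall>\<phi>\<in>\<Phi>. \<exists>h. h \<in> Fs \<and> (\<forall>y\<in>?Z k \<inter> P \<phi>. h y = 0) \<and> \<not> (\<forall>y\<in>?Z k. h y = 0)" by blast
    then obtain h where h: "\<And>\<phi>. \<phi> \<in> \<Phi> \<Longrightarrow> h \<phi> \<in> Fs" "\<And>\<phi> y. \<phi> \<in> \<Phi> \<Longrightarrow> y \<in> ?Z k \<inter> P \<phi> \<Longrightarrow> h \<phi> y = 0"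
      "\<And>\<phi>. \<phi> \<in> \<Phi> \<Longrightarrow> \<not> (\<forall>y\<in>?Z k. h \<phi> y = 0)"
      by metis
    have "\<not> (\<forall>y\<in>?Z k. (\<Prod>\<phi>\<in>\<Psi>. h \<phi> y) = 0)" if "finite \<Psi>" "\<Psi> \<subseteq> \<Phi>" for \<Psi>
      using that
    proof (induction)
      case empty
      then show ?case using ne[of k] by auto
    next
      case (insert \<phi> \<Psi>)
      then have \<phi>: "\<phi> \<in> \<Phi>" and \<Psi>: "\<Psi> \<subseteq> \<Phi>" by auto
      have in_Fs: "(\<lambda>y. \<Prod>\<phi>\<in>\<Psi>. h \<phi> y) \<in> Fs" using h(1) \<Psi> by (intro prod_in) auto
      show ?case
      proof
        assume "\<forall>y\<in>?Z k. (\<Prod>\<phi>\<in>insert \<phi> \<Psi>. h \<phi> y) = 0"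
        then have "\<forall>y\<in>?Z k. h \<phi> y * (\<Prod>\<phi>\<in>\<Psi>. h \<phi> y) = 0" using insert.hyps by simp
        from prime[OF le_refl h(1)[OF \<phi>] in_Fs this] show False
          using h(3)[OF \<phi>] insert.IH[OF \<Psi>] by (elim disjE) simp_all
      qed
    qed
    from this[OF cover(1) subset_refl] obtain y where y: "y \<in> ?Z k" "(\<Prod>\<phi>\<in>\<Phi>. h \<phi> y) \<noteq> 0" by auto
    then obtain \<phi> where "\<phi> \<in> \<Phi>" "y \<in> P \<phi>" using cover(2) sub[of k] by blast
    then have "h \<phi> y = 0" using h(2) y by blast
    then show False using y(2) \<open>\<phi> \<in> \<Phi>\<close> cover(1) by auto
  qed
  then obtain \<phi> where \<phi>: "\<phi> \<in> \<Phi>" "\<And>h. h \<in> Fs \<Longrightarrow> (\<forall>y\<in>?Z k \<inter> P \<phi>. h y = 0) \<Longrightarrow> (\<forall>y\<in>?Z k. h y = 0)"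
    by blast
  obtain e D V where e: "finite V" "card V \<le> m" "\<forall>y i. i \<notin> V \<longrightarrow> e y i = 0" "D \<in> polyfun"
    "\<forall>y\<in>P \<phi> \<inter> (topspace T \<inter> U). D (e y) \<noteq> 0"
    "\<forall>g\<in>Fs. \<exists>N\<in>polyfun. \<exists>j. \<forall>y\<in>P \<phi> \<inter> (topspace T \<inter> U). g y * D (e y :: 'i \<Rightarrow> 'k alg_closure) ^ j = N (e y)"
    using param[OF \<phi>(1)] by (elim exE conjE)
  let ?Y = "?Z k \<inter> P \<phi>"
  have Y: "?Y \<subseteq> P \<phi> \<inter> (topspace T \<inter> U)" using sub[of k] by auto
  have "k \<le> card V"
  proof (rule algebraic_dependence_bound[where e = e and Y = ?Y and g = g, OF e(1,3,4)])
    show "D (e y) \<noteq> 0" if "y \<in> ?Y" for y using e(5) Y that by blast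
    show "\<exists>N\<in>polyfun. \<exists>j. \<forall>y\<in>?Y. g i y * D (e y) ^ j = N (e y)" if "i < k" for i
      using e(6)[rule_format, OF g(1)[OF that]] Y by blast
    fix N c \<alpha>
    assume 0: "\<forall>y\<in>?Y. (\<Sum>\<alpha>\<in>?A k N. to_ac (c \<alpha>) * (\<Prod>i<k. g i y ^ \<alpha> i)) = 0" and \<alpha>: "\<alpha> \<in> ?A k N"
    have "(\<lambda>y. \<Sum>\<alpha>\<in>?A k N. to_ac (c \<alpha>) * (\<Prod>i<k. g i y ^ \<alpha> i)) \<in> Fs"
      by (intro sum_in mult_in prod_in power_in const_in g(1)) auto
    from indep[OF le_refl \<phi>(2)[OF this 0]] show "c \<alpha> = 0" using \<alpha> by blast
  qed
  then show ?thesis using e(2) by simp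
qed

lemma closure_of_irreducible:
  assumes Y: "Y \<subseteq> topspace T" "Y \<noteq> {}"
    and meet: "\<And>U V. openin T U \<Longrightarrow> openin T V \<Longrightarrow> Y \<inter> U \<noteq> {} \<Longrightarrow> Y \<inter> V \<noteq> {} \<Longrightarrow> Y \<inter> U \<inter> V \<noteq> {}"
  shows "irreducible_closedin T (T closure_of Y)"
  unfolding irreducible_closedin_def
proof (intro conjI allI impI)
  show "closedin T (T closure_of Y)" by simp
  show "T closure_of Y \<noteq> {}" using closure_of_subset[OF Y(1)] Y(2) by blast
  fix A B assume AB: "closedin T A \<and> closedin T B \<and> T closure_of Y = A \<union> B"
  have "Y \<subseteq> A \<or> Y \<subseteq> B"
  proof (rule ccontr)
    assume "\<not> (Y \<subseteq> A \<or> Y \<subseteq> B)"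
    then have "Y \<inter> (topspace T - A) \<noteq> {}" "Y \<inter> (topspace T - B) \<noteq> {}" using Y(1) by auto
    moreover have "openin T (topspace T - A)" "openin T (topspace T - B)" using AB by auto
    ultimately have "Y \<inter> (topspace T - A) \<inter> (topspace T - B) \<noteq> {}" by (intro meet)
    moreover have "Y \<subseteq> A \<union> B" using closure_of_subset[OF Y(1)] AB by auto
    ultimately show False by auto
  qed
  then show "T closure_of Y = A \<or> T closure_of Y = B"
    using AB closure_of_minimal[of Y A T] closure_of_minimal[of Y B T] by auto
qed

section \<open>Linear forms that are not zero divisors\<close>

abbreviation pvar :: "'v \<Rightarrow> ('v, 'k::comm_ring_1) mpoly" where
  "pvar v \<equiv> monom (single v 1)"

text \<open>Points on a conic in the dual plane: any three of these linear forms are linearly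
  independent.\<close>

definition lin :: "'k::comm_ring_1 \<Rightarrow> (3, 'k) mpoly" where
  "lin a = pvar 0 + scale a (pvar 1) + scale (a\<^sup>2) (pvar 2)"

lemma UNIV_3': "(UNIV :: 3 set) = {0, 1, 2}"
proof -
  have "x \<in> {0, 1, 2}" for x :: 3 using exhaust_3[of x] by auto
  then show ?thesis by blast
qed

lemma distinct_3 [simp]: "(0::3) \<noteq> 1" "(0::3) \<noteq> 2" "(1::3) \<noteq> 2" "(1::3) \<noteq> 0" "(2::3) \<noteq> 0" "(2::3) \<noteq> 1"
  by simp_all

lemma all_3: "(\<forall>v::3. P v) \<longleftrightarrow> P 0 \<and> P 1 \<and> P 2"
proof -
  have "(\<forall>v::3. P v) \<longleftrightarrow> (\<forall>v\<in>UNIV. P v)" by simp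
  then show ?thesis unfolding UNIV_3' by simp
qed

lemma mdeg_3: "mdeg (m :: 3 exps) = lookup m 0 + lookup m 1 + lookup m 2"
  unfolding mdeg_UNIV UNIV_3' by simp

lemma lin_form: "lin a \<in> forms 1"
  unfolding lin_def by (intro forms_add forms_scale) simp_all

lemma scale_mult_left: "scale c f * g = scale c (f * g)"
  by (simp add: scale_def mult.assoc)

lemma scale_mult_right: "f * scale c g = scale c (f * g)"
  by (simp add: scale_def mult.left_commute)

lemma ideal_scale: "is_ideal J \<Longrightarrow> f \<in> J \<Longrightarrow> scale c f \<in> J"
  unfolding scale_def by (rule ideal_mult)

lemma ideal_scale_iff:
  fixes c :: "'k::field"
  assumes "is_ideal J" "c \<noteq> 0" shows "scale c f \<in> J \<longleftrightarrow> f \<in> J"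
proof
  assume "scale c f \<in> J"
  then have "scale (inverse c) (scale c f) \<in> J" by (rule ideal_scale[OF assms(1)])
  then show "f \<in> J" using assms(2) by simp
qed (rule ideal_scale[OF assms(1)])

lemma forms_1_mult:
  assumes J: "is_ideal J" and v: "\<And>v :: 3. pvar v * u \<in> J" and g: "g \<in> forms 1"
  shows "g * u \<in> J"
proof -
  have "\<exists>v. m = single v 1" if "m \<in> keys g" for m
  proof -
    have "mdeg m = 1" using g that by (rule formsD)
    then have "lookup m 0 + lookup m 1 + lookup m 2 = 1" by (simp add: mdeg_3)
    then consider "lookup m 0 = 1" "lookup m 1 = 0" "lookup m 2 = 0" | "lookup m 0 = 0" "lookup m 1 = 1" "lookup m 2 = 0"
      | "lookup m 0 = 0" "lookup m 1 = 0" "lookup m 2 = 1" by linarith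
    then show ?thesis
    proof cases
      case 1
      then have "\<forall>v. lookup m v = lookup (single 0 1) v" by (subst all_3) (simp add: lookup_single when_def)
      then have "m = single 0 1" by (intro poly_mapping_eqI) blast
      then show ?thesis by blast
    next
      case 2
      then have "\<forall>v. lookup m v = lookup (single 1 1) v" by (subst all_3) (simp add: lookup_single when_def)
      then have "m = single 1 1" by (intro poly_mapping_eqI) blast
      then show ?thesis by blast
    next
      case 3
      then have "\<forall>v. lookup m v = lookup (single 2 1) v" by (subst all_3) (simp add: lookup_single when_def)
      then have "m = single 2 1" by (intro poly_mapping_eqI) blast
      then show ?thesis by blast
    qed
  qed
  then have "(\<Sum>m\<in>keys g. scale (lookup g m) (monom m * u)) \<in> J"
    using v by (intro ideal_sum[OF J] ideal_scale[OF J]) auto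
  moreover have "g * u = (\<Sum>m\<in>keys g. scale (lookup g m) (monom m)) * u" by (simp only: mpoly_expand_monom)
  ultimately show ?thesis by (simp add: sum_distrib_right scale_mult_left)
qed

lemma scale_ring_simps:
  "scale c f = single 0 c * f"
  "single 0 (a + b) = (single 0 a + single 0 b :: ('v, 'k::comm_ring_1) mpoly)"
  "single 0 (a - b) = (single 0 a - single 0 b :: ('v, 'k::comm_ring_1) mpoly)"
  "single 0 (a * b) = (single 0 a * single 0 b :: ('v, 'k::comm_ring_1) mpoly)"
  by (simp_all add: scale_def single_add single_diff mult_single)

text \<open>If \<open>u\<close> is killed by three independent linear forms, it is killed by all of them, and
  saturation applies.\<close>

lemma three_linear_forms:
  fixes J :: "(3, 'k::field) mpoly set"
  assumes J: "is_ideal J" and sat: "saturated_ideal J"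
    and abc: "a \<noteq> b" "a \<noteq> c" "b \<noteq> c" "lin a * u \<in> J" "lin b * u \<in> J" "lin c * u \<in> J"
  shows "u \<in> J"
proof -
  have yz: "(pvar 1 + scale (p + q) (pvar 2)) * u \<in> J" if "p \<noteq> q" "lin p * u \<in> J" "lin q * u \<in> J" for p q
  proof -
    have "lin p * u - lin q * u = scale (p - q) ((pvar 1 + scale (p + q) (pvar 2)) * u)"
      by (simp add: lin_def scale_ring_simps power2_eq_square algebra_simps)
    then show ?thesis using ideal_diff[OF J that(2,3)] ideal_scale_iff[OF J, of "p - q"] that(1) by simp
  qed
  have "(pvar 1 + scale (a + b) (pvar 2)) * u - (pvar 1 + scale (a + c) (pvar 2)) * u = scale (b - c) (pvar 2 * u)"
    by (simp add: scale_ring_simps algebra_simps)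
  then have z: "pvar 2 * u \<in> J"
    using ideal_diff[OF J yz[of a b] yz[of a c]] abc ideal_scale_iff[OF J, of "b - c"] by simp
  have "pvar 1 * u = (pvar 1 + scale (a + b) (pvar 2)) * u - scale (a + b) (pvar 2 * u)"
    by (simp add: scale_ring_simps algebra_simps)
  then have y: "pvar 1 * u \<in> J" using ideal_diff[OF J yz[of a b] ideal_scale[OF J z, of "a + b"]] abc by simp
  have "pvar 0 * u = lin a * u - scale a (pvar 1 * u) - scale (a\<^sup>2) (pvar 2 * u)"
    by (simp add: lin_def scale_ring_simps algebra_simps)
  then have x: "pvar 0 * u \<in> J"
    using ideal_diff[OF J ideal_diff[OF J abc(4) ideal_scale[OF J y, of a]] ideal_scale[OF J z, of "a\<^sup>2"]] by simp
  have "\<forall>v. pvar v * u \<in> J" using x y z by (subst all_3) simp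
  then have "\<forall>g\<in>forms 1. g * u \<in> J" using forms_1_mult[OF J] by blast
  then show ?thesis using sat unfolding saturated_ideal_def by blast
qed

text \<open>Suppose that all these forms are zero divisors. For a form \<open>u\<close> outside
  \<open>J\<close>, at most two of the given linear forms kill \<open>u\<close>; call them \<open>Z u\<close>.
  Every \<open>lin a\<close> kills some form \<open>w a\<close> outside \<open>J\<close>, and maximality
  allows \<open>Z (w a)\<close> to be stable under multiples of \<open>w a\<close> outside \<open>J\<close>.
  As each \<open>Z (w a)\<close> has at most two elements, there is a sequence of \<open>n + 1\<close>
  indices such that no \<open>lin (s j)\<close> kills an earlier \<open>w (s i)\<close>. The forms
  \<open>w (s i)\<close>, raised to one degree, are then independent modulo \<open>J\<close>, which has
  colength at most \<open>n\<close> in large degrees.\<close>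

lemma exists_nonzerodivisor:
  fixes J :: "(3, 'k::field) mpoly set" and A :: "'k set"
  assumes hom: "homogeneous_ideal J" and sat: "saturated_ideal J"
    and hf: "\<forall>\<^sub>F i in sequentially. hilbert_function J i \<le> n"
    and A: "finite A" "2 * n < card A"
  shows "\<exists>a\<in>A. \<forall>f. lin a * f \<in> J \<longrightarrow> f \<in> J"
proof (rule ccontr)
  assume neg: "\<not> ?thesis"
  have J: "is_ideal J" using hom by (rule homogeneous_ideal_ideal)
  define Z where "Z u = {b \<in> A. lin b * u \<in> J}" for u
  have finZ: "finite (Z u)" for u using A by (simp add: Z_def)
  have Z2: "card (Z u) \<le> 2" if "u \<notin> J" for u
  proof (rule ccontr)
    assume "\<not> card (Z u) \<le> 2"
    then have "3 \<le> card (Z u)" by simp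
    then obtain T where "T \<subseteq> Z u" "card T = 3" by (meson obtain_subset_with_card_n)
    then obtain a b c where "{a, b, c} \<subseteq> Z u" "a \<noteq> b" "a \<noteq> c" "b \<noteq> c" by (auto simp: card_3_iff)
    then show False using three_linear_forms[OF J sat, of a b c u] that by (auto simp: Z_def)
  qed
  have Zmono: "Z u \<subseteq> Z (g * u)" for g u
    using ideal_mult[OF J, of _ g] by (auto simp: Z_def mult.left_commute)
  define stable where "stable w \<longleftrightarrow> w \<notin> J \<and> (\<forall>g e. g \<in> forms e \<longrightarrow> g * w \<notin> J \<longrightarrow> Z (g * w) = Z w)" for w
  have ex: "\<exists>d w. w \<in> forms d \<and> stable w \<and> a \<in> Z w" if a: "a \<in> A" for a
  proof -
    obtain f where f: "lin a * f \<in> J" "f \<notin> J" using neg a by blast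
    then obtain d where d: "hom_component d f \<notin> J" using homogeneous_ideal_mem_iff[OF hom] by blast
    define u where "u = hom_component d f"
    have "lin a * u = hom_component (1 + d) (lin a * f)" unfolding u_def by (rule hom_component_form_mult[OF lin_form, symmetric])
    then have au: "lin a * u \<in> J" using f(1) hom by (simp add: homogeneous_ideal_def)
    define P where "P w \<longleftrightarrow> w \<notin> J \<and> (\<exists>g e. g \<in> forms e \<and> w = g * u)" for w
    have "P u" unfolding P_def using d by (intro conjI exI[of _ 1] exI[of _ 0]) (simp_all add: u_def forms_def)
    moreover have "\<forall>w. P w \<longrightarrow> card (Z w) < 3"
    proof (intro allI impI)
      fix w assume "P w"
      then have "w \<notin> J" by (simp add: P_def)
      from Z2[OF this] show "card (Z w) < 3" by simp
    qed
    ultimately have "\<exists>w. P w \<and> (\<forall>w'. P w' \<longrightarrow> card (Z w') \<le> card (Z w))" by (rule ex_has_greatest_nat)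
    then obtain w where w: "P w" "\<And>w'. P w' \<Longrightarrow> card (Z w') \<le> card (Z w)" by blast
    obtain g e where g: "g \<in> forms e" "w = g * u" using w(1) by (auto simp: P_def)
    have "stable w"
      unfolding stable_def
    proof (intro conjI allI impI)
      show "w \<notin> J" using w(1) by (simp add: P_def)
      fix g' e' assume g': "g' \<in> forms e'" "g' * w \<notin> J"
      have "g' * w = (g' * g) * u" by (simp add: g(2) mult.assoc)
      then have "P (g' * w)" using g'(2) forms_mult[OF g'(1) g(1)] by (auto simp: P_def)
      then show "Z (g' * w) = Z w" using w(2) Zmono[of w g'] finZ card_seteq by metis
    qed
    moreover have "w \<in> forms (e + d)" using g forms_mult[OF g(1) hom_component_in_forms] by (simp add: u_def)
    moreover have "a \<in> Z w" using au a Zmono[of u g] g(2) by (auto simp: Z_def)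
    ultimately show ?thesis by blast
  qed
  then obtain df w0 where w0: "\<And>a. a \<in> A \<Longrightarrow> w0 a \<in> forms (df a)" "\<And>a. a \<in> A \<Longrightarrow> stable (w0 a)" "\<And>a. a \<in> A \<Longrightarrow> a \<in> Z (w0 a)"
    by metis
  obtain M where M: "\<And>i. i \<ge> M \<Longrightarrow> hilbert_function J i \<le> n" using hf by (auto simp: eventually_sequentially)
  define N where "N = M + (\<Sum>a\<in>A. df a)"
  have dfN: "df a \<le> N" if "a \<in> A" for a
  proof -
    have "df a \<le> (\<Sum>a\<in>A. df a)" using that A by (intro member_le_sum) auto
    then show ?thesis by (simp add: N_def)
  qed
  have "\<exists>w. w \<in> forms N \<and> stable w \<and> a \<in> Z w" if a: "a \<in> A" for a
  proof -
    have "w0 a \<notin> J" using w0(2)[OF a] by (simp add: stable_def)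
    then obtain g where g: "g \<in> forms (N - df a)" "g * w0 a \<notin> J"
      using sat unfolding saturated_ideal_def by blast
    have "stable (g * w0 a)"
      unfolding stable_def
    proof (intro conjI allI impI g(2))
      fix g' e' assume g': "g' \<in> forms e'" "g' * (g * w0 a) \<notin> J"
      then have "(g' * g) * w0 a \<notin> J" by (simp add: mult.assoc)
      then have "Z ((g' * g) * w0 a) = Z (w0 a)" using w0(2)[OF a] forms_mult[OF g'(1) g(1)] unfolding stable_def by blast
      moreover have "Z (g * w0 a) = Z (w0 a)" using w0(2)[OF a] g unfolding stable_def by blast
      ultimately show "Z (g' * (g * w0 a)) = Z (g * w0 a)" by (simp add: mult.assoc)
    qed
    moreover have "g * w0 a \<in> forms N" using forms_mult[OF g(1) w0(1)[OF a]] dfN[OF a] by simp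
    moreover have "a \<in> Z (g * w0 a)" using w0(3)[OF a] Zmono by blast
    ultimately show ?thesis by blast
  qed
  then obtain w where w: "\<And>a. a \<in> A \<Longrightarrow> w a \<in> forms N" "\<And>a. a \<in> A \<Longrightarrow> stable (w a)" "\<And>a. a \<in> A \<Longrightarrow> a \<in> Z (w a)"
    by metis
  have "\<exists>s :: nat \<Rightarrow> 'k. (\<forall>i<r. s i \<in> A) \<and> (\<forall>j<r. \<forall>i<j. s j \<notin> Z (w (s i)))" if "r \<le> Suc n" for r
    using that
  proof (induction r)
    case (Suc r)
    then obtain s where s: "\<forall>i<r. s i \<in> A" "\<forall>j<r. \<forall>i<j. s j \<notin> Z (w (s i))" by auto
    have "card (\<Union>i<r. Z (w (s i))) \<le> (\<Sum>i<r. card (Z (w (s i))))" by (rule card_UN_le) simp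
    also have "\<dots> \<le> (\<Sum>i<r. 2)"
      using s(1) w(2) by (intro sum_mono Z2) (auto simp: stable_def)
    also have "\<dots> < card A" using Suc.prems A(2) by simp
    finally have "\<not> A \<subseteq> (\<Union>i<r. Z (w (s i)))" using card_mono[of "\<Union>i<r. Z (w (s i))" A] finZ by auto
    then obtain b where b: "b \<in> A" "\<And>i. i < r \<Longrightarrow> b \<notin> Z (w (s i))" by blast
    show ?case
    proof (intro exI[of _ "s(r := b)"] conjI allI impI)
      show "(s(r := b)) i \<in> A" if "i < Suc r" for i using that s(1) b(1) by (cases "i = r") auto
      show "(s(r := b)) j \<notin> Z (w ((s(r := b)) i))" if "j < Suc r" "i < j" for i j
        using that s(2) b(2)[of i] by (cases "j = r") auto
    qed
  qed simp
  from this[OF le_refl] obtain s :: "nat \<Rightarrow> 'k" where s: "\<And>i. i < Suc n \<Longrightarrow> s i \<in> A" "\<And>i j. j < Suc n \<Longrightarrow> i < j \<Longrightarrow> s j \<notin> Z (w (s i))"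
    by blast
  have nz: "(\<Prod>b\<in>T. lin b) * w a \<notin> J \<and> (\<Prod>b\<in>T. lin b) \<in> forms (card T)"
    if "finite T" "T \<subseteq> A - Z (w a)" "a \<in> A" for T a
    using that(1,2)
  proof (induction)
    case empty
    then show ?case using w(2)[OF that(3)] by (simp add: stable_def forms_def)
  next
    case (insert b T)
    then have IH: "(\<Prod>b\<in>T. lin b) * w a \<notin> J" "(\<Prod>b\<in>T. lin b) \<in> forms (card T)" by auto
    then have "Z ((\<Prod>b\<in>T. lin b) * w a) = Z (w a)" using w(2)[OF that(3)] unfolding stable_def by blast
    then have "lin b * ((\<Prod>b\<in>T. lin b) * w a) \<notin> J" using insert.prems by (auto simp: Z_def)
    then show ?case using insert.hyps forms_mult[OF lin_form IH(2)] by (simp add: mult.assoc)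
  qed
  have "card {..<Suc n} \<le> hilbert_function J N"
  proof (rule hf_ge[OF J, where u = "\<lambda>i. w (s i)"])
    show "w (s i) \<in> forms N" if "i \<in> {..<Suc n}" for i using w(1) s(1) that by simp
    fix c i assume c: "(\<Sum>i\<in>{..<Suc n}. scale (c i) (w (s i))) \<in> J" and "i \<in> {..<Suc n}"
    then have "i < Suc n" by simp
    then show "c i = 0"
    proof (induction i rule: less_induct)
      case (less i)
      \<comment> \<open>The factor \<open>g\<close> kills all later terms of the relation, but by stability not
        the \<open>i\<close>-th.\<close>
      define g where "g = (\<Prod>b\<in>s ` {i<..<Suc n}. lin b)"
      have "s ` {i<..<Suc n} \<subseteq> A - Z (w (s i))" using s by auto
      then have gi: "g * w (s i) \<notin> J" 
        unfolding g_def using nz[of "s ` {i<..<Suc n}" "s i"] s(1)[OF less.prems] by simp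
      have gj: "g * w (s j) \<in> J" if "j \<in> {i<..<Suc n}" for j
      proof -
        have "g = lin (s j) * (\<Prod>b\<in>s ` {i<..<Suc n} - {s j}. lin b)"
          unfolding g_def using that by (intro prod.remove) auto
        then have gw: "g * w (s j) = (\<Prod>b\<in>s ` {i<..<Suc n} - {s j}. lin b) * (lin (s j) * w (s j))"
          by (simp only: mult_ac)
        have "lin (s j) * w (s j) \<in> J" using w(3)[OF s(1), of j] that by (simp add: Z_def)
        then show ?thesis unfolding gw by (rule ideal_mult[OF J])
      qed
      have "g * (\<Sum>i\<in>{..<Suc n}. scale (c i) (w (s i))) = (\<Sum>j\<in>{..<Suc n}. scale (c j) (g * w (s j)))"
        by (simp add: sum_distrib_left scale_mult_right del: sum.lessThan_Suc)
      also have "\<dots> = scale (c i) (g * w (s i)) + (\<Sum>j\<in>{..<Suc n} - {i}. scale (c j) (g * w (s j)))"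
        using less.prems by (intro sum.remove) auto
      finally have "scale (c i) (g * w (s i)) = g * (\<Sum>i\<in>{..<Suc n}. scale (c i) (w (s i))) - (\<Sum>j\<in>{..<Suc n} - {i}. scale (c j) (g * w (s j)))"
        by simp
      moreover have "(\<Sum>j\<in>{..<Suc n} - {i}. scale (c j) (g * w (s j))) \<in> J"
      proof (intro ideal_sum[OF J])
        fix j assume j: "j \<in> {..<Suc n} - {i}"
        show "scale (c j) (g * w (s j)) \<in> J"
        proof (cases "j < i")
          case True
          then show ?thesis using less.IH[of j] j J by (simp add: ideal_zero)
        next
          case False
          then show ?thesis using j by (intro ideal_scale[OF J] gj) auto
        qed
      qed
      ultimately have "scale (c i) (g * w (s i)) \<in> J" using ideal_diff[OF J ideal_mult[OF J c]] by simp
      then show ?case using gi ideal_scale_iff[OF J, of "c i" "g * w (s i)"] by auto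
    qed
  qed simp
  moreover have "hilbert_function J N \<le> n" by (rule M) (simp add: N_def)
  ultimately show False by simp
qed

section \<open>Dehomogenisation\<close>

definition const2 :: "'k::comm_ring_1 \<Rightarrow> 'k poly poly" where
  "const2 c = [:[:c:]:]"

definition mon2 :: "nat \<Rightarrow> nat \<Rightarrow> 'k::comm_ring_1 poly poly" where
  "mon2 s l = pmonom (pmonom 1 s) l"

abbreviation polycomb :: "(nat \<times> nat \<Rightarrow> 'k::comm_ring_1) \<Rightarrow> (nat \<times> nat) set \<Rightarrow> 'k poly poly" where
  "polycomb c S \<equiv> \<Sum>(s, l)\<in>S. const2 (c (s, l)) * mon2 s l"

text \<open>Setting \<open>lin a\<close> to 1 eliminates the variable 0; the variables 1 and 2 become
  \<open>u\<close> and \<open>v\<close>.\<close>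

definition psi_var :: "'k::field \<Rightarrow> 3 \<Rightarrow> 'k poly poly" where
  "psi_var a v = (if v = 0 then 1 - const2 a * mon2 1 0 - const2 (a\<^sup>2) * mon2 0 1 else if v = 1 then mon2 1 0 else mon2 0 1)"

definition psi :: "'k::field \<Rightarrow> (3, 'k) mpoly \<Rightarrow> 'k poly poly" where
  "psi a = evalh const2 (psi_var a)"

lemma const2_hom: "rhom const2"
  by (rule rhom.intro) (simp_all add: const2_def one_pCons)

lemma psi_hom: "rhom (psi a)"
  unfolding psi_def by (rule rhom.evalh_hom[OF const2_hom])

lemma mon2_mult: "mon2 s l * mon2 s' l' = mon2 (s + s') (l + l')"
  by (simp add: mon2_def mult_monom)

lemma mon2_0 [simp]: "mon2 0 0 = 1"
  by (simp add: mon2_def monom_eq_1)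

lemma mon2_power: "mon2 s l ^ n = mon2 (n * s) (n * l)"
  by (induction n) (simp_all add: mon2_mult)

lemma coeff_mon2: "coeff (coeff (mon2 s l) j) i = (if j = l \<and> i = s then 1 else 0)"
  by (auto simp: mon2_def coeff_monom)

lemma coeff_const2_mult: "coeff (coeff (const2 c * F) j) i = c * coeff (coeff F j) i"
  by (simp add: const2_def)

lemma psi_single: "psi a (single m c) = const2 c * pp (psi_var a) m"
  unfolding psi_def by (rule rhom.evalh_single[OF const2_hom])

lemma psi_scale: "psi a (scale c f) = const2 c * psi a f"
  unfolding scale_def rhom.hom_mult[OF psi_hom] psi_single by simp

lemma psi_monom: "psi a (monom m) = pp (psi_var a) m"
  unfolding monom_def psi_single by (simp add: rhom.hom_one[OF const2_hom])

lemma psi_pvar: "psi a (pvar v) = psi_var a v"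
  unfolding psi_monom by simp

lemma psi_lin: "psi a (lin a) = 1"
  unfolding lin_def rhom.hom_add[OF psi_hom] psi_scale psi_pvar psi_var_def by simp

lemma psi_yz: "psi a (pvar 1 ^ s * pvar 2 ^ l) = mon2 s l"
  unfolding rhom.hom_mult[OF psi_hom] rhom.hom_power[OF psi_hom] psi_pvar psi_var_def
  by (simp add: mon2_power mon2_mult)

lemma poly2_expand: "F = (\<Sum>l\<le>degree F. \<Sum>s\<le>degree (coeff F l). const2 (coeff (coeff F l) s) * mon2 s l)"
proof (intro poly_eqI)
  fix j i
  have c: "coeff (coeff (\<Sum>l\<le>degree F. \<Sum>s\<le>degree (coeff F l). const2 (coeff (coeff F l) s) * mon2 s l) j) i
      = (\<Sum>l\<le>degree F. \<Sum>s\<le>degree (coeff F l). coeff (coeff F l) s * (if j = l \<and> i = s then 1 else 0))"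
    by (simp only: coeff_sum coeff_const2_mult coeff_mon2)
  have "(\<Sum>s\<le>degree (coeff F l). coeff (coeff F l) s * (if j = l \<and> i = s then 1 else 0)) = (if j = l then coeff (coeff F j) i else 0)" for l
  proof (cases "j = l")
    case True
    then have "(\<Sum>s\<le>degree (coeff F l). coeff (coeff F l) s * (if j = l \<and> i = s then 1 else 0)) = (\<Sum>s\<le>degree (coeff F l). if s = i then coeff (coeff F l) s else 0)"
      by (intro sum.cong refl) auto
    also have "\<dots> = coeff (coeff F l) i" by (simp add: sum.delta coeff_eq_0)
    finally show ?thesis using True by simp
  qed simp
  then have "coeff (coeff (\<Sum>l\<le>degree F. \<Sum>s\<le>degree (coeff F l). const2 (coeff (coeff F l) s) * mon2 s l) j) i
      = (\<Sum>l\<le>degree F. if l = j then coeff (coeff F j) i else 0)"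
    unfolding c by (intro sum.cong refl) auto
  also have "\<dots> = coeff (coeff F j) i" by (simp add: sum.delta coeff_eq_0)
  finally show "coeff (coeff F j) i = coeff (coeff (\<Sum>l\<le>degree F. \<Sum>s\<le>degree (coeff F l). const2 (coeff (coeff F l) s) * mon2 s l) j) i" by simp
qed

lemma psi_surj: "\<exists>f. psi a f = F"
proof -
  have "psi a (\<Sum>l\<le>degree F. \<Sum>s\<le>degree (coeff F l). scale (coeff (coeff F l) s) (pvar 1 ^ s * pvar 2 ^ l))
      = (\<Sum>l\<le>degree F. \<Sum>s\<le>degree (coeff F l). const2 (coeff (coeff F l) s) * mon2 s l)"
    by (simp only: rhom.hom_sum[OF psi_hom] psi_scale psi_yz)
  also have "\<dots> = F" by (rule poly2_expand[symmetric])
  finally show ?thesis by (rule exI)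
qed

lemma psi_form_yz:
  assumes "s + l \<le> N"
  shows "pvar 1 ^ s * pvar 2 ^ l * lin a ^ (N - s - l) \<in> forms N" "psi a (pvar 1 ^ s * pvar 2 ^ l * lin a ^ (N - s - l)) = mon2 s l"
proof -
  have "pvar 1 ^ s \<in> (forms (s * 1) :: (3, 'a) mpoly set)" "pvar 2 ^ l \<in> (forms (l * 1) :: (3, 'a) mpoly set)"
    "lin a ^ (N - s - l) \<in> forms ((N - s - l) * 1)"
    by (intro forms_power lin_form; simp)+
  from forms_mult[OF forms_mult[OF this(1,2)] this(3)]
  show "pvar 1 ^ s * pvar 2 ^ l * lin a ^ (N - s - l) \<in> forms N" using assms by simp
  show "psi a (pvar 1 ^ s * pvar 2 ^ l * lin a ^ (N - s - l)) = mon2 s l"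
    unfolding rhom.hom_mult[OF psi_hom, of _ "pvar 1 ^ s * pvar 2 ^ l"] psi_yz rhom.hom_power[OF psi_hom] psi_lin by simp
qed

definition ex3 :: "nat \<Rightarrow> nat \<Rightarrow> nat \<Rightarrow> 3 exps" where
  "ex3 i s l = single 0 i + single 1 s + single 2 l"

lemma lookup_ex3 [simp]: "lookup (ex3 i s l) 0 = i" "lookup (ex3 i s l) 1 = s" "lookup (ex3 i s l) 2 = l"
  by (simp_all add: ex3_def lookup_add lookup_single when_def)

lemma ex3_eqI: "lookup m 0 = i \<Longrightarrow> lookup m 1 = s \<Longrightarrow> lookup m 2 = l \<Longrightarrow> m = ex3 i s l"
proof -
  assume "lookup m 0 = i" "lookup m 1 = s" "lookup m 2 = l"
  then have "\<forall>v. lookup m v = lookup (ex3 i s l) v" by (subst all_3) simp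
  then show ?thesis by (intro poly_mapping_eqI) blast
qed

lemma ex3_eq_iff [simp]: "ex3 i s l = ex3 i' s' l' \<longleftrightarrow> i = i' \<and> s = s' \<and> l = l'"
  by (metis lookup_ex3)

lemma mdeg_ex3 [simp]: "mdeg (ex3 i s l) = i + s + l"
  by (simp add: mdeg_3)

lemma psi0_var: "psi_var 0 v = (if v = 0 then 1 else if v = 1 then mon2 1 0 else mon2 0 1)"
  by (simp add: psi_var_def const2_def)

lemma psi0_monom: "psi 0 (monom m) = mon2 (lookup m 1) (lookup m 2)"
proof -
  have "pp (psi_var 0) m = (\<Prod>v\<in>{0, 1, 2}. psi_var 0 v ^ lookup m v)"
    by (rule pp_superset) (simp_all flip: UNIV_3')
  then show ?thesis unfolding psi_monom psi0_var by (simp add: mon2_power mon2_mult)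
qed

lemma coeff_psi0:
  fixes f :: "(3, 'k::field) mpoly"
  assumes f: "f \<in> forms N"
  shows "coeff (coeff (psi 0 f) l) s = (if s + l \<le> N then lookup f (ex3 (N - s - l) s l) else 0)"
proof -
  have "psi 0 f = psi 0 (\<Sum>m\<in>keys f. scale (lookup f m) (monom m))" by (simp only: mpoly_expand_monom)
  also have "\<dots> = (\<Sum>m\<in>keys f. const2 (lookup f m) * mon2 (lookup m 1) (lookup m 2))"
    by (simp only: rhom.hom_sum[OF psi_hom] psi_scale psi0_monom)
  finally have "coeff (coeff (psi 0 f) l) s = (\<Sum>m\<in>keys f. lookup f m * (if l = lookup m 2 \<and> s = lookup m 1 then 1 else 0))"
    by (simp only: coeff_sum coeff_const2_mult coeff_mon2)
  also have "\<dots> = (\<Sum>m\<in>keys f. if m = ex3 (N - s - l) s l then if s + l \<le> N then lookup f m else 0 else 0)"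
  proof (intro sum.cong refl)
    fix m assume "m \<in> keys f"
    then have d: "lookup m 0 + lookup m 1 + lookup m 2 = N" using formsD[OF f] by (simp add: mdeg_3)
    have "l = lookup m 2 \<and> s = lookup m 1 \<longleftrightarrow> m = ex3 (N - s - l) s l \<and> s + l \<le> N"
    proof
      assume "l = lookup m 2 \<and> s = lookup m 1"
      then show "m = ex3 (N - s - l) s l \<and> s + l \<le> N" using d by (auto intro!: ex3_eqI)
    qed (metis lookup_ex3(2,3))
    then show "lookup f m * (if l = lookup m 2 \<and> s = lookup m 1 then 1 else 0) = (if m = ex3 (N - s - l) s l then if s + l \<le> N then lookup f m else 0 else 0)"
      by auto
  qed
  also have "\<dots> = (if s + l \<le> N then lookup f (ex3 (N - s - l) s l) else 0)"
    by (simp add: sum.delta' in_keys_iff)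
  finally show ?thesis .
qed

lemma psi0_inj:
  assumes f: "f \<in> forms N" "psi 0 f = 0" shows "f = 0"
proof (rule poly_mapping_eqI)
  fix m :: "3 exps"
  show "lookup f m = lookup 0 m"
  proof (cases "mdeg m = N")
    case True
    then have "m = ex3 (N - lookup m 1 - lookup m 2) (lookup m 1) (lookup m 2)" "lookup m 1 + lookup m 2 \<le> N"
      by (auto intro!: ex3_eqI simp: mdeg_3)
    then show ?thesis using coeff_psi0[OF f(1), of "lookup m 2" "lookup m 1"] f(2) by simp
  next
    case False
    then show ?thesis using f(1) by (auto simp: forms_def in_keys_iff)
  qed
qed

text \<open>Linear change of coordinates, which reduces \<open>psi a\<close> to
  \<open>psi 0\<close>.\<close>

definition shear :: "'k::field \<Rightarrow> 'k \<Rightarrow> (3, 'k) mpoly \<Rightarrow> (3, 'k) mpoly" where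
  "shear c d = evalh (single 0) (\<lambda>v. if v = 0 then pvar 0 + scale c (pvar 1) + scale d (pvar 2) else pvar v)"

lemma single0_hom: "rhom (single 0 :: 'k::comm_ring_1 \<Rightarrow> ('v, 'k) mpoly)"
  by (rule rhom.intro) (simp_all add: single_add mult_single)

lemma shear_hom: "rhom (shear c d)"
  unfolding shear_def by (rule rhom.evalh_hom[OF single0_hom])

lemma shear_const: "shear c d (single 0 e) = single 0 e"
  unfolding shear_def rhom.evalh_single[OF single0_hom] by simp

lemma shear_var: "shear c d (pvar v) = (if v = 0 then pvar 0 + scale c (pvar 1) + scale d (pvar 2) else pvar v)"
  unfolding shear_def monom_def rhom.evalh_single[OF single0_hom] by simp

lemma shear_scale: "shear c d (scale e f) = scale e (shear c d f)"
  unfolding scale_def rhom.hom_mult[OF shear_hom] shear_const ..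

lemma evalh_id: "evalh (single 0) pvar f = f"
  using hom_eq_evalh[of "\<lambda>f. f" "single 0" pvar f] by (simp add: rhom_def)

lemma shear_inverse: "shear (-c) (-d) (shear c d f) = f"
proof -
  have "shear (-c) (-d) (shear c d f) = evalh (single 0) pvar f"
  proof (rule hom_eq_evalh)
    show "rhom (\<lambda>f. shear (-c) (-d) (shear c d f))" by (rule rhom_comp[OF shear_hom shear_hom])
    show "shear (-c) (-d) (shear c d (single 0 e)) = single 0 e" for e by (simp add: shear_const)
    show "shear (-c) (-d) (shear c d (pvar v)) = pvar v" for v
    proof (cases "v = 0")
      case True
      then show ?thesis
        unfolding shear_var by (simp add: rhom.hom_add[OF shear_hom] shear_scale shear_var[simplified] kvec.scale_minus_left)
    next
      case False
      then show ?thesis unfolding shear_var by (simp add: shear_var[simplified])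
    qed
  qed
  then show ?thesis by (simp only: evalh_id)
qed

lemma shear_forms:
  assumes "f \<in> forms N" shows "shear c d f \<in> forms N"
proof -
  let ?g = "\<lambda>v :: 3. if v = 0 then pvar 0 + scale c (pvar 1) + scale d (pvar 2) else pvar v"
  have g: "?g v \<in> forms 1" for v by (auto intro!: forms_add forms_scale)
  have "(\<Prod>v\<in>S. ?g v ^ lookup m v) \<in> forms (\<Sum>v\<in>S. lookup m v)" if "finite S" for S m
    using that
  proof induction
    case (insert v S)
    then show ?case using forms_mult[OF forms_power[OF g, of v "lookup m v"] insert.IH] by simp
  qed (simp add: forms_def)
  then have "pp ?g m \<in> forms (mdeg m)" for m by (simp add: pp_def mdeg_def)
  then have "(\<Sum>m\<in>keys f. scale (lookup f m) (pp ?g m)) \<in> forms N"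
    using assms by (intro forms_sum forms_scale) (auto simp: forms_def)
  then show ?thesis by (simp add: shear_def evalh_def scale_def)
qed

lemma psi_shear: "psi a f = psi 0 (shear (-a) (-(a\<^sup>2)) f)"
proof -
  have "psi 0 (shear (-a) (-(a\<^sup>2)) f) = evalh const2 (psi_var a) f"
  proof (rule hom_eq_evalh)
    show "rhom (\<lambda>f. psi 0 (shear (-a) (-(a\<^sup>2)) f))" by (rule rhom_comp[OF psi_hom shear_hom])
    show "psi 0 (shear (-a) (-(a\<^sup>2)) (single 0 c)) = const2 c" for c
      by (simp add: shear_const psi_single)
    show "psi 0 (shear (-a) (-(a\<^sup>2)) (pvar v)) = psi_var a v" for v
      unfolding shear_var by (auto simp: rhom.hom_add[OF psi_hom] rhom.hom_diff[OF psi_hom] psi_scale psi_pvar[simplified] psi_var_def const2_def)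
  qed
  then show ?thesis unfolding psi_def[of a] by (rule sym)
qed

lemma psi_inj:
  assumes "f \<in> forms N" "psi a f = 0" shows "f = 0"
proof -
  have "shear (-a) (-(a\<^sup>2)) f = 0"
    using assms shear_forms by (intro psi0_inj[of _ N]) (simp_all flip: psi_shear)
  then have "shear (-(-a)) (-(-(a\<^sup>2))) 0 = f" using shear_inverse[of "-a" "-(a\<^sup>2)" f] by simp
  then show ?thesis by (simp add: rhom.hom_zero[OF shear_hom])
qed

lemma psi_ideal: "is_ideal J \<Longrightarrow> is_ideal (psi a ` J)"
proof (rule is_idealI)
  assume J: "is_ideal J"
  show "0 \<in> psi a ` J" by (rule image_eqI[of _ _ 0]) (simp_all add: ideal_zero[OF J] rhom.hom_zero[OF psi_hom])
  fix F G assume F: "F \<in> psi a ` J"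
  then obtain f where f: "f \<in> J" "F = psi a f" by auto
  obtain g where g: "psi a g = G" using psi_surj by blast
  show "G * F \<in> psi a ` J"
    using f g ideal_mult[OF J f(1), of g] by (intro image_eqI[of _ _ "g * f"]) (simp_all add: rhom.hom_mult[OF psi_hom])
  assume "G \<in> psi a ` J"
  then obtain g' where g': "g' \<in> J" "G = psi a g'" by auto
  then show "F + G \<in> psi a ` J"
    using f ideal_add[OF J f(1) g'(1)] by (intro image_eqI[of _ _ "f + g'"]) (simp_all add: rhom.hom_add[OF psi_hom])
qed

text \<open>If \<open>psi a f = psi a g\<close> with \<open>g\<close> in \<open>J\<close>, bring
  \<open>f\<close> and the components of \<open>g\<close> to one degree by powers of \<open>lin a\<close>. On
  forms of that degree \<open>psi a\<close> is injective, so a power of \<open>lin a\<close> times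
  \<open>f\<close> lies in \<open>J\<close>.\<close>

lemma psi_mem_iff:
  assumes hom: "homogeneous_ideal J" and nzd: "\<And>f. lin a * f \<in> J \<Longrightarrow> f \<in> J" and f: "f \<in> forms N"
  shows "psi a f \<in> psi a ` J \<longleftrightarrow> f \<in> J"
proof
  assume "psi a f \<in> psi a ` J"
  then obtain g where g: "g \<in> J" "psi a f = psi a g" by auto
  have J: "is_ideal J" using hom by (rule homogeneous_ideal_ideal)
  define D where "D = mdeg ` keys g"
  define M where "M = N + (\<Sum>d\<in>D. d)"
  have le: "d \<le> M" if "d \<in> D" for d
  proof -
    have "d \<le> (\<Sum>d\<in>D. d)" using that by (intro member_le_sum) (auto simp: D_def)
    then show ?thesis by (simp add: M_def)
  qed
  define G where "G = (\<Sum>d\<in>D. lin a ^ (M - d) * hom_component d g)"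
  have pw: "lin a ^ k \<in> forms k" for k using forms_power[OF lin_form, of a k] by simp
  have psiG: "psi a (lin a ^ k * h) = psi a h" for k h
    unfolding rhom.hom_mult[OF psi_hom] rhom.hom_power[OF psi_hom] psi_lin by simp
  have GJ: "G \<in> J" unfolding G_def
    using g(1) hom by (intro ideal_sum[OF J] ideal_mult[OF J]) (simp add: homogeneous_ideal_def)
  have GM: "G \<in> forms M" unfolding G_def
  proof (rule forms_sum)
    fix d assume "d \<in> D"
    then show "lin a ^ (M - d) * hom_component d g \<in> forms M"
      using forms_mult[OF pw[of "M - d"] hom_component_in_forms[of d g]] le by simp
  qed
  have "psi a G = psi a (\<Sum>d\<in>D. hom_component d g)"
    unfolding G_def rhom.hom_sum[OF psi_hom] psiG ..
  also have "(\<Sum>d\<in>D. hom_component d g) = g" by (rule sum_hom_components) (auto simp: D_def)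
  finally have "psi a (lin a ^ (M - N) * f - G) = 0" unfolding rhom.hom_diff[OF psi_hom] psiG g(2) by simp
  moreover have "lin a ^ (M - N) * f - G \<in> forms M"
    using forms_mult[OF pw[of "M - N"] f] GM by (intro forms_diff) (simp_all add: M_def add.commute)
  ultimately have "lin a ^ (M - N) * f - G = 0" by (rule psi_inj[rotated])
  then have in_J: "lin a ^ (M - N) * f \<in> J" using GJ by simp
  have "lin a ^ k * f \<in> J \<longrightarrow> f \<in> J" for k
  proof (induction k)
    case (Suc k)
    then show ?case using nzd[of "lin a ^ k * f"] by (simp add: mult.assoc)
  qed simp
  then show "f \<in> J" using in_J by blast
qed auto

section \<open>Every ideal of finite colength lies in a cell\<close>

definition cell_indices :: "nat \<Rightarrow> (nat \<Rightarrow> nat) \<Rightarrow> cell_index set" where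
  "cell_indices n \<beta> = (SIGMA i:{..<n}. {..Suc i} \<times> {..<\<beta> i - \<beta> (Suc i)})"

lemma finite_cell_indices: "finite (cell_indices n \<beta>)"
  unfolding cell_indices_def by auto

text \<open>Summation by parts of
  \<open>(i + 2) (\<beta>\<^sub>i - \<beta>\<^sub>i\<^sub>+\<^sub>1)\<close>.\<close>

lemma card_cell_indices:
  assumes "cell_shape n \<beta>"
  shows "card (cell_indices n \<beta>) = (\<Sum>l<n. \<beta> l) + \<beta> 0"
proof -
  have "card (cell_indices n \<beta>) = (\<Sum>i<n. (i + 2) * (\<beta> i - \<beta> (Suc i)))"
    unfolding cell_indices_def by (subst card_SigmaI) (auto simp: card_cartesian_product)
  also have "(\<Sum>i<m. (i + 2) * (\<beta> i - \<beta> (Suc i))) + (m + 1) * \<beta> m = (\<Sum>l<m. \<beta> l) + \<beta> 0" for m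
  proof (induction m)
    case (Suc m)
    have le: "\<beta> (Suc m) \<le> \<beta> m" using assms by (simp add: cell_shape_def)
    then obtain r where r: "\<beta> m = \<beta> (Suc m) + r" using le_Suc_ex by blast
    have "(m + 2) * (\<beta> m - \<beta> (Suc m)) + (Suc m + 1) * \<beta> (Suc m) = (m + 2) * \<beta> m"
      by (simp add: r algebra_simps)
    then show ?case using Suc by (simp add: algebra_simps)
  qed simp
  from this[of n] have "(\<Sum>i<n. (i + 2) * (\<beta> i - \<beta> (Suc i))) = (\<Sum>l<n. \<beta> l) + \<beta> 0"
    using assms by (simp add: cell_shape_def)
  finally show ?thesis .
qed

lemma monic_low_sum:
  fixes q :: "'k::field poly"
  assumes "degree q = m" "lead_coeff q = 1"
  shows "q = pmonom 1 m + (\<Sum>s<m. pmonom (coeff q s) s)"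
  using assms by (intro poly_eqI) (auto simp: coeff_low_sum coeff_monom coeff_eq_0)

lemma low_sum:
  fixes q :: "'k::field poly"
  assumes "q = 0 \<or> degree q < m"
  shows "q = (\<Sum>s<m. pmonom (coeff q s) s)"
  using assms by (intro poly_eqI) (auto simp: coeff_low_sum coeff_eq_0)

lemma low_degree: "degree (\<Sum>s<m. pmonom (f s) s) < m \<or> (\<Sum>s<m. pmonom (f s) s) = (0 :: 'k::field poly)"
proof (cases m)
  case (Suc m')
  have "degree (\<Sum>s<m. pmonom (f s) s) \<le> m'"
    by (rule degree_le) (auto simp: coeff_low_sum Suc simp del: sum.lessThan_Suc)
  then show ?thesis using Suc by simp
qed simp

lemma smult_sum_right': "smult c (\<Sum>i\<in>S. F i) = (\<Sum>i\<in>S. smult c (F i))" for c :: "'a::comm_ring_1"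
  by (induction S rule: infinite_finite_induct) (simp_all add: smult_add_right)

lemma smult_left_cancel: "c \<noteq> 0 \<Longrightarrow> smult c F = smult c G \<Longrightarrow> F = G" for c :: "'a::idom"
proof -
  assume c: "c \<noteq> 0" and "smult c F = smult c G"
  then have "smult c (F - G) = 0" by (simp add: smult_diff_right)
  then show "F = G" using c by simp
qed

lemma v_mult_coeff: "coeff ([:0, 1:] * F) (Suc j) = coeff F (j :: nat)" "coeff ([:0, 1:] * F) 0 = 0"
  for F :: "'a::comm_ring_1 poly"
  by simp_all

lemma degree_v_mult: "degree F \<le> l \<Longrightarrow> degree ([:0, 1:] * F) \<le> Suc l" for F :: "'a::comm_ring_1 poly"
  using degree_mult_le[of "[:0, 1:]" F] degree_pCons_le[of 0 "1 :: 'a poly"] by (simp add: order_trans)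

lemma degree_less_coeff: "degree F \<le> l \<Longrightarrow> coeff F l = 0 \<Longrightarrow> F = 0 \<or> degree F < l"
  by (metis le_neq_implies_less leading_coeff_0_iff)

text \<open>Let \<open>P\<^sub>l\<close> be the monic generator of the ideal of coefficients of
  \<open>v\<^sup>l\<close> in the elements of \<open>I\<close> of degree at most \<open>l\<close>, and
  \<open>G\<^sub>l\<close> an element with this coefficient. The \<open>a\<^sub>i\<^sub>l\<close> are found row
  by row: \<open>v P\<^sub>i h\<^sub>i - q\<^sub>i G\<^sub>i\<^sub>+\<^sub>1\<close> lies in
  \<open>I\<close> and has degree at most \<open>i\<close>, so it is a combination of the
  \<open>P\<^sub>l h\<^sub>l\<close> with coefficients \<open>B\<^sub>l\<close> for \<open>l \<le> i\<close>;
  the remainders of the \<open>B\<^sub>l\<close> modulo \<open>q\<^sub>i\<close> are the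
  \<open>a\<^sub>i\<^sub>l\<close>, and the quotients only change \<open>G\<^sub>i\<^sub>+\<^sub>1\<close> by
  elements of \<open>I\<close>.\<close>

lemma cell_exists:
  fixes I :: "'k::field poly poly set"
  assumes I: "is_ideal I"
    and colength: "\<And>S. finite S \<Longrightarrow> (\<And>c x. polycomb c S \<in> I \<Longrightarrow> x \<in> S \<Longrightarrow> c x = (0 :: 'k)) \<Longrightarrow> card S \<le> n"
  shows "\<exists>\<beta> p. cell_shape n \<beta> \<and> (\<Sum>l<n. \<beta> l) \<le> n \<and> cell n \<beta> p I \<and> (\<forall>x. x \<notin> cell_indices n \<beta> \<longrightarrow> p x = 0)"
proof -
  have row: "polycomb c S = (\<Sum>l<L. pmonom (\<Sum>s<d l. pmonom (c (s, l)) s) l)"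
    if "S = (\<lambda>(l, s). (s, l)) ` (SIGMA l:{..<L}. {..<d l})" for S L d and c :: "nat \<times> nat \<Rightarrow> 'k"
  proof -
    have "inj_on (\<lambda>(l, s). (s, l)) (SIGMA l:{..<L}. {..<d l})" by (auto simp: inj_on_def)
    then have "polycomb c S = (\<Sum>(l, s)\<in>(SIGMA l:{..<L}. {..<d l}). const2 (c (s, l)) * mon2 s l)"
      unfolding that by (subst sum.reindex) (auto simp: case_prod_unfold intro!: sum.cong)
    also have "\<dots> = (\<Sum>l<L. \<Sum>s<d l. const2 (c (s, l)) * mon2 s l)"
      by (rule sum.Sigma[symmetric]) auto
    also have "\<dots> = (\<Sum>l<L. pmonom (\<Sum>s<d l. pmonom (c (s, l)) s) l)"
      by (intro sum.cong refl) (simp add: const2_def mon2_def smult_monom monom_sum)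
    finally show ?thesis .
  qed
  have coeff_row: "coeff (\<Sum>l<L. pmonom (f l) l) j = (if j < L then f j else 0)" for L j and f :: "nat \<Rightarrow> 'k poly"
    by (simp add: coeff_sum coeff_monom sum.delta)
  have nonzero: "\<exists>F\<in>I. degree F \<le> l \<and> coeff F l \<noteq> 0" for l
  proof (rule ccontr)
    assume *: "\<not> ?thesis"
    let ?S = "(\<lambda>s. (s, l)) ` {..<Suc n}"
    have "card ?S \<le> n"
    proof (rule colength)
      fix c x assume c: "polycomb c ?S \<in> I" and x: "x \<in> ?S"
      have "polycomb c ?S = pmonom (\<Sum>s<Suc n. pmonom (c (s, l)) s) l"
        by (subst sum.reindex) (auto simp: inj_on_def const2_def mon2_def smult_monom monom_sum simp del: sum.lessThan_Suc)
      then have "coeff (pmonom (\<Sum>s<Suc n. pmonom (c (s, l)) s) l) l = 0"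
        using * c degree_monom_le by metis
      then have "(\<Sum>s<Suc n. pmonom (c (s, l)) s) = 0" by (simp add: coeff_monom)
      then have "coeff (\<Sum>s<Suc n. pmonom (c (s, l)) s) (fst x) = 0" by simp
      then show "c x = 0" using x unfolding coeff_low_sum by auto
    qed simp
    moreover have "card ?S = Suc n" by (subst card_image) (auto simp: inj_on_def)
    ultimately show False by simp
  qed
  have "\<exists>G. G \<in> I \<and> degree G \<le> l \<and> lead_coeff (coeff G l) = 1 \<and> (\<forall>F\<in>I. degree F \<le> l \<longrightarrow> coeff G l dvd coeff F l)" for l
  proof -
    let ?P = "\<lambda>d. \<exists>F\<in>I. degree F \<le> l \<and> coeff F l \<noteq> 0 \<and> degree (coeff F l) = d"
    define d where "d = (LEAST d. ?P d)"
    have "\<exists>d. ?P d" using nonzero[of l] by blast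
    then have "?P d" unfolding d_def by (rule LeastI_ex)
    then obtain F0 where F0: "F0 \<in> I" "degree F0 \<le> l" "coeff F0 l \<noteq> 0" "degree (coeff F0 l) = d" by blast
    define G where "G = smult [:inverse (lead_coeff (coeff F0 l)):] F0"
    have G: "G \<in> I" "degree G \<le> l" unfolding G_def
      by (rule ideal_smult[OF I F0(1)]) (rule order_trans[OF degree_smult_le F0(2)])
    have cG: "coeff G l = smult (inverse (lead_coeff (coeff F0 l))) (coeff F0 l)" by (simp add: G_def)
    have lcG: "lead_coeff (coeff G l) = 1" unfolding cG using F0(3) by simp
    have "degree (coeff G l) = degree (coeff F0 l)" unfolding cG using F0(3) by simp
    then have dG: "degree (coeff G l) = d" unfolding F0(4) .
    have "coeff G l dvd coeff F l" if F: "F \<in> I" "degree F \<le> l" for F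
    proof (rule ccontr)
      assume nd: "\<not> coeff G l dvd coeff F l"
      define R where "R = F - smult (coeff F l div coeff G l) G"
      have cR: "coeff R l = coeff F l mod coeff G l" by (simp add: R_def minus_div_mult_eq_mod)
      have "coeff G l \<noteq> 0" using lcG by auto
      then have "degree (coeff R l) < d" "coeff R l \<noteq> 0"
        unfolding cR dG[symmetric] using nd degree_mod_less[of "coeff G l" "coeff F l"] by (auto simp: dvd_eq_mod_eq_0)
      moreover have "R \<in> I" unfolding R_def using F G by (intro ideal_diff ideal_smult I)
      moreover have "degree R \<le> l" unfolding R_def using F G
        by (intro degree_diff_le order_trans[OF degree_smult_le]) auto
      ultimately have "?P (degree (coeff R l))" by blast
      then show False using not_less_Least[of "degree (coeff R l)" ?P] \<open>degree (coeff R l) < d\<close> by (simp add: d_def)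
    qed
    then show ?thesis using G lcG by blast
  qed
  then obtain G where G: "\<And>l. G l \<in> I" "\<And>l. degree (G l) \<le> l" "\<And>l. lead_coeff (coeff (G l) l) = 1"
    "\<And>l F. F \<in> I \<Longrightarrow> degree F \<le> l \<Longrightarrow> coeff (G l) l dvd coeff F l"
    by metis
  define P where "P l = coeff (G l) l" for l
  define \<beta> where "\<beta> l = degree (P l)" for l
  have P: "lead_coeff (P l) = 1" "P l \<noteq> 0" for l using G(3)[of l] by (auto simp: P_def)
  have dvdP: "P l dvd coeff F l" if "F \<in> I" "degree F \<le> l" for F l using G(4)[OF that] by (simp add: P_def)
  have stepP: "P (Suc l) dvd P l" for l
  proof -
    have "P (Suc l) dvd coeff ([:0, 1:] * G l) (Suc l)"
      by (rule dvdP[OF ideal_mult[OF I G(1)] degree_v_mult[OF G(2)]])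
    then show ?thesis unfolding v_mult_coeff P_def .
  qed
  define q where "q i = P i div P (Suc i)" for i
  have Pq: "P i = q i * P (Suc i)" for i using stepP[of i] by (simp add: q_def)
  have q0: "q i \<noteq> 0" for i using Pq[of i] P(2)[of i] by auto
  have q: "lead_coeff (q i) = 1" "degree (q i) = \<beta> i - \<beta> (Suc i)" for i
  proof -
    have "lead_coeff (P i) = lead_coeff (q i) * lead_coeff (P (Suc i))" unfolding Pq[of i] by (rule lead_coeff_mult)
    then show "lead_coeff (q i) = 1" using P by simp
    have "degree (P i) = degree (q i) + degree (P (Suc i))"
      unfolding Pq[of i] by (rule degree_mult_eq[OF q0 P(2)])
    then show "degree (q i) = \<beta> i - \<beta> (Suc i)" by (simp add: \<beta>_def)
  qed
  have \<beta>_mono: "\<beta> (Suc l) \<le> \<beta> l" for l unfolding \<beta>_def using stepP P(2) by (intro dvd_imp_degree_le)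
  have small: "F = 0" if F: "F \<in> I" "\<And>l. coeff F l = 0 \<or> degree (coeff F l) < \<beta> l" for F
  proof (rule ccontr)
    assume "F \<noteq> 0"
    then have "coeff F (degree F) \<noteq> 0" by simp
    moreover have "P (degree F) dvd coeff F (degree F)" using F(1) by (intro dvdP) auto
    ultimately have "degree (P (degree F)) \<le> degree (coeff F (degree F))" by (intro dvd_imp_degree_le)
    then show False using F(2)[of "degree F"] \<open>coeff F (degree F) \<noteq> 0\<close> by (simp add: \<beta>_def)
  qed
  have total: "(\<Sum>l<L. \<beta> l) \<le> n" for L
  proof -
    let ?S = "(\<lambda>(l, s). (s, l)) ` (SIGMA l:{..<L}. {..<\<beta> l})"
    have "card ?S \<le> n"
    proof (rule colength)
      fix c x assume c: "polycomb c ?S \<in> I" and x: "x \<in> ?S"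
      let ?R = "\<Sum>l<L. pmonom (\<Sum>s<\<beta> l. pmonom (c (s, l)) s) l"
      have "?R = 0"
      proof (rule small)
        show "?R \<in> I"
          using c unfolding row[OF refl] .
        fix l
        have "degree (\<Sum>s<\<beta> l. pmonom (c (s, l)) s) < \<beta> l \<or> (\<Sum>s<\<beta> l. pmonom (c (s, l)) s) = 0"
          by (rule low_degree)
        then show "coeff ?R l = 0 \<or>
            degree (coeff ?R l) < \<beta> l"
          unfolding coeff_row by auto
      qed
      then have "coeff (coeff ?R (snd x)) (fst x) = 0" by simp
      then show "c x = 0" using x unfolding coeff_row by (auto simp: coeff_low_sum)
    qed auto
    moreover have "card ?S = (\<Sum>l<L. \<beta> l)"
      by (subst card_image) (auto simp: inj_on_def)
    ultimately show ?thesis by simp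
  qed
  have \<beta>0: "\<beta> l = 0" if "n \<le> l" for l
  proof (rule ccontr)
    assume "\<beta> l \<noteq> 0"
    then have "1 \<le> \<beta> j" if "j \<le> l" for j using lift_Suc_antimono_le[of \<beta> j l, OF \<beta>_mono that] by simp
    then have "(\<Sum>j<Suc l. 1) \<le> (\<Sum>j<Suc l. \<beta> j)" by (intro sum_mono) auto
    then show False using total[of "Suc l"] that by simp
  qed
  have shape: "cell_shape n \<beta>" using \<beta>_mono \<beta>0 by (simp add: cell_shape_def)
  have P1: "P l = 1" if "n \<le> l" for l
  proof -
    have d0: "degree (P l) = 0" using \<beta>0[OF that] by (simp add: \<beta>_def)
    then have "P l = [:coeff (P l) 0:]" by (rule degree_0_id[symmetric])
    moreover have "coeff (P l) 0 = 1" using P(1)[of l] unfolding d0 .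
    ultimately show ?thesis by (simp add: one_pCons)
  qed
  have Pprod: "P j = (\<Prod>i\<in>{j..<m}. q i) * P m" if "j \<le> m" for j m
    using that
  proof (induction rule: inc_induct)
    case (step j)
    have "{j..<m} = insert j {Suc j..<m}" using step by auto
    then have "(\<Prod>i\<in>{j..<m}. q i) = q j * (\<Prod>i\<in>{Suc j..<m}. q i)" by simp
    then show ?case unfolding Pq[of j] step.IH by (simp only: mult.assoc)
  qed simp
  have span: "\<exists>B. F = (\<Sum>j\<le>m. smult (B j * P j) (cell_h q a j))"
    if "F \<in> I" "degree F \<le> m" "\<And>j. j \<le> m \<Longrightarrow> smult (P j) (cell_h q a j) \<in> I" for F m a
    using that
  proof (induction m arbitrary: F)
    case 0
    then obtain b where b: "coeff F 0 = P 0 * b" using dvdP[of F 0] by (auto elim: dvdE)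
    have "F = [:coeff F 0:]" using 0(2) by (simp add: degree_0_id)
    then have "F = smult (b * P 0) 1" by (simp add: b mult.commute)
    then show ?case by (intro exI[of _ "\<lambda>_. b"]) simp
  next
    case (Suc m)
    obtain b where b: "coeff F (Suc m) = P (Suc m) * b" by (rule dvdE[OF dvdP[OF Suc.prems(1,2)]])
    define F' where "F' = F - smult (b * P (Suc m)) (cell_h q a (Suc m))"
    have "smult b (smult (P (Suc m)) (cell_h q a (Suc m))) \<in> I" by (rule ideal_smult[OF I Suc.prems(3)]) simp
    then have "F' \<in> I" unfolding F'_def using Suc.prems(1) by (intro ideal_diff I) simp_all
    moreover have "degree F' \<le> Suc m" unfolding F'_def using Suc.prems(2)
      by (intro degree_diff_le order_trans[OF degree_smult_le]) simp_all
    then have "F' = 0 \<or> degree F' < Suc m"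
      by (rule degree_less_coeff) (simp add: F'_def b mult.commute)
    then have "degree F' \<le> m" by auto
    ultimately obtain B where B: "F' = (\<Sum>j\<le>m. smult (B j * P j) (cell_h q a j))" using Suc.IH[of F'] Suc.prems(3) by auto
    have "(\<Sum>j\<le>m. smult ((B(Suc m := b)) j * P j) (cell_h q a j)) = F'"
      unfolding B by (intro sum.cong refl) auto
    moreover have "F = F' + smult ((B(Suc m := b)) (Suc m) * P (Suc m)) (cell_h q a (Suc m))" by (simp add: F'_def)
    ultimately have "F = (\<Sum>j\<le>Suc m. smult ((B(Suc m := b)) j * P j) (cell_h q a j))" by (simp only: sum.atMost_Suc)
    then show ?case by (intro exI[of _ "B(Suc m := b)"])
  qed
  have "\<exists>a. (\<forall>i<m. \<forall>l\<le>i. a i l = 0 \<or> degree (a i l) < \<beta> i - \<beta> (Suc i)) \<and> (\<forall>j\<le>m. smult (P j) (cell_h q a j) \<in> I)" for m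
  proof (induction m)
    case 0
    have "smult (P 0) 1 = G 0" using G(2)[of 0] by (simp add: P_def degree_0_id)
    then show ?case using G(1)[of 0] by (intro exI[of _ "\<lambda>_ _. 0"]) simp
  next
    case (Suc m)
    then obtain a where a: "\<forall>i<m. \<forall>l\<le>i. a i l = 0 \<or> degree (a i l) < \<beta> i - \<beta> (Suc i)" "\<And>j. j \<le> m \<Longrightarrow> smult (P j) (cell_h q a j) \<in> I"
      by blast
    define F where "F = [:0, 1:] * smult (P m) (cell_h q a m) - smult (q m) (G (Suc m))"
    have "F \<in> I" unfolding F_def
      by (rule ideal_diff[OF I ideal_mult[OF I a(2)[OF le_refl]] ideal_smult[OF I G(1)]])
    have "degree F \<le> Suc m" unfolding F_def
    proof (rule degree_diff_le)
      show "degree ([:0, 1:] * smult (P m) (cell_h q a m)) \<le> Suc m"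
        by (intro degree_v_mult order_trans[OF degree_smult_le]) simp
      show "degree (smult (q m) (G (Suc m))) \<le> Suc m" by (rule order_trans[OF degree_smult_le G(2)])
    qed
    moreover have "coeff F (Suc m) = P m - q m * P (Suc m)" unfolding F_def coeff_diff v_mult_coeff by (simp add: P_def)
    then have "coeff F (Suc m) = 0" using Pq[of m] by simp
    ultimately have "F = 0 \<or> degree F < Suc m" by (rule degree_less_coeff)
    then have "degree F \<le> m" by auto
    from span[OF \<open>F \<in> I\<close> this a(2)] obtain B where B: "F = (\<Sum>j\<le>m. smult (B j * P j) (cell_h q a j))" by blast
    define a' where "a' = a(m := (\<lambda>j. B j mod q m))"
    have same: "cell_h q a' j = cell_h q a j" if "j \<le> m" for j
      by (rule cell_h_cong[where m = m]) (use that in \<open>auto simp: a'_def\<close>)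
    have "smult (P m) (cell_h q a' (Suc m)) = [:0, 1:] * smult (P m) (cell_h q a m) - (\<Sum>j\<in>{..m}. smult ((B j mod q m) * P j) (cell_h q a j))"
    proof -
      have "smult (P m) (smult (a' m j * (\<Prod>i\<in>{j..<m}. q i)) (cell_h q a' j)) = smult ((B j mod q m) * P j) (cell_h q a j)" if "j \<in> {..m}" for j
        using that same[of j] by (simp add: a'_def Pprod[of j m] mult_ac)
      then show ?thesis unfolding cell_h.simps(2) using same[of m]
        by (simp add: smult_diff_right smult_sum_right')
    qed
    also have "\<dots> = smult (q m) (G (Suc m)) + (F - (\<Sum>j\<in>{..m}. smult ((B j mod q m) * P j) (cell_h q a j)))"
      by (simp add: F_def)
    also have "F - (\<Sum>j\<in>{..m}. smult ((B j mod q m) * P j) (cell_h q a j)) = (\<Sum>j\<in>{..m}. smult ((B j - B j mod q m) * P j) (cell_h q a j))"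
      unfolding B by (simp add: sum_subtractf smult_diff_left left_diff_distrib)
    also have "\<dots> = smult (q m) (\<Sum>j\<in>{..m}. smult (B j div q m * P j) (cell_h q a j))"
      by (simp add: smult_sum_right' minus_mod_eq_mult_div mult.assoc)
    finally have "smult (q m) (smult (P (Suc m)) (cell_h q a' (Suc m))) = smult (q m) (G (Suc m) + (\<Sum>j\<in>{..m}. smult (B j div q m * P j) (cell_h q a j)))"
      unfolding Pq[of m] by (simp add: smult_add_right)
    then have eq: "smult (P (Suc m)) (cell_h q a' (Suc m)) = G (Suc m) + (\<Sum>j\<in>{..m}. smult (B j div q m * P j) (cell_h q a j))"
      by (rule smult_left_cancel[OF q0[of m]])
    have "smult (B j div q m * P j) (cell_h q a j) \<in> I" if "j \<le> m" for j
      using ideal_smult[OF I a(2)[OF that], of "B j div q m"] by simp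
    then have new: "smult (P (Suc m)) (cell_h q a' (Suc m)) \<in> I"
      unfolding eq by (intro ideal_add ideal_sum I G(1)) simp
    have "B j mod q m = 0 \<or> degree (B j mod q m) < \<beta> m - \<beta> (Suc m)" for j
      using degree_mod_less[OF q0[of m], of "B j"] q(2) by simp
    then have "\<forall>i<Suc m. \<forall>l\<le>i. a' i l = 0 \<or> degree (a' i l) < \<beta> i - \<beta> (Suc i)"
      using a(1) by (auto simp: a'_def less_Suc_eq)
    moreover have "smult (P j) (cell_h q a' j) \<in> I" if "j \<le> Suc m" for j
      using new a(2)[of j] same[of j] that by (cases "j = Suc m") auto
    ultimately show ?case by blast
  qed
  from this[of n] obtain a where "\<forall>i<n. \<forall>l\<le>i. a i l = 0 \<or> degree (a i l) < \<beta> i - \<beta> (Suc i)" "\<forall>j\<le>n. smult (P j) (cell_h q a j) \<in> I"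
    by (elim exE conjE)
  then have a: "\<And>i l. i < n \<Longrightarrow> l \<le> i \<Longrightarrow> a i l = 0 \<or> degree (a i l) < \<beta> i - \<beta> (Suc i)" "\<And>j. j \<le> n \<Longrightarrow> smult (P j) (cell_h q a j) \<in> I"
    by simp_all
  define p where "p = (\<lambda>(i, l, s). if (i, l, s) \<in> cell_indices n \<beta> then if l = Suc i then coeff (q i) s else coeff (a i l) s else 0)"
  have pq: "cell_q \<beta> p i = q i" for i
  proof -
    have "(\<Sum>s<\<beta> i - \<beta> (Suc i). pmonom (p (i, Suc i, s)) s) = (\<Sum>s<\<beta> i - \<beta> (Suc i). pmonom (coeff (q i) s) s)"
      using \<beta>0[of i] by (intro sum.cong refl) (cases "i < n"; auto simp: p_def cell_indices_def)
    then show ?thesis unfolding cell_q_def using monic_low_sum[OF q(2,1)] by simp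
  qed
  have pa: "cell_a \<beta> p i l = a i l" if "i < n" "l \<le> i" for i l
  proof -
    have "cell_a \<beta> p i l = (\<Sum>s<\<beta> i - \<beta> (Suc i). pmonom (coeff (a i l) s) s)"
      unfolding cell_a_def using that by (intro sum.cong refl) (auto simp: p_def cell_indices_def)
    then show ?thesis using low_sum[OF a(1)[OF that]] by simp
  qed
  have ph: "cellh \<beta> p j = cell_h q a j" if "j \<le> n" for j
  proof -
    have "cell_q \<beta> p = q" using pq by blast
    then show ?thesis using cell_h_cong[where m = n and a = "cell_a \<beta> p" and a' = a and q = q and j = j] pa that by simp
  qed
  have pQ: "cell_Q n \<beta> p l = P l" for l
  proof (cases "l \<le> n")
    case True
    then show ?thesis using Pprod[OF True] P1[of n] by (simp add: cell_Q_def pq)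
  next
    case False
    then show ?thesis using P1[of l] by (simp add: cell_Q_ge)
  qed
  have gens: "smult (cell_Q n \<beta> p l) (cellh \<beta> p l) \<in> I" for l
  proof (induction l)
    case 0
    then show ?case using a(2)[of 0] ph[of 0] pQ[of 0] by simp
  next
    case (Suc l)
    show ?case
    proof (cases "Suc l \<le> n")
      case True
      then show ?thesis using a(2) ph pQ by simp
    next
      case False
      then have "\<beta> l - \<beta> (Suc l) = 0" using \<beta>0[of l] by simp
      then have "cell_a \<beta> p l j = 0" for j by (simp add: cell_a_def)
      then have "cellh \<beta> p (Suc l) = [:0, 1:] * cellh \<beta> p l" by (simp add: cell_h.simps(2))
      then show ?thesis using Suc False ideal_mult[OF I, of "cellh \<beta> p l" "[:0, 1:]"] by (simp add: cell_Q_ge)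
    qed
  qed
  have indep: "\<forall>l<n. N l = 0" if N: "\<forall>l. N l = 0 \<or> degree (N l) < \<beta> l" "(\<Sum>l<n. smult (N l) (cellh \<beta> p l)) \<in> I" for N
  proof (rule ccontr)
    assume "\<not> ?thesis"
    then have ne: "{l. l < n \<and> N l \<noteq> 0} \<noteq> {}" by auto
    define m where "m = Max {l. l < n \<and> N l \<noteq> 0}"
    have m: "m < n" "N m \<noteq> 0" using Max_in[OF _ ne] by (auto simp: m_def)
    have top: "N l = 0" if "m < l" "l < n" for l
    proof (rule ccontr)
      assume "N l \<noteq> 0"
      then have "l \<le> m" unfolding m_def using that by (intro Max_ge) auto
      then show False using that by simp
    qed
    let ?F = "\<Sum>l<n. smult (N l) (cellh \<beta> p l)"
    have "degree ?F \<le> m"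
    proof (rule degree_sum_le)
      fix l assume "l \<in> {..<n}"
      then show "degree (smult (N l) (cellh \<beta> p l)) \<le> m"
        using top[of l] by (cases "l \<le> m") (auto intro: order_trans[OF degree_smult_le])
    qed simp
    then have "P m dvd coeff ?F m" using N(2) by (intro dvdP)
    moreover have "coeff ?F m = (\<Sum>l<n. if l = m then N m else 0)"
      unfolding coeff_sum
    proof (intro sum.cong refl)
      fix l assume l: "l \<in> {..<n}"
      show "coeff (smult (N l) (cellh \<beta> p l)) m = (if l = m then N m else 0)"
        using top[of l] l by (cases l m rule: linorder_cases) (auto simp: coeff_eq_0)
    qed
    ultimately have "P m dvd N m" using m by simp
    then have "degree (P m) \<le> degree (N m)" using m(2) by (rule dvd_imp_degree_le)
    then show False using N(1)[rule_format, of m] m(2) by (auto simp: \<beta>_def)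
  qed
  have "cell n \<beta> p I" unfolding cell_def using I gens indep by blast
  moreover have "\<forall>x. x \<notin> cell_indices n \<beta> \<longrightarrow> p x = 0" by (auto simp: p_def)
  ultimately show ?thesis using shape total[of n] by blast
qed

section \<open>Charts of the Hilbert scheme\<close>

lemma chart_coord_mem:
  fixes J :: "'k::field ac_ideal"
  assumes J: "J \<in> hilb_chart n B" and m: "m \<in> deg_exps n"
  shows "monom m - (\<Sum>b\<in>B. scale (chart_coord n B J (m, b)) (monom b)) \<in> J"
proof -
  have id: "is_ideal J" and qb: "quot_basis (forms n) (J \<inter> forms n) (monom ` B)"
    using J by (auto simp: hilb_chart_def hilb_points_def homogeneous_ideal_def)
  have B: "B \<subseteq> deg_exps n"
    and ind: "\<And>c b. lincomb c B \<in> J \<Longrightarrow> b \<in> B \<Longrightarrow> c b = 0"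
    and spn: "\<And>f. f \<in> forms n \<Longrightarrow> \<exists>c. f - lincomb c B \<in> J"
    using qb[unfolded monom_quot_basis_iff[OF id]] by blast+
  let ?P = "\<lambda>c. (\<forall>b'. b' \<notin> B \<longrightarrow> c b' = 0) \<and> monom m - lincomb c B \<in> J"
  obtain c where c: "monom m - lincomb c B \<in> J" using spn[of "monom m"] m by auto
  define c' where "c' b = (if b \<in> B then c b else 0)" for b
  have P: "?P c'" using c by (simp add: c'_def)
  have "d = c'" if d: "?P d" for d
  proof
    fix b
    have "(monom m - lincomb c' B) - (monom m - lincomb d B) \<in> J"
      by (rule ideal_diff[OF id conjunct2[OF P] conjunct2[OF d]])
    then have "(\<Sum>b\<in>B. scale (d b - c' b) (monom b)) \<in> J"
      by (simp only: kvec.scale_left_diff_distrib sum_subtractf) (simp add: algebra_simps)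
    from ind[OF this, of b] show "d b = c' b" using d P by (cases "b \<in> B") auto
  qed
  with P have the: "(THE c. ?P c) = c'" by (rule the_equality[of ?P])
  have "chart_coord n B J (m, b) = c' b" if "b \<in> B" for b
    using m that the by (simp add: chart_coord_def)
  then show ?thesis using P by simp
qed

lemma chart_mem_iff:
  fixes J :: "'k::field ac_ideal"
  assumes J: "J \<in> hilb_chart n B"
  shows "lincomb c (deg_exps n) \<in> J \<longleftrightarrow> (\<forall>b\<in>B. (\<Sum>m\<in>deg_exps n. c m * chart_coord n B J (m, b)) = 0)"
proof -
  have id: "is_ideal J" and qb: "quot_basis (forms n) (J \<inter> forms n) (monom ` B)"
    using J by (auto simp: hilb_chart_def hilb_points_def homogeneous_ideal_def)
  have ind: "\<And>c b. lincomb c B \<in> J \<Longrightarrow> b \<in> B \<Longrightarrow> c b = 0"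
    using qb[unfolded monom_quot_basis_iff[OF id]] by blast
  note coord = chart_coord_mem[OF J]
  let ?d = "\<lambda>b. \<Sum>m\<in>deg_exps n. c m * chart_coord n B J (m, b)"
  have "lincomb c (deg_exps n) - (lincomb ?d B)
      = (\<Sum>m\<in>deg_exps n. scale (c m) (monom m - (\<Sum>b\<in>B. scale (chart_coord n B J (m, b)) (monom b))))"
  proof -
    have "(\<Sum>b\<in>B. scale (?d b) (monom b :: (3, 'k alg_closure) mpoly)) = (\<Sum>b\<in>B. \<Sum>m\<in>deg_exps n. scale (c m) (scale (chart_coord n B J (m, b)) (monom b)))"
      by (simp add: kvec.scale_sum_left)
    also have "\<dots> = (\<Sum>m\<in>deg_exps n. scale (c m) (\<Sum>b\<in>B. scale (chart_coord n B J (m, b)) (monom b)))"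
      by (subst sum.swap) (simp only: kvec.scale_sum_right)
    finally show ?thesis by (simp only: kvec.scale_right_diff_distrib sum_subtractf)
  qed
  also have "\<dots> \<in> J" using coord by (intro ideal_sum[OF id] ideal_scale[OF id]) auto
  finally have *: "lincomb c (deg_exps n) - lincomb ?d B \<in> J" .
  show ?thesis
  proof
    assume "lincomb c (deg_exps n) \<in> J"
    from ideal_diff[OF id this *] have "lincomb ?d B \<in> J" by simp
    from ind[OF this] show "\<forall>b\<in>B. ?d b = 0" by blast
  next
    assume "\<forall>b\<in>B. ?d b = 0"
    then have "lincomb ?d B = (0 :: (3, 'k alg_closure) mpoly)" by simp
    then show "lincomb c (deg_exps n) \<in> J" using * by simp
  qed
qed

lemma hilb_pointsD:
  assumes "J \<in> hilb_points n"
  shows "homogeneous_ideal J" "saturated_ideal J" "is_ideal J" "\<forall>\<^sub>F i in sequentially. hilbert_function J i = n"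
  using assms by (auto simp: hilb_points_def homogeneous_ideal_def)

lemma hilb_chartD:
  assumes "J \<in> hilb_chart n B"
  shows "J \<in> hilb_points n" "B \<subseteq> deg_exps n" "finite B" "hilbert_function J n = card B"
proof -
  show 1: "J \<in> hilb_points n" using assms by (simp add: hilb_chart_def)
  have qb: "quot_basis (forms n) (J \<inter> forms n) (monom ` B)" using assms by (simp add: hilb_chart_def)
  show "B \<subseteq> deg_exps n" by (rule monom_quot_basis_iff[OF hilb_pointsD(3)[OF 1], THEN iffD1, THEN conjunct1, OF qb])
  then show "finite B" by (rule finite_subset[OF _ finite_mdeg])
  show "hilbert_function J n = card B" by (rule hf_eq_card[OF hilb_pointsD(3)[OF 1] qb])
qed

definition chart_funs :: "nat \<Rightarrow> 3 exps set \<Rightarrow> ('k::field ac_ideal \<Rightarrow> 'k alg_closure) set" where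
  "chart_funs n B = range (\<lambda>f J. eval_over f (chart_coord n B J))"

lemma chart_funs_ring: "fun_ring (chart_funs n B :: ('k::field ac_ideal \<Rightarrow> 'k alg_closure) set)"
proof -
  have ev: "rhom (\<lambda>f. eval_over f a)" for a :: "3 exps \<times> 3 exps \<Rightarrow> 'k alg_closure"
    unfolding eval_over_evalh by (rule rhom.evalh_hom[OF rhom_to_ac])
  let ?A = "chart_funs n B :: ('k ac_ideal \<Rightarrow> 'k alg_closure) set"
  show ?thesis
  proof
    show "(\<lambda>_. 0) \<in> ?A" unfolding chart_funs_def
      by (rule range_eqI[of _ _ 0]) (simp add: rhom.hom_zero[OF ev])
    show "(\<lambda>_. 1) \<in> ?A" unfolding chart_funs_def
      by (rule range_eqI[of _ _ 1]) (simp add: rhom.hom_one[OF ev])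
    fix F G :: "'k ac_ideal \<Rightarrow> 'k alg_closure"
    assume "F \<in> ?A" "G \<in> ?A"
    then obtain f g where fg: "F = (\<lambda>J. eval_over f (chart_coord n B J))" "G = (\<lambda>J. eval_over g (chart_coord n B J))"
      by (auto simp: chart_funs_def)
    show "(\<lambda>e. F e + G e) \<in> ?A" unfolding chart_funs_def fg
      by (rule range_eqI[of _ _ "f + g"]) (simp add: rhom.hom_add[OF ev])
    show "(\<lambda>e. F e * G e) \<in> ?A" unfolding chart_funs_def fg
      by (rule range_eqI[of _ _ "f * g"]) (simp add: rhom.hom_mult[OF ev])
  next
    fix F :: "'k ac_ideal \<Rightarrow> 'k alg_closure"
    assume "F \<in> ?A"
    then obtain f where fg: "F = (\<lambda>J. eval_over f (chart_coord n B J))" by (auto simp: chart_funs_def)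
    show "(\<lambda>e. - F e) \<in> ?A" unfolding chart_funs_def fg
      by (rule range_eqI[of _ _ "- f"]) (simp add: rhom.hom_uminus[OF ev])
  qed
qed

lemma chart_funs_coord: "(\<lambda>J. chart_coord n B J z) \<in> chart_funs n B"
  unfolding chart_funs_def
  by (rule range_eqI[of _ _ "monom (single z 1)"]) (simp add: eval_over_evalh rhom.evalh_single[OF rhom_to_ac] monom_def)

lemma chart_funs_const: "(\<lambda>_. to_ac c) \<in> chart_funs n B"
  unfolding chart_funs_def
  by (rule range_eqI[of _ _ "single 0 c"]) (simp add: eval_over_evalh rhom.evalh_single[OF rhom_to_ac])

text \<open>If a member has Hilbert function \<open>n\<close> at \<open>n\<close>, then \<open>B\<close> has
  \<open>n\<close> elements, so its coordinates provide the right number of equations.\<close>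

lemma chart_transition:
  "chart_family (chart_funs n B) n (\<lambda>J. J) {J \<in> hilb_chart n B. hilbert_function J n = n}
    (if finite B \<and> card B = n then B else {}) (\<lambda>m J b. chart_coord n B J (m, b) :: 'k::field alg_closure)"
proof -
  interpret fun_ring "chart_funs n B :: ('k ac_ideal \<Rightarrow> 'k alg_closure) set"
    by (rule chart_funs_ring)
  let ?E = "{J \<in> hilb_chart n B. hilbert_function J n = n} :: 'k ac_ideal set"
  show ?thesis
  proof
    show "(\<lambda>_. to_ac (b :: 'k)) \<in> chart_funs n B" for b by (rule chart_funs_const)
    show "finite (if finite B \<and> card B = n then B else {})" "card (if finite B \<and> card B = n then B else {}) \<le> n" by simp_all
    show "(\<lambda>e. chart_coord n B e (m, x) :: 'k alg_closure) \<in> chart_funs n B" for m x by (rule chart_funs_coord)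
  next
    fix J :: "'k ac_ideal" assume J: "J \<in> ?E"
    then show "J \<in> hilb_points n" "hilbert_function J n = n" by (auto intro: hilb_chartD)
    have eq: "(if finite B \<and> card B = n then B else {}) = B" using J hilb_chartD(3,4)[of J n B] by simp
    have "J \<in> hilb_chart n B" using J by simp
    then show "lincomb c (deg_exps n) \<in> J \<longleftrightarrow>
      (\<forall>x\<in>if finite B \<and> card B = n then B else {}. (\<Sum>m\<in>deg_exps n. c m * chart_coord n B J (m, x)) = 0)" for c
      unfolding eq by (rule chart_mem_iff)
  qed
qed

section \<open>The topology of the Hilbert scheme\<close>

lemma hilb_basic_open: 
  "g \<in> chart_funs n B \<Longrightarrow> openin (hilb_space n) {J \<in> hilb_chart n B. g J \<noteq> (0 :: 'k::field alg_closure)}"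
  unfolding hilb_space_def openin_topology_generated_by_iff chart_funs_def
  by (rule generate_topology_on.Basis) auto

text \<open>Continuity of the family, with the nonvanishing sets of the functions in \<open>A\<close> as basis
  of the topology on \<open>E\<close>.\<close>

lemma (in chart_family) open_preimage:
  assumes "openin (hilb_space n) W" "e \<in> E" "J e \<in> W"
  shows "\<exists>G\<in>A. G e \<noteq> 0 \<and> (\<forall>e'\<in>E. G e' \<noteq> 0 \<longrightarrow> J e' \<in> W)"
proof -
  let ?Q = "\<lambda>W. \<forall>e\<in>E. J e \<in> W \<longrightarrow> (\<exists>G\<in>A. G e \<noteq> 0 \<and> (\<forall>e'\<in>E. G e' \<noteq> 0 \<longrightarrow> J e' \<in> W))"
  have "?Q W"
    using assms(1) unfolding hilb_space_def openin_topology_generated_by_iff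
  proof induction
    case (Int a b)
    show ?case
    proof (intro ballI impI)
      fix e assume e: "e \<in> E" "J e \<in> a \<inter> b"
      obtain g where g: "g \<in> A" "g e \<noteq> 0" "\<forall>e'\<in>E. g e' \<noteq> 0 \<longrightarrow> J e' \<in> a"
        using Int.IH(1)[rule_format, of e] e by auto
      obtain g' where g': "g' \<in> A" "g' e \<noteq> 0" "\<forall>e'\<in>E. g' e' \<noteq> 0 \<longrightarrow> J e' \<in> b"
        using Int.IH(2)[rule_format, of e] e by auto
      show "\<exists>G\<in>A. G e \<noteq> 0 \<and> (\<forall>e'\<in>E. G e' \<noteq> 0 \<longrightarrow> J e' \<in> a \<inter> b)"
        using g g' by (intro bexI[OF _ mult_in[OF g(1) g'(1)]]) auto
    qed
  next
    case (UN K)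
    show ?case
    proof (intro ballI impI)
      fix e assume e: "e \<in> E" "J e \<in> \<Union>K"
      then obtain k where k: "k \<in> K" "J e \<in> k" by auto
      obtain g where g: "g \<in> A" "g e \<noteq> 0" "\<forall>e'\<in>E. g e' \<noteq> 0 \<longrightarrow> J e' \<in> k"
        using UN.IH[OF k(1), rule_format, of e] e k by auto
      then have "\<forall>e'\<in>E. g e' \<noteq> 0 \<longrightarrow> J e' \<in> \<Union>K" using k(1) by auto
      with g(1,2) show "\<exists>G\<in>A. G e \<noteq> 0 \<and> (\<forall>e'\<in>E. G e' \<noteq> 0 \<longrightarrow> J e' \<in> \<Union>K)" by (intro bexI conjI)
    qed
  next
    case (Basis W)
    then obtain B and f :: "(3 exps \<times> 3 exps, 'k) mpoly" where W: "W = {J \<in> hilb_chart n B. eval_over f (chart_coord n B J) \<noteq> 0}" by blast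
    obtain G where G: "G \<in> A" "\<forall>e\<in>E. (J e \<in> hilb_chart n B \<and> eval_over f (chart_coord n B (J e)) \<noteq> 0) \<longleftrightarrow> G e \<noteq> 0"
      using chart_open[of B f] by (elim bexE)
    show ?case unfolding W by (intro ballI impI bexI[OF _ G(1)]) (use G(2) in auto)
  qed simp
  from this[THEN bspec, OF assms(2), THEN mp, OF assms(3)] show ?thesis .
qed

lemma hilb_open_basis:
  assumes W: "openin (hilb_space n) W" and J: "J \<in> W" "J \<in> hilb_chart n B" "hilbert_function J n = n"
  shows "\<exists>g\<in>chart_funs n B. g J \<noteq> (0 :: 'k::field alg_closure) \<and> {J' \<in> hilb_chart n B. hilbert_function J' n = n \<and> g J' \<noteq> 0} \<subseteq> W"
proof -
  have "J \<in> {J \<in> hilb_chart n B. hilbert_function J n = n}" using J by simp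
  from chart_family.open_preimage[OF chart_transition W this J(1)]
  obtain g where g: "g \<in> chart_funs n B" "g J \<noteq> 0" "\<forall>J'\<in>{J \<in> hilb_chart n B. hilbert_function J n = n}. g J' \<noteq> 0 \<longrightarrow> J' \<in> W"
    by (elim bexE conjE)
  then show ?thesis by (intro bexI[OF _ g(1)]) auto
qed

lemma topspace_hilb_space: "topspace (hilb_space n) = (hilb_points n :: 'k::field ac_ideal set)"
proof
  show "topspace (hilb_space n) \<subseteq> (hilb_points n :: 'k ac_ideal set)"
    unfolding hilb_space_def topology_generated_by_topspace by (auto simp: hilb_chart_def)
  show "hilb_points n \<subseteq> topspace (hilb_space n :: 'k ac_ideal topology)"
  proof
    fix J :: "'k ac_ideal" assume J: "J \<in> hilb_points n"
    obtain B where "quot_basis (forms n) (J \<inter> forms n) (monom ` B)"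
      using hf_basis_exists[OF hilb_pointsD(3)[OF J], of n] by blast
    then have "J \<in> {J \<in> hilb_chart n B. (1 :: 'k alg_closure) \<noteq> 0}" using J by (simp add: hilb_chart_def)
    moreover have "openin (hilb_space n) {J :: 'k ac_ideal. J \<in> hilb_chart n B \<and> (1 :: 'k alg_closure) \<noteq> 0}"
      by (rule hilb_basic_open[where g = "\<lambda>_. 1", OF fun_ring.one_in[OF chart_funs_ring]])
    then have "{J :: 'k ac_ideal. J \<in> hilb_chart n B \<and> (1 :: 'k alg_closure) \<noteq> 0} \<subseteq> topspace (hilb_space n)" by (rule openin_subset)
    ultimately show "J \<in> topspace (hilb_space n)" by (rule subsetD[rotated])
  qed
qed

lemma hilb_chart_exists:
  assumes "J \<in> hilb_points n"
  shows "\<exists>B. J \<in> hilb_chart n B"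
  using hf_basis_exists[OF hilb_pointsD(3)[OF assms], of n] assms by (auto simp: hilb_chart_def)

section \<open>The upper bound\<close>

lemma fun_ring_comp: "fun_ring A \<Longrightarrow> fun_ring {\<lambda>J. G (e J) | G. G \<in> A}"
proof -
  assume "fun_ring A"
  then interpret fun_ring A .
  show ?thesis
  proof
    show "(\<lambda>_. 0) \<in> {\<lambda>J. G (e J) | G. G \<in> A}" by (intro CollectI exI[of _ "\<lambda>_. 0"]) simp
    show "(\<lambda>_. 1) \<in> {\<lambda>J. G (e J) | G. G \<in> A}" by (intro CollectI exI[of _ "\<lambda>_. 1"]) simp
  next
    fix f g assume "f \<in> {\<lambda>J. G (e J) | G. G \<in> A}" "g \<in> {\<lambda>J. G (e J) | G. G \<in> A}"
    then obtain f' g' where fg: "f = (\<lambda>J. f' (e J))" "f' \<in> A" "g = (\<lambda>J. g' (e J))" "g' \<in> A" by blast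
    show "(\<lambda>J. f J + g J) \<in> {\<lambda>J. G (e J) | G. G \<in> A}"
      unfolding fg by (intro CollectI exI[of _ "\<lambda>x. f' x + g' x"] conjI add_in fg refl)
    show "(\<lambda>J. f J * g J) \<in> {\<lambda>J. G (e J) | G. G \<in> A}"
      unfolding fg by (intro CollectI exI[of _ "\<lambda>x. f' x * g' x"] conjI mult_in fg refl)
  next
    fix f assume "f \<in> {\<lambda>J. G (e J) | G. G \<in> A}"
    then obtain f' where fg: "f = (\<lambda>J. f' (e J))" "f' \<in> A" by blast
    show "(\<lambda>J. - f J) \<in> {\<lambda>J. G (e J) | G. G \<in> A}"
      unfolding fg by (intro CollectI exI[of _ "\<lambda>x. - f' x"] conjI uminus_in fg refl)
  qed
qed

text \<open>Homogenising with powers of \<open>lin a\<close> turns monomials in \<open>u, v\<close> into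
  forms of one large degree.\<close>

lemma colength_bound:
  fixes J :: "(3, 'k::field) mpoly set"
  assumes J: "is_ideal J" and hf: "\<forall>\<^sub>F i in sequentially. hilbert_function J i = n"
    and S: "finite S" "\<And>c x. polycomb c S \<in> psi a ` J \<Longrightarrow> x \<in> S \<Longrightarrow> c x = (0 :: 'k)"
  shows "card S \<le> n"
proof -
  interpret psi: rhom "psi a" by (rule psi_hom)
  obtain N0 where N0: "\<And>i. i \<ge> N0 \<Longrightarrow> hilbert_function J i = n" using hf by (auto simp: eventually_sequentially)
  define N where "N = N0 + (\<Sum>(s, l)\<in>S. s + l)"
  have le: "s + l \<le> N" if "(s, l) \<in> S" for s l
    using member_le_sum[OF that, of "\<lambda>(s, l). s + l"] S(1) by (simp add: N_def)
  let ?u = "\<lambda>(s, l). pvar 1 ^ s * pvar 2 ^ l * lin a ^ (N - s - l)"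
  have "card S \<le> hilbert_function J N"
  proof (rule hf_ge[OF J S(1), of ?u])
    show "?u x \<in> forms N" if "x \<in> S" for x
      using that by (cases x) (simp only: prod.case psi_form_yz(1)[OF le])
    fix c x assume c: "(\<Sum>x\<in>S. scale (c x) (?u x)) \<in> J" and x: "x \<in> S"
    have "psi a (\<Sum>x\<in>S. scale (c x) (?u x)) = polycomb c S"
      unfolding psi.hom_sum
    proof (intro sum.cong refl)
      fix x assume "x \<in> S"
      then show "psi a (scale (c x) (?u x)) = (case x of (s, l) \<Rightarrow> const2 (c (s, l)) * mon2 s l)"
        by (cases x) (simp only: psi_scale prod.case psi_form_yz(2)[OF le])
    qed
    then have "polycomb c S \<in> psi a ` J" using c by (rule image_eqI[OF sym])
    then show "c x = 0" by (rule S(2)[where c = c, OF _ x])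
  qed
  then show ?thesis using N0[of N] by (simp add: N_def)
qed

definition hilb_cell :: "nat \<Rightarrow> 'k::field \<Rightarrow> (nat \<Rightarrow> nat) \<Rightarrow> (cell_index \<Rightarrow> 'k) \<Rightarrow> (3, 'k) mpoly set \<Rightarrow> bool" where
  "hilb_cell n a \<beta> p J \<longleftrightarrow> (\<forall>f. lin a * f \<in> J \<longrightarrow> f \<in> J) \<and> cell_shape n \<beta> \<and> (\<Sum>l<n. \<beta> l) \<le> n \<and>
     cell n \<beta> p (psi a ` J) \<and> (\<forall>x. x \<notin> cell_indices n \<beta> \<longrightarrow> p x = 0)"

lemma hilb_cell_exists:
  assumes J: "J \<in> hilb_points n" and A: "finite A" "2 * n < card A"
  shows "\<exists>a\<in>A. \<exists>\<beta> p. hilb_cell n a \<beta> p J"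
proof -
  have "\<forall>\<^sub>F i in sequentially. hilbert_function J i \<le> n"
    using hilb_pointsD(4)[OF J] by (rule eventually_mono) simp
  then obtain a where a: "a \<in> A" "\<forall>f. lin a * f \<in> J \<longrightarrow> f \<in> J"
    using exists_nonzerodivisor[OF hilb_pointsD(1,2)[OF J] _ A] by blast
  have "\<exists>\<beta> p. cell_shape n \<beta> \<and> (\<Sum>l<n. \<beta> l) \<le> n \<and> cell n \<beta> p (psi a ` J) \<and> (\<forall>x. x \<notin> cell_indices n \<beta> \<longrightarrow> p x = 0)"
    using colength_bound[OF hilb_pointsD(3,4)[OF J], of _ a]
    by (rule cell_exists[OF psi_ideal[OF hilb_pointsD(3)[OF J]]])
  then show ?thesis using a unfolding hilb_cell_def by blast
qed

text \<open>A form lies in the ideal iff all coefficients of its normal form vanish, and these are linear in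
  the form, with coefficients in \<open>A\<close>.\<close>

lemma hilb_cell_chart_family:
  fixes p :: "'e \<Rightarrow> 'k::field params" and J :: "'e \<Rightarrow> 'k ac_ideal"
  assumes A: "fun_ring A" and const_in: "\<And>c. (\<lambda>_. c) \<in> A" and p: "\<And>x. (\<lambda>e. p e x) \<in> A"
    and \<beta>: "cell_shape n \<beta>" "(\<Sum>l<n. \<beta> l) \<le> n"
    and E: "\<And>e. e \<in> E \<Longrightarrow> J e \<in> hilb_points n" "\<And>e. e \<in> E \<Longrightarrow> hilbert_function (J e) n = n"
      "\<And>e. e \<in> E \<Longrightarrow> hilb_cell n a \<beta> (p e) (J e)"
  shows "\<exists>w. chart_family A n J E (SIGMA l:{..<n}. {..<\<beta> l}) w"
proof -
  interpret fun_ring A by (rule A)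
  interpret psi: rhom "psi a" by (rule psi_hom)
  let ?P = "\<lambda>m N. (\<forall>l. pfam (N l)) \<and> (\<forall>l e. N l e = 0 \<or> degree (N l e) < \<beta> l) \<and>
    (\<forall>e I. cell n \<beta> (p e) I \<longrightarrow> psi a (monom m) - (\<Sum>l<n. smult (N l e) (cellh \<beta> (p e) l)) \<in> I)"
  have "\<exists>N. ?P m N" for m
  proof -
    have "pfam2 (\<lambda>_. psi a (monom m))"
      by (rule pfam2I[OF pfamI, OF const_in order_refl order_refl])
    note fam = this
    show ?thesis
    proof (rule cell_normal_form[OF \<beta>(1) p fam])
      fix N assume N: "\<And>l. pfam (N l)" "\<And>l e. N l e = 0 \<or> degree (N l e) < \<beta> l"
        "\<And>e I. cell n \<beta> (p e) I \<Longrightarrow> psi a (monom m) - (\<Sum>l<n. smult (N l e) (cellh \<beta> (p e) l)) \<in> I"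
      show ?thesis by (intro exI[of _ N] conjI allI impI N)
    qed
  qed
  then have "\<forall>m. \<exists>N. ?P m N" by (rule allI)
  from choice[OF this] obtain N where N0: "\<forall>m. ?P m (N m)" by (elim exE)
  note N = N0[THEN spec, THEN conjunct1, THEN spec] N0[THEN spec, THEN conjunct2, THEN conjunct1, THEN spec, THEN spec]
    N0[THEN spec, THEN conjunct2, THEN conjunct2, THEN spec, THEN spec, THEN mp]
  show ?thesis
  proof (intro exI[of _ "\<lambda>m e (l, s). coeff (N m l e) s"], unfold_locales)
    show "(\<lambda>_. to_ac b) \<in> A" for b :: 'k by (rule const_in)
    show "finite (SIGMA l:{..<n}. {..<\<beta> l})" by simp
    show "card (SIGMA l:{..<n}. {..<\<beta> l}) \<le> n" using \<beta>(2) by (simp add: card_SigmaI)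
    show "(\<lambda>e. case x of (l, s) \<Rightarrow> coeff (N m l e) s) \<in> A" for m x
      by (cases x) (simp add: pfam_coeff N(1))
  next
    fix e assume e: "e \<in> E"
    show "J e \<in> hilb_points n" "hilbert_function (J e) n = n" using E e by auto
    have nzd: "\<And>f. lin a * f \<in> J e \<Longrightarrow> f \<in> J e" and cl: "cell n \<beta> (p e) (psi a ` J e)"
      using E(3)[OF e] by (simp_all add: hilb_cell_def)
    note I = cellD(1)[OF cl]
    fix c :: "3 exps \<Rightarrow> 'k alg_closure"
    let ?f = "\<Sum>m\<in>deg_exps n. scale (c m) (monom m) :: (3, 'k alg_closure) mpoly"
    define M where "M l = (\<Sum>m\<in>deg_exps n. smult (c m) (N m l e))" for l
    have coeff_M: "coeff (M l) s = (\<Sum>m\<in>deg_exps n. c m * coeff (N m l e) s)" for l s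
      by (simp add: M_def coeff_sum)
    have degM: "M l = 0 \<or> degree (M l) < \<beta> l" for l
    proof (cases "\<beta> l")
      case 0
      then have "N m l e = 0" for m using N(2)[of m l e] by simp
      then show ?thesis by (simp add: M_def)
    next
      case (Suc b)
      have "degree (N m l e) \<le> b" for m using N(2)[of m l e] Suc by auto
      then have "degree (M l) \<le> b" unfolding M_def
        by (intro degree_sum_le finite_mdeg order_trans[OF degree_smult_le]) 
      then show ?thesis using Suc by simp
    qed
    have f: "?f \<in> forms n" by (intro forms_sum forms_scale) auto
    have "?f \<in> J e \<longleftrightarrow> psi a ?f \<in> psi a ` J e" by (rule psi_mem_iff[OF hilb_pointsD(1)[OF E(1)[OF e]] nzd f, symmetric])
    also have "\<dots> \<longleftrightarrow> (\<Sum>l<n. smult (M l) (cellh \<beta> (p e) l)) \<in> psi a ` J e"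
    proof -
      let ?R = "\<Sum>l<n. smult (M l) (cellh \<beta> (p e) l)"
      have "?R = (\<Sum>l<n. \<Sum>m\<in>deg_exps n. smult (smult (c m) (N m l e)) (cellh \<beta> (p e) l))"
        unfolding M_def by (intro sum.cong refl smult_sum)
      also have "\<dots> = (\<Sum>m\<in>deg_exps n. \<Sum>l<n. const2 (c m) * smult (N m l e) (cellh \<beta> (p e) l))"
        by (subst sum.swap) (simp add: const2_def)
      finally have R: "?R = (\<Sum>m\<in>deg_exps n. \<Sum>l<n. const2 (c m) * smult (N m l e) (cellh \<beta> (p e) l))" .
      have "psi a ?f - ?R = (\<Sum>m\<in>deg_exps n. const2 (c m) * (psi a (monom m) - (\<Sum>l<n. smult (N m l e) (cellh \<beta> (p e) l))))"
        unfolding R by (simp add: psi.hom_sum psi_scale right_diff_distrib sum_subtractf sum_distrib_left)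
      also have "\<dots> \<in> psi a ` J e" by (intro ideal_sum[OF I] ideal_mult[OF I] N(3) cl)
      finally have d: "psi a ?f - ?R \<in> psi a ` J e" .
      show ?thesis
      proof
        assume "psi a ?f \<in> psi a ` J e"
        from ideal_diff[OF I this d] show "?R \<in> psi a ` J e" by simp
      next
        assume "?R \<in> psi a ` J e"
        from ideal_add[OF I d this] show "psi a ?f \<in> psi a ` J e" by simp
      qed
    qed
    also have "\<dots> \<longleftrightarrow> (\<forall>l<n. M l = 0)"
    proof
      assume "(\<Sum>l<n. smult (M l) (cellh \<beta> (p e) l)) \<in> psi a ` J e"
      then show "\<forall>l<n. M l = 0" using cellD(3)[OF cl degM] by blast
    qed (simp add: ideal_zero[OF I])
    also have "\<dots> \<longleftrightarrow> (\<forall>l<n. \<forall>s<\<beta> l. coeff (M l) s = 0)"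
    proof (intro iffI allI impI)
      fix l assume l: "\<forall>l<n. \<forall>s<\<beta> l. coeff (M l) s = 0" "l < n"
      show "M l = 0"
      proof (rule ccontr)
        assume "M l \<noteq> 0"
        then have "coeff (M l) (degree (M l)) \<noteq> 0" "degree (M l) < \<beta> l" using degM[of l] by auto
        then show False using l by blast
      qed
    qed simp
    also have "\<dots> \<longleftrightarrow> (\<forall>x\<in>SIGMA l:{..<n}. {..<\<beta> l}. (\<Sum>m\<in>deg_exps n. c m * (case x of (l, s) \<Rightarrow> coeff (N m l e) s)) = 0)"
      by (auto simp: coeff_M)
    finally show "?f \<in> J e \<longleftrightarrow> (\<forall>x\<in>SIGMA l:{..<n}. {..<\<beta> l}. (\<Sum>m\<in>deg_exps n. c m * (case x of (l, s) \<Rightarrow> coeff (N m l e) s)) = 0)" .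
  qed
qed

lemma infinite_UNIV_alg_closed: "infinite (UNIV :: 'a::alg_closed_field set)"
proof
  assume fin: "finite (UNIV :: 'a set)"
  let ?P = "\<Prod>a\<in>UNIV. [:- a, 1:] :: 'a poly"
  have "degree ?P = (\<Sum>a\<in>(UNIV :: 'a set). degree [:- a, 1:])" by (rule degree_prod_eq_sum_degree) simp
  then have "degree ?P > 0" using fin by (simp add: card_gt_0_iff)
  then have "degree (?P + 1) > 0" by (subst degree_add_eq_left) simp_all
  then obtain x where "poly (?P + 1) x = 0" using alg_closed_imp_poly_has_root by blast
  moreover have "poly ?P x = 0" using fin by (simp add: poly_prod) 
  ultimately show False by simp
qed

lemma num_points_eqI: "(\<And>N. n \<le> N \<Longrightarrow> H N = n) \<Longrightarrow> num_points H = n"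
  unfolding num_points_def
proof (rule the_equality)
  assume H: "\<And>N. n \<le> N \<Longrightarrow> H N = n"
  then show "\<forall>\<^sub>F i in sequentially. H i = n" by (auto simp: eventually_sequentially)
  fix m assume "\<forall>\<^sub>F i in sequentially. H i = m"
  then obtain M where "\<And>i. i \<ge> M \<Longrightarrow> H i = m" by (auto simp: eventually_sequentially)
  from this[of "max M n"] H[of "max M n"] show "m = n" by simp
qed

lemma krull_chain_start:
  assumes "irreducible_closedin (hilb_stratum H) (C :: 'k::field ac_ideal set)" and n: "num_points H = n"
  shows "\<exists>B. C \<inter> hilb_chart n B \<noteq> {}"
proof -
  obtain J where J: "J \<in> C" using assms(1) by (auto simp: irreducible_closedin_def)
  then have "J \<in> topspace (hilb_stratum H)" using irreducible_closedD(3)[OF assms(1)] by auto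
  then have "J \<in> hilb_points n" by (simp add: hilb_stratum_def topspace_hilb_space n)
  then show ?thesis using hilb_chart_exists[of J n] J by blast
qed

theorem dim_hilb_stratum_le:
  assumes n: "num_points H = n" "H n = n"
  shows "dim_hilb_stratum TYPE('k::field) H \<le> enat (2 * n)"
  unfolding dim_hilb_stratum_def krull_dim_def
proof (rule Sup_least)
  let ?T = "hilb_stratum H :: 'k ac_ideal topology"
  fix x assume "x \<in> {enat k |k C. (\<forall>i\<le>k. irreducible_closedin ?T (C i)) \<and> (\<forall>i<k. C i \<subset> C (Suc i))}"
  then obtain k C where x: "x = enat k" and C: "\<forall>i\<le>k. irreducible_closedin ?T (C i)" "\<forall>i<k. C i \<subset> C (Suc i)"
    by blast
  obtain B where B: "C 0 \<inter> hilb_chart n B \<noteq> {}"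
    using krull_chain_start[OF C(1)[rule_format, OF le0] n(1)] by blast
  let ?U = "hilb_chart n B :: 'k ac_ideal set"
  let ?Fs = "chart_funs n B :: ('k ac_ideal \<Rightarrow> 'k alg_closure) set"
  have top: "topspace ?T = {J \<in> hilb_points n. hilbert_function J = H}"
    by (auto simp: hilb_stratum_def topspace_hilb_space n)
  then have topU: "topspace ?T \<inter> ?U = {J \<in> ?U. hilbert_function J = H}"
    by (auto simp: hilb_chart_def)
  obtain A :: "'k alg_closure set" where A: "finite A" "card A = Suc (2 * n)"
    using infinite_arbitrarily_large[OF infinite_UNIV_alg_closed] by blast
  \<comment> \<open>The pieces: a cell and one of the \<open>2 n + 1\<close> linear forms. As the
    \<open>\<beta>\<^sub>l\<close> sum up to at most \<open>n\<close>, the sequences \<open>\<beta>\<close> with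
    entries up to \<open>n\<close> suffice.\<close>
  define \<Phi> where "\<Phi> = A \<times> {\<beta> :: nat \<Rightarrow> nat. \<forall>l. (l \<in> {..<n} \<longrightarrow> \<beta> l \<in> {..n}) \<and> (l \<notin> {..<n} \<longrightarrow> \<beta> l = 0)}"
  define P where "P = (\<lambda>(a, \<beta>). {J :: 'k ac_ideal. \<exists>p. hilb_cell n a \<beta> p J})"
  have "k \<le> 2 * n"
  proof (rule krull_chain_bound[where T = ?T and U = ?U and Fs = ?Fs and P = P and \<Phi> = \<Phi> and C = C])
    show "fun_ring ?Fs" by (rule chart_funs_ring)
    show "(\<lambda>_. to_ac c) \<in> ?Fs" for c by (rule chart_funs_const)
    fix g assume g: "g \<in> ?Fs"
    have "openin (hilb_space n) {J \<in> ?U. g J \<noteq> 0}" by (rule hilb_basic_open[OF g])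
    then have "openin ?T ({J \<in> ?U. g J \<noteq> 0} \<inter> {J. hilbert_function J = H})"
      unfolding hilb_stratum_def n by (rule openin_subtopology_Int)
    moreover have "{J \<in> ?U. g J \<noteq> 0} \<inter> {J. hilbert_function J = H} = {x \<in> topspace ?T \<inter> ?U. g x \<noteq> 0}"
      unfolding topU by auto
    ultimately show "openin ?T {x \<in> topspace ?T \<inter> ?U. g x \<noteq> 0}" by simp
  next
    fix W J assume W: "openin ?T W" and J: "J \<in> W" "J \<in> ?U"
    obtain W' where W': "openin (hilb_space n) W'" "W = W' \<inter> {J. hilbert_function J = H}"
      using W unfolding hilb_stratum_def n openin_subtopology by auto
    have "hilbert_function J n = n" using J W' n by auto
    then obtain g where g: "g \<in> ?Fs" "g J \<noteq> 0" "{J' \<in> ?U. hilbert_function J' n = n \<and> g J' \<noteq> 0} \<subseteq> W'"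
      using hilb_open_basis[OF W'(1) _ J(2)] J(1) W'(2) by auto
    then show "\<exists>g\<in>?Fs. g J \<noteq> 0 \<and> {y \<in> topspace ?T \<inter> ?U. g y \<noteq> 0} \<subseteq> W"
      unfolding topU W'(2) using n(2) by (intro bexI[of _ g]) auto
  next
    show "irreducible_closedin ?T (C i)" if "i \<le> k" for i using C that by blast
    show "C i \<subset> C (Suc i)" if "i < k" for i using C that by blast
    show "C 0 \<inter> ?U \<noteq> {}" by (rule B)
    show "finite \<Phi>" unfolding \<Phi>_def using A(1) by (intro finite_cartesian_product finite_set_of_finite_funs) auto
    show "topspace ?T \<inter> ?U \<subseteq> (\<Union>\<phi>\<in>\<Phi>. P \<phi>)"
    proof
      fix J assume "J \<in> topspace ?T \<inter> ?U"
      then have "J \<in> hilb_points n" using top by auto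
      then obtain a \<beta> p where ap: "a \<in> A" "hilb_cell n a \<beta> p J"
        using hilb_cell_exists[of J n A] A by auto
      have "\<beta> l \<le> n" if "l < n" for l
      proof -
        have "\<beta> l \<le> (\<Sum>l<n. \<beta> l)" using that by (intro member_le_sum) auto
        then show ?thesis using ap(2) by (simp add: hilb_cell_def)
      qed
      then have "(a, \<beta>) \<in> \<Phi>" using ap by (auto simp: \<Phi>_def hilb_cell_def cell_shape_def)
      then show "J \<in> (\<Union>\<phi>\<in>\<Phi>. P \<phi>)" using ap(2) by (intro UN_I[of "(a, \<beta>)"]) (auto simp: P_def)
    qed
  next
    fix \<phi> assume "\<phi> \<in> \<Phi>"
    obtain a \<beta> where \<phi>: "\<phi> = (a, \<beta>)" by fastforce
    let ?E = "P \<phi> \<inter> (topspace ?T \<inter> ?U)"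
    define e where "e J = (if J \<in> ?E then SOME p. hilb_cell n a \<beta> p J else (\<lambda>_. 0))" for J
    have e: "hilb_cell n a \<beta> (e J) J" if "J \<in> ?E" for J
    proof -
      have "\<exists>p. hilb_cell n a \<beta> p J" using that by (simp add: P_def \<phi>)
      from someI_ex[OF this] show ?thesis using that by (simp add: e_def)
    qed
    show "\<exists>(e :: 'k ac_ideal \<Rightarrow> 'k params) D V. finite V \<and> card V \<le> 2 * n \<and>
      (\<forall>y i. i \<notin> V \<longrightarrow> e y i = 0) \<and> D \<in> polyfun \<and> (\<forall>y\<in>?E. D (e y) \<noteq> 0) \<and>
      (\<forall>g\<in>?Fs. \<exists>N\<in>polyfun. \<exists>j. \<forall>y\<in>?E. g y * D (e y) ^ j = N (e y))"
    proof (cases "?E = {}")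
      case True
      show ?thesis
        by (rule exI[of _ "\<lambda>_ _. 0"], rule exI[of _ "\<lambda>_. 1"], rule exI[of _ "{}"], simp only: True)
          (auto intro: polyfun.const)
    next
      case False
      then obtain J0 where "J0 \<in> ?E" by blast
      note c0 = e[OF this]
      have \<beta>: "cell_shape n \<beta>" "(\<Sum>l<n. \<beta> l) \<le> n" using c0 by (simp_all add: hilb_cell_def)
      have "\<beta> 0 \<le> n"
      proof (cases "n = 0")
        case False
        then have "\<beta> 0 \<le> (\<Sum>l<n. \<beta> l)" by (intro member_le_sum) auto
        then show ?thesis using \<beta> by simp
      qed (use \<beta> in \<open>simp add: cell_shape_def\<close>)
      then have card: "card (cell_indices n \<beta>) \<le> 2 * n" using \<beta> by (simp add: card_cell_indices)
      let ?A = "{\<lambda>J. G (e J) | G. G \<in> polyfun}"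
      have mem: "(\<lambda>J. G (e J)) \<in> ?A" if "G \<in> polyfun" for G using that by blast
      have "\<exists>w. chart_family ?A n (\<lambda>J. J) ?E (SIGMA l:{..<n}. {..<\<beta> l}) w"
      proof (rule hilb_cell_chart_family[where p = e and a = a and \<beta> = \<beta> and J = "\<lambda>J. J"])
        show "fun_ring ?A" by (rule fun_ring_comp[OF fun_ring_polyfun])
        show "(\<lambda>_. c) \<in> ?A" for c by (rule mem[OF polyfun.const])
        show "(\<lambda>J. e J x) \<in> ?A" for x by (rule mem[OF polyfun.var])
        show "cell_shape n \<beta>" "(\<Sum>l<n. \<beta> l) \<le> n" by (fact \<beta>)+
        fix J assume J: "J \<in> ?E"
        show "hilb_cell n a \<beta> (e J) J" by (rule e[OF J])
        show "J \<in> hilb_points n" "hilbert_function J n = n" using J top n by auto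
      qed
      then obtain w where "chart_family ?A n (\<lambda>J. J) ?E (SIGMA l:{..<n}. {..<\<beta> l}) w" by (elim exE)
      from chart_family.chart_functions[OF this, of B]
      obtain D' where D': "D' \<in> ?A" "\<forall>J\<in>?E. J \<in> hilb_chart n B \<longleftrightarrow> D' J \<noteq> 0"
        "\<forall>f :: (3 exps \<times> 3 exps, 'k) mpoly. \<exists>k. \<exists>N\<in>?A. \<forall>J\<in>?E. D' J \<noteq> 0 \<longrightarrow> eval_over f (chart_coord n B J) * D' J ^ k = N J"
        by (elim bexE conjE)
      obtain D where D: "D' = (\<lambda>J. D (e J))" "D \<in> polyfun" using D'(1) by blast
      have D0: "\<forall>J\<in>?E. D (e J) \<noteq> 0" using D'(2) D(1) by auto
      show ?thesis
      proof (rule exI[of _ e], rule exI[of _ D], rule exI[of _ "cell_indices n \<beta>"], intro conjI finite_cell_indices card D(2) D0 allI impI ballI)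
        show "e y i = 0" if "i \<notin> cell_indices n \<beta>" for y i
        proof (cases "y \<in> ?E")
          case True
          have "hilb_cell n a \<beta> (e y) y" using True by (rule e)
          then show ?thesis using that unfolding hilb_cell_def by blast
        next
          case False
          then show ?thesis unfolding e_def by (simp only: if_False)
        qed
        fix g assume "g \<in> ?Fs"
        then obtain f where f: "g = (\<lambda>J. eval_over f (chart_coord n B J))" unfolding chart_funs_def by (elim imageE)
        obtain j N' where N': "N' \<in> ?A" "\<forall>J\<in>?E. D' J \<noteq> 0 \<longrightarrow> eval_over f (chart_coord n B J) * D' J ^ j = N' J"
          using D'(3)[rule_format, of f] by (elim exE bexE)
        obtain N where N: "N' = (\<lambda>J. N (e J))" "N \<in> polyfun" using N'(1) by blast
        show "\<exists>N\<in>polyfun. \<exists>j. \<forall>y\<in>?E. g y * D (e y) ^ j = N (e y)"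
          by (rule bexI[OF _ N(2)], rule exI[of _ j]) (use N'(2) D0 in \<open>simp add: f D(1) N(1)\<close>)
      qed
    qed
  qed
  then show "x \<le> enat (2 * n)" using x by simp
qed

section \<open>The ideal with given cell coordinates\<close>

definition cell_ideal :: "nat \<Rightarrow> (nat \<Rightarrow> nat) \<Rightarrow> (cell_index \<Rightarrow> 'k::field) \<Rightarrow> 'k poly poly set" where
  "cell_ideal n \<beta> p = {\<Sum>l\<le>D. smult (cell_Q n \<beta> p l * M l) (cellh \<beta> p l) | D M. True}"

lemma cell_ideal_sumI:
  assumes "\<And>l. l \<le> D \<Longrightarrow> cell_Q n \<beta> p l dvd G l"
  shows "(\<Sum>l\<le>D. smult (G l) (cellh \<beta> p l)) \<in> cell_ideal n \<beta> p"
proof -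
  have "(\<Sum>l\<le>D. smult (G l) (cellh \<beta> p l)) = (\<Sum>l\<le>D. smult (cell_Q n \<beta> p l * (G l div cell_Q n \<beta> p l)) (cellh \<beta> p l))"
    using assms by (intro sum.cong refl) simp
  then show ?thesis unfolding cell_ideal_def by (intro CollectI exI conjI TrueI)
qed

lemma cell_ideal_smult_h:
  assumes "cell_Q n \<beta> p l dvd c"
  shows "smult c (cellh \<beta> p l) \<in> cell_ideal n \<beta> p"
proof -
  have "(\<Sum>j\<le>l. smult (if j = l then c else 0) (cellh \<beta> p j)) \<in> cell_ideal n \<beta> p"
    using assms by (intro cell_ideal_sumI) auto
  moreover have "(\<Sum>j\<le>l. smult (if j = l then c else 0) (cellh \<beta> p j)) = (\<Sum>j\<le>l. if j = l then smult c (cellh \<beta> p j) else 0)"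
    by (intro sum.cong refl) auto
  ultimately show ?thesis by (simp add: sum.delta)
qed

lemma cell_ideal_add:
  assumes "F \<in> cell_ideal n \<beta> p" "G \<in> cell_ideal n \<beta> p"
  shows "F + G \<in> cell_ideal n \<beta> p"
proof -
  obtain D M D' M' where F: "F = (\<Sum>l\<le>D. smult (cell_Q n \<beta> p l * M l) (cellh \<beta> p l))"
    and G: "G = (\<Sum>l\<le>D'. smult (cell_Q n \<beta> p l * M' l) (cellh \<beta> p l))"
    using assms unfolding cell_ideal_def by blast
  let ?E = "max D D'"
  have F': "F = (\<Sum>l\<le>?E. smult (cell_Q n \<beta> p l * (if l \<le> D then M l else 0)) (cellh \<beta> p l))"
    unfolding F by (rule sum.mono_neutral_cong_left) auto
  have G': "G = (\<Sum>l\<le>?E. smult (cell_Q n \<beta> p l * (if l \<le> D' then M' l else 0)) (cellh \<beta> p l))"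
    unfolding G by (rule sum.mono_neutral_cong_left) auto
  have "F + G = (\<Sum>l\<le>?E. smult (cell_Q n \<beta> p l * ((if l \<le> D then M l else 0) + (if l \<le> D' then M' l else 0))) (cellh \<beta> p l))"
    unfolding F' G' by (simp only: sum.distrib[symmetric] smult_add_left distrib_left)
  also have "\<dots> \<in> cell_ideal n \<beta> p" by (rule cell_ideal_sumI) simp
  finally show ?thesis .
qed

lemma cell_ideal_sum: "(\<And>i. i \<in> S \<Longrightarrow> F i \<in> cell_ideal n \<beta> p) \<Longrightarrow> (\<Sum>i\<in>S. F i) \<in> cell_ideal n \<beta> p"
proof (induction S rule: infinite_finite_induct)
  case (insert x S)
  then show ?case by (simp add: cell_ideal_add)
qed (use cell_ideal_smult_h[of n \<beta> p 0 0] in simp_all)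

lemma cell_Q_Suc: "l < n \<Longrightarrow> cell_Q n \<beta> p l = cell_q \<beta> p l * cell_Q n \<beta> p (Suc l)"
  by (simp add: cell_Q_def prod.atLeast_Suc_lessThan)

lemma cell_Q_Suc_dvd: "cell_Q n \<beta> p (Suc l) dvd cell_Q n \<beta> p l"
  by (cases "l < n") (simp_all add: cell_Q_Suc cell_Q_ge)

lemma cell_Q_dvd_prod: "i \<le> l \<Longrightarrow> cell_Q n \<beta> p i dvd (\<Prod>j\<in>{i..<l}. cell_q \<beta> p j) * cell_Q n \<beta> p l"
proof (cases "l \<le> n")
  case False
  assume "i \<le> l"
  have "{i..<l} = {i..<n} \<union> {max i n..<l}" using False \<open>i \<le> l\<close> by auto
  then have "(\<Prod>j\<in>{i..<l}. cell_q \<beta> p j) = (\<Prod>j\<in>{i..<n}. cell_q \<beta> p j) * (\<Prod>j\<in>{max i n..<l}. cell_q \<beta> p j)"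
    by (simp add: prod.union_disjoint)
  then show ?thesis by (simp add: cell_Q_def mult.assoc)
qed (use cell_Q_split[of i l n \<beta> p] in simp)

lemma cellh_v_mult: "[:0, 1:] * cellh \<beta> p l = cellh \<beta> p (Suc l) +
    (\<Sum>i\<in>{..l}. smult (cell_a \<beta> p l i * (\<Prod>j\<in>{i..<l}. cell_q \<beta> p j)) (cellh \<beta> p i))"
  by (simp add: cell_h.simps(2))

text \<open>The products \<open>q\<^sub>i \<cdots> q\<^sub>l\<^sub>-\<^sub>1\<close> in the recursion for
  \<open>h\<^sub>l\<^sub>+\<^sub>1\<close> turn \<open>Q\<^sub>l\<close> into multiples of
  \<open>Q\<^sub>i\<close>.\<close>

lemma cell_ideal_v_mult:
  assumes "F \<in> cell_ideal n \<beta> p"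
  shows "[:0, 1:] * F \<in> cell_ideal n \<beta> p"
proof -
  obtain D M where F: "F = (\<Sum>l\<le>D. smult (cell_Q n \<beta> p l * M l) (cellh \<beta> p l))"
    using assms unfolding cell_ideal_def by blast
  have "[:0, 1:] * F = (\<Sum>l\<le>D. smult (cell_Q n \<beta> p l * M l) ([:0, 1:] * cellh \<beta> p l))"
    unfolding F sum_distrib_left by (intro sum.cong refl) (rule mult_smult_right)
  also have "\<dots> \<in> cell_ideal n \<beta> p"
  proof (rule cell_ideal_sum)
    fix l
    have "smult (cell_Q n \<beta> p l * M l) ([:0, 1:] * cellh \<beta> p l) = smult (cell_Q n \<beta> p l * M l) (cellh \<beta> p (Suc l)) +
      (\<Sum>i\<in>{..l}. smult ((cell_Q n \<beta> p l * M l) * (cell_a \<beta> p l i * (\<Prod>j\<in>{i..<l}. cell_q \<beta> p j))) (cellh \<beta> p i))"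
      by (simp only: cellh_v_mult smult_add_right smult_sum_right' smult_smult)
    moreover have "smult (cell_Q n \<beta> p l * M l) (cellh \<beta> p (Suc l)) \<in> cell_ideal n \<beta> p"
      by (intro cell_ideal_smult_h dvd_mult2 cell_Q_Suc_dvd)
    moreover have "cell_Q n \<beta> p i dvd (cell_Q n \<beta> p l * M l) * (cell_a \<beta> p l i * (\<Prod>j\<in>{i..<l}. cell_q \<beta> p j))" if "i \<le> l" for i
    proof -
      have "(cell_Q n \<beta> p l * M l) * (cell_a \<beta> p l i * (\<Prod>j\<in>{i..<l}. cell_q \<beta> p j))
          = ((\<Prod>j\<in>{i..<l}. cell_q \<beta> p j) * cell_Q n \<beta> p l) * (M l * cell_a \<beta> p l i)"
        by (simp only: mult.assoc mult.commute mult.left_commute)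
      then show ?thesis by (simp only: dvd_mult2 cell_Q_dvd_prod[OF that])
    qed
    ultimately show "smult (cell_Q n \<beta> p l * M l) ([:0, 1:] * cellh \<beta> p l) \<in> cell_ideal n \<beta> p"
      by (auto intro!: cell_ideal_add cell_ideal_sum cell_ideal_smult_h)
  qed
  finally show ?thesis .
qed

lemma cell_ideal_smult: "F \<in> cell_ideal n \<beta> p \<Longrightarrow> smult c F \<in> cell_ideal n \<beta> p"
proof -
  assume "F \<in> cell_ideal n \<beta> p"
  then obtain D M where F: "F = (\<Sum>l\<le>D. smult (cell_Q n \<beta> p l * M l) (cellh \<beta> p l))"
    unfolding cell_ideal_def by blast
  have "smult c F = (\<Sum>l\<le>D. smult (c * (cell_Q n \<beta> p l * M l)) (cellh \<beta> p l))"
    by (simp only: F smult_sum_right' smult_smult)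
  then show ?thesis using cell_ideal_sumI[of D n \<beta> p "\<lambda>l. c * (cell_Q n \<beta> p l * M l)"] by simp
qed

lemma cell_ideal_is_ideal: "is_ideal (cell_ideal n \<beta> p)"
proof (rule is_idealI)
  show "0 \<in> cell_ideal n \<beta> p" using cell_ideal_smult_h[of n \<beta> p 0 0] by simp
  show "F + G \<in> cell_ideal n \<beta> p" if "F \<in> cell_ideal n \<beta> p" "G \<in> cell_ideal n \<beta> p" for F G
    using that by (rule cell_ideal_add)
  fix F G assume F: "F \<in> cell_ideal n \<beta> p"
  show "G * F \<in> cell_ideal n \<beta> p"
  proof (induction G)
    case 0
    show ?case using \<open>0 \<in> cell_ideal n \<beta> p\<close> by simp
  next
    case (pCons c G)
    have "pCons c G * F = smult c F + [:0, 1:] * (G * F)" by simp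
    then show ?case using pCons.IH by (simp only: cell_ideal_add cell_ideal_smult[OF F] cell_ideal_v_mult)
  qed
qed

lemma cell_ideal_expand_dvd:
  assumes "(\<Sum>l\<le>D. smult (G l) (cellh \<beta> p l)) \<in> cell_ideal n \<beta> p" "l \<le> D"
  shows "cell_Q n \<beta> p l dvd G l"
proof -
  obtain D' M where "(\<Sum>l\<le>D. smult (G l) (cellh \<beta> p l)) = (\<Sum>l\<le>D'. smult (cell_Q n \<beta> p l * M l) (cellh \<beta> p l))"
    using assms(1) unfolding cell_ideal_def by blast
  moreover let ?E = "Suc (max D D')"
  have "(\<Sum>l\<le>D. smult (G l) (cellh \<beta> p l)) = (\<Sum>l<?E. smult (if l \<le> D then G l else 0) (cellh \<beta> p l))"
    by (rule sum.mono_neutral_cong_left) auto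
  moreover have "(\<Sum>l\<le>D'. smult (cell_Q n \<beta> p l * M l) (cellh \<beta> p l)) = (\<Sum>l<?E. smult (cell_Q n \<beta> p l * (if l \<le> D' then M l else 0)) (cellh \<beta> p l))"
    by (rule sum.mono_neutral_cong_left) auto
  ultimately have "(\<Sum>l<?E. smult ((if l \<le> D then G l else 0) - cell_Q n \<beta> p l * (if l \<le> D' then M l else 0)) (cellh \<beta> p l)) = 0"
    by (simp only: smult_diff_left sum_subtractf) simp
  from expand_monic_unique[where H = "cellh \<beta> p", OF _ _ this, of l]
  have "(if l \<le> D then G l else 0) - cell_Q n \<beta> p l * (if l \<le> D' then M l else 0) = 0" using assms(2) by simp
  then have "G l = cell_Q n \<beta> p l * (if l \<le> D' then M l else 0)" using assms(2) by (simp only: if_True right_minus_eq)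
  then show ?thesis by (rule dvdI)
qed

text \<open>The coefficient of \<open>v\<^sup>D\<close> is that of \<open>h\<^sub>D\<close> in the unique
  expansion along the \<open>h\<^sub>l\<close>.\<close>

lemma cell_ideal_coeff_dvd:
  assumes F: "F \<in> cell_ideal n \<beta> p" and D: "degree F \<le> D"
  shows "cell_Q n \<beta> p D dvd coeff F D"
proof -
  have lc: "lead_coeff (cellh \<beta> p l) = 1" "degree (cellh \<beta> p l) = l" for l by simp_all
  obtain G where G: "F = (\<Sum>l\<le>D. smult (G l) (cellh \<beta> p l))"
    using expand_monic[where H = "cellh \<beta> p", OF lc D] by blast
  have "coeff F D = (\<Sum>l\<le>D. if l = D then G l else 0)"
    unfolding G coeff_sum
  proof (intro sum.cong refl)
    fix l assume "l \<in> {..D}"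
    then show "coeff (smult (G l) (cellh \<beta> p l)) D = (if l = D then G l else 0)"
      by (cases "l = D") (simp_all add: coeff_eq_0)
  qed
  then have "coeff F D = G D" by (simp add: sum.delta)
  then show ?thesis using cell_ideal_expand_dvd[where D = D and G = G and \<beta> = \<beta> and p = p and n = n and l = D] F G by simp
qed

lemma cell_cell_ideal:
  assumes sh: "cell_shape n \<beta>"
  shows "cell n \<beta> p (cell_ideal n \<beta> p)"
  unfolding cell_def
proof (intro conjI allI impI cell_ideal_is_ideal cell_ideal_smult_h dvd_refl)
  fix N l assume N: "\<forall>l. N l = 0 \<or> degree (N l) < \<beta> l"
    and in_I: "(\<Sum>l<n. smult (N l) (cellh \<beta> p l)) \<in> cell_ideal n \<beta> p" and l: "l < n"
  have "{..<n} = {..n-1}" using l by auto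
  then have "cell_Q n \<beta> p l dvd N l"
    using cell_ideal_expand_dvd[where D = "n - 1" and G = N and \<beta> = \<beta> and p = p and n = n and l = l] in_I l by simp
  moreover have "degree (cell_Q n \<beta> p l) = \<beta> l" using cell_Q_monic[OF sh, of p l] by simp
  ultimately show "N l = 0" using N dvd_imp_degree_le[of "cell_Q n \<beta> p l" "N l"] by fastforce
qed

subsection \<open>Total degrees\<close>

text \<open>Total degree at most \<open>N\<close> in both variables.\<close>

definition td :: "nat \<Rightarrow> 'k::field poly poly \<Rightarrow> bool" where
  "td N F \<longleftrightarrow> (\<forall>l. coeff F l = 0 \<or> degree (coeff F l) + l \<le> N)"

lemma td_coeff: "td N F \<longleftrightarrow> (\<forall>l s. N < s + l \<longrightarrow> coeff (coeff F l) s = 0)"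
proof
  assume *: "\<forall>l s. N < s + l \<longrightarrow> coeff (coeff F l) s = 0"
  show "td N F" unfolding td_def
  proof (rule allI, rule ccontr)
    fix l assume c: "\<not> (coeff F l = 0 \<or> degree (coeff F l) + l \<le> N)"
    then have "coeff (coeff F l) (degree (coeff F l)) = 0" using * by simp
    then show False using c by simp
  qed
next
  assume td: "td N F"
  show "\<forall>l s. N < s + l \<longrightarrow> coeff (coeff F l) s = 0"
  proof (intro allI impI)
    fix l s assume "N < s + l"
    then show "coeff (coeff F l) s = 0" using td[unfolded td_def, rule_format, of l] by (auto intro: coeff_eq_0)
  qed
qed

lemma td_0 [simp]: "td N 0" by (simp add: td_def)
lemma td_add: "td N F \<Longrightarrow> td N G \<Longrightarrow> td N (F + G)" by (simp add: td_coeff)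
lemma td_diff: "td N F \<Longrightarrow> td N G \<Longrightarrow> td N (F - G)" by (simp add: td_coeff)
lemma td_sum: "(\<And>i. i \<in> S \<Longrightarrow> td N (F i)) \<Longrightarrow> td N (\<Sum>i\<in>S. F i)"
  by (induction S rule: infinite_finite_induct) (auto intro: td_add)
lemma td_smult: 
  assumes "td N F" "c = 0 \<or> degree c + N \<le> N'"
  shows "td N' (smult c F)"
proof (cases "c = 0")
  case False
  show ?thesis unfolding td_def
  proof
    fix l
    show "coeff (smult c F) l = 0 \<or> degree (coeff (smult c F) l) + l \<le> N'"
      using assms False degree_mult_eq[of c "coeff F l"] unfolding td_def by (cases "coeff F l = 0") fastforce+
  qed
qed simp

lemma td_v_mult: "td N F \<Longrightarrow> td (Suc N) ([:0, 1:] * F)"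
  unfolding td_def
proof
  fix l assume *: "\<forall>l. coeff F l = 0 \<or> degree (coeff F l) + l \<le> N"
  show "coeff ([:0, 1:] * F) l = 0 \<or> degree (coeff ([:0, 1:] * F) l) + l \<le> Suc N"
    using * by (cases l) (simp_all only: v_mult_coeff, auto)
qed

lemma td_psi0: "f \<in> forms N \<Longrightarrow> td N (psi 0 f)"
  by (simp add: td_coeff coeff_psi0)

lemma td_exists: "\<exists>N. td N F"
proof -
  have "td N G" if "N = degree F + (\<Sum>l\<le>degree F. degree (coeff F l))" "G = F" for N G
    unfolding td_def
  proof
    fix l
    show "coeff G l = 0 \<or> degree (coeff G l) + l \<le> N"
    proof (cases "l \<le> degree F")
      case True
      have "degree (coeff F l) \<le> (\<Sum>l\<le>degree F. degree (coeff F l))" using True by (intro member_le_sum) auto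
      then show ?thesis using True that by simp
    qed (simp add: that coeff_eq_0)
  qed
  then show ?thesis by blast
qed

lemma psi0_form_exists:
  fixes F :: "'k::field poly poly"
  assumes "td N F" shows "\<exists>f\<in>forms N. psi 0 f = F"
proof -
  interpret psi: rhom "psi (0 :: 'k)" by (rule psi_hom)
  let ?g = "\<lambda>l s. if s + l \<le> N then scale (coeff (coeff F l) s) (pvar 1 ^ s * pvar 2 ^ l * lin 0 ^ (N - s - l)) else 0"
  define f where "f = (\<Sum>l\<le>degree F. \<Sum>s\<le>degree (coeff F l). ?g l s)"
  have "?g l s \<in> forms N" for l s
  proof (cases "s + l \<le> N")
    case True
    show ?thesis unfolding if_P[OF True] by (intro forms_scale psi_form_yz(1) True)
  qed simp
  then have "f \<in> forms N" unfolding f_def by (intro forms_sum)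
  moreover have "psi 0 f = F"
  proof -
    have g: "psi 0 (?g l s) = const2 (coeff (coeff F l) s) * mon2 s l" for l s
    proof (cases "s + l \<le> N")
      case True
      then show ?thesis by (simp only: if_True psi_scale psi_form_yz(2))
    next
      case False
      then have "coeff (coeff F l) s = 0" using assms by (simp add: td_coeff)
      then show ?thesis using False by (simp add: const2_def)
    qed
    have "psi 0 f = (\<Sum>l\<le>degree F. \<Sum>s\<le>degree (coeff F l). const2 (coeff (coeff F l) s) * mon2 s l)"
      unfolding f_def by (simp only: psi.hom_sum g)
    then show ?thesis using poly2_expand[of F] by (rule trans[OF _ sym])
  qed
  ultimately show ?thesis by blast
qed

section \<open>The homogeneous ideal with given cell coordinates\<close>

text \<open>The staircase of monomials \<open>u\<^sup>s v\<^sup>l\<close> that form a basis of the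
  quotient.\<close>

definition boxes :: "(nat \<Rightarrow> nat) \<Rightarrow> (nat \<times> nat) set" where
  "boxes \<beta> = {(l, s). s < \<beta> l}"

text \<open>The parameters that do not raise the total degree of \<open>h\<^sub>i\<^sub>+\<^sub>1\<close>
  above \<open>i + 1\<close>: the term with \<open>u\<^sup>s\<close> in \<open>a\<^sub>i\<^sub>l\<close> is
  multiplied by \<open>q\<^sub>l \<cdots> q\<^sub>i\<^sub>-\<^sub>1\<close>, of degree
  \<open>\<beta>\<^sub>l - \<beta>\<^sub>i\<close>, and by \<open>h\<^sub>l\<close>, of degree
  \<open>l\<close>. The coefficients of \<open>q\<^sub>i\<close> never do.\<close>

definition good_indices :: "nat \<Rightarrow> (nat \<Rightarrow> nat) \<Rightarrow> cell_index set" where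
  "good_indices n \<beta> = {(i, l, s) \<in> cell_indices n \<beta>. l = Suc i \<or> s + (\<beta> l - \<beta> i) + l \<le> Suc i}"

text \<open>The homogenisation of \<open>cell_ideal\<close> by the variable 0.\<close>

definition cell_proj :: "nat \<Rightarrow> (nat \<Rightarrow> nat) \<Rightarrow> (cell_index \<Rightarrow> 'k::field) \<Rightarrow> (3, 'k) mpoly set" where
  "cell_proj n \<beta> p = {f. \<forall>d. psi 0 (hom_component d f) \<in> cell_ideal n \<beta> p}"

lemma cell_proj_form: 
  fixes f :: "(3, 'k::field) mpoly"
  assumes f: "f \<in> forms N"
  shows "f \<in> cell_proj n \<beta> p \<longleftrightarrow> psi 0 f \<in> cell_ideal n \<beta> p"
proof -
  interpret psi: rhom "psi (0 :: 'k)" by (rule psi_hom)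
  have "psi 0 (hom_component d f) = (if d = N then psi 0 f else 0)" for d
    using hom_component_forms[OF f, of d] by simp
  then show ?thesis using ideal_zero[OF cell_ideal_is_ideal, of n \<beta> p] by (simp add: cell_proj_def)
qed

lemma cell_proj_homogeneous: "homogeneous_ideal (cell_proj n \<beta> p)"
proof -
  interpret psi: rhom "psi (0 :: 'a)" by (rule psi_hom)
  note I = cell_ideal_is_ideal[of n \<beta> p]
  have "is_ideal (cell_proj n \<beta> p)"
  proof (rule is_idealI)
    show "0 \<in> cell_proj n \<beta> p" by (simp add: cell_proj_def ideal_zero[OF I])
    show "f + g \<in> cell_proj n \<beta> p" if "f \<in> cell_proj n \<beta> p" "g \<in> cell_proj n \<beta> p" for f g
      using that by (simp add: cell_proj_def hom_component_add psi.hom_add ideal_add[OF I])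
    fix f g assume f: "f \<in> cell_proj n \<beta> p"
    show "g * f \<in> cell_proj n \<beta> p"
      unfolding cell_proj_def
    proof (intro CollectI allI)
      fix d
      have "(\<Sum>e\<in>mdeg ` keys g. hom_component e g) = g" by (rule sum_hom_components) auto
      then have "g * f = (\<Sum>e\<in>mdeg ` keys g. hom_component e g * f)"
        by (simp only: sum_distrib_right[symmetric])
      then have "psi 0 (hom_component d (g * f)) = (\<Sum>e\<in>mdeg ` keys g. psi 0 (hom_component d (hom_component e g * f)))"
        by (simp only: hom_component_sum psi.hom_sum)
      also have "\<dots> \<in> cell_ideal n \<beta> p"
      proof (rule ideal_sum[OF I])
        fix e
        show "psi 0 (hom_component d (hom_component e g * f)) \<in> cell_ideal n \<beta> p"
        proof (cases "e \<le> d")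
          case True
          then obtain d' where d: "d = e + d'" using le_Suc_ex by blast
          have "psi 0 (hom_component d' f) \<in> cell_ideal n \<beta> p" using f by (simp add: cell_proj_def)
          then show ?thesis
            unfolding d hom_component_form_mult[OF hom_component_in_forms] psi.hom_mult by (rule ideal_mult[OF I])
        next
          case False
          then have "hom_component d (hom_component e g * f) = 0"
            by (intro hom_component_form_mult_less[OF hom_component_in_forms]) simp
          then show ?thesis by (simp add: ideal_zero[OF I])
        qed
      qed
      finally show "psi 0 (hom_component d (g * f)) \<in> cell_ideal n \<beta> p" .
    qed
  qed
  moreover have "hom_component d f \<in> cell_proj n \<beta> p" if "f \<in> cell_proj n \<beta> p" for f d
    using that by (subst cell_proj_form[OF hom_component_in_forms]) (simp add: cell_proj_def)
  ultimately show ?thesis unfolding homogeneous_ideal_def by blast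
qed

lemma cell_proj_nonzerodivisor:
  assumes "pvar 0 ^ k * f \<in> cell_proj n \<beta> p" shows "f \<in> cell_proj n \<beta> p"
proof -
  interpret psi: rhom "psi (0 :: 'a)" by (rule psi_hom)
  have x: "pvar 0 ^ k \<in> (forms k :: (3, 'a) mpoly set)" using forms_power[of "pvar 0" 1 k] by simp
  have "psi 0 (pvar 0 ^ k * hom_component d f) = psi 0 (hom_component d f)" for d
    by (simp only: psi.hom_mult psi.hom_power psi_pvar psi0_var) simp
  moreover have "psi 0 (hom_component (k + d) (pvar 0 ^ k * f)) \<in> cell_ideal n \<beta> p" for d
    using assms by (simp add: cell_proj_def)
  ultimately have "psi 0 (hom_component d f) \<in> cell_ideal n \<beta> p" for d
    by (simp only: hom_component_form_mult[OF x])
  then show ?thesis by (simp add: cell_proj_def)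
qed

lemma cell_proj_saturated: "saturated_ideal (cell_proj n \<beta> p)"
  unfolding saturated_ideal_def
proof (intro allI impI, elim exE)
  fix f :: "(3, 'a) mpoly" and k
  assume *: "\<forall>g\<in>forms k. g * f \<in> cell_proj n \<beta> p"
  have "pvar 0 ^ k \<in> (forms k :: (3, 'a) mpoly set)" using forms_power[of "pvar 0" 1 k] by simp
  from bspec[OF * this] show "f \<in> cell_proj n \<beta> p" by (rule cell_proj_nonzerodivisor)
qed

lemma psi_cell_proj: "psi 0 ` cell_proj n \<beta> p = cell_ideal n \<beta> p"
proof
  interpret psi: rhom "psi (0 :: 'a)" by (rule psi_hom)
  show "psi 0 ` cell_proj n \<beta> p \<subseteq> cell_ideal n \<beta> p"
  proof
    fix F assume "F \<in> psi 0 ` cell_proj n \<beta> p"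
    then obtain f where f: "F = psi 0 f" "f \<in> cell_proj n \<beta> p" by blast
    have "(\<Sum>d\<in>mdeg ` keys f. hom_component d f) = f" by (rule sum_hom_components) auto
    then have "psi 0 f = psi 0 (\<Sum>d\<in>mdeg ` keys f. hom_component d f)" by (rule arg_cong[OF sym])
    also have "\<dots> \<in> cell_ideal n \<beta> p" unfolding psi.hom_sum
      by (rule ideal_sum[OF cell_ideal_is_ideal]) (use f(2) in \<open>simp add: cell_proj_def\<close>)
    finally show "F \<in> cell_ideal n \<beta> p" using f by simp
  qed
  show "cell_ideal n \<beta> p \<subseteq> psi 0 ` cell_proj n \<beta> p"
  proof
    fix F assume F: "F \<in> cell_ideal n \<beta> p"
    obtain N where "td N F" using td_exists by blast
    then obtain f where f: "f \<in> forms N" "psi 0 f = F" by (rule psi0_form_exists[THEN bexE])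
    have "f \<in> cell_proj n \<beta> p" using F f(2) by (simp add: cell_proj_form[OF f(1)])
    then show "F \<in> psi 0 ` cell_proj n \<beta> p" by (rule image_eqI[where f = "psi 0", OF f(2)[symmetric]])
  qed
qed

lemma hilb_cell_cell_proj:
  assumes "cell_shape n \<beta>" "(\<Sum>l<n. \<beta> l) \<le> n" "\<And>x. x \<notin> cell_indices n \<beta> \<Longrightarrow> p x = 0"
  shows "hilb_cell n 0 \<beta> p (cell_proj n \<beta> p)"
  unfolding hilb_cell_def psi_cell_proj
proof (intro conjI allI impI assms(1,2) cell_cell_ideal)
  show "p x = 0" if "x \<notin> cell_indices n \<beta>" for x using that by (rule assms(3))
  fix f assume "lin 0 * f \<in> cell_proj n \<beta> p"
  then show "f \<in> cell_proj n \<beta> p" by (rule_tac cell_proj_nonzerodivisor[of 1]) (simp add: lin_def)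
qed

subsection \<open>Its Hilbert function\<close>

lemma boxes_bound:
  assumes sh: "cell_shape n \<beta>" and sum: "(\<Sum>l<n. \<beta> l) \<le> n" and b: "(l, s) \<in> boxes \<beta>"
  shows "l < n" "l + s < n"
proof -
  have sb: "s < \<beta> l" using b by (simp add: boxes_def)
  show l: "l < n"
  proof (rule ccontr)
    assume "\<not> l < n"
    then show False using sh sb by (simp add: cell_shape_def)
  qed
  have anti: "\<beta> l \<le> \<beta> j" if "j \<le> l" for j
    using that by (induction rule: inc_induct) (use cell_shape_Suc[OF sh] order_trans in \<open>simp, metis\<close>)
  have "l + s < (\<Sum>j<l. 1) + \<beta> l" using sb by simp
  also have "\<dots> \<le> (\<Sum>j<l. \<beta> j) + \<beta> l" 
  proof (intro add_right_mono sum_mono)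
    fix j assume "j \<in> {..<l}"
    then show "1 \<le> \<beta> j" using sb anti[of j] by simp
  qed
  also have "\<dots> = (\<Sum>j<Suc l. \<beta> j)" by simp
  also have "\<dots> \<le> (\<Sum>j<n. \<beta> j)" using l by (intro sum_mono2) auto
  finally show "l + s < n" using sum by simp
qed

lemma boxes_eq_Sigma: 
  assumes sh: "cell_shape n \<beta>" shows "boxes \<beta> = (SIGMA l:{..<n}. {..<\<beta> l})"
  using sh unfolding boxes_def cell_shape_def by (auto simp: not_le intro: ccontr)

lemma boxes_finite: assumes "cell_shape n \<beta>" shows "finite (boxes \<beta>)" "card (boxes \<beta>) = (\<Sum>l<n. \<beta> l)"
  unfolding boxes_eq_Sigma[OF assms] by (simp_all add: card_SigmaI)

text \<open>In a box \<open>(l, s)\<close> the exponent of \<open>v\<close> comes first, unlike in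
  \<open>polycomb\<close>.\<close>

abbreviation boxcomb :: "(nat \<times> nat \<Rightarrow> 'k::comm_ring_1) \<Rightarrow> (nat \<times> nat) set \<Rightarrow> 'k poly poly" where
  "boxcomb c S \<equiv> \<Sum>(l, s)\<in>S. const2 (c (l, s)) * mon2 s l"

lemma coeff_mon2_sum:
  assumes "finite S"
  shows "coeff (coeff (boxcomb c S) l) s = (if (l, s) \<in> S then c (l, s) else 0)"
proof -
  have "coeff (coeff (boxcomb c S) l) s = (\<Sum>y\<in>S. if y = (l, s) then c y else 0)"
    by (simp add: coeff_sum case_prod_unfold coeff_const2_mult coeff_mon2) 
      (intro sum.cong refl, auto)
  then show ?thesis using assms by (simp add: sum.delta)
qed

lemma boxes_independent:
  assumes sh: "cell_shape n \<beta>" and S: "S \<subseteq> boxes \<beta>"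
    and F: "boxcomb c S \<in> cell_ideal n \<beta> p" and x: "x \<in> S"
  shows "c x = 0"
proof (rule ccontr)
  assume cx: "c x \<noteq> 0"
  let ?F = "\<Sum>(l, s)\<in>S. const2 (c (l, s)) * mon2 s l"
  have fin: "finite S" using finite_subset[OF S boxes_finite(1)[OF sh]] .
  have co: "coeff (coeff ?F l) s = (if (l, s) \<in> S then c (l, s) else 0)" for l s
    by (rule coeff_mon2_sum[OF fin])
  obtain l s where ls: "x = (l, s)" by fastforce
  have "coeff (coeff ?F l) s \<noteq> 0" using co x cx ls by simp
  then have "?F \<noteq> 0" by auto
  let ?d = "degree ?F"
  have d0: "coeff ?F ?d \<noteq> 0" using \<open>?F \<noteq> 0\<close> by (simp add: leading_coeff_0_iff)
  have "cell_Q n \<beta> p ?d dvd coeff ?F ?d" by (rule cell_ideal_coeff_dvd[OF F order_refl])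
  from dvd_imp_degree_le[OF this d0] have "\<beta> ?d \<le> degree (coeff ?F ?d)" using cell_Q_monic[OF sh, of p ?d] by simp
  moreover have "coeff (coeff ?F ?d) (degree (coeff ?F ?d)) \<noteq> 0" using d0 by simp
  then have "(?d, degree (coeff ?F ?d)) \<in> S" unfolding co by (rule contrapos_np) simp
  ultimately show False using S by (auto simp: boxes_def)
qed

lemma td_cellh:
  assumes sh: "cell_shape n \<beta>" and good: "\<And>x. x \<notin> good_indices n \<beta> \<Longrightarrow> p x = 0"
  shows "td l (cellh \<beta> p l)"
proof (induction l rule: less_induct)
  case (less l)
  show ?case
  proof (cases l)
    case 0
    then show ?thesis by (simp add: td_def coeff_1)
  next
    case (Suc i)
    have "td l (smult (cell_a \<beta> p i j * (\<Prod>k\<in>{j..<i}. cell_q \<beta> p k)) (cellh \<beta> p j))" if j: "j \<le> i" for j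
    proof (rule td_smult)
      show "td j (cellh \<beta> p j)" using less.IH[of j] j Suc by simp
      note dP = cell_q_prod_monic[OF sh j, of p, THEN conjunct1]
      show "cell_a \<beta> p i j * (\<Prod>k\<in>{j..<i}. cell_q \<beta> p k) = 0 \<or>
        degree (cell_a \<beta> p i j * (\<Prod>k\<in>{j..<i}. cell_q \<beta> p k)) + j \<le> l"
      proof (cases "cell_a \<beta> p i j = 0")
        case False
        let ?s = "degree (cell_a \<beta> p i j)"
        have "coeff (cell_a \<beta> p i j) ?s \<noteq> 0" using False by simp
        then have "p (i, j, ?s) \<noteq> 0" unfolding cell_a_def coeff_low_sum by (auto split: if_splits)
        then have "(i, j, ?s) \<in> good_indices n \<beta>" using good by blast
        then have "?s + (\<beta> j - \<beta> i) + j \<le> l" using j Suc by (auto simp: good_indices_def)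
        moreover have "degree (cell_a \<beta> p i j * (\<Prod>k\<in>{j..<i}. cell_q \<beta> p k)) = ?s + (\<beta> j - \<beta> i)"
          by (subst degree_mult_eq[OF False]) (simp_all add: dP cell_q_neq_0)
        ultimately show ?thesis by simp
      qed simp
    qed
    then have "td l (\<Sum>j\<in>{..i}. smult (cell_a \<beta> p i j * (\<Prod>k\<in>{j..<i}. cell_q \<beta> p k)) (cellh \<beta> p j))"
      by (intro td_sum) simp
    moreover have "td l ([:0, 1:] * cellh \<beta> p i)" unfolding Suc using less.IH[of i] Suc by (intro td_v_mult) simp
    ultimately show ?thesis unfolding Suc cell_h.simps(2) by (intro td_diff) simp_all
  qed
qed

text \<open>Reduction from the top power of \<open>v\<close> downwards by the
  \<open>Q\<^sub>l h\<^sub>l\<close>, which by the bound on the degree of \<open>h\<^sub>l\<close> does not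
  raise the total degree.\<close>

lemma boxes_span:
  assumes sh: "cell_shape n \<beta>" and good: "\<And>x. x \<notin> good_indices n \<beta> \<Longrightarrow> p x = 0"
  shows "td N F \<Longrightarrow> (\<And>j. j \<ge> D \<Longrightarrow> coeff F j = 0) \<Longrightarrow>
    \<exists>c. F - boxcomb c {(l, s) \<in> boxes \<beta>. l + s \<le> N} \<in> cell_ideal n \<beta> p"
proof (induction D arbitrary: F)
  case 0
  then have "F = 0" by (simp add: poly_eq_iff)
  then show ?case by (intro exI[of _ "\<lambda>_. 0"]) (simp add: const2_def case_prod_unfold ideal_zero[OF cell_ideal_is_ideal])
next
  case (Suc D)
  let ?B = "{(l, s) \<in> boxes \<beta>. l + s \<le> N}"
  have finB: "finite ?B" by (rule finite_subset[OF _ boxes_finite(1)[OF sh]]) auto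
  let ?Q = "cell_Q n \<beta> p D"
  have dQ: "degree ?Q = \<beta> D" using cell_Q_monic[OF sh, of p D] by simp
  define g where "g = coeff F D div ?Q"
  define r where "r = coeff F D mod ?Q"
  have gr: "coeff F D = ?Q * g + r" by (simp add: g_def r_def)
  have r: "r = 0 \<or> degree r < \<beta> D" using degree_mod_less[of ?Q "coeff F D"] dQ by (auto simp: r_def)
  have tdF: "coeff F D = 0 \<or> degree (coeff F D) + D \<le> N" using Suc.prems(1) by (simp add: td_def)
  have dg: "degree (coeff F D) = degree (?Q * g) \<and> degree (?Q * g) = \<beta> D + degree g" if "g \<noteq> 0"
  proof -
    have e: "degree (?Q * g) = \<beta> D + degree g" using that dQ by (subst degree_mult_eq) auto
    have "degree (?Q * g + r) = degree (?Q * g)"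
    proof (cases "r = 0")
      case False
      then show ?thesis using r e by (intro degree_add_eq_left) simp
    qed simp
    then show ?thesis using e gr by simp
  qed
  have Qg: "?Q * g = 0 \<or> degree (?Q * g) + D \<le> N"
  proof (cases "g = 0")
    case False
    have "degree (coeff F D) = degree (?Q * g)" using dg[OF False] by simp
    moreover have "coeff F D \<noteq> 0"
    proof
      assume "coeff F D = 0"
      then show False using False by (simp add: g_def)
    qed
    ultimately show ?thesis using tdF by simp
  qed simp
  have rd: "r = 0 \<or> degree r + D \<le> N"
  proof (cases "r = 0 \<or> coeff F D = 0")
    case True
    then show ?thesis by (auto simp: r_def)
  next
    case False
    have "degree r \<le> degree (coeff F D)"
    proof (cases "g = 0")
      case True then show ?thesis using gr by simp
    next
      case g: False
      show ?thesis using r dg[OF g] by (cases "r = 0") simp_all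
    qed
    then show ?thesis using tdF False by auto
  qed
  define R where "R = pmonom r D"
  have coR: "coeff R j = (if j = D then r else 0)" for j by (simp add: R_def coeff_monom)
  have tdR: "td N R" using rd by (auto simp: td_def coR)
  define F' where "F' = F - smult (?Q * g) (cellh \<beta> p D) - R"
  have "td N F'" unfolding F'_def
    by (intro td_diff Suc.prems(1) tdR td_smult[OF td_cellh[OF sh good] Qg])
  moreover have "coeff F' j = 0" if "j \<ge> D" for j
  proof (cases "j = D")
    case True
    then show ?thesis by (simp add: F'_def coR gr)
  next
    case False
    then show ?thesis using that Suc.prems(2)[of j] by (simp add: F'_def coR coeff_eq_0)
  qed
  ultimately obtain c where c: "F' - boxcomb c ?B \<in> cell_ideal n \<beta> p"
    using Suc.IH[of F'] by blast
  have R: "R = (\<Sum>(l, s)\<in>?B. const2 (if l = D then coeff r s else 0) * mon2 s l)"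
  proof (rule poly_eqI, rule poly_eqI)
    fix l s
    have "coeff (coeff (\<Sum>(l, s)\<in>?B. const2 (if l = D then coeff r s else 0) * mon2 s l) l) s
        = (if (l, s) \<in> ?B then (if l = D then coeff r s else 0) else 0)"
      using coeff_mon2_sum[OF finB, of "\<lambda>(l, s). if l = D then coeff r s else 0" l s] by (simp only: prod.case)
    also have "\<dots> = (if l = D then coeff r s else 0)"
    proof (cases "l = D \<and> coeff r s \<noteq> 0")
      case True
      then have "s \<le> degree r" "r \<noteq> 0" by (auto intro: le_degree)
      then have "(l, s) \<in> ?B" using r rd True by (auto simp: boxes_def)
      then show ?thesis by simp
    qed auto
    finally show "coeff (coeff R l) s = coeff (coeff (\<Sum>(l, s)\<in>?B. const2 (if l = D then coeff r s else 0) * mon2 s l) l) s"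
      by (simp add: coR)
  qed
  let ?c = "\<lambda>(l, s). c (l, s) + (if l = D then coeff r s else 0)"
  have "F - boxcomb ?c ?B
      = (F' - boxcomb c ?B) + smult (?Q * g) (cellh \<beta> p D)"
  proof -
    have "boxcomb ?c ?B = boxcomb c ?B + R"
      unfolding R sum.distrib[symmetric]
      by (intro sum.cong refl) (simp only: case_prod_unfold rhom.hom_add[OF const2_hom] distrib_right prod.sel)
    then show ?thesis by (simp add: F'_def)
  qed
  also have "\<dots> \<in> cell_ideal n \<beta> p"
    by (intro cell_ideal_add c cell_ideal_smult_h dvd_triv_left)
  finally show ?case by blast
qed

lemma cell_proj_quot_basis:
  assumes sh: "cell_shape n \<beta>" and good: "\<And>x. x \<notin> good_indices n \<beta> \<Longrightarrow> p x = 0"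
  shows "quot_basis (forms N) (cell_proj n \<beta> p \<inter> forms N) (monom ` (\<lambda>(l, s). ex3 (N - s - l) s l) ` {(l, s) \<in> boxes \<beta>. l + s \<le> N})"
proof -
  let ?J = "cell_proj n \<beta> p" and ?B = "{(l, s) \<in> boxes \<beta>. l + s \<le> N}"
  interpret psi: rhom "psi (0 :: 'a)" by (rule psi_hom)
  have finB: "finite ?B" by (rule finite_subset[OF _ boxes_finite(1)[OF sh]]) auto
  have id: "is_ideal ?J" by (rule homogeneous_ideal_ideal[OF cell_proj_homogeneous])
  let ?u = "\<lambda>(l, s). monom (ex3 (N - s - l) s l) :: (3, 'a) mpoly"
  have ps: "psi 0 (\<Sum>x\<in>?B. scale (c x) (?u x)) = boxcomb c ?B" for c
    unfolding psi.hom_sum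
    by (intro sum.cong refl) (simp only: case_prod_unfold psi_scale psi0_monom lookup_ex3 prod.collapse)
  have u: "?u x \<in> forms N" if "x \<in> ?B" for x using that by auto
  have fu: "(\<Sum>x\<in>?B. scale (c x) (?u x)) \<in> forms N" for c by (intro forms_sum forms_scale u)
  have "quot_basis (forms N) (?J \<inter> forms N) (?u ` ?B)"
  proof (rule quot_basisI[OF subspace_Int_forms[OF id]])
    show "?u ` ?B \<subseteq> forms N" using u by blast
    show "indep_mod (?J \<inter> forms N) ?B ?u"
      unfolding indep_mod_def
    proof (intro conjI finB allI impI ballI)
      fix c x assume c: "(\<Sum>x\<in>?B. scale (c x) (?u x)) \<in> ?J \<inter> forms N" and x: "x \<in> ?B"
      have "psi 0 (\<Sum>x\<in>?B. scale (c x) (?u x)) \<in> cell_ideal n \<beta> p" using c cell_proj_form[OF fu[of c], of n \<beta> p] by simp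
      then show "c x = 0" unfolding ps by (rule boxes_independent[where S = ?B and c = c, OF sh _ _ x, rotated]) auto
    qed
    show "span_mod (forms N) (?J \<inter> forms N) ?B ?u"
      unfolding span_mod_def
    proof (intro conjI finB ballI)
      fix f :: "(3, 'a) mpoly" assume f: "f \<in> forms N"
      have deg0: "coeff (psi 0 f) j = 0" if "j \<ge> Suc (degree (psi 0 f))" for j using that by (simp add: coeff_eq_0)
      obtain c where "psi 0 f - boxcomb c ?B \<in> cell_ideal n \<beta> p"
        by (rule exE[OF boxes_span[where D = "Suc (degree (psi 0 f))" and p = p and F = "psi 0 f", OF sh good td_psi0[OF f] deg0]])
      then have "psi 0 (f - (\<Sum>x\<in>?B. scale (c x) (?u x))) \<in> cell_ideal n \<beta> p" by (simp only: psi.hom_diff ps)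
      then have "f - (\<Sum>x\<in>?B. scale (c x) (?u x)) \<in> ?J"
        using cell_proj_form[OF forms_diff[OF f fu[of c]], of n \<beta> p] by simp
      then show "\<exists>c. f - (\<Sum>x\<in>?B. scale (c x) (?u x)) \<in> ?J \<inter> forms N"
        using forms_diff[OF f fu[of c]] by (intro exI[of _ c] IntI)
    qed
  qed
  moreover have "?u ` ?B = monom ` (\<lambda>(l, s). ex3 (N - s - l) s l) ` ?B" by (simp add: image_image case_prod_unfold)
  ultimately show ?thesis by simp
qed

lemma hilbert_function_cell_proj:
  fixes p :: "cell_index \<Rightarrow> 'k::field"
  assumes sh: "cell_shape n \<beta>" and good: "\<And>x. x \<notin> good_indices n \<beta> \<Longrightarrow> p x = 0"
  shows "hilbert_function (cell_proj n \<beta> p) N = card {(l, s) \<in> boxes \<beta>. l + s \<le> N}"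
proof -
  have "hilbert_function (cell_proj n \<beta> p) N = card ((\<lambda>(l, s). ex3 (N - s - l) s l) ` {(l, s) \<in> boxes \<beta>. l + s \<le> N})"
    by (rule hf_eq_card[OF homogeneous_ideal_ideal[OF cell_proj_homogeneous] cell_proj_quot_basis[OF sh good]])
  also have "\<dots> = card {(l, s) \<in> boxes \<beta>. l + s \<le> N}"
    by (rule card_image) (auto simp: inj_on_def)
  finally show ?thesis .
qed

section \<open>Cell coordinates as functions on a chart\<close>

lemma const2_mult_mon2: "const2 c * mon2 s l = pmonom (pmonom c s) l"
  by (intro poly_eqI) (simp add: coeff_const2_mult coeff_mon2 coeff_monom)

locale cell_stratum =
  fixes n :: nat and \<beta> :: "nat \<Rightarrow> nat"
  assumes sh: "cell_shape n \<beta>" and sum_\<beta>: "(\<Sum>l<n. \<beta> l) = n"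
begin

text \<open>All functions \<open>p\<close> are allowed as parameters; the inadmissible entries are set to
  zero, so that the parameter space is an affine space.\<close>

definition gp :: "(cell_index \<Rightarrow> 'k::field) \<Rightarrow> cell_index \<Rightarrow> 'k" where
  "gp p x = (if x \<in> good_indices n \<beta> then p x else 0)"

definition J :: "(cell_index \<Rightarrow> 'k::field) \<Rightarrow> (3, 'k) mpoly set" where
  "J p = cell_proj n \<beta> (gp p)"

text \<open>The boxes, homogenised in degree \<open>n\<close>; their chart contains all members of the
  family.\<close>

definition B0 :: "3 exps set" where
  "B0 = (\<lambda>(l, s). ex3 (n - s - l) s l) ` boxes \<beta>"

lemma gp_good: "x \<notin> good_indices n \<beta> \<Longrightarrow> gp p x = 0"
  by (simp add: gp_def)

lemma boxes_le: "(l, s) \<in> boxes \<beta> \<Longrightarrow> l + s < n"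
  by (rule boxes_bound(2)[OF sh]) (simp_all add: sum_\<beta>)

lemma boxes_all: "n \<le> N \<Longrightarrow> {(l, s) \<in> boxes \<beta>. l + s \<le> N} = boxes \<beta>"
  using boxes_le by fastforce

lemma hf_J: "hilbert_function (J p :: (3, 'k::field) mpoly set) N = card {(l, s) \<in> boxes \<beta>. l + s \<le> N}"
  unfolding J_def by (rule hilbert_function_cell_proj[OF sh gp_good])

lemma hf_J_n: "n \<le> N \<Longrightarrow> hilbert_function (J p :: (3, 'k::field) mpoly set) N = n"
  unfolding hf_J by (simp add: boxes_all boxes_finite[OF sh] sum_\<beta>)

lemma J_hilb: "J p \<in> hilb_points n"
  unfolding hilb_points_def using hf_J_n[where p = p]
  by (auto simp: J_def cell_proj_homogeneous cell_proj_saturated eventually_sequentially)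

lemma J_chart: "J p \<in> hilb_chart n B0"
proof -
  have "quot_basis (forms n) (J p \<inter> forms n) (monom ` (\<lambda>(l, s). ex3 (n - s - l) s l) ` {(l, s) \<in> boxes \<beta>. l + s \<le> n})"
    unfolding J_def by (rule cell_proj_quot_basis[OF sh gp_good])
  then show ?thesis unfolding boxes_all[OF order_refl] using J_hilb[of p] by (simp add: hilb_chart_def B0_def)
qed

lemma inj_boxes: "inj_on (\<lambda>(l, s). ex3 (n - s - l) s l) (boxes \<beta>)"
  by (auto simp: inj_on_def)

definition cf :: "(('k::field params) \<Rightarrow> 'k alg_closure) set" where
  "cf = {\<lambda>p. f (J p) | f. f \<in> chart_funs n B0}"

lemma cf_ring: "fun_ring (cf :: (('k::field params) \<Rightarrow> 'k alg_closure) set)"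
  unfolding cf_def by (rule fun_ring_comp[OF chart_funs_ring])

definition co :: "nat \<Rightarrow> nat \<times> nat \<Rightarrow> ('k::field params) \<Rightarrow> 'k alg_closure" where
  "co l = (\<lambda>(l', s) p. chart_coord n B0 (J p) (ex3 (n - \<beta> l - l) (\<beta> l) l, ex3 (n - s - l') s l'))"

lemma co_in: "(co l x :: ('k::field params) \<Rightarrow> 'k alg_closure) \<in> cf"
proof -
  let ?f = "\<lambda>J :: 'k ac_ideal. chart_coord n B0 J (ex3 (n - \<beta> l - l) (\<beta> l) l, ex3 (n - snd x - fst x) (snd x) (fst x))"
  have "(co l x :: ('k params) \<Rightarrow> _) = (\<lambda>p. ?f (J p))" by (simp add: co_def case_prod_unfold)
  moreover have "?f \<in> chart_funs n B0" by (rule chart_funs_coord)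
  ultimately show ?thesis unfolding cf_def by (intro CollectI exI[of _ ?f] conjI)
qed

text \<open>The difference of the monomial \<open>u\<^sup>s v\<^sup>l\<close>,
  \<open>s = \<beta>\<^sub>l\<close>, and its expansion in the boxes, an element of the ideal. Its
  coefficients are chart coordinates; it agrees with \<open>Q\<^sub>l h\<^sub>l\<close> in degree
  \<open>l\<close> of \<open>v\<close>.\<close>

definition EE :: "nat \<Rightarrow> ('k::field params) \<Rightarrow> 'k alg_closure poly poly" where
  "EE l p = mon2 (\<beta> l) l - (\<Sum>(l', s)\<in>boxes \<beta>. const2 (co l (l', s) p) * mon2 s l')"

lemma \<beta>_bound: assumes "l \<le> n" shows "l + \<beta> l \<le> n"
proof (cases "\<beta> l")
  case 0
  then show ?thesis using assms by simp
next
  case (Suc b)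
  then have "(l, b) \<in> boxes \<beta>" by (simp add: boxes_def)
  from boxes_le[OF this] show ?thesis using Suc by simp
qed

lemma EE_in: assumes l: "l \<le> n" shows "EE l p \<in> cell_ideal n \<beta> (gp p)"
proof -
  interpret psi: rhom "psi (0 :: 'a alg_closure)" by (rule psi_hom)
  let ?m = "ex3 (n - \<beta> l - l) (\<beta> l) l"
  let ?f = "monom ?m - (\<Sum>b\<in>B0. scale (chart_coord n B0 (J p) (?m, b)) (monom b))"
  have m: "?m \<in> deg_exps n" using \<beta>_bound[OF l] by simp
  have B0: "B0 \<subseteq> deg_exps n" using hilb_chartD(2)[OF J_chart] .
  have "?f \<in> J p" by (rule chart_coord_mem[OF J_chart m])
  moreover have "?f \<in> forms n" using m B0 by (intro forms_diff forms_sum forms_scale) auto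
  ultimately have "psi 0 ?f \<in> cell_ideal n \<beta> (gp p)"
    using cell_proj_form[of ?f n n \<beta> "gp p"] by (simp add: J_def)
  moreover have "psi 0 ?f = EE l p"
  proof -
    have "psi 0 (\<Sum>b\<in>B0. scale (chart_coord n B0 (J p) (?m, b)) (monom b)) = (\<Sum>(l', s)\<in>boxes \<beta>. const2 (co l (l', s) p) * mon2 s l')"
      unfolding psi.hom_sum B0_def sum.reindex[OF inj_boxes]
      unfolding B0_def[symmetric]
      by (intro sum.cong refl) (simp only: comp_def case_prod_unfold psi_scale psi0_monom lookup_ex3 co_def prod.sel)
    then show ?thesis by (simp only: EE_def psi.hom_diff psi0_monom lookup_ex3)
  qed
  ultimately show ?thesis by simp
qed

lemma coeff_EE: "coeff (coeff (EE l p) l') s = (if l' = l \<and> s = \<beta> l then 1 else 0) - (if (l', s) \<in> boxes \<beta> then co l (l', s) p else 0)"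
  unfolding EE_def coeff_diff coeff_mon2 coeff_mon2_sum[OF boxes_finite(1)[OF sh], where c = "\<lambda>x. co l x p"] ..

lemma degree_Q: "degree (cell_Q n \<beta> p l) = \<beta> l" and lead_Q: "coeff (cell_Q n \<beta> p l) (\<beta> l) = 1"
  using cell_Q_monic[OF sh, of p l] by auto

text \<open>The coefficient of a highest power \<open>v\<^sup>D\<close> with \<open>D > l\<close> would have
  degree below \<open>\<beta>\<^sub>D\<close> but be divisible by \<open>Q\<^sub>D\<close>.\<close>

lemma degree_EE: assumes l: "l \<le> n" shows "degree (EE l p) \<le> l"
proof (rule ccontr)
  assume d: "\<not> degree (EE l p) \<le> l"
  let ?D = "degree (EE l p)"
  let ?c = "coeff (EE l p) ?D"
  have c0: "?c \<noteq> 0" using d by auto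
  have "cell_Q n \<beta> (gp p) ?D dvd ?c" by (rule cell_ideal_coeff_dvd[OF EE_in[OF l] order_refl])
  from dvd_imp_degree_le[OF this c0] have "\<beta> ?D \<le> degree ?c" by (simp add: degree_Q)
  then have "(?D, degree ?c) \<notin> boxes \<beta>" by (simp add: boxes_def)
  then have "coeff ?c (degree ?c) = 0" using d by (simp only: coeff_EE) auto
  then show False using c0 by simp
qed

lemma lead_EE: assumes l: "l \<le> n" shows "coeff (EE l p) l = cell_Q n \<beta> (gp p) l"
proof -
  let ?Q = "cell_Q n \<beta> (gp p) l" and ?c = "coeff (EE l p) l"
  have dv: "?Q dvd ?c - ?Q" by (intro dvd_diff dvd_refl cell_ideal_coeff_dvd[OF EE_in[OF l] degree_EE[OF l]])
  have "coeff (?c - ?Q) s = 0" if "s \<ge> \<beta> l" for s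
  proof (cases "s = \<beta> l")
    case True
    then show ?thesis by (simp add: coeff_EE lead_Q boxes_def)
  next
    case False
    then show ?thesis using that by (simp add: coeff_EE boxes_def coeff_eq_0 degree_Q)
  qed
  then have small: "?c - ?Q = 0 \<or> degree (?c - ?Q) < \<beta> l"
    by (metis leading_coeff_0_iff not_less)
  have "?c - ?Q = 0"
  proof (rule ccontr)
    assume "?c - ?Q \<noteq> 0"
    then show False using dvd_imp_degree_le[OF dv] small by (simp add: degree_Q)
  qed
  then show ?thesis by simp
qed

context
  fixes A :: "(('k::field params) \<Rightarrow> 'k alg_closure) set"
  assumes A_def: "A = cf"
begin

interpretation fun_ring A unfolding A_def by (rule cf_ring)

lemma EE_fam: "pfam2 (EE l)"
  unfolding EE_def[abs_def] case_prod_unfold const2_mult_mon2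
  unfolding mon2_def
  by (intro pfam2_diff pfam2_sum pfam2_monom pfam_monom one_in) (simp only: A_def co_in prod.collapse)

lemma Q_fam: "pfam (\<lambda>p. cell_Q n \<beta> (gp p) l)"
proof (cases "l \<le> n")
  case True
  have "pfam (\<lambda>p. coeff (EE l p) l)" by (rule pfam2_coeff[OF EE_fam])
  then show ?thesis by (simp only: lead_EE[OF True])
qed (simp add: cell_Q_ge)

lemma q_fam: assumes i: "i < n" shows "pfam (\<lambda>p. cell_q \<beta> (gp p) i)"
proof -
  have "pfam (\<lambda>p. cell_Q n \<beta> (gp p) i div cell_Q n \<beta> (gp p) (Suc i))"
    by (rule pfam_divmod(2)[OF Q_fam Q_fam, where \<beta> = "\<beta> (Suc i)"]) (use cell_Q_monic[OF sh] in auto)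
  then show ?thesis by (simp add: cell_Q_Suc[OF i])
qed

text \<open>Modulo the ideal, \<open>Q\<^sub>i\<^sub>+\<^sub>1 h\<^sub>i\<^sub>+\<^sub>1\<close> agrees with
  \<open>EE (i + 1)\<close>. Comparing the coefficients of \<open>h\<^sub>l\<close> determines
  \<open>a\<^sub>i\<^sub>l R\<close>, where
  \<open>R = q\<^sub>l \<cdots> q\<^sub>i\<^sub>-\<^sub>1 Q\<^sub>i\<^sub>+\<^sub>1\<close>, modulo
  \<open>Q\<^sub>l = R q\<^sub>i\<close>, hence exactly, since
  \<open>deg a\<^sub>i\<^sub>l < deg q\<^sub>i\<close>.\<close>

lemma a_fam:
  assumes i: "i < n" and l: "l \<le> i" and h: "\<And>j. j \<le> i \<Longrightarrow> pfam2 (\<lambda>p. cellh \<beta> (gp p) j)"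
  shows "pfam (\<lambda>p. cell_a \<beta> (gp p) i l)"
proof -
  let ?Q = "\<lambda>j (p :: 'k params). cell_Q n \<beta> (gp p) j" and ?h = "\<lambda>j (p :: 'k params). cellh \<beta> (gp p) j"
  let ?a = "\<lambda>j (p :: 'k params). cell_a \<beta> (gp p) i j"
  let ?P = "\<lambda>j (p :: 'k params). \<Prod>k\<in>{j..<i}. cell_q \<beta> (gp p) k"
  define W where "W p = EE (Suc i) p - smult (?Q (Suc i) p) ([:0, 1:] * ?h i p)" for p :: "'k params"
  have W_fam: "pfam2 W" unfolding W_def[abs_def] by (intro pfam2_diff EE_fam pfam2_smult Q_fam pfam2_mult pfam2_v h order_refl)
  define T where "T p = (\<Sum>j\<in>{..i}. smult (?Q (Suc i) p * (?a j p * ?P j p)) (?h j p))" for p :: "'k params"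
  have WT: "W p + T p = EE (Suc i) p - smult (?Q (Suc i) p) (?h (Suc i) p)" for p
  proof -
    have "smult (?Q (Suc i) p) (?h (Suc i) p) = smult (?Q (Suc i) p) ([:0, 1:] * ?h i p) - T p"
      unfolding T_def cell_h.simps(2) smult_diff_right smult_sum_right' smult_smult by simp
    then show ?thesis by (simp add: W_def)
  qed
  have degT: "degree (T p) \<le> i" for p
    unfolding T_def by (intro degree_sum_le) (auto intro: order_trans[OF degree_smult_le])
  have degW: "degree (W p) \<le> i" for p
  proof -
    have "degree (EE (Suc i) p - smult (?Q (Suc i) p) (?h (Suc i) p)) \<le> i"
    proof (rule degree_le, intro allI impI)
      fix j assume j: "i < j"
      show "coeff (EE (Suc i) p - smult (?Q (Suc i) p) (?h (Suc i) p)) j = 0"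
      proof (cases "j = Suc i")
        case True
        then show ?thesis using lead_EE[of "Suc i" p] i by simp
      next
        case False
        then show ?thesis using degree_EE[of "Suc i" p] i j by (simp add: coeff_eq_0)
      qed
    qed
    then have "degree ((W p + T p) - T p) \<le> i" unfolding WT by (rule degree_diff_le[OF _ degT])
    then show ?thesis by simp
  qed
  define H where "H j p = (if j \<le> i then ?h j p else pmonom 1 j)" for j and p :: "'k params"
  have H1: "pfam2 (H j)" for j
  proof (cases "j \<le> i")
    case True
    then show ?thesis using h[OF True] by (simp add: H_def[abs_def])
  next
    case False
    then show ?thesis using pfam2_monom[OF pfam_1, of j] by (simp add: H_def[abs_def])
  qed
  have H2: "lead_coeff (H j p) = 1" "degree (H j p) = j" for j p by (simp_all add: H_def degree_monom_eq)
  obtain G where G: "\<forall>j. pfam (G j)" "\<forall>p. W p = (\<Sum>j\<le>i. smult (G j p) (H j p))"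
    using pfam2_expand_aux[OF H1 H2 W_fam degW] by (elim exE conjE)
  have W: "W p = (\<Sum>j\<le>i. smult (G j p) (?h j p))" for p
    using G(2) by (simp add: H_def)
  let ?R = "\<lambda>p. ?P l p * ?Q (Suc i) p"
  have QR: "?Q l p = ?R p * cell_q \<beta> (gp p) i" for p
  proof -
    have "?Q l p = ?P l p * ?Q i p" using l i by (intro cell_Q_split) auto
    then show ?thesis by (simp only: cell_Q_Suc[OF i] mult.assoc mult.commute mult.left_commute)
  qed
  have R0: "?R p \<noteq> 0" for p by (simp add: cell_q_neq_0)
  have degR: "degree (?R p) = \<beta> l - (\<beta> i - \<beta> (Suc i))" and lcR: "lead_coeff (?R p) = 1" for p
  proof -
    have "degree (?Q l p) = degree (?R p) + degree (cell_q \<beta> (gp p) i)"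
      unfolding QR by (rule degree_mult_eq[OF R0 cell_q_neq_0])
    then show "degree (?R p) = \<beta> l - (\<beta> i - \<beta> (Suc i))"
      using cell_q_monic[of \<beta> "gp p" i] by (simp add: degree_Q)
    have "lead_coeff (?P l p) = 1" by (rule cell_q_prod_monic[OF sh l, THEN conjunct2])
    then show "lead_coeff (?R p) = 1" 
      by (simp only: lead_coeff_mult cell_Q_monic[OF sh, THEN conjunct2] mult_1)
  qed
  have eq: "?a l p = ((- G l p) mod ?Q l p) div ?R p" for p
  proof -
    have "(\<Sum>j\<le>i. smult (G j p + ?Q (Suc i) p * (?a j p * ?P j p)) (?h j p)) = W p + T p"
      unfolding W T_def by (simp only: smult_add_left sum.distrib atMost_def)
    also have "\<dots> \<in> cell_ideal n \<beta> (gp p)"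
      unfolding WT using i by (intro ideal_diff[OF cell_ideal_is_ideal] EE_in cell_ideal_smult_h) auto
    finally have "?Q l p dvd G l p + ?Q (Suc i) p * (?a l p * ?P l p)"
      by (rule cell_ideal_expand_dvd[where G = "\<lambda>j. G j p + ?Q (Suc i) p * (?a j p * ?P j p)", OF _ l])
    then have "?Q l p dvd - (G l p + ?Q (Suc i) p * (?a l p * ?P l p))" by (simp only: dvd_minus_iff)
    moreover have "- (G l p + ?Q (Suc i) p * (?a l p * ?P l p)) = - G l p - ?a l p * ?R p" by (simp add: algebra_simps)
    ultimately have "(- G l p) mod ?Q l p = (?a l p * ?R p) mod ?Q l p" by (simp only: mod_eq_dvd_iff)
    also have "\<dots> = ?a l p * ?R p"
    proof (cases "?a l p = 0")
      case False
      have "degree (?a l p) < \<beta> i - \<beta> (Suc i)"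
        using low_degree[of "\<lambda>s. gp p (i, l, s)" "\<beta> i - \<beta> (Suc i)"] False unfolding cell_a_def by blast
      then have "degree (?a l p * ?R p) < degree (?Q l p)"
        unfolding QR degree_mult_eq[OF False R0] degree_mult_eq[OF R0 cell_q_neq_0]
        using cell_q_monic[of \<beta> "gp p" i] by simp
      then show ?thesis by (rule mod_poly_less)
    qed simp
    finally show ?thesis using R0[of p] by simp
  qed
  have "pfam (\<lambda>p. ((- G l p) mod ?Q l p) div ?R p)"
  proof (rule pfam_divmod(2))
    show "pfam (\<lambda>p. (- G l p) mod ?Q l p)"
      using G(1) cell_Q_monic[OF sh] by (intro pfam_divmod(1)[OF pfam_uminus Q_fam, where \<beta> = "\<beta> l"]) auto
    show "pfam ?R" using i by (intro pfam_mult pfam_prod Q_fam q_fam) auto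
  qed (rule lcR, rule degR)
  then show ?thesis by (simp only: eq)
qed

lemma h_fam: "i \<le> n \<Longrightarrow> pfam2 (\<lambda>p. cellh \<beta> (gp p) i)"
proof (induction i rule: less_induct)
  case (less i)
  show ?case
  proof (cases i)
    case (Suc j)
    have jn: "j < n" using less.prems Suc by simp
    have h: "pfam2 (\<lambda>p. cellh \<beta> (gp p) k)" if "k \<le> j" for k using less.IH[of k] that Suc less.prems by simp
    show ?thesis unfolding Suc cell_h.simps(2)
      using jn by (intro pfam2_diff pfam2_mult pfam2_v pfam2_sum pfam2_smult pfam_mult pfam_prod h a_fam q_fam) auto
  qed simp
qed

lemma param_in_A: assumes x: "x \<in> cell_indices n \<beta>" shows "(\<lambda>p. gp p x) \<in> A"
proof -
  obtain i l s where ils: "x = (i, l, s)" by (cases x) auto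
  then have i: "i < n" and l: "l \<le> Suc i" and s: "s < \<beta> i - \<beta> (Suc i)" using x by (auto simp: cell_indices_def)
  show ?thesis
  proof (cases "l = Suc i")
    case True
    have "(\<lambda>p. coeff (cell_q \<beta> (gp p) i) s) \<in> A" by (rule pfam_coeff[OF q_fam[OF i]])
    moreover have "coeff (cell_q \<beta> (gp p) i) s = gp p x" for p :: "'k params"
      using s by (simp add: cell_q_def coeff_low_sum coeff_monom ils True)
    ultimately show ?thesis by simp
  next
    case False
    then have li: "l \<le> i" using l by simp
    have "(\<lambda>p. coeff (cell_a \<beta> (gp p) i l) s) \<in> A"
      using i by (intro pfam_coeff a_fam i li h_fam) auto
    moreover have "coeff (cell_a \<beta> (gp p) i l) s = gp p x" for p :: "'k params"
      using s by (simp add: cell_a_def coeff_low_sum ils)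
    ultimately show ?thesis by simp
  qed
qed

end

lemma param_in: "x \<in> cell_indices n \<beta> \<Longrightarrow> (\<lambda>p :: 'k::field params. gp p x) \<in> cf"
  by (rule param_in_A[OF refl])

end

section \<open>The lower bound\<close>

lemma polyfun_line_meet:
  fixes p q :: "'i \<Rightarrow> 'k::alg_closed_field"
  assumes "G \<in> polyfun" "G' \<in> polyfun" "G p \<noteq> 0" "G' q \<noteq> 0"
  shows "\<exists>t. G (\<lambda>i. p i + t * (q i - p i)) \<noteq> 0 \<and> G' (\<lambda>i. p i + t * (q i - p i)) \<noteq> 0"
proof -
  obtain P where P: "\<forall>t. G (\<lambda>i. p i + t * (q i - p i)) = poly P t"
    using polyfun_line[OF assms(1), of p "\<lambda>i. q i - p i"] by (elim exE)
  obtain P' where P': "\<forall>t. G' (\<lambda>i. p i + t * (q i - p i)) = poly P' t"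
    using polyfun_line[OF assms(2), of p "\<lambda>i. q i - p i"] by (elim exE)
  have "poly P 0 \<noteq> 0" using P[rule_format, of 0] assms(3) by simp
  moreover have "poly P' 1 \<noteq> 0" using P'[rule_format, of 1] assms(4) by simp
  ultimately have "P * P' \<noteq> 0" by auto
  then have "finite {t. poly (P * P') t = 0}" by (rule poly_roots_finite)
  then have "{t. poly (P * P') t = 0} \<noteq> UNIV" using infinite_UNIV_alg_closed by metis
  then show ?thesis using P P' by auto
qed

context cell_stratum
begin

lemma polyfun_gp: "(\<lambda>p. gp p x) \<in> polyfun"
  by (cases "x \<in> good_indices n \<beta>") (simp_all add: gp_def polyfun.const polyfun.var)

lemma J_family: "\<exists>w. chart_family polyfun n (J :: ('k::field params) \<Rightarrow> _) UNIV (SIGMA l:{..<n}. {..<\<beta> l}) w"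
proof (rule hilb_cell_chart_family[where p = gp and a = 0])
  show "(\<Sum>l<n. \<beta> l) \<le> n" by (simp add: sum_\<beta>)
  show "hilb_cell n 0 \<beta> (gp p) (J p)" for p :: "'k params"
    unfolding J_def
    by (rule hilb_cell_cell_proj[OF sh]) (auto simp: sum_\<beta> gp_def good_indices_def)
qed (simp_all add: fun_ring_polyfun polyfun.const polyfun_gp sh J_hilb hf_J_n)

text \<open>\<open>C r\<close> is the closure of the family over the subspace of the first \<open>r\<close>
  admissible coordinates. It is irreducible because open sets pull back to nonvanishing sets of polynomials, and
  the \<open>r\<close>-th coordinate, a function on the chart, vanishes on \<open>C r\<close> within the chart
  but not on \<open>C (Suc r)\<close>.\<close>

theorem dim_hilb_stratum_ge:
  assumes H: "\<And>N. H N = card {(l, s) \<in> boxes \<beta>. l + s \<le> N}"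
  shows "enat (card (good_indices n \<beta>)) \<le> dim_hilb_stratum TYPE('k::field) H"
proof -
  let ?T = "hilb_stratum H :: 'k ac_ideal topology"
  have Hn: "H N = n" if "n \<le> N" for N unfolding H using that by (simp add: boxes_all boxes_finite[OF sh] sum_\<beta>)
  have num: "num_points H = n" by (rule num_points_eqI[OF Hn])
  have top: "topspace ?T = {J \<in> hilb_points n. hilbert_function J = H}"
    by (auto simp: hilb_stratum_def topspace_hilb_space num)
  have J_top: "J p \<in> topspace ?T" for p using J_hilb[of p] hf_J[of p] H by (auto simp: top)
  have pre: "\<exists>G\<in>polyfun. G p \<noteq> 0 \<and> (\<forall>p'. G p' \<noteq> 0 \<longrightarrow> J p' \<in> W)" if W: "openin ?T W" and p: "J p \<in> W" for W p
  proof -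
    obtain W' where W': "openin (hilb_space n) W'" "W = W' \<inter> {J. hilbert_function J = H}"
      using W unfolding hilb_stratum_def num openin_subtopology by auto
    obtain w where w: "chart_family polyfun n (J :: ('k params) \<Rightarrow> _) UNIV (SIGMA l:{..<n}. {..<\<beta> l}) w"
      using J_family by (elim exE)
    have "J p \<in> W'" using p W' by simp
    from chart_family.open_preimage[where e = p, OF w W'(1) UNIV_I this]
    obtain G where G: "G \<in> polyfun" "G p \<noteq> 0" "\<forall>p'\<in>UNIV. G p' \<noteq> 0 \<longrightarrow> J p' \<in> W'"
      by (elim bexE conjE)
    moreover have "hilbert_function (J p') = H" for p' :: "'k params" using J_top[of p'] by (simp add: top)
    ultimately have "\<forall>p'. G p' \<noteq> 0 \<longrightarrow> J p' \<in> W" unfolding W'(2) by simp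
    with G(1,2) show ?thesis by (intro bexI conjI)
  qed
  let ?m = "card (good_indices n \<beta>)"
  have fin: "finite (good_indices n \<beta>)"
    by (rule finite_subset[OF _ finite_cell_indices[of n \<beta>]]) (auto simp: good_indices_def)
  obtain g where g: "bij_betw g {..<?m} (good_indices n \<beta>)"
    using ex_bij_betw_nat_finite[OF fin] by (auto simp: atLeast0LessThan)
  define S where "S r = {p :: 'k params. \<forall>x. p x \<noteq> 0 \<longrightarrow> x \<in> g ` {..<r}}" for r
  define C where "C r = ?T closure_of (J ` S r)" for r
  have XT: "J ` S r \<subseteq> topspace ?T" for r using J_top by blast
  have irr: "irreducible_closedin ?T (C r)" for r
    unfolding C_def
  proof (rule closure_of_irreducible[OF XT])
    have "(\<lambda>_. 0) \<in> S r" by (simp add: S_def)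
    then show "J ` S r \<noteq> {}" by blast
    fix U V assume UV: "openin ?T U" "openin ?T V" "J ` S r \<inter> U \<noteq> {}" "J ` S r \<inter> V \<noteq> {}"
    obtain p where p: "p \<in> S r" "J p \<in> U" using UV(3) by auto
    obtain q where q: "q \<in> S r" "J q \<in> V" using UV(4) by auto
    obtain G where G: "G \<in> polyfun" "G p \<noteq> 0" "\<forall>p'. G p' \<noteq> 0 \<longrightarrow> J p' \<in> U" using pre[OF UV(1) p(2)] by (elim bexE conjE)
    obtain G' where G': "G' \<in> polyfun" "G' q \<noteq> 0" "\<forall>p'. G' p' \<noteq> 0 \<longrightarrow> J p' \<in> V" using pre[OF UV(2) q(2)] by (elim bexE conjE)
    obtain t where t: "G (\<lambda>i. p i + t * (q i - p i)) \<noteq> 0" "G' (\<lambda>i. p i + t * (q i - p i)) \<noteq> 0"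
      using polyfun_line_meet[where G = G and G' = G' and p = p and q = q, OF G(1) G'(1) G(2) G'(2)] by (elim exE conjE)
    let ?p = "\<lambda>i. p i + t * (q i - p i)"
    have "?p \<in> S r"
      unfolding S_def
    proof (intro CollectI allI impI)
      fix x assume "?p x \<noteq> 0"
      then have "p x \<noteq> 0 \<or> q x \<noteq> 0" by auto
      then show "x \<in> g ` {..<r}" using p(1) q(1) unfolding S_def by blast
    qed
    moreover have "J ?p \<in> U" "J ?p \<in> V" using G(3) G'(3) t by simp_all
    ultimately have "J ?p \<in> J ` S r \<inter> U \<inter> V" by (intro IntI imageI)
    then show "J ` S r \<inter> U \<inter> V \<noteq> {}" by (rule ex_in_conv[THEN iffD1, OF exI])
  qed
  have strict: "C r \<subset> C (Suc r)" if r: "r < ?m" for r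
  proof -
    have gr: "g r \<in> good_indices n \<beta>" using g r by (auto simp: bij_betw_def)
    then have "g r \<in> cell_indices n \<beta>" by (auto simp: good_indices_def)
    from param_in[OF this] obtain f where f: "(\<lambda>p :: 'k params. gp p (g r)) = (\<lambda>p. f (J p))" "f \<in> chart_funs n B0"
      unfolding cf_def by (elim CollectE exE conjE)
    have f: "f (J p) = p (g r)" for p using fun_cong[OF f(1), of p] gr by (simp add: gp_def)
    define W where "W = {J \<in> hilb_chart n B0. f J \<noteq> 0} \<inter> {J. hilbert_function J = H}"
    have W: "openin ?T W" unfolding W_def hilb_stratum_def num
      by (rule openin_subtopology_Int[OF hilb_basic_open]) fact
    have JW: "J p \<in> W \<longleftrightarrow> p (g r) \<noteq> 0" for p
      using J_top[of p] by (simp add: W_def J_chart f top)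
    have "J ` S r \<inter> W = {}"
    proof -
      have "p (g r) = 0" if "p \<in> S r" for p
      proof (rule ccontr)
        assume pg: "p (g r) \<noteq> 0"
        have "\<forall>x. p x \<noteq> 0 \<longrightarrow> x \<in> g ` {..<r}" using that unfolding S_def by (rule CollectD)
        from this[rule_format, OF pg] have "g r \<in> g ` {..<r}" .
        then obtain x where x: "x < r" "g r = g x" by (elim imageE) simp
        have "r = x" by (rule inj_onD[OF bij_betw_imp_inj_on[OF g] x(2)]) (use r x(1) in simp_all)
        then show False using x(1) by simp
      qed
      then show ?thesis using JW by (intro equals0I) (elim IntE imageE, simp)
    qed
    then have "J ` S r \<subseteq> topspace ?T - W" using XT[of r] by (simp add: subset_eq disjoint_iff)
    then have Cr: "C r \<subseteq> topspace ?T - W" unfolding C_def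
      by (rule closure_of_minimal) (rule closedin_diff[OF closedin_topspace W])
    define e where "e x = (if x = g r then 1 else 0 :: 'k alg_closure)" for x
    have "e \<in> S (Suc r)" by (auto simp: S_def e_def)
    then have "J e \<in> C (Suc r)" unfolding C_def by (rule subsetD[OF closure_of_subset[OF XT] imageI])
    moreover have "J e \<in> W" by (simp add: JW e_def)
    ultimately have "\<not> C (Suc r) \<subseteq> topspace ?T - W" by (meson DiffD2 subsetD)
    then have "\<not> C (Suc r) \<subseteq> C r" using Cr by (elim contrapos_nn) (rule subset_trans)
    moreover have "g ` {..<r} \<subseteq> g ` {..<Suc r}" by (intro image_mono) auto
    then have "S r \<subseteq> S (Suc r)" unfolding S_def by (intro Collect_mono impI all_mono) auto
    then have "C r \<subseteq> C (Suc r)" unfolding C_def by (intro closure_of_mono image_mono)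
    ultimately show ?thesis unfolding less_le_not_le by (rule_tac conjI)
  qed
  show ?thesis
    unfolding dim_hilb_stratum_def krull_dim_def
    by (rule Sup_upper) (intro CollectI exI[of _ ?m] exI[of _ C] conjI allI impI refl irr strict)
qed

end

section \<open>Leading monomials\<close>

definition LM :: "('v::linorder, 'k::field) mpoly set \<Rightarrow> 'v exps set" where
  "LM J = {Max (keys f) | f. f \<in> J \<and> f \<noteq> 0}"

lemma LM_add:
  assumes J: "is_ideal J" and m: "m \<in> LM J"
  shows "u + m \<in> LM J"
proof -
  obtain f where f: "f \<in> J" "f \<noteq> 0" "m = Max (keys f)" using m by (auto simp: LM_def)
  have "Max (keys (monom u * f)) = u + m"
    unfolding keys_monom_mult f(3)
  proof (rule mono_Max_commute[symmetric])
    show "mono ((+) u)" by (rule monoI) (rule add_left_mono)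
  qed (use f(2) in simp_all)
  moreover have "monom u * f \<in> J" by (rule ideal_mult[OF J f(1)])
  moreover have "monom u * f \<noteq> 0"
  proof
    assume "monom u * f = 0"
    then have "(+) u ` keys f = {}" using keys_monom_mult[of u f] by simp
    then show False using f(2) by simp
  qed
  ultimately show ?thesis unfolding LM_def by (intro CollectI exI[of _ "monom u * f"] conjI) simp_all
qed

text \<open>Macaulay: replacing a leading monomial by smaller ones terminates, since there are finitely many
  monomials of degree \<open>N\<close>.\<close>

lemma std_monomials_basis:
  fixes J :: "('v::{finite,linorder}, 'k::field) mpoly set"
  assumes hom: "homogeneous_ideal J"
  shows "quot_basis (forms N) (J \<inter> forms N) (monom ` {m. mdeg m = N \<and> m \<notin> LM J})"
proof -
  note J = homogeneous_ideal_ideal[OF hom]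
  let ?B = "{m. mdeg m = N \<and> m \<notin> LM J}"
  have finB: "finite ?B" by (rule finite_subset[OF _ finite_mdeg[of N]]) auto
  define V where "V = {f. \<exists>c. f - lincomb c ?B \<in> J}"
  have V0: "f \<in> V" if "f \<in> J" for f
    unfolding V_def using that by (intro CollectI exI[of _ "\<lambda>_. 0"]) simp
  have Vadd: "f + g \<in> V" if fg: "f \<in> V" "g \<in> V" for f g
  proof -
    obtain c d where "f - lincomb c ?B \<in> J" "g - lincomb d ?B \<in> J"
      using fg by (auto simp: V_def)
    from ideal_add[OF J this] have "(f + g) - (\<Sum>b\<in>?B. scale (c b + d b) (monom b)) \<in> J"
      by (simp only: kvec.scale_left_distrib sum.distrib) (simp add: algebra_simps)
    then show ?thesis unfolding V_def by (intro CollectI exI[of _ "\<lambda>b. c b + d b"])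
  qed
  have Vscale: "scale a f \<in> V" if f: "f \<in> V" for a f
  proof -
    obtain c where "f - lincomb c ?B \<in> J" using f by (auto simp: V_def)
    from ideal_scale[OF J this, of a] have "scale a f - (\<Sum>b\<in>?B. scale (a * c b) (monom b)) \<in> J"
      by (simp add: kvec.scale_right_diff_distrib kvec.scale_sum_right)
    then show ?thesis unfolding V_def by (intro CollectI exI[of _ "\<lambda>b. a * c b"])
  qed
  have Vsum: "(\<Sum>i\<in>S. F i) \<in> V" if "\<And>i. i \<in> S \<Longrightarrow> F i \<in> V" for S and F :: "'v exps \<Rightarrow> ('v, 'k) mpoly"
    using that by (induction S rule: infinite_finite_induct) (auto intro: Vadd V0 ideal_zero[OF J])
  have Vmonom: "monom m \<in> V" if "mdeg m = N" for m
  proof -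
    have "\<forall>m\<in>{m'. mdeg m' = N \<and> m' \<le> m0}. monom m \<in> V" for m0
    proof (induction "card {m'. mdeg m' = N \<and> m' < m0}" arbitrary: m0 rule: less_induct)
      case less
      have fin: "finite {m'. mdeg m' = N \<and> m' < m0}" for m0 :: "'v exps"
        by (rule finite_subset[OF _ finite_mdeg[of N]]) auto
      have small: "monom m \<in> V" if m: "mdeg m = N" "m < m0" for m
      proof -
        have "{m'. mdeg m' = N \<and> m' < m} \<subset> {m'. mdeg m' = N \<and> m' < m0}" using m by auto
        then have "card {m'. mdeg m' = N \<and> m' < m} < card {m'. mdeg m' = N \<and> m' < m0}"
          by (rule psubset_card_mono[OF fin])
        from less[OF this] show ?thesis using m by simp
      qed
      have "monom m0 \<in> V" if m0: "mdeg m0 = N"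
      proof (cases "m0 \<in> LM J")
        case False
        let ?c = "\<lambda>b. if b = m0 then 1 else 0"
        have "lincomb ?c ?B = (\<Sum>b\<in>?B. if b = m0 then monom b else (0 :: ('v, 'k) mpoly))"
          by (intro sum.cong refl) auto
        also have "\<dots> = monom m0" using finB m0 False by (subst sum.delta) auto
        finally have "monom m0 - lincomb ?c ?B \<in> J" by (simp only: diff_self ideal_zero[OF J])
        then show ?thesis unfolding V_def by (intro CollectI exI[of _ ?c])
      next
        case True
        then obtain f where f: "f \<in> J" "f \<noteq> 0" "m0 = Max (keys f)" by (auto simp: LM_def)
        define g where "g = hom_component N f"
        have g: "g \<in> J" using hom f(1) by (simp add: g_def homogeneous_ideal_def)
        have mk: "m0 \<in> keys f" unfolding f(3) by (rule Max_in) (use f(2) in simp_all)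
        have kg: "keys g = {m \<in> keys f. mdeg m = N}" by (auto simp: g_def in_keys_iff lookup_hom_component split: if_splits)
        have gm: "lookup g m0 \<noteq> 0" using mk m0 by (simp add: g_def lookup_hom_component in_keys_iff)
        have "g = scale (lookup g m0) (monom m0) + (\<Sum>m\<in>keys g - {m0}. scale (lookup g m) (monom m))"
          using mpoly_expand_monom[of g] sum.remove[of "keys g" m0 "\<lambda>m. scale (lookup g m) (monom m)"] gm by (simp add: in_keys_iff)
        then have eq: "scale (lookup g m0) (monom m0) = g + (\<Sum>m\<in>keys g - {m0}. scale (- lookup g m) (monom m))"
          by (simp add: kvec.scale_minus_left sum_negf algebra_simps)
        have "scale (- lookup g m) (monom m) \<in> V" if "m \<in> keys g - {m0}" for m
        proof (rule Vscale[OF small])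
          have m: "m \<in> keys f" "mdeg m = N" using that unfolding kg by simp_all
          show "mdeg m = N" by (rule m(2))
          have "m \<le> m0" unfolding f(3) by (rule Max_ge[OF finite_keys m(1)])
          then show "m < m0" using that by auto
        qed
        then have "scale (lookup g m0) (monom m0) \<in> V" unfolding eq by (intro Vadd[OF V0[OF g]] Vsum)
        from Vscale[OF this, of "inverse (lookup g m0)"] show ?thesis using gm by simp
      qed
      then show ?case using small by (auto simp: le_less)
    qed
    then show ?thesis using that by auto
  qed
  have "f \<in> V" if f: "f \<in> forms N" for f
  proof -
    have "(\<Sum>m\<in>keys f. scale (lookup f m) (monom m)) \<in> V"
      using f by (intro Vsum Vscale Vmonom) (auto simp: forms_def)
    then show ?thesis by (simp only: mpoly_expand_monom)
  qed
  moreover have "c b = 0" if c: "lincomb c ?B \<in> J" and b: "b \<in> ?B" for c b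
  proof (rule ccontr)
    assume cb: "c b \<noteq> 0"
    let ?f = "\<Sum>b\<in>?B. scale (c b) (monom b)"
    have lf: "lookup ?f m = (if m \<in> ?B then c m else 0)" for m by (rule lookup_sum_scale_monom[OF finB])
    have bk: "b \<in> keys ?f" using cb b by (simp add: in_keys_iff lf)
    then have "?f \<noteq> 0" by auto
    then have "Max (keys ?f) \<in> LM J" using c by (auto simp: LM_def)
    moreover have "Max (keys ?f) \<in> ?B"
    proof (rule ccontr)
      assume n: "Max (keys ?f) \<notin> ?B"
      have "Max (keys ?f) \<in> keys ?f" using bk by (intro Max_in) auto
      moreover have "lookup ?f (Max (keys ?f)) = 0" unfolding lf using n by (simp only: if_False)
      ultimately show False unfolding in_keys_iff by (rule notE)
    qed
    ultimately show False by simp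
  qed
  ultimately show ?thesis unfolding monom_quot_basis_iff[OF J] V_def by blast
qed

lemma hilbert_function_std_monomials:
  fixes J :: "('v::{finite,linorder}, 'k::field) mpoly set"
  assumes "homogeneous_ideal J"
  shows "hilbert_function J N = card {m. mdeg m = N \<and> m \<notin> LM J}"
  by (rule hf_eq_card[OF homogeneous_ideal_ideal[OF assms] std_monomials_basis[OF assms]])

section \<open>Homogeneous primes\<close>

lemma hom_component_mult:
  "hom_component N (f * g) = (\<Sum>i\<le>N. hom_component i f * hom_component (N - i) g)"
proof -
  let ?D = "mdeg ` keys f \<union> {..N}"
  have "(\<Sum>i\<in>?D. hom_component i f) = f" by (rule sum_hom_components) auto
  then have "f * g = (\<Sum>i\<in>?D. hom_component i f * g)" by (simp only: sum_distrib_right[symmetric])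
  then have "hom_component N (f * g) = (\<Sum>i\<in>?D. hom_component N (hom_component i f * g))"
    by (simp only: hom_component_sum)
  also have "\<dots> = (\<Sum>i\<le>N. hom_component i f * hom_component (N - i) g)"
  proof (rule sum.mono_neutral_cong_right)
    show "\<forall>i\<in>?D - {..N}. hom_component N (hom_component i f * g) = 0"
      by (intro ballI hom_component_form_mult_less[OF hom_component_in_forms]) auto
    show "hom_component N (hom_component i f * g) = hom_component i f * hom_component (N - i) g" if "i \<in> {..N}" for i
      using hom_component_form_mult[OF hom_component_in_forms, of i "N - i" f g] that by simp
  qed auto
  finally show ?thesis .
qed

text \<open>For a product of two elements outside \<open>P\<close>, look at the lowest components outside
  \<open>P\<close>.\<close>

lemma homogeneous_prime_idealI:
  fixes P :: "('v, 'k::comm_ring_1) mpoly set"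
  assumes hom: "homogeneous_ideal P" and "1 \<notin> P"
    and forms_prime: "\<And>f g d e. f \<in> forms d \<Longrightarrow> g \<in> forms e \<Longrightarrow> f * g \<in> P \<Longrightarrow> f \<in> P \<or> g \<in> P"
  shows "prime_ideal P"
  unfolding prime_ideal_def
proof (intro conjI allI impI)
  show J: "is_ideal P" by (rule homogeneous_ideal_ideal[OF hom])
  show "P \<noteq> UNIV" using assms(2) by auto
  fix f g assume fg: "f * g \<in> P"
  show "f \<in> P \<or> g \<in> P"
  proof (rule ccontr)
    assume *: "\<not> (f \<in> P \<or> g \<in> P)"
    then have ex: "\<exists>d. hom_component d f \<notin> P" "\<exists>d. hom_component d g \<notin> P"
      using homogeneous_ideal_mem_iff[OF hom] by blast+
    define d where "d = (LEAST d. hom_component d f \<notin> P)"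
    define e where "e = (LEAST e. hom_component e g \<notin> P)"
    have d: "hom_component d f \<notin> P" unfolding d_def using ex(1) by (rule LeastI_ex)
    have e: "hom_component e g \<notin> P" unfolding e_def using ex(2) by (rule LeastI_ex)
    have dl: "hom_component i f \<in> P" if "i < d" for i using not_less_Least that unfolding d_def by blast
    have el: "hom_component i g \<in> P" if "i < e" for i using not_less_Least that unfolding e_def by blast
    have "hom_component (d + e) (f * g) = hom_component d f * hom_component e g + (\<Sum>i\<in>{..d + e} - {d}. hom_component i f * hom_component (d + e - i) g)"
      unfolding hom_component_mult by (subst sum.remove[of _ d]) auto
    moreover have "(\<Sum>i\<in>{..d + e} - {d}. hom_component i f * hom_component (d + e - i) g) \<in> P"
    proof (rule ideal_sum[OF J])
      fix i assume i: "i \<in> {..d + e} - {d}"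
      show "hom_component i f * hom_component (d + e - i) g \<in> P"
      proof (cases "i < d")
        case True
        then show ?thesis by (intro ideal_mult2[OF J] dl)
      next
        case False
        then show ?thesis using i by (intro ideal_mult[OF J] el) auto
      qed
    qed
    moreover have "hom_component (d + e) (f * g) \<in> P" using hom fg by (simp add: homogeneous_ideal_def)
    ultimately have "(hom_component d f * hom_component e g + (\<Sum>i\<in>{..d + e} - {d}. hom_component i f * hom_component (d + e - i) g))
       - (\<Sum>i\<in>{..d + e} - {d}. hom_component i f * hom_component (d + e - i) g) \<in> P"
      by (intro ideal_diff[OF J]) simp_all
    then have "hom_component d f * hom_component e g \<in> P" by simp
    then show False using forms_prime[OF hom_component_in_forms hom_component_in_forms] d e by blast
  qed
qed

definition add_gen :: "('v, 'k::comm_ring_1) mpoly set \<Rightarrow> ('v, 'k) mpoly \<Rightarrow> ('v, 'k) mpoly set" where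
  "add_gen I f = {q + a * f | q a. q \<in> I}"

lemma add_gen_homogeneous:
  assumes hom: "homogeneous_ideal I" and f: "f \<in> forms e"
  shows "homogeneous_ideal (add_gen I f)" "I \<subseteq> add_gen I f" "f \<in> add_gen I f"
proof -
  note J = homogeneous_ideal_ideal[OF hom]
  have mem: "q + a * f \<in> add_gen I f" if "q \<in> I" for q a using that by (auto simp: add_gen_def)
  show "I \<subseteq> add_gen I f" using mem[where a = 0] by auto
  show "f \<in> add_gen I f" using mem[OF ideal_zero[OF J], of 1] by simp
  have "is_ideal (add_gen I f)"
  proof (rule is_idealI)
    show "0 \<in> add_gen I f" using mem[OF ideal_zero[OF J], of 0] by simp
    fix g assume "g \<in> add_gen I f"
    then obtain q a where g: "g = q + a * f" "q \<in> I" by (auto simp: add_gen_def)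
    show "c * g \<in> add_gen I f" for c
      using mem[OF ideal_mult[OF J g(2), of c], of "c * a"] by (simp add: g(1) distrib_left mult.assoc)
    fix g' assume "g' \<in> add_gen I f"
    then obtain q' a' where g': "g' = q' + a' * f" "q' \<in> I" by (auto simp: add_gen_def)
    show "g + g' \<in> add_gen I f"
      using mem[OF ideal_add[OF J g(2) g'(2)], of "a + a'"] by (simp add: g(1) g'(1) algebra_simps)
  qed
  moreover have "hom_component d g \<in> add_gen I f" if g: "g \<in> add_gen I f" for g d
  proof -
    obtain q a where qa: "g = q + a * f" "q \<in> I" using g by (auto simp: add_gen_def)
    have q: "hom_component d q \<in> I" using hom qa(2) by (simp add: homogeneous_ideal_def)
    show ?thesis
    proof (cases "e \<le> d")
      case True
      have "hom_component d (a * f) = hom_component (d - e) a * f"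
        using hom_component_form_mult[OF f, of "d - e" a] True by (simp add: mult.commute)
      then show ?thesis using mem[OF q, of "hom_component (d - e) a"] by (simp add: qa(1) hom_component_add)
    next
      case False
      then have "hom_component d (a * f) = 0"
        using hom_component_form_mult_less[OF f, of d a] by (simp add: mult.commute)
      then show ?thesis using mem[OF q, of 0] by (simp add: qa(1) hom_component_add)
    qed
  qed
  ultimately show "homogeneous_ideal (add_gen I f)" by (simp add: homogeneous_ideal_def)
qed

text \<open>Krull: a homogeneous ideal that is maximal among those disjoint from the multiplicative set
  \<open>T\<close>. Since \<open>P\<close> is homogeneous, it is enough to test primality on forms.\<close>

lemma homogeneous_prime_avoiding:
  fixes I :: "('v, 'k::field) mpoly set"
  assumes hom: "homogeneous_ideal I" and T: "1 \<in> T" "\<And>s t. s \<in> T \<Longrightarrow> t \<in> T \<Longrightarrow> s * t \<in> T" and disj: "I \<inter> T = {}"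
  shows "\<exists>P. homogeneous_ideal P \<and> prime_ideal P \<and> I \<subseteq> P \<and> P \<inter> T = {}"
proof -
  let ?\<A> = "{Q. homogeneous_ideal Q \<and> I \<subseteq> Q \<and> Q \<inter> T = {}}"
  have "\<exists>M\<in>?\<A>. \<forall>Q\<in>?\<A>. M \<subseteq> Q \<longrightarrow> Q = M"
  proof (rule subset_Zorn_nonempty)
    show "?\<A> \<noteq> {}" using hom disj by auto
    fix \<C> assume \<C>: "\<C> \<noteq> {}" "subset.chain ?\<A> \<C>"
    have mem: "homogeneous_ideal Q" "is_ideal Q" "I \<subseteq> Q" "Q \<inter> T = {}" if "Q \<in> \<C>" for Q
      using \<C>(2) that homogeneous_ideal_ideal unfolding subset_chain_def by auto
    have "is_ideal (\<Union>\<C>)"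
    proof (rule is_idealI)
      obtain Q where "Q \<in> \<C>" using \<C>(1) by auto
      then show "0 \<in> \<Union>\<C>" using ideal_zero[OF mem(2)] by auto
      show "g * f \<in> \<Union>\<C>" if "f \<in> \<Union>\<C>" for f g using that ideal_mult[OF mem(2)] by auto
      fix f g assume "f \<in> \<Union>\<C>" "g \<in> \<Union>\<C>"
      then obtain Q Q' where Q: "Q \<in> \<C>" "f \<in> Q" "Q' \<in> \<C>" "g \<in> Q'" by auto
      then have "Q \<subseteq> Q' \<or> Q' \<subseteq> Q" using \<C>(2) unfolding subset_chain_def by auto
      then have "f + g \<in> Q \<or> f + g \<in> Q'"
      proof
        assume "Q \<subseteq> Q'"
        then have "f \<in> Q'" using Q(2) by (rule subsetD)
        then show ?thesis using ideal_add[OF mem(2)[OF Q(3)] _ Q(4)] by simp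
      next
        assume "Q' \<subseteq> Q"
        then have "g \<in> Q" using Q(4) by (rule subsetD)
        then show ?thesis using ideal_add[OF mem(2)[OF Q(1)] Q(2)] by simp
      qed
      then show "f + g \<in> \<Union>\<C>" using Q by auto
    qed
    moreover have "hom_component d f \<in> \<Union>\<C>" if f: "f \<in> \<Union>\<C>" for f d
    proof -
      obtain Q where Q: "Q \<in> \<C>" "f \<in> Q" using f by auto
      then have "hom_component d f \<in> Q" using mem(1)[OF Q(1)] by (simp add: homogeneous_ideal_def)
      then show ?thesis using Q(1) by auto
    qed
    ultimately have "homogeneous_ideal (\<Union>\<C>)" by (simp add: homogeneous_ideal_def)
    moreover have "I \<subseteq> \<Union>\<C>" using \<C>(1) mem(3) by auto
    moreover have "\<Union>\<C> \<inter> T = {}" using mem(4) by auto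
    ultimately show "\<Union>\<C> \<in> ?\<A>" by simp
  qed
  then obtain P where "P \<in> ?\<A>" and mx0: "\<forall>Q\<in>?\<A>. P \<subseteq> Q \<longrightarrow> Q = P" by (elim bexE)
  then have P: "homogeneous_ideal P" "I \<subseteq> P" "P \<inter> T = {}" by simp_all
  have mx: "Q = P" if "homogeneous_ideal Q" "I \<subseteq> Q" "Q \<inter> T = {}" "P \<subseteq> Q" for Q
    using that by (intro mx0[THEN bspec, THEN mp]) simp_all
  note J = homogeneous_ideal_ideal[OF P(1)]
  have meet: "\<exists>q a. q \<in> P \<and> q + a * f \<in> T" if f: "f \<in> forms d" "f \<notin> P" for f d
  proof (rule ccontr)
    assume "\<not> ?thesis"
    then have "add_gen P f \<inter> T = {}" by (auto simp: add_gen_def)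
    then have "add_gen P f = P"
      using P(2) add_gen_homogeneous[OF P(1) f(1)] by (intro mx) auto
    then show False using add_gen_homogeneous(3)[OF P(1) f(1)] f(2) by simp
  qed
  have "prime_ideal P"
  proof (rule homogeneous_prime_idealI[OF P(1)])
    show "1 \<notin> P" using P(3) T(1) by auto
    fix f g d e assume fg: "f \<in> forms d" "g \<in> forms e" "f * g \<in> P"
    show "f \<in> P \<or> g \<in> P"
    proof (rule ccontr)
      assume n: "\<not> (f \<in> P \<or> g \<in> P)"
      then have nf: "f \<notin> P" "g \<notin> P" by simp_all
      obtain q a where q: "q \<in> P" "q + a * f \<in> T" using meet[OF fg(1) nf(1)] by (elim exE conjE)
      obtain r b where r: "r \<in> P" "r + b * g \<in> T" using meet[OF fg(2) nf(2)] by (elim exE conjE)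
      have "(q + a * f) * (r + b * g) = (r + b * g) * q + ((a * f) * r + (a * b) * (f * g))"
        by (simp add: algebra_simps)
      also have "\<dots> \<in> P" by (intro ideal_add[OF J] ideal_mult[OF J] q r fg)
      finally show False using T(2)[OF q(2) r(2)] P(3) by auto
    qed
  qed
  then show ?thesis using P by blast
qed

section \<open>Zero-dimensional ideals have bounded Hilbert function\<close>

text \<open>If every pair of variables satisfies a relation in \<open>I\<close>, every standard monomial has
  two bounded exponents, and there are boundedly many of each degree.\<close>

lemma independent_variables_exist:
  fixes I :: "(3, 'k::field) mpoly set"
  assumes hom: "homogeneous_ideal I" and unb: "\<not> (\<exists>b. \<forall>N. hilbert_function I N \<le> b)"
  shows "\<exists>i j. i \<noteq> j \<and> (\<forall>f\<in>I. f \<noteq> 0 \<longrightarrow> (\<exists>m\<in>keys f. \<not> keys m \<subseteq> {i, j}))"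
proof (rule ccontr)
  note J = homogeneous_ideal_ideal[OF hom]
  assume "\<not> ?thesis"
  then have *: "\<exists>f\<in>I. f \<noteq> 0 \<and> (\<forall>m\<in>keys f. keys m \<subseteq> {i, j})" if "i \<noteq> j" for i j
    using that by metis
  have "\<exists>m\<in>LM I. keys m \<subseteq> {i, j}" if ij: "i \<noteq> j" for i j
  proof -
    obtain f where f: "f \<in> I" "f \<noteq> 0" "\<forall>m\<in>keys f. keys m \<subseteq> {i, j}" using *[OF ij] by (elim bexE conjE)
    have "Max (keys f) \<in> keys f" using f(2) by (intro Max_in) auto
    then show ?thesis using f unfolding LM_def by (intro bexI[of _ "Max (keys f)"]) auto
  qed
  then obtain \<mu> where \<mu>: "\<And>i j. i \<noteq> j \<Longrightarrow> \<mu> i j \<in> LM I" "\<And>i j. i \<noteq> j \<Longrightarrow> keys (\<mu> i j) \<subseteq> {i, j}"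
    by metis
  define D where "D = mdeg (\<mu> 0 1) + mdeg (\<mu> 0 2) + mdeg (\<mu> 1 2)"
  have std: "lookup m i < D \<or> lookup m j < D" if m: "m \<notin> LM I" and ij: "i \<noteq> j" and D: "mdeg (\<mu> i j) \<le> D" for m and i j :: 3
  proof (rule ccontr)
    assume n: "\<not> (lookup m i < D \<or> lookup m j < D)"
    have "lookup (\<mu> i j) v \<le> lookup m v" for v
    proof (cases "v \<in> {i, j}")
      case True
      then show ?thesis using n D lookup_le_mdeg[of "\<mu> i j" v] by auto
    next
      case False
      then have "v \<notin> keys (\<mu> i j)" using \<mu>(2)[OF ij] by blast
      then show ?thesis by (simp add: in_keys_iff)
    qed
    then have "m = (m - \<mu> i j) + \<mu> i j" by (intro poly_mapping_eqI) (simp add: lookup_add lookup_minus)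
    then show False using LM_add[OF J \<mu>(1)[OF ij], of "m - \<mu> i j"] m by simp
  qed
  let ?P = "{..<D} \<times> {..<D}"
  let ?F = "\<lambda>N. (\<lambda>(s, t). ex3 (N - s - t) s t) ` ?P \<union> (\<lambda>(s, t). ex3 s (N - s - t) t) ` ?P \<union> (\<lambda>(s, t). ex3 s t (N - s - t)) ` ?P"
  have "hilbert_function I N \<le> D * D + D * D + D * D" for N
  proof -
    have "{m. mdeg m = N \<and> m \<notin> LM I} \<subseteq> ?F N"
    proof
      fix m assume "m \<in> {m. mdeg m = N \<and> m \<notin> LM I}"
      then have m: "lookup m 0 + lookup m 1 + lookup m 2 = N" "m \<notin> LM I" by (auto simp: mdeg_3)
      have "lookup m 0 < D \<or> lookup m 1 < D" "lookup m 0 < D \<or> lookup m 2 < D" "lookup m 1 < D \<or> lookup m 2 < D"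
        by (intro std m(2); simp add: D_def)+
      then consider "lookup m 1 < D" "lookup m 2 < D" | "lookup m 0 < D" "lookup m 2 < D" | "lookup m 0 < D" "lookup m 1 < D"
        by linarith
      then show "m \<in> ?F N"
      proof cases
        case 1
        have "m = ex3 (N - lookup m 1 - lookup m 2) (lookup m 1) (lookup m 2)" by (rule ex3_eqI) (use m in simp_all)
        then have "m \<in> (\<lambda>(s, t). ex3 (N - s - t) s t) ` ?P" using 1 by (intro image_eqI[of _ _ "(lookup m 1, lookup m 2)"]) simp_all
        then show ?thesis by simp
      next
        case 2
        have "m = ex3 (lookup m 0) (N - lookup m 0 - lookup m 2) (lookup m 2)" by (rule ex3_eqI) (use m in simp_all)
        then have "m \<in> (\<lambda>(s, t). ex3 s (N - s - t) t) ` ?P" using 2 by (intro image_eqI[of _ _ "(lookup m 0, lookup m 2)"]) simp_all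
        then show ?thesis by simp
      next
        case 3
        have "m = ex3 (lookup m 0) (lookup m 1) (N - lookup m 0 - lookup m 1)" by (rule ex3_eqI) (use m in simp_all)
        then have "m \<in> (\<lambda>(s, t). ex3 s t (N - s - t)) ` ?P" using 3 by (intro image_eqI[of _ _ "(lookup m 0, lookup m 1)"]) simp_all
        then show ?thesis by simp
      qed
    qed
    then have "card {m. mdeg m = N \<and> m \<notin> LM I} \<le> card (?F N)" by (intro card_mono) auto
    also have "\<dots> \<le> card ((\<lambda>(s, t). ex3 (N - s - t) s t) ` ?P) + card ((\<lambda>(s, t). ex3 s (N - s - t) t) ` ?P) + card ((\<lambda>(s, t). ex3 s t (N - s - t)) ` ?P)"
      by (intro order_trans[OF card_Un_le] add_right_mono card_Un_le)
    also have "\<dots> \<le> card ?P + card ?P + card ?P"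
      by (intro add_mono card_image_le) simp_all
    finally show ?thesis by (simp add: hilbert_function_std_monomials[OF hom])
  qed
  then show False using unb by blast
qed

lemma pvar_power: "pvar v ^ k = (monom (single v k) :: ('v, 'k::comm_ring_1) mpoly)"
proof (induction k)
  case (Suc k)
  then show ?case by (simp add: monom_mult flip: single_add)
qed simp

lemma high_forms_in_ideal:
  fixes Q :: "(3, 'k::field) mpoly set"
  assumes J: "is_ideal Q" and pow: "\<And>v. pvar v ^ k v \<in> Q" and f: "f \<in> forms N" and N: "k 0 + k 1 + k 2 \<le> N"
  shows "f \<in> Q"
proof -
  have mon: "monom m \<in> Q" if m: "mdeg m = N" for m
  proof -
    have "\<exists>v. k v \<le> lookup m v"
    proof (rule ccontr)
      assume "\<not> ?thesis"
      then have "lookup m 0 < k 0" "lookup m 1 < k 1" "lookup m 2 < k 2" by (auto simp: not_le)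
      then show False using m N by (simp add: mdeg_3)
    qed
    then obtain v where v: "k v \<le> lookup m v" ..
    have meq: "m = (m - single v (k v)) + single v (k v)"
      using v by (intro poly_mapping_eqI) (auto simp: lookup_add lookup_minus lookup_single when_def)
    have "monom m = (monom ((m - single v (k v)) + single v (k v)) :: (3, 'k) mpoly)" by (rule arg_cong[OF meq])
    also have "\<dots> = monom (m - single v (k v)) * pvar v ^ k v" by (simp only: pvar_power monom_mult)
    also have "\<dots> \<in> Q" by (rule ideal_mult[OF J pow])
    finally show ?thesis .
  qed
  have "(\<Sum>m\<in>keys f. scale (lookup f m) (monom m)) \<in> Q"
    using f by (intro ideal_sum[OF J] ideal_scale[OF J] mon) (auto simp: forms_def)
  then show ?thesis by (simp add: mpoly_expand_monom)
qed

text \<open>Otherwise all forms of degree at least some \<open>K\<close> are in \<open>Q\<close> plus the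
  multiples of \<open>x\<^sub>i\<close>. Then powers of \<open>x\<^sub>i\<close> times monomials of degree
  \<open>K\<close> span all higher degrees modulo \<open>Q\<close>, and the Hilbert function of \<open>Q\<close>
  is bounded; but the monomials in \<open>x\<^sub>i, x\<^sub>j\<close> make it unbounded.\<close>

lemma relevant_after_adding_variable:
  fixes Q :: "(3, 'k::field) mpoly set"
  assumes hom: "homogeneous_ideal Q" and ij: "i \<noteq> j"
    and ind: "\<forall>f\<in>Q. (\<forall>m\<in>keys f. keys m \<subseteq> {i, j}) \<longrightarrow> f = 0"
  shows "\<exists>v. \<forall>k. pvar v ^ k \<notin> add_gen Q (pvar i)"
proof (rule ccontr)
  note J = homogeneous_ideal_ideal[OF hom]
  assume "\<not> ?thesis"
  then have "\<forall>v. \<exists>k. pvar v ^ k \<in> add_gen Q (pvar i)" by simp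
  from choice[OF this] obtain k where k: "\<forall>v. pvar v ^ k v \<in> add_gen Q (pvar i)" by (elim exE)
  define K where "K = k 0 + k 1 + k 2"
  have v1: "pvar i \<in> (forms 1 :: (3, 'k) mpoly set)" by simp
  have Q': "homogeneous_ideal (add_gen Q (pvar i))" by (rule add_gen_homogeneous(1)[OF hom v1])
  have in_Q': "f \<in> add_gen Q (pvar i)" if "f \<in> forms N" "K \<le> N" for f N
    by (rule high_forms_in_ideal[OF homogeneous_ideal_ideal[OF Q'] k[rule_format] that(1)]) (use that(2) in \<open>simp add: K_def\<close>)
  have span: "\<exists>c. f - (\<Sum>m\<in>deg_exps K. scale (c m) (pvar i ^ r * monom m)) \<in> Q" if "f \<in> forms (K + r)" for f r
    using that
  proof (induction r arbitrary: f)
    case 0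
    have "lincomb (lookup f) (deg_exps K) = f" using 0 by (intro form_expand) simp
    then have "f - (\<Sum>m\<in>deg_exps K. scale (lookup f m) (pvar i ^ 0 * monom m)) = 0" by simp
    then show ?case by (intro exI[of _ "lookup f"]) (simp add: ideal_zero[OF J])
  next
    case (Suc r)
    obtain q a where qa: "f = q + a * pvar i" "q \<in> Q" using in_Q'[OF Suc.prems] by (auto simp: add_gen_def)
    let ?a = "hom_component (K + r) a"
    have "f = hom_component (1 + (K + r)) f" using hom_component_forms[OF Suc.prems, of "1 + (K + r)"] by simp
    also have "\<dots> = hom_component (1 + (K + r)) q + pvar i * ?a"
      unfolding qa(1) hom_component_add using hom_component_form_mult[OF v1, of "K + r" a] by (simp add: mult.commute)
    finally have f: "f = hom_component (1 + (K + r)) q + pvar i * ?a" .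
    have q: "hom_component (1 + (K + r)) q \<in> Q" using hom qa(2) by (simp add: homogeneous_ideal_def)
    obtain c where c: "?a - (\<Sum>m\<in>deg_exps K. scale (c m) (pvar i ^ r * monom m)) \<in> Q"
      using Suc.IH[of ?a, OF hom_component_in_forms] by (elim exE)
    have "f - (\<Sum>m\<in>deg_exps K. scale (c m) (pvar i ^ Suc r * monom m))
        = hom_component (1 + (K + r)) q + pvar i * (?a - (\<Sum>m\<in>deg_exps K. scale (c m) (pvar i ^ r * monom m)))"
    proof -
      have "(\<Sum>m\<in>deg_exps K. scale (c m) (pvar i ^ Suc r * monom m)) = pvar i * (\<Sum>m\<in>deg_exps K. scale (c m) (pvar i ^ r * monom m :: (3, 'k) mpoly))"
        by (simp only: sum_distrib_left scale_mult_right power_Suc mult.assoc)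
      then show ?thesis by (simp only: f right_diff_distrib add_diff_eq)
    qed
    also have "\<dots> \<in> Q" by (rule ideal_add[OF J q ideal_mult[OF J c]])
    finally show ?case by (intro exI[of _ c])
  qed
  define N where "N = K + card (deg_exps K)"
  let ?m = "\<lambda>s. single i s + single j (N - s)"
  have "hilbert_function Q N \<le> card (deg_exps K)"
  proof (rule hf_le[OF J finite_mdeg, where u = "\<lambda>m. pvar i ^ card (deg_exps K) * monom m"])
    fix m :: "3 exps" assume m: "m \<in> deg_exps K"
    have "pvar i ^ card (deg_exps K) \<in> (forms (card (deg_exps K)) :: (3, 'k) mpoly set)"
      by (simp only: pvar_power monom_in_forms_iff mdeg_single)
    from forms_mult[OF this, of "monom m" K] m show "pvar i ^ card (deg_exps K) * monom m \<in> (forms N :: (3, 'k) mpoly set)"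
      by (simp add: N_def add.commute)
  next
    fix f :: "(3, 'k) mpoly" assume "f \<in> forms N"
    then show "\<exists>c. f - (\<Sum>x\<in>deg_exps K. scale (c x) (pvar i ^ card (deg_exps K) * monom x)) \<in> Q"
      unfolding N_def by (rule span)
  qed
  moreover have "card {..N} \<le> hilbert_function Q N"
  proof (rule hf_ge[OF J, where u = "\<lambda>s. monom (?m s)"])
    show "monom (?m s) \<in> (forms N :: (3, 'k) mpoly set)" if "s \<in> {..N}" for s
      using that by (simp add: mdeg_add)
    fix c s assume c: "(\<Sum>s\<in>{..N}. scale (c s) (monom (?m s))) \<in> Q" and s: "s \<in> {..N}"
    let ?f = "\<Sum>s\<in>{..N}. scale (c s) (monom (?m s))"
    have l: "lookup ?f m = (\<Sum>s\<in>{..N}. if ?m s = m then c s else 0)" for m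
      by (simp add: lookup_sum lookup_monom) (intro sum.cong refl, auto)
    have "\<forall>m\<in>keys ?f. keys m \<subseteq> {i, j}"
    proof
      fix m assume "m \<in> keys ?f"
      then have "(\<Sum>s\<in>{..N}. if ?m s = m then c s else 0) \<noteq> 0" unfolding in_keys_iff l .
      then have "\<exists>s. ?m s = m"
      proof (rule contrapos_np)
        assume "\<nexists>s. ?m s = m"
        then show "(\<Sum>s\<in>{..N}. if ?m s = m then c s else 0) = 0" by simp
      qed
      then obtain s where s: "?m s = m" by (elim exE)
      have "keys (?m s) \<subseteq> keys (single i s) \<union> keys (single j (N - s))" by (rule Poly_Mapping.keys_add)
      also have "\<dots> \<subseteq> {i, j}" by auto
      finally have "keys (?m s) \<subseteq> {i, j}" .
      then show "keys m \<subseteq> {i, j}" by (simp only: s)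
    qed
    then have "?f = 0" by (rule bspec[OF ind c, THEN mp])
    from arg_cong[OF this, of "\<lambda>g. lookup g (?m s)"]
    have "lookup ?f (?m s) = 0" by (simp only: lookup_zero)
    moreover have inj: "?m s' = ?m s \<longleftrightarrow> s' = s" for s'
    proof
      assume "?m s' = ?m s"
      then have "lookup (?m s') i = lookup (?m s) i" by simp
      then show "s' = s" using ij by (simp add: lookup_add lookup_single when_def)
    qed simp
    ultimately have "(\<Sum>s'\<in>{..N}. if s' = s then c s' else 0) = 0" unfolding l by (simp only: inj)
    then show "c s = 0" using s by (simp add: sum.delta)
  qed simp
  ultimately show False by (simp add: N_def)
qed

text \<open>If the Hilbert function is unbounded, some prime \<open>Q\<close> over \<open>I\<close> avoids all
  nonzero polynomials in two variables \<open>x\<^sub>i, x\<^sub>j\<close>, and a larger prime \<open>P\<close>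
  contains \<open>x\<^sub>i\<close> but not all variables. The closures of the points \<open>P\<close> and
  \<open>Q\<close> form a chain of length 1.\<close>

theorem zero_dimensional_bounded:
  fixes I :: "(3, 'k::field) mpoly set"
  assumes hom: "homogeneous_ideal I" and dim: "krull_dim (proj_space I) = 0"
  shows "\<exists>b. \<forall>N. hilbert_function I N \<le> b"
proof (rule ccontr)
  assume "\<not> ?thesis"
  from independent_variables_exist[OF hom this]
  obtain i j :: 3 where ij: "i \<noteq> j" and ind: "\<forall>f\<in>I. f \<noteq> 0 \<longrightarrow> (\<exists>m\<in>keys f. \<not> keys m \<subseteq> {i, j})"
    by (elim exE conjE)
  let ?T = "{f :: (3, 'k) mpoly. f \<noteq> 0 \<and> (\<forall>m\<in>keys f. keys m \<subseteq> {i, j})}"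
  have "\<exists>Q. homogeneous_ideal Q \<and> prime_ideal Q \<and> I \<subseteq> Q \<and> Q \<inter> ?T = {}"
  proof (rule homogeneous_prime_avoiding[OF hom])
    show "1 \<in> ?T" by simp
    show "I \<inter> ?T = {}" using ind by blast
    fix s t assume s: "s \<in> ?T" and t: "t \<in> ?T"
    have "keys m \<subseteq> {i, j}" if m: "m \<in> keys (s * t)" for m
    proof -
      obtain a b where ab: "m = a + b" "a \<in> keys s" "b \<in> keys t" using Poly_Mapping.keys_mult[of s t] m by auto
      then have "keys a \<subseteq> {i, j}" "keys b \<subseteq> {i, j}" using s t by auto
      then show ?thesis using Poly_Mapping.keys_add[of a b] unfolding ab(1) by blast
    qed
    then show "s * t \<in> ?T" using s t by simp
  qed
  then obtain Q where Q: "homogeneous_ideal Q" "prime_ideal Q" "I \<subseteq> Q" "Q \<inter> ?T = {}" by (elim exE conjE)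
  have iQ: "pvar i \<notin> Q"
  proof
    assume "pvar i \<in> Q"
    moreover have "pvar i \<in> ?T" by simp
    ultimately show False using Q(4) by blast
  qed
  have indQ: "\<forall>f\<in>Q. (\<forall>m\<in>keys f. keys m \<subseteq> {i, j}) \<longrightarrow> f = 0"
  proof (intro ballI impI, rule ccontr)
    fix f assume f: "f \<in> Q" "\<forall>m\<in>keys f. keys m \<subseteq> {i, j}" "f \<noteq> 0"
    then have "f \<in> Q \<inter> ?T" by simp
    then show False using Q(4) by simp
  qed
  obtain v where v: "\<forall>k. pvar v ^ k \<notin> add_gen Q (pvar i)"
    using relevant_after_adding_variable[OF Q(1) ij indQ] by (elim exE)
  have v1: "pvar i \<in> (forms 1 :: (3, 'k) mpoly set)" by simp
  note G = add_gen_homogeneous[OF Q(1) v1]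
  have "\<exists>P. homogeneous_ideal P \<and> prime_ideal P \<and> add_gen Q (pvar i) \<subseteq> P \<and> P \<inter> range (\<lambda>k. pvar v ^ k) = {}"
  proof (rule homogeneous_prime_avoiding[OF G(1)])
    show "1 \<in> range (\<lambda>k. pvar v ^ k :: (3, 'k) mpoly)" by (rule range_eqI[of _ _ 0]) simp
    show "add_gen Q (pvar i) \<inter> range (\<lambda>k. pvar v ^ k) = {}" using v by auto
    fix s t :: "(3, 'k) mpoly" assume "s \<in> range (\<lambda>k. pvar v ^ k)" "t \<in> range (\<lambda>k. pvar v ^ k)"
    then obtain k l where "s = pvar v ^ k" "t = pvar v ^ l" by (elim rangeE)
    then show "s * t \<in> range (\<lambda>k. pvar v ^ k)" by (intro range_eqI[of _ _ "k + l"]) (simp add: power_add)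
  qed
  then obtain P where P: "homogeneous_ideal P" "prime_ideal P" "add_gen Q (pvar i) \<subseteq> P" "P \<inter> range (\<lambda>k. pvar v ^ k) = {}"
    by (elim exE conjE)
  have QP: "Q \<subseteq> P" using G(2) P(3) by (rule subset_trans)
  have iP: "pvar i \<in> P" using G(3) P(3) by (rule subsetD[rotated])
  have vP: "pvar v \<notin> P"
  proof
    assume "pvar v \<in> P"
    moreover have "pvar v \<in> range (\<lambda>k. pvar v ^ k :: (3, 'k) mpoly)" by (rule range_eqI[of _ _ 1]) simp
    ultimately show False using P(4) by blast
  qed
  have pts: "P \<in> proj_points I" "Q \<in> proj_points I"
    using P(1,2) vP Q(1,2,3) iQ QP unfolding proj_points_def by (auto intro: exI[of _ v] exI[of _ i])
  let ?X = "proj_space I"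
  let ?D = "\<lambda>f. {P \<in> proj_points I. f \<notin> P}"
  have basic: "openin ?X (?D f)" if "f \<in> forms d" for f d
    unfolding proj_space_def openin_topology_generated_by_iff
    by (rule generate_topology_on.Basis) (use that in blast)
  have top: "P' \<in> topspace ?X" if P': "P' \<in> proj_points I" for P'
  proof -
    obtain w where w: "pvar w \<notin> P'" using P' unfolding proj_points_def by blast
    have "pvar w \<in> (forms 1 :: (3, 'k) mpoly set)" by simp
    from openin_subset[OF basic[OF this]] show ?thesis using w P' by auto
  qed
  have generic: "Q \<in> W" if W: "openin ?X W" and "P \<in> W" for W
  proof -
    have "P \<in> W \<longrightarrow> Q \<in> W"
      using W unfolding proj_space_def openin_topology_generated_by_iff
    proof induction
      case (Basis W)
      then obtain f where "W = ?D f" by blast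
      then show ?case using pts QP by auto
    qed auto
    then show ?thesis using that by simp
  qed
  define C where "C r = ?X closure_of {if r = 0 then P else Q}" for r :: nat
  have irr: "irreducible_closedin ?X (C r)" for r
    unfolding C_def by (rule closure_of_irreducible) (use top pts in auto)
  have mem: "(if r = 0 then P else Q) \<in> C r" for r
    unfolding C_def using closure_of_subset[of "{if r = 0 then P else Q}" ?X] top pts by auto
  have "C 0 \<subset> C 1"
  proof
    have "P \<in> C 1" unfolding C_def in_closure_of using top[OF pts(1)] generic by auto
    then show "C 0 \<subseteq> C 1" unfolding C_def by (intro closure_of_minimal) auto
    have "C 0 \<subseteq> topspace ?X - ?D (pvar i)"
      unfolding C_def
    proof (rule closure_of_minimal)
      show "{if 0 = (0::nat) then P else Q} \<subseteq> topspace ?X - ?D (pvar i)" using top[OF pts(1)] iP by auto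
      show "closedin ?X (topspace ?X - ?D (pvar i))" by (rule closedin_diff[OF closedin_topspace basic[OF v1]])
    qed
    then have "Q \<notin> C 0" using iQ pts(2) by auto
    moreover have "Q \<in> C 1" using mem[of 1] by simp
    ultimately show "C 0 \<noteq> C 1" by auto
  qed
  then have "enat 1 \<le> krull_dim ?X"
    unfolding krull_dim_def using irr by (intro Sup_upper CollectI exI[of _ 1] exI[of _ C]) auto
  then show False using dim by (simp add: zero_enat_def)
qed

section \<open>Extension of scalars to the algebraic closure\<close>

text \<open>Linear forms on the algebraic closure over the base field. Applying them to coefficients moves
  statements from the extended ideal down to \<open>I\<close>.\<close>

definition klin :: "('k::field alg_closure \<Rightarrow> 'k) \<Rightarrow> bool" where
  "klin \<phi> \<longleftrightarrow> (\<forall>x y. \<phi> (x + y) = \<phi> x + \<phi> y) \<and> (\<forall>c x. \<phi> (to_ac c * x) = c * \<phi> x)"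

lemma klinD:
  assumes "klin \<phi>"
  shows "\<phi> (x + y) = \<phi> x + \<phi> y" "\<phi> (to_ac c * x) = c * \<phi> x" "\<phi> 0 = 0"
proof -
  show *: "\<phi> (x + y) = \<phi> x + \<phi> y" "\<phi> (to_ac c * x) = c * \<phi> x" for x y c using assms by (auto simp: klin_def)
  show "\<phi> 0 = 0" using *(2)[of 0 0] by simp
qed

lemma klin_mult: "klin \<phi> \<Longrightarrow> klin (\<lambda>x. \<phi> (c * x))"
  unfolding klin_def distrib_left by (metis mult.left_commute)

lemma klin_separates:
  fixes x :: "'k::field alg_closure"
  assumes "\<And>\<phi>. klin \<phi> \<Longrightarrow> \<phi> x = 0"
  shows "x = 0"
proof (rule ccontr)
  assume x: "x \<noteq> 0"
  have ind: "acv.independent {x}" using x by simp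
  let ?E = "acv.extend_basis {x}"
  have E: "acv.independent ?E" "acv.span ?E = UNIV" "x \<in> ?E"
    using acv.independent_extend_basis[OF ind] acv.span_extend_basis[OF ind] acv.extend_basis_superset[OF ind] by auto
  let ?l = "\<lambda>y. acv.representation ?E y x"
  have "klin ?l"
    unfolding klin_def
  proof (intro conjI allI)
    show "?l (y + z) = ?l y + ?l z" for y z using E by (simp add: acv.representation_add)
    show "?l (to_ac c * y) = c * ?l y" for c y
      using acv.representation_scale[OF E(1), of y c] E(2) by (simp add: ac_scale_def)
  qed
  then have "?l x = 0" by (rule assms)
  moreover have "?l x = 1" using acv.representation_basis[OF E(1,3)] by simp
  ultimately show False by simp
qed

definition mapc :: "('a::zero \<Rightarrow> 'b::zero) \<Rightarrow> ('v exps \<Rightarrow>\<^sub>0 'a) \<Rightarrow> ('v exps \<Rightarrow>\<^sub>0 'b)" where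
  "mapc = Poly_Mapping.map"

lemma lookup_mapc: "\<phi> 0 = 0 \<Longrightarrow> lookup (mapc \<phi> f) m = \<phi> (lookup f m)"
  by (simp add: mapc_def Poly_Mapping.map.rep_eq when_def)

lemma mapc_add: "klin \<phi> \<Longrightarrow> mapc \<phi> (f + g) = mapc \<phi> f + mapc \<phi> g"
  by (rule poly_mapping_eqI) (simp add: lookup_mapc klinD lookup_add)

lemma mapc_sum: "klin \<phi> \<Longrightarrow> mapc \<phi> (\<Sum>i\<in>A. F i) = (\<Sum>i\<in>A. mapc \<phi> (F i))"
proof (induction A rule: infinite_finite_induct)
  case (insert x F)
  then show ?case by (simp add: mapc_add)
qed (auto intro!: poly_mapping_eqI simp: lookup_mapc klinD)

lemma mapc_scale: "klin \<phi> \<Longrightarrow> mapc \<phi> (scale c f) = mapc (\<lambda>x. \<phi> (c * x)) f"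
  by (rule poly_mapping_eqI) (simp add: lookup_mapc klinD)

lemma single_mult: "single m c * f = scale c (monom m * f)" for f :: "('v, 'k::comm_ring_1) mpoly"
  by (simp add: scale_def monom_def mult_single flip: mult.assoc)

lemma lookup_monom_mult_notin: "m \<notin> (+) u ` keys f \<Longrightarrow> lookup (monom u * f) m = 0"
  using keys_monom_mult[of u f] not_in_keys_iff_lookup_eq_zero[of m "monom u * f"] by simp

lemma mapc_monom_mult:
  assumes "klin \<phi>"
  shows "mapc \<phi> (monom u * f) = monom u * mapc \<phi> f"
proof (rule poly_mapping_eqI)
  fix m
  have z: "\<phi> 0 = 0" by (rule klinD(3)[OF assms])
  show "lookup (mapc \<phi> (monom u * f)) m = lookup (monom u * mapc \<phi> f) m"
  proof (cases "m \<in> range ((+) u)")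
    case True
    then obtain m' where "m = u + m'" by auto
    then show ?thesis using z by (simp add: lookup_mapc)
  next
    case False
    have "lookup (monom u * f) m = 0" by (rule lookup_monom_mult_notin) (use False in blast)
    moreover have "lookup (monom u * mapc \<phi> f) m = 0" by (rule lookup_monom_mult_notin) (use False in blast)
    ultimately show ?thesis using z by (simp add: lookup_mapc)
  qed
qed

definition ext :: "('v, 'k::field) mpoly \<Rightarrow> ('v, 'k alg_closure) mpoly" where
  "ext = mapc to_ac"

lemma lookup_ext [simp]: "lookup (ext f) m = to_ac (lookup f m)"
  by (simp add: ext_def lookup_mapc)

lemma ext_forms: "f \<in> forms d \<Longrightarrow> ext f \<in> forms d"
  by (auto simp: forms_def in_keys_iff)

lemma mapc_ext: "klin \<phi> \<Longrightarrow> mapc \<phi> (ext f) = scale (\<phi> 1) f"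
proof (rule poly_mapping_eqI)
  fix m assume l: "klin \<phi>"
  have "\<phi> (to_ac (lookup f m) * 1) = lookup f m * \<phi> 1" by (rule klinD(2)[OF l])
  then show "lookup (mapc \<phi> (ext f)) m = lookup (scale (\<phi> 1) f) m" using l by (simp add: lookup_mapc klinD mult.commute)
qed

lemma mapc_ext_mult:
  assumes "klin \<phi>" shows "mapc \<phi> (ext g * f) = g * mapc \<phi> f"
proof -
  have "ext g = (\<Sum>m\<in>keys g. single m (to_ac (lookup g m)))"
  proof (rule poly_mapping_eqI)
    fix k
    have "lookup (\<Sum>m\<in>keys g. single m (to_ac (lookup g m))) k = (\<Sum>m\<in>keys g. if m = k then to_ac (lookup g m) else 0)"
      by (simp add: lookup_sum lookup_single when_def)
    also have "\<dots> = to_ac (lookup g k)" by (subst sum.delta) (auto simp: in_keys_iff)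
    finally show "lookup (ext g) k = lookup (\<Sum>m\<in>keys g. single m (to_ac (lookup g m))) k" by simp
  qed
  then have "mapc \<phi> (ext g * f) = (\<Sum>m\<in>keys g. mapc \<phi> (single m (to_ac (lookup g m)) * f))"
    by (simp only: sum_distrib_right mapc_sum[OF assms])
  also have "\<dots> = (\<Sum>m\<in>keys g. single m (lookup g m) * mapc \<phi> f)"
  proof (intro sum.cong refl)
    fix m
    have "mapc \<phi> (single m (to_ac (lookup g m)) * f) = mapc \<phi> (scale (to_ac (lookup g m)) (monom m * f))"
      by (simp only: single_mult)
    also have "\<dots> = scale (lookup g m) (mapc \<phi> (monom m * f))"
      by (rule poly_mapping_eqI) (simp add: lookup_mapc klinD[OF assms])
    also have "\<dots> = single m (lookup g m) * mapc \<phi> f"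
      by (simp only: single_mult mapc_monom_mult[OF assms])
    finally show "mapc \<phi> (single m (to_ac (lookup g m)) * f) = single m (lookup g m) * mapc \<phi> f" .
  qed
  also have "\<dots> = g * mapc \<phi> f" by (simp only: sum_distrib_right[symmetric] mpoly_expand)
  finally show ?thesis .
qed

text \<open>The ideal generated by \<open>I\<close> over the algebraic closure: an element is in it iff its
  coordinates with respect to a basis of the closure over the base field lie in \<open>I\<close>.\<close>

definition ext_ideal :: "('v, 'k::field) mpoly set \<Rightarrow> ('v, 'k alg_closure) mpoly set" where
  "ext_ideal I = {f. \<forall>\<phi>. klin \<phi> \<longrightarrow> mapc \<phi> f \<in> I}"

lemma hom_component_mapc: "\<phi> 0 = 0 \<Longrightarrow> hom_component d (mapc \<phi> f) = mapc \<phi> (hom_component d f)"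
  by (rule poly_mapping_eqI) (simp add: lookup_hom_component lookup_mapc)

lemma ext_ideal_homogeneous:
  assumes hom: "homogeneous_ideal I" shows "homogeneous_ideal (ext_ideal I)"
proof -
  note J = homogeneous_ideal_ideal[OF hom]
  have "is_ideal (ext_ideal I)"
  proof (rule is_idealI)
    have "mapc \<phi> (0 :: ('a, 'b alg_closure) mpoly) = 0" if "klin \<phi>" for \<phi> :: "'b alg_closure \<Rightarrow> 'b"
      by (rule poly_mapping_eqI) (simp add: lookup_mapc klinD[OF that])
    then show "0 \<in> ext_ideal I" using ideal_zero[OF J] by (simp add: ext_ideal_def)
    show add: "f + g \<in> ext_ideal I" if "f \<in> ext_ideal I" "g \<in> ext_ideal I" for f g
      using that by (simp add: ext_ideal_def mapc_add ideal_add[OF J])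
    fix f g :: "('a, 'b alg_closure) mpoly" assume f: "f \<in> ext_ideal I"
    have s: "single m c * f \<in> ext_ideal I" for m c
      unfolding ext_ideal_def
    proof (intro CollectI allI impI)
      fix \<phi> :: "'b alg_closure \<Rightarrow> 'b" assume l: "klin \<phi>"
      have "mapc \<phi> (single m c * f) = monom m * mapc (\<lambda>x. \<phi> (c * x)) f"
        by (simp only: single_mult mapc_scale[OF l] mapc_monom_mult[OF klin_mult[OF l]])
      moreover have "mapc (\<lambda>x. \<phi> (c * x)) f \<in> I" using f klin_mult[OF l, of c] by (simp add: ext_ideal_def)
      ultimately show "mapc \<phi> (single m c * f) \<in> I" using ideal_mult[OF J] by simp
    qed
    have "(\<Sum>m\<in>K. single m (lookup g m) * f) \<in> ext_ideal I" for K
      by (induction K rule: infinite_finite_induct) (simp_all add: add s \<open>0 \<in> ext_ideal I\<close>)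
    from this[of "keys g"] show "g * f \<in> ext_ideal I" by (simp only: sum_distrib_right[symmetric] mpoly_expand)
  qed
  moreover have "hom_component d f \<in> ext_ideal I" if "f \<in> ext_ideal I" for f d
    unfolding ext_ideal_def
  proof (intro CollectI allI impI)
    fix \<phi> :: "'b alg_closure \<Rightarrow> 'b" assume l: "klin \<phi>"
    have "hom_component d (mapc \<phi> f) \<in> I" using that hom l by (simp add: ext_ideal_def homogeneous_ideal_def)
    then show "mapc \<phi> (hom_component d f) \<in> I" by (simp only: hom_component_mapc[where \<phi> = \<phi>, OF klinD(3)[OF l]])
  qed
  ultimately show ?thesis by (simp add: homogeneous_ideal_def)
qed

lemma ext_ideal_saturated:
  assumes "saturated_ideal I" shows "saturated_ideal (ext_ideal I)"
  unfolding saturated_ideal_def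
proof (intro allI impI, elim exE)
  fix f :: "('a, 'b alg_closure) mpoly" and k assume *: "\<forall>g\<in>forms k. g * f \<in> ext_ideal I"
  show "f \<in> ext_ideal I"
    unfolding ext_ideal_def
  proof (intro CollectI allI impI)
    fix \<phi> :: "'b alg_closure \<Rightarrow> 'b" assume l: "klin \<phi>"
    have "g * mapc \<phi> f \<in> I" if g: "g \<in> forms k" for g
    proof -
      have "ext g * f \<in> ext_ideal I" using *[THEN bspec, OF ext_forms[OF g]] .
      then have "mapc \<phi> (ext g * f) \<in> I" using l by (simp add: ext_ideal_def)
      then show ?thesis by (simp only: mapc_ext_mult[OF l])
    qed
    then have "\<exists>k. \<forall>g\<in>forms k. g * mapc \<phi> f \<in> I" by (intro exI[of _ k] ballI)
    then show "mapc \<phi> f \<in> I" using assms[unfolded saturated_ideal_def, THEN spec, THEN mp] by simp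
  qed
qed

lemma hilbert_function_ext_ideal:
  fixes I :: "('v::finite, 'k::field) mpoly set"
  assumes hom: "homogeneous_ideal I"
  shows "hilbert_function (ext_ideal I) = hilbert_function I"
proof
  fix N
  note J = homogeneous_ideal_ideal[OF hom]
  note J' = homogeneous_ideal_ideal[OF ext_ideal_homogeneous[OF hom]]
  obtain B where qb: "quot_basis (forms N) (I \<inter> forms N) (monom ` B)"
    using hf_basis_exists[OF J, of N] by (elim exE conjE)
  have B: "B \<subseteq> {m. mdeg m = N}"
    and ind: "\<forall>c. lincomb c B \<in> I \<longrightarrow> (\<forall>b\<in>B. c b = 0)"
    and spn: "\<forall>f\<in>forms N. \<exists>c. f - lincomb c B \<in> I"
    using qb[unfolded monom_quot_basis_iff[OF J]] by simp_all
  have fB: "finite B" by (rule finite_subset[OF B finite_mdeg])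
  have "quot_basis (forms N) (ext_ideal I \<inter> forms N) (monom ` B)"
    unfolding monom_quot_basis_iff[OF J']
  proof (intro conjI B allI impI ballI)
    fix c :: "'v exps \<Rightarrow> 'k alg_closure" and b assume c: "lincomb c B \<in> ext_ideal I" and b: "b \<in> B"
    show "c b = 0"
    proof (rule klin_separates)
      fix \<phi> :: "'k alg_closure \<Rightarrow> 'k" assume l: "klin \<phi>"
      have eq: "mapc \<phi> (lincomb c B) = (\<Sum>b\<in>B. scale (\<phi> (c b)) (monom b))"
        unfolding mapc_sum[OF l]
        by (intro sum.cong refl poly_mapping_eqI) (simp add: lookup_mapc klinD[OF l] lookup_monom)
      have "mapc \<phi> (lincomb c B) \<in> I" using c l by (simp add: ext_ideal_def)
      then have "(\<Sum>b\<in>B. scale (\<phi> (c b)) (monom b)) \<in> I" by (simp only: eq)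
      from ind[THEN spec[of _ "\<lambda>b. \<phi> (c b)"], THEN mp, OF this] show "\<phi> (c b) = 0" using b by simp
    qed
  next
    fix f :: "('v, 'k alg_closure) mpoly" assume f: "f \<in> forms N"
    have "\<exists>c. monom m - lincomb c B \<in> ext_ideal I" if m: "mdeg m = N" for m
    proof -
      obtain c where c: "monom m - lincomb c B \<in> I" using spn[THEN bspec, of "monom m"] m by auto
      have eq: "ext (monom m - lincomb c B) = monom m - (\<Sum>b\<in>B. scale (to_ac (c b)) (monom b))"
        by (rule poly_mapping_eqI) (auto simp: lookup_minus lookup_sum lookup_monom to_ac_sum intro!: sum.cong)
      have "ext (monom m - lincomb c B) \<in> ext_ideal I"
        using c by (simp add: ext_ideal_def mapc_ext ideal_scale[OF J])
      then show ?thesis unfolding eq by (intro exI[of _ "\<lambda>b. to_ac (c b)"])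
    qed
    then have "\<forall>m. \<exists>c. mdeg m = N \<longrightarrow> monom m - lincomb c B \<in> ext_ideal I" by blast
    from choice[OF this] obtain d where d: "\<forall>m. mdeg m = N \<longrightarrow> monom m - lincomb (d m) B \<in> ext_ideal I"
      by (elim exE)
    let ?c = "\<lambda>b. \<Sum>m\<in>keys f. lookup f m * d m b"
    have "(\<Sum>m\<in>keys f. scale (lookup f m) (monom m - lincomb (d m) B)) \<in> ext_ideal I"
      using f d by (intro ideal_sum[OF J'] ideal_scale[OF J']) (auto simp: forms_def)
    also have "(\<Sum>m\<in>keys f. scale (lookup f m) (monom m - lincomb (d m) B)) = f - lincomb ?c B"
    proof -
      have "(\<Sum>b\<in>B. scale (?c b) (monom b :: ('v, 'k alg_closure) mpoly)) = (\<Sum>b\<in>B. \<Sum>m\<in>keys f. scale (lookup f m) (scale (d m b) (monom b)))"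
        by (simp add: kvec.scale_sum_left)
      also have "\<dots> = (\<Sum>m\<in>keys f. scale (lookup f m) (lincomb (d m) B))"
        by (subst sum.swap) (simp only: kvec.scale_sum_right)
      finally show ?thesis by (simp only: kvec.scale_right_diff_distrib sum_subtractf mpoly_expand_monom)
    qed
    finally show "\<exists>c. f - lincomb c B \<in> ext_ideal I" by (intro exI[of _ ?c])
  qed
  from hf_eq_card[OF J' this] hf_eq_card[OF J qb]
  show "hilbert_function (ext_ideal I) N = hilbert_function I N" by simp
qed

section \<open>First differences of Hilbert functions\<close>

lemma ex3_less_var0: "ex3 0 s l < single 0 (Suc 0)"
proof -
  have "less_fun (lookup (ex3 0 s l)) (lookup (single (0 :: 3) (Suc 0)))"
    unfolding less_fun_def
  proof (intro exI[of _ 0] conjI allI impI)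
    show "lookup (ex3 0 s l) 0 < lookup (single 0 (Suc 0)) 0" by (simp add: lookup_single)
    fix k' :: 3 assume "k' < 0"
    moreover have "\<not> k' < 0" unfolding less_bit1_def bit1.Rep_0 using Rep_bit1[of k'] by simp
    ultimately show "lookup (ex3 0 s l) k' = lookup (single 0 (Suc 0)) k'" by simp
  qed
  then show ?thesis by (simp add: less_poly_mapping.rep_eq)
qed

lemma LM_lin: 
  assumes "is_ideal J" "lin a \<in> J" shows "single 0 1 \<in> LM J"
proof -
  have e: "single 0 1 = ex3 1 0 0" "single 1 1 = ex3 0 1 0" "single 2 1 = ex3 0 0 1"
    by (rule ex3_eqI; simp add: lookup_single)+
  have l: "lookup (lin a) m = (if m = ex3 1 0 0 then 1 else if m = ex3 0 1 0 then a else if m = ex3 0 0 1 then a\<^sup>2 else 0)" for m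
    unfolding lin_def e by (auto simp: lookup_add lookup_monom)
  have k: "single 0 1 \<in> keys (lin a)" unfolding e by (simp add: in_keys_iff l)
  have "Max (keys (lin a)) = single 0 1"
  proof (rule Max_eqI[OF finite_keys _ k])
    fix m assume "m \<in> keys (lin a)"
    then have "m = single 0 1 \<or> m = ex3 0 1 0 \<or> m = ex3 0 0 1" unfolding e by (auto simp: in_keys_iff l split: if_splits)
    then show "m \<le> single 0 1" using ex3_less_var0[of 1 0] ex3_less_var0[of 0 1] by auto
  qed
  moreover have "lin a \<noteq> 0" using k by auto
  ultimately show ?thesis using assms(2) unfolding LM_def by (intro CollectI exI[of _ "lin a"]) simp
qed

context
  fixes J :: "(3, 'k::field) mpoly set" and a :: 'k
  assumes hom: "homogeneous_ideal J" and nzd: "\<And>f. lin a * f \<in> J \<Longrightarrow> f \<in> J"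
begin

lemma is_ideal_J: "is_ideal J" by (rule homogeneous_ideal_ideal[OF hom])

lemma hf_hyperplane_0: "hilbert_function (add_gen J (lin a)) 0 = hilbert_function J 0"
proof -
  have "add_gen J (lin a) \<inter> forms 0 = J \<inter> forms 0"
  proof (intro equalityI subsetI)
    fix f assume f: "f \<in> add_gen J (lin a) \<inter> forms 0"
    then obtain q b where qb: "f = q + b * lin a" "q \<in> J" by (auto simp: add_gen_def)
    have "f = hom_component 0 f" using f hom_component_forms[of f 0 0] by simp
    also have "\<dots> = hom_component 0 q"
      using hom_component_form_mult_less[OF lin_form, of 0 a b] by (simp add: qb(1) hom_component_add mult.commute)
    also have "\<dots> \<in> J" using hom qb(2) by (simp add: homogeneous_ideal_def)
    finally show "f \<in> J \<inter> forms 0" using f by simp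
  qed (use add_gen_homogeneous(2)[OF hom lin_form] in auto)
  then show ?thesis by (simp add: hilbert_function_def)
qed

text \<open>Multiplication by the nonzerodivisor \<open>lin a\<close> gives the exact sequence that relates
  the quotients by \<open>J\<close> and by \<open>J + (lin a)\<close>.\<close>

lemma hf_hyperplane_Suc: "hilbert_function J (Suc N) = hilbert_function J N + hilbert_function (add_gen J (lin a)) (Suc N)"
proof -
  let ?J' = "add_gen J (lin a)"
  note G = add_gen_homogeneous[OF hom lin_form, of a]
  note J' = homogeneous_ideal_ideal[OF G(1)]
  obtain B where qB: "quot_basis (forms N) (J \<inter> forms N) (monom ` B)" using hf_basis_exists[OF is_ideal_J, of N] by (elim exE conjE)
  obtain B' where qB': "quot_basis (forms (Suc N)) (?J' \<inter> forms (Suc N)) (monom ` B')"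
    using hf_basis_exists[OF J', of "Suc N"] by (elim exE conjE)
  have B: "B \<subseteq> {m. mdeg m = N}"
    and ind: "\<forall>c. lincomb c B \<in> J \<longrightarrow> (\<forall>b\<in>B. c b = 0)"
    and spn: "\<forall>f\<in>forms N. \<exists>c. f - lincomb c B \<in> J"
    using qB[unfolded monom_quot_basis_iff[OF is_ideal_J]] by simp_all
  have B': "B' \<subseteq> {m. mdeg m = Suc N}"
    and ind': "\<forall>c. lincomb c B' \<in> ?J' \<longrightarrow> (\<forall>b\<in>B'. c b = 0)"
    and spn': "\<forall>f\<in>forms (Suc N). \<exists>c. f - lincomb c B' \<in> ?J'"
    using qB'[unfolded monom_quot_basis_iff[OF J']] by simp_all
  have fB: "finite B" "finite B'" using finite_subset[OF B finite_mdeg] finite_subset[OF B' finite_mdeg] by auto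
  let ?u = "case_sum (\<lambda>b. lin a * monom b) monom :: _ \<Rightarrow> (3, 'k) mpoly"
  have split: "(\<Sum>x\<in>B <+> B'. scale (c x) (?u x)) = lin a * (\<Sum>b\<in>B. scale (c (Inl b)) (monom b)) + (\<Sum>b\<in>B'. scale (c (Inr b)) (monom b))" for c
    using fB by (simp add: sum.Plus sum_distrib_left scale_mult_right)
  have lin_in: "lin a * f \<in> ?J'" for f using ideal_mult2[OF J' G(3)] .
  have "hilbert_function J (Suc N) = card (B <+> B')"
  proof (rule hf_eqI[OF is_ideal_J, where u = ?u])
    show "finite (B <+> B')" using fB by simp
    show "?u x \<in> forms (Suc N)" if "x \<in> B <+> B'" for x
      using that B B' forms_mult[OF lin_form, of _ N a] by (auto simp: subset_eq)
    fix c x assume c: "(\<Sum>x\<in>B <+> B'. scale (c x) (?u x)) \<in> J" and x: "x \<in> B <+> B'"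
    let ?s = "\<Sum>b\<in>B. scale (c (Inl b)) (monom b)" and ?s' = "\<Sum>b\<in>B'. scale (c (Inr b)) (monom b)"
    have "lin a * ?s + ?s' \<in> ?J'" using c G(2) unfolding split by (rule_tac subsetD)
    from ideal_diff[OF J' this lin_in[of ?s]] have "?s' \<in> ?J'" by simp
    from ind'[THEN spec[of _ "\<lambda>b. c (Inr b)"], THEN mp, OF this] have r: "\<forall>b\<in>B'. c (Inr b) = 0" .
    then have "?s' = 0" by simp
    then have "lin a * ?s \<in> J" using c unfolding split by simp
    then have "?s \<in> J" by (rule nzd)
    from ind[THEN spec[of _ "\<lambda>b. c (Inl b)"], THEN mp, OF this] have l: "\<forall>b\<in>B. c (Inl b) = 0" .
    show "c x = 0" using x l r by auto
  next
    fix f :: "(3, 'k) mpoly" assume f: "f \<in> forms (Suc N)"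
    obtain c' where c': "f - lincomb c' B' \<in> ?J'" using spn'[THEN bspec, OF f] by (elim exE)
    let ?g = "f - lincomb c' B'"
    have g: "?g \<in> forms (Suc N)" using f B' by (intro forms_diff forms_sum forms_scale) auto
    obtain q b where qb: "?g = q + b * lin a" "q \<in> J" using c' unfolding add_gen_def by (elim CollectE exE conjE)
    let ?b = "hom_component N b"
    have "?g = hom_component (1 + N) ?g" using hom_component_forms[OF g, of "1 + N"] by simp
    also have "\<dots> = hom_component (1 + N) q + lin a * ?b"
      unfolding qb(1) hom_component_add using hom_component_form_mult[OF lin_form, of N a b] by (simp add: mult.commute)
    finally have g2: "?g = hom_component (1 + N) q + lin a * ?b" .
    have q: "hom_component (1 + N) q \<in> J" using hom qb(2) by (simp add: homogeneous_ideal_def)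
    obtain c where c: "?b - lincomb c B \<in> J" using spn[THEN bspec, OF hom_component_in_forms[of N b]] by (elim exE)
    have "f - (\<Sum>x\<in>B <+> B'. scale (case_sum c c' x) (?u x)) = ?g - lin a * (lincomb c B)"
      unfolding split by simp
    also have "\<dots> = hom_component (1 + N) q + lin a * (?b - lincomb c B)"
      unfolding g2 by (simp only: right_diff_distrib add_diff_eq)
    also have "\<dots> \<in> J" by (rule ideal_add[OF is_ideal_J q ideal_mult[OF is_ideal_J c]])
    finally show "\<exists>c. f - (\<Sum>x\<in>B <+> B'. scale (c x) (?u x)) \<in> J" by (intro exI[of _ "case_sum c c'"])
  qed
  also have "\<dots> = card B + card B'" using fB by (simp add: card_Plus)
  finally show ?thesis by (simp add: hf_eq_card[OF is_ideal_J qB] hf_eq_card[OF J' qB'])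
qed

lemma hf_sum: "hilbert_function J N = (\<Sum>i\<le>N. hilbert_function (add_gen J (lin a)) i)"
  by (induction N) (simp_all add: hf_hyperplane_0 hf_hyperplane_Suc)

text \<open>The variable 0 is a leading monomial, so standard monomials involve two variables only. The
  \<open>card (M N)\<close> leading monomials among these in degree \<open>N\<close>, if there are any, have
  at least one more multiple in degree \<open>N + 1\<close>.\<close>

lemma hf_hyperplane_shape:
  defines "g \<equiv> hilbert_function (add_gen J (lin a))"
  shows "g N \<le> Suc N" "g N \<le> N \<Longrightarrow> g (Suc N) \<le> g N"
proof -
  let ?J' = "add_gen J (lin a)"
  note G = add_gen_homogeneous[OF hom lin_form, of a]
  note J' = homogeneous_ideal_ideal[OF G(1)]
  have x: "single 0 1 \<in> LM ?J'" by (rule LM_lin[OF J' G(3)])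
  define M where "M N = {s \<in> {..N}. ex3 0 s (N - s) \<in> LM ?J'}" for N
  have g: "g N = Suc N - card (M N)" for N
  proof -
    have "{m. mdeg m = N \<and> m \<notin> LM ?J'} = (\<lambda>s. ex3 0 s (N - s)) ` ({..N} - M N)"
    proof (intro equalityI subsetI)
      fix m assume "m \<in> {m. mdeg m = N \<and> m \<notin> LM ?J'}"
      then have m: "lookup m 0 + lookup m 1 + lookup m 2 = N" "m \<notin> LM ?J'" by (auto simp: mdeg_3)
      have "lookup m 0 = 0"
      proof (rule ccontr)
        assume "lookup m 0 \<noteq> 0"
        then have "m = (m - single 0 1) + single 0 1"
          by (intro poly_mapping_eqI) (auto simp: lookup_add lookup_minus lookup_single when_def)
        then show False using LM_add[OF J' x, of "m - single 0 1"] m(2) by simp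
      qed
      then have "m = ex3 0 (lookup m 1) (N - lookup m 1)" using m(1) by (intro ex3_eqI) simp_all
      then show "m \<in> (\<lambda>s. ex3 0 s (N - s)) ` ({..N} - M N)"
        using m by (intro image_eqI[of _ _ "lookup m 1"]) (simp_all add: M_def)
    qed (auto simp: M_def)
    then have "g N = card ((\<lambda>s. ex3 0 s (N - s)) ` ({..N} - M N))"
      by (simp add: g_def hilbert_function_std_monomials[OF G(1)])
    also have "\<dots> = card ({..N} - M N)" by (rule card_image) (auto simp: inj_on_def)
    also have "\<dots> = Suc N - card (M N)" by (subst card_Diff_subset) (auto simp: M_def)
    finally show ?thesis .
  qed
  show "g N \<le> Suc N" by (simp add: g)
  assume "g N \<le> N"
  then have ne: "M N \<noteq> {}" by (auto simp: g)
  have fin: "finite (M N)" for N by (simp add: M_def)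
  have y: "M N \<subseteq> M (Suc N)"
  proof
    fix s assume s: "s \<in> M N"
    have "ex3 0 s (Suc N - s) = single 2 1 + ex3 0 s (N - s)"
      using s by (intro ex3_eqI[symmetric]) (auto simp: lookup_add lookup_single M_def)
    then show "s \<in> M (Suc N)" using s LM_add[OF J', of "ex3 0 s (N - s)" "single 2 1"] by (simp add: M_def)
  qed
  have z: "Suc ` M N \<subseteq> M (Suc N)"
  proof
    fix s' assume "s' \<in> Suc ` M N"
    then obtain s where s: "s' = Suc s" "s \<in> M N" by auto
    have "ex3 0 (Suc s) (N - s) = single 1 1 + ex3 0 s (N - s)"
      using s by (intro ex3_eqI[symmetric]) (auto simp: lookup_add lookup_single M_def)
    then show "s' \<in> M (Suc N)" using s LM_add[OF J', of "ex3 0 s (N - s)" "single 1 1"] by (simp add: M_def)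
  qed
  have "Suc (Max (M N)) \<notin> M N" using Max_ge[OF fin, of "Suc (Max (M N))" N] by auto
  then have "Suc (card (M N)) = card (insert (Suc (Max (M N))) (M N))" using fin by simp
  also have "\<dots> \<le> card (M (Suc N))"
    using y z Max_in[OF fin ne] by (intro card_mono fin) auto
  finally show "g (Suc N) \<le> g N" by (simp add: g)
qed

end

section \<open>Monomial ideals and lex-segment ideals in two variables\<close>

definition monomials_in :: "'v exps set \<Rightarrow> ('v, 'k::comm_ring_1) mpoly set" where
  "monomials_in M = {f. keys f \<subseteq> M}"

lemma monomials_in_ideal:
  fixes M :: "'v exps set"
  assumes up: "\<And>u w. u \<in> M \<Longrightarrow> w + u \<in> M"
  shows "is_ideal (monomials_in M :: ('v, 'k::comm_ring_1) mpoly set)"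
proof (rule is_idealI)
  show "0 \<in> monomials_in M" by (simp add: monomials_in_def)
  show "f + g \<in> monomials_in M" if "f \<in> monomials_in M" "g \<in> monomials_in M" for f g :: "('v, 'k) mpoly"
    using that Poly_Mapping.keys_add[of f g] unfolding monomials_in_def by auto
  show "g * f \<in> monomials_in M" if f: "f \<in> monomials_in M" for f g :: "('v, 'k) mpoly"
    using Poly_Mapping.keys_mult[of g f] f up unfolding monomials_in_def by auto
qed

lemma monomial_ideal_generated:
  fixes A :: "'v exps set"
  shows "ideal_generated (monom ` A) = (monomials_in {w + u | w u. u \<in> A} :: ('v, 'k::comm_ring_1) mpoly set)"
proof
  let ?M = "{w + u | w u. u \<in> A}"
  have up: "w + u \<in> ?M" if u: "u \<in> ?M" for u w
  proof -
    obtain w' a where "u = w' + a" "a \<in> A" using u by blast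
    then show ?thesis by (intro CollectI exI[of _ "w + w'"] exI[of _ a]) (simp add: add.assoc)
  qed
  show "ideal_generated (monom ` A) \<subseteq> (monomials_in ?M :: ('v, 'k) mpoly set)"
  proof (rule self_module.span_minimal)
    show "monom ` A \<subseteq> (monomials_in ?M :: ('v, 'k) mpoly set)"
    proof
      fix f :: "('v, 'k) mpoly" assume "f \<in> monom ` A"
      then obtain a where a: "f = monom a" "a \<in> A" by blast
      then have "a \<in> ?M" by (intro CollectI exI[of _ 0] exI[of _ a]) simp
      then show "f \<in> monomials_in ?M" by (simp add: a(1) monomials_in_def)
    qed
    show "is_ideal (monomials_in ?M :: ('v, 'k) mpoly set)" by (rule monomials_in_ideal[OF up])
  qed
  show "(monomials_in ?M :: ('v, 'k) mpoly set) \<subseteq> ideal_generated (monom ` A)"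
  proof
    fix f :: "('v, 'k) mpoly" assume f: "f \<in> monomials_in ?M"
    have "single m (lookup f m) \<in> ideal_generated (monom ` A)" if m: "m \<in> keys f" for m
    proof -
      obtain w u where wu: "m = w + u" "u \<in> A" using f m unfolding monomials_in_def by blast
      have "single m (lookup f m) = single w (lookup f m) * monom u" by (simp add: wu(1) monom_def mult_single)
      then show ?thesis using wu(2) by (simp add: self_module.span_scale self_module.span_base)
    qed
    then have "(\<Sum>m\<in>keys f. single m (lookup f m)) \<in> ideal_generated (monom ` A)" by (rule self_module.span_sum)
    then show "f \<in> ideal_generated (monom ` A)" by (simp only: mpoly_expand)
  qed
qed

lemma monomials_in_basis:
  fixes M :: "'v exps set" and f :: "('v, 'k::field) mpoly"
  assumes B: "finite B" "B \<inter> M = {}"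
  shows "lincomb c B \<in> (monomials_in M :: ('v, 'k) mpoly set) \<Longrightarrow> x \<in> B \<Longrightarrow> c x = 0"
    and "keys f \<subseteq> B \<union> M \<Longrightarrow> f - lincomb (lookup f) B \<in> monomials_in M"
proof -
  assume c: "lincomb c B \<in> (monomials_in M :: ('v, 'k) mpoly set)" and x: "x \<in> B"
  have "x \<notin> keys (lincomb c B)" using c x B(2) unfolding monomials_in_def by blast
  then have "lookup (lincomb c B) x = 0" by (simp only: not_in_keys_iff_lookup_eq_zero)
  then show "c x = 0" unfolding lookup_sum_scale_monom[OF B(1)] using x by (simp only: if_True)
next
  assume f: "keys f \<subseteq> B \<union> M"
  show "f - lincomb (lookup f) B \<in> monomials_in M"
    unfolding monomials_in_def
  proof (intro CollectI subsetI)
    fix m assume m: "m \<in> keys (f - lincomb (lookup f) B)"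
    have "lookup (f - lincomb (lookup f) B) m = lookup f m - (if m \<in> B then lookup f m else 0)"
      by (simp only: lookup_minus lookup_sum_scale_monom[OF B(1)])
    with m have "m \<notin> B \<and> m \<in> keys f" by (auto simp: in_keys_iff split: if_splits)
    then show "m \<in> M" using f by blast
  qed
qed

lemma monomials_in_hf:
  fixes M :: "'v::finite exps set"
  assumes up: "\<And>u w. u \<in> M \<Longrightarrow> w + u \<in> M"
  shows "hilbert_function (monomials_in M :: ('v, 'k::field) mpoly set) i = card {m. mdeg m = i \<and> m \<notin> M}"
proof -
  let ?B = "{m. mdeg m = i \<and> m \<notin> M}"
  have B: "finite ?B" "?B \<inter> M = {}" by (rule finite_subset[OF _ finite_mdeg[of i]]) auto
  note basis = monomials_in_basis[OF B, where 'k = 'k]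
  show ?thesis
  proof (rule hf_eqI[OF monomials_in_ideal[OF up] B(1), where u = monom])
    fix c x assume "lincomb c ?B \<in> (monomials_in M :: ('v, 'k) mpoly set)" "x \<in> ?B"
    then show "c x = 0" by (rule basis(1))
  next
    fix f :: "('v, 'k) mpoly" assume "f \<in> forms i"
    then have "keys f \<subseteq> ?B \<union> M" by (auto simp: forms_def)
    from basis(2)[OF this] show "\<exists>c. f - lincomb c ?B \<in> monomials_in M" by (intro exI[of _ "lookup f"])
  qed auto
qed

lemma monomials_in_quot_dim:
  fixes M :: "'v exps set"
  assumes up: "\<And>u w. u \<in> M \<Longrightarrow> w + u \<in> M" and fin: "finite (- M)"
  shows "quot_dim UNIV (monomials_in M :: ('v, 'k::field) mpoly set) = card (- M)"
proof -
  note basis = monomials_in_basis[OF fin, where 'k = 'k and M = M]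
  show ?thesis
  proof (rule quot_dim_eqI[OF ideal_subspace[OF monomials_in_ideal], where u = monom])
    show "w + u \<in> M" if "u \<in> M" for u w using that by (rule up)
    show "indep_mod (monomials_in M :: ('v, 'k) mpoly set) (- M) monom"
      unfolding indep_mod_def by (intro conjI fin allI impI ballI basis(1)) auto
    show "span_mod UNIV (monomials_in M :: ('v, 'k) mpoly set) (- M) monom"
      unfolding span_mod_def by (intro conjI fin ballI exI, rule basis(2)) auto
  qed (rule subset_UNIV)
qed

subsection \<open>Exponents in two variables\<close>

definition ex2 :: "nat \<Rightarrow> nat \<Rightarrow> 2 exps" where
  "ex2 a b = single 0 a + single 1 b"

lemma UNIV_2': "(UNIV :: 2 set) = {0, 1}"
proof -
  have "{0, 1} = (UNIV :: 2 set)" by (rule card_subset_eq) simp_all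
  then show ?thesis ..
qed

lemma all_2: "(\<forall>v::2. P v) \<longleftrightarrow> P 0 \<and> P 1"
proof -
  have "(\<forall>v::2. P v) \<longleftrightarrow> (\<forall>v\<in>UNIV. P v)" by simp
  then show ?thesis unfolding UNIV_2' by simp
qed

lemma lookup_ex2 [simp]: "lookup (ex2 a b) 0 = a" "lookup (ex2 a b) 1 = b"
  by (simp_all add: ex2_def lookup_add lookup_single when_def)

lemma mdeg_2: "mdeg (m :: 2 exps) = lookup m 0 + lookup m 1"
  unfolding mdeg_UNIV UNIV_2' by simp

lemma mdeg_ex2 [simp]: "mdeg (ex2 a b) = a + b"
  by (simp add: mdeg_2)

lemma ex2_eqI: "lookup m 0 = a \<Longrightarrow> lookup m 1 = b \<Longrightarrow> m = ex2 a b"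
  by (rule poly_mapping_eqI) (use all_2[of "\<lambda>v. lookup m v = lookup (ex2 a b) v"] in simp)

lemma ex2_eq_iff [simp]: "ex2 a b = ex2 a' b' \<longleftrightarrow> a = a' \<and> b = b'"
  by (metis lookup_ex2)

text \<open>If the first exponents agree, so do the second ones, because the degrees are equal.\<close>

lemma less_2_iff:
  fixes u v :: "2 exps"
  assumes d: "mdeg u = mdeg v"
  shows "u < v \<longleftrightarrow> lookup u 0 < lookup v 0"
proof
  have zero: "\<not> k < (0 :: 2)" for k unfolding less_bit0_def bit0.Rep_0 using Rep_bit0[of k] by simp
  assume "u < v"
  then obtain k where k: "lookup u k < lookup v k" "\<forall>k'<k. lookup u k' = lookup v k'"
    by (auto simp: less_poly_mapping.rep_eq less_fun_def)
  have "k = 0 \<or> k = 1" using all_2[of "\<lambda>v. v = 0 \<or> v = 1"] by simp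
  then show "lookup u 0 < lookup v 0"
  proof
    assume k1: "k = 1"
    have "(0 :: 2) < 1" unfolding less_bit0_def bit0.Rep_0 bit0.Rep_1 by simp
    then have "lookup u 0 = lookup v 0" using k(2) k1 by blast
    then show ?thesis using k(1) k1 d by (simp add: mdeg_2)
  qed (use k in simp)
next
  have zero: "\<not> k < (0 :: 2)" for k unfolding less_bit0_def bit0.Rep_0 using Rep_bit0[of k] by simp
  assume "lookup u 0 < lookup v 0"
  then show "u < v" unfolding less_poly_mapping.rep_eq less_fun_def using zero by (intro exI[of _ 0] conjI allI impI) simp_all
qed

subsection \<open>Lex-segment ideals\<close>

lemma down_closed_nat:
  fixes S :: "nat set"
  assumes fin: "finite S" and down: "\<And>a b. a \<in> S \<Longrightarrow> b < a \<Longrightarrow> b \<in> S"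
  shows "S = {..<card S}"
proof (cases "S = {}")
  case False
  have e: "S = {..Max S}"
  proof (intro equalityI subsetI)
    fix b assume "b \<in> {..Max S}"
    then show "b \<in> S" using down[OF Max_in[OF fin False], of b] Max_in[OF fin False] by (cases "b = Max S") auto
  qed (use fin in auto)
  have "card S = card {..Max S}" by (rule arg_cong[OF e])
  then have "{..<card S} = {..Max S}" by (simp add: lessThan_Suc_atMost)
  with e show ?thesis by (rule trans[OF _ sym])
qed simp

text \<open>The first differences that occur for \<open>n\<close> points. From the first \<open>N\<close> with
  \<open>g N \<le> N\<close> on, \<open>g\<close> is weakly decreasing.\<close>

locale hshape =
  fixes g :: "nat \<Rightarrow> nat" and n :: nat
  assumes g_le: "g N \<le> Suc N" and g_dec: "g N \<le> N \<Longrightarrow> g (Suc N) \<le> g N"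
    and g_total: "\<exists>M. (\<forall>N\<ge>M. g N = 0) \<and> (\<Sum>i<M. g i) = n"
begin

lemma g_anti:
  assumes j: "g N \<le> j" "j \<le> N" and N': "N \<le> N'"
  shows "g N' \<le> j"
  using N'
proof (induction N' rule: dec_induct)
  case base
  show ?case by (rule j(1))
next
  case (step N')
  then have "g N' \<le> N'" "g N' \<le> j" using j by auto
  then show ?case using g_dec[of N'] by simp
qed

lemma g_sum_le: "(\<Sum>i<N. g i) \<le> n"
proof -
  obtain M where M: "\<forall>N\<ge>M. g N = 0" "(\<Sum>i<M. g i) = n" using g_total by blast
  have "(\<Sum>i<N. g i) \<le> (\<Sum>i<max N M. g i)" by (intro sum_mono2) auto
  also have "\<dots> = (\<Sum>i<M. g i)" by (rule sum.mono_neutral_right) (use M in auto)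
  finally show ?thesis using M by simp
qed

lemma g_zero: "n \<le> N \<Longrightarrow> g N = 0"
proof (rule ccontr)
  assume N: "n \<le> N" "g N \<noteq> 0"
  have "1 \<le> g i" if "i \<le> N" for i
  proof (rule ccontr)
    assume "\<not> 1 \<le> g i"
    then have "g N \<le> 0" using that by (intro g_anti[of i 0 N]) auto
    then show False using N by simp
  qed
  then have "(\<Sum>i<Suc N. 1) \<le> (\<Sum>i<Suc N. g i)" by (intro sum_mono) simp
  then show False using g_sum_le[of "Suc N"] N by simp
qed

lemma g_sum: "n \<le> N \<Longrightarrow> (\<Sum>i<N. g i) = n"
proof -
  assume N: "n \<le> N"
  obtain M where M: "\<forall>N\<ge>M. g N = 0" "(\<Sum>i<M. g i) = n" using g_total by blast
  have "(\<Sum>i<N. g i) = (\<Sum>i<max N M. g i)" by (rule sum.mono_neutral_left) (use N g_zero in auto)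
  also have "\<dots> = (\<Sum>i<M. g i)" by (rule sum.mono_neutral_right) (use M in auto)
  finally show ?thesis using M by simp
qed

definition lex_exps :: "2 exps set" where
  "lex_exps = {m. g (mdeg m) \<le> lookup m 0}"

lemma lex_exps_up: "u \<in> lex_exps \<Longrightarrow> w + u \<in> lex_exps"
proof -
  assume "u \<in> lex_exps"
  then have "g (mdeg u) \<le> lookup u 0" by (simp add: lex_exps_def)
  then have "g (mdeg (w + u)) \<le> lookup u 0" by (rule g_anti) (simp_all add: lookup_le_mdeg mdeg_add)
  then show ?thesis by (simp add: lex_exps_def lookup_add)
qed

lemma card_not_lex_exps: "card {m. mdeg m = i \<and> m \<notin> lex_exps} = g i"
proof -
  have "{m. mdeg m = i \<and> m \<notin> lex_exps} = (\<lambda>a. ex2 a (i - a)) ` {..<g i}"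
  proof (intro equalityI subsetI)
    fix m assume "m \<in> {m. mdeg m = i \<and> m \<notin> lex_exps}"
    then have m: "lookup m 0 + lookup m 1 = i" "lookup m 0 < g i" by (auto simp: lex_exps_def mdeg_2)
    have "m = ex2 (lookup m 0) (i - lookup m 0)" by (rule ex2_eqI) (use m in simp_all)
    then show "m \<in> (\<lambda>a. ex2 a (i - a)) ` {..<g i}" using m(2) by blast
  next
    fix m assume "m \<in> (\<lambda>a. ex2 a (i - a)) ` {..<g i}"
    then obtain a where a: "m = ex2 a (i - a)" "a < g i" by blast
    then show "m \<in> {m. mdeg m = i \<and> m \<notin> lex_exps}" using g_le[of i] by (simp add: lex_exps_def)
  qed
  moreover have "card ((\<lambda>a. ex2 a (i - a)) ` {..<g i}) = card {..<g i}" by (rule card_image) (auto simp: inj_on_def)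
  ultimately show ?thesis by simp
qed

text \<open>Exponents of the first variable beyond \<open>d\<close> need no new generators, because
  \<open>g\<close> stays at most \<open>d\<close> from degree \<open>d\<close> on.\<close>

lemma lex_ideal_generators:
  assumes d: "g d \<le> d"
  shows "\<exists>A. finite A \<and> card A \<le> Suc d \<and> lex_exps = {w + u | w u. u \<in> A}"
proof -
  define b where "b j = (LEAST b. g (j + b) \<le> j)" for j
  have b: "g (j + b j) \<le> j" for j
    unfolding b_def by (rule LeastI[of _ n]) (simp add: g_zero)
  have bl: "b j \<le> c" if "g (j + c) \<le> j" for j c
    unfolding b_def using that by (rule Least_le)
  let ?A = "(\<lambda>j. ex2 j (b j)) ` {..d}"
  have A: "ex2 j (b j) \<in> lex_exps" for j using b by (simp add: lex_exps_def)
  have "lex_exps = {w + u | w u. u \<in> ?A}"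
  proof (intro equalityI subsetI)
    fix m assume "m \<in> lex_exps"
    then have m: "g (lookup m 0 + lookup m 1) \<le> lookup m 0" by (simp add: lex_exps_def mdeg_2)
    define j where "j = min (lookup m 0) d"
    have "g (j + lookup m 1) \<le> j"
    proof (cases "lookup m 0 \<le> d")
      case True
      then show ?thesis using m by (simp add: j_def)
    next
      case False
      then have "j = d" by (simp add: j_def)
      then show ?thesis using g_anti[OF d order_refl, of "d + lookup m 1"] by simp
    qed
    then have "b j \<le> lookup m 1" by (rule bl)
    then have "m = (m - ex2 j (b j)) + ex2 j (b j)"
      by (intro poly_mapping_eqI, unfold lookup_add lookup_minus)
        (use all_2[of "\<lambda>v. lookup m v = lookup m v - lookup (ex2 j (b j)) v + lookup (ex2 j (b j)) v"] in \<open>simp add: j_def\<close>)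
    moreover have "ex2 j (b j) \<in> ?A" by (simp add: j_def)
    ultimately show "m \<in> {w + u | w u. u \<in> ?A}" by (intro CollectI exI[of _ "m - ex2 j (b j)"] exI[of _ "ex2 j (b j)"] conjI)
  next
    fix m assume "m \<in> {w + u | w u. u \<in> ?A}"
    then show "m \<in> lex_exps" using A lex_exps_up by auto
  qed
  moreover have "card ?A \<le> Suc d" using card_image_le[of "{..d}" "\<lambda>j. ex2 j (b j)"] by simp
  ultimately show ?thesis by (intro exI[of _ ?A]) simp
qed

lemma lex_segment_monomials_in: "lex_segment_ideal (monomials_in lex_exps :: (2, 'k::comm_ring_1) mpoly set)"
proof -
  have n: "g n \<le> n" using g_zero[of n] by simp
  obtain A where A: "lex_exps = {w + u | w u. u \<in> A}" using lex_ideal_generators[OF n] by blast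
  have "monomial_ideal (monomials_in lex_exps :: (2, 'k) mpoly set)"
    unfolding monomial_ideal_def by (rule exI[of _ A]) (simp only: monomial_ideal_generated A)
  moreover have "monom v \<in> (monomials_in lex_exps :: (2, 'k) mpoly set)"
    if "monom u \<in> (monomials_in lex_exps :: (2, 'k) mpoly set)" "mdeg v = mdeg u" "u < v" for u v
    using that less_2_iff[of u v] by (simp add: monomials_in_def lex_exps_def)
  ultimately show ?thesis unfolding lex_segment_ideal_def by blast
qed

text \<open>In each degree the monomials outside a lex-segment ideal are those with the smallest exponents of
  the first variable, so their number determines them.\<close>

lemma lex_segment_unique:
  fixes L :: "(2, 'k::field) mpoly set"
  assumes L: "lex_segment_ideal L" and hf: "\<And>i. hilbert_function L i = g i"
  shows "L = monomials_in lex_exps"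
proof -
  obtain A where A: "L = ideal_generated (monom ` A)" using L by (auto simp: lex_segment_ideal_def monomial_ideal_def)
  define M where "M = {w + u | w u. u \<in> A}"
  have LM: "L = monomials_in M" unfolding A M_def by (rule monomial_ideal_generated)
  have up: "w + u \<in> M" if u: "u \<in> M" for u w
  proof -
    obtain w' a where "u = w' + a" "a \<in> A" using u by (auto simp: M_def)
    then show ?thesis unfolding M_def by (intro CollectI exI[of _ "w + w'"] exI[of _ a]) (simp add: add.assoc)
  qed
  have mem: "monom u \<in> L \<longleftrightarrow> u \<in> M" for u by (simp add: LM monomials_in_def)
  have seg: "v \<in> M" if "u \<in> M" "mdeg v = mdeg u" "u < v" for u v
    using L that unfolding lex_segment_ideal_def mem by blast
  have M: "ex2 a c \<in> M \<longleftrightarrow> g (a + c) \<le> a" for a c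
  proof -
    let ?i = "a + c"
    define S where "S = {a \<in> {..?i}. ex2 a (?i - a) \<notin> M}"
    have "{m. mdeg m = ?i \<and> m \<notin> M} = (\<lambda>a. ex2 a (?i - a)) ` S"
    proof (intro equalityI subsetI)
      fix m assume "m \<in> {m. mdeg m = ?i \<and> m \<notin> M}"
      then have m: "lookup m 0 + lookup m 1 = ?i" "m \<notin> M" by (auto simp: mdeg_2)
      have e: "m = ex2 (lookup m 0) (?i - lookup m 0)" by (rule ex2_eqI) (use m in simp_all)
      then have "lookup m 0 \<in> S" using m by (simp add: S_def)
      then show "m \<in> (\<lambda>a. ex2 a (?i - a)) ` S" using e by (rule_tac image_eqI)
    qed (auto simp: S_def)
    then have "g ?i = card ((\<lambda>a. ex2 a (?i - a)) ` S)"
      using hf[of ?i] monomials_in_hf[OF up, where 'k = 'k, of ?i] by (simp only: LM)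
    also have "\<dots> = card S" by (rule card_image) (auto simp: inj_on_def)
    finally have card: "g ?i = card S" .
    have "b \<in> S" if a: "a' \<in> S" and b: "b < a'" for a' b
    proof (rule ccontr)
      assume "b \<notin> S"
      then have "ex2 b (?i - b) \<in> M" using a b by (simp add: S_def)
      then have "ex2 a' (?i - a') \<in> M"
        by (rule seg) (use a b less_2_iff[of "ex2 b (?i - b)" "ex2 a' (?i - a')"] in \<open>simp_all add: S_def\<close>)
      then show False using a by (simp add: S_def)
    qed
    then have "S = {..<g ?i}" unfolding card by (intro down_closed_nat) (auto simp: S_def)
    then have "a \<in> S \<longleftrightarrow> a < g ?i" by blast
    then show ?thesis by (auto simp: S_def)
  qed
  have "m \<in> M \<longleftrightarrow> m \<in> lex_exps" for m
  proof -
    have e: "ex2 (lookup m 0) (lookup m 1) = m" by (rule ex2_eqI[symmetric]) simp_all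
    show ?thesis using M[of "lookup m 0" "lookup m 1"] unfolding e by (simp add: lex_exps_def mdeg_2)
  qed
  then have "M = lex_exps" by blast
  then show ?thesis by (simp only: LM)
qed

lemma Lex_eq: "(Lex (\<lambda>i. int (g i)) :: (2, 'k::field) mpoly set) = monomials_in lex_exps"
  unfolding Lex_def
proof (rule the_equality)
  have "hilbert_function (monomials_in lex_exps :: (2, 'k) mpoly set) i = g i" for i
    using monomials_in_hf[OF lex_exps_up, where 'k = 'k, of i] by (simp add: card_not_lex_exps)
  then show "lex_segment_ideal (monomials_in lex_exps :: (2, 'k) mpoly set) \<and>
    (\<forall>i. int (hilbert_function (monomials_in lex_exps :: (2, 'k) mpoly set) i) = int (g i))"
    by (simp add: lex_segment_monomials_in)
  fix L :: "(2, 'k) mpoly set"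
  assume "lex_segment_ideal L \<and> (\<forall>i. int (hilbert_function L i) = int (g i))"
  then show "L = monomials_in lex_exps" by (intro lex_segment_unique) simp_all
qed

lemma quot_dim_Lex: "quot_dim UNIV (Lex (\<lambda>i. int (g i)) :: (2, 'k::field) mpoly set) = n"
proof -
  have U: "- lex_exps = (\<Union>i\<in>{..<n}. {m. mdeg m = i \<and> m \<notin> lex_exps})"
  proof (intro equalityI subsetI)
    fix m assume m: "m \<in> - lex_exps"
    have "mdeg m < n"
    proof (rule ccontr)
      assume "\<not> mdeg m < n"
      then have "g (mdeg m) = 0" by (intro g_zero) simp
      then show False using m by (simp add: lex_exps_def)
    qed
    then show "m \<in> (\<Union>i\<in>{..<n}. {m. mdeg m = i \<and> m \<notin> lex_exps})" using m by simp
  qed auto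
  have fin: "finite {m :: 2 exps. mdeg m = i \<and> m \<notin> lex_exps}" for i
    by (rule finite_subset[OF _ finite_mdeg[of i]]) auto
  have "card (- lex_exps) = (\<Sum>i\<in>{..<n}. card {m. mdeg m = i \<and> m \<notin> lex_exps})"
    unfolding U by (rule card_UN_disjoint) (use fin in auto)
  also have "\<dots> = n" by (simp add: card_not_lex_exps g_sum)
  finally have c: "card (- lex_exps) = n" .
  have "finite (- lex_exps)" unfolding U using fin by blast
  then have "quot_dim UNIV (monomials_in lex_exps :: (2, 'k) mpoly set) = card (- lex_exps)"
    by (rule monomials_in_quot_dim[rotated]) (rule lex_exps_up)
  then show ?thesis by (simp only: Lex_eq c)
qed

lemma num_generators_Lex:
  assumes d: "g d \<le> d"
  shows "num_generators (Lex (\<lambda>i. int (g i)) :: (2, 'k::field) mpoly set) \<le> Suc d"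
proof -
  obtain A where A: "finite A" "card A \<le> Suc d" "lex_exps = {w + u | w u. u \<in> A}"
    using lex_ideal_generators[OF d] by blast
  let ?G = "monom ` A :: (2, 'k) mpoly set"
  have "num_generators (Lex (\<lambda>i. int (g i)) :: (2, 'k) mpoly set) \<le> card ?G"
    unfolding num_generators_def
  proof (rule Least_le, intro exI[of _ ?G] conjI)
    show "ideal_generated ?G = Lex (\<lambda>i. int (g i))" by (simp only: Lex_eq monomial_ideal_generated A(3))
  qed (use A in simp_all)
  also have "\<dots> \<le> card A" by (rule card_image_le[OF A(1)])
  finally show ?thesis using A(2) by simp
qed

end

section \<open>The cells of a stratum\<close>

lemma card_diagonal_boxes:
  assumes g: "\<And>i. g i \<le> Suc i" and B: "\<And>l s. (l, s) \<in> B \<longleftrightarrow> s < g (l + s)"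
  shows "card {(l, s) \<in> B. l + s \<le> N} = (\<Sum>i\<le>N. g i)"
proof -
  have "{(l, s) \<in> B. l + s \<le> N} = (\<lambda>(i, s). (i - s, s)) ` (SIGMA i:{..N}. {..<g i})"
  proof (intro equalityI subsetI)
    fix x assume "x \<in> {(l, s) \<in> B. l + s \<le> N}"
    then obtain l s where x: "x = (l, s)" "s < g (l + s)" "l + s \<le> N" using B by auto
    then show "x \<in> (\<lambda>(i, s). (i - s, s)) ` (SIGMA i:{..N}. {..<g i})" by (intro image_eqI[of _ _ "(l + s, s)"]) auto
  next
    fix x assume "x \<in> (\<lambda>(i, s). (i - s, s)) ` (SIGMA i:{..N}. {..<g i})"
    then obtain i s where x: "x = (i - s, s)" "i \<le> N" "s < g i" by auto
    then have "s \<le> i" using g[of i] by simp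
    then show "x \<in> {(l, s) \<in> B. l + s \<le> N}" using x B by auto
  qed
  moreover have "inj_on (\<lambda>(i, s). (i - s, s)) (SIGMA i:{..N}. {..<g i})"
  proof (rule inj_onI, clarify)
    fix i s j assume "s < g i" "s < g j" "i - s = j - s"
    then show "i = j \<and> s = s" using g[of i] g[of j] by simp
  qed
  ultimately show ?thesis by (simp add: card_image card_SigmaI)
qed

context hshape
begin

text \<open>On each diagonal \<open>l + s = i\<close> exactly \<open>g i\<close> boxes lie in the
  staircase, namely those with \<open>s < g i\<close>.\<close>

definition \<beta> :: "nat \<Rightarrow> nat" where "\<beta> l = (LEAST s. g (l + s) \<le> s)"

lemma \<beta>_le: "g (l + \<beta> l) \<le> \<beta> l"
  unfolding \<beta>_def by (rule LeastI[of _ n]) (simp add: g_zero)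

lemma less_\<beta>_iff: "s < \<beta> l \<longleftrightarrow> s < g (l + s)"
proof
  assume "s < \<beta> l"
  then show "s < g (l + s)" unfolding \<beta>_def using not_less_Least[of s "\<lambda>s. g (l + s) \<le> s"] by simp
next
  assume s: "s < g (l + s)"
  show "s < \<beta> l"
  proof (rule ccontr)
    assume "\<not> s < \<beta> l"
    then have "g (l + s) \<le> \<beta> l" "\<beta> l \<le> s" using g_anti[OF \<beta>_le[of l], of "l + s"] by auto
    then show False using s by simp
  qed
qed

lemma \<beta>_Suc: "\<beta> (Suc l) \<le> \<beta> l" and \<beta>_drop: "\<beta> l \<le> Suc (\<beta> (Suc l))"
proof -
  have "\<not> \<beta> l < g (Suc l + \<beta> l)" using g_anti[OF \<beta>_le[of l], of "Suc l + \<beta> l"] by simp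
  then show "\<beta> (Suc l) \<le> \<beta> l" using less_\<beta>_iff[of "\<beta> l" "Suc l"] by simp
  have "g (l + Suc (\<beta> (Suc l))) \<le> \<beta> (Suc l)" using \<beta>_le[of "Suc l"] by simp
  then show "\<beta> l \<le> Suc (\<beta> (Suc l))" using less_\<beta>_iff[of "Suc (\<beta> (Suc l))" l] by simp
qed

lemma \<beta>_shape: "cell_shape n \<beta>"
  unfolding cell_shape_def
proof (intro conjI allI impI \<beta>_Suc)
  fix l assume "n \<le> l"
  then show "\<beta> l = 0" using less_\<beta>_iff[of 0 l] g_zero[of l] by simp
qed

lemma card_boxes: "card {(l, s) \<in> boxes \<beta>. l + s \<le> N} = (\<Sum>i\<le>N. g i)"
  by (rule card_diagonal_boxes[OF g_le]) (simp add: boxes_def less_\<beta>_iff)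

lemma \<beta>_sum: "(\<Sum>l<n. \<beta> l) = n"
proof -
  have "{(l, s) \<in> boxes \<beta>. l + s \<le> n} = boxes \<beta>"
  proof (intro equalityI subsetI)
    fix x assume x: "x \<in> boxes \<beta>"
    obtain l s where ls: "x = (l, s)" by fastforce
    then have "s < g (l + s)" using x by (simp add: boxes_def less_\<beta>_iff)
    then have "\<not> n \<le> l + s" using g_zero[of "l + s"] by auto
    then show "x \<in> {(l, s) \<in> boxes \<beta>. l + s \<le> n}" using x ls by simp
  qed auto
  then have "card (boxes \<beta>) = (\<Sum>i\<le>n. g i)" using card_boxes[of n] by simp
  also have "\<dots> = n" using g_sum[of "Suc n"] by (simp add: lessThan_Suc_atMost)
  finally show ?thesis by (simp add: boxes_finite[OF \<beta>_shape])
qed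

text \<open>The staircase descends by steps of at most 1, so \<open>\<beta>\<^sub>l + l\<close> is weakly
  increasing and all parameters have \<open>s = 0\<close>.\<close>

lemma good_indices_\<beta>: "good_indices n \<beta> = cell_indices n \<beta>"
proof -
  have "s + (\<beta> l - \<beta> i) + l \<le> Suc i" if "l \<le> i" "s < \<beta> i - \<beta> (Suc i)" for i l s
  proof -
    have "\<beta> l + l \<le> \<beta> i + i" using that(1)
    proof (induction rule: inc_induct)
      case (step m)
      then show ?case using \<beta>_drop[of m] by simp
    qed simp
    then show ?thesis using that \<beta>_drop[of i] by simp
  qed
  note good = this
  have "l = Suc i \<or> s + (\<beta> l - \<beta> i) + l \<le> Suc i" if x: "(i, l, s) \<in> cell_indices n \<beta>" for i l s
  proof (cases "l = Suc i")
    case False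
    then show ?thesis using good[of l i s] x by (simp add: cell_indices_def)
  qed simp
  then show ?thesis unfolding good_indices_def by auto
qed

lemma dim_ge_regular:
  assumes H: "\<And>N. H N = (\<Sum>i\<le>N. g i)"
  shows "enat (n + \<beta> 0) \<le> dim_hilb_stratum TYPE('k::field) H"
proof -
  interpret cell_stratum n \<beta> by unfold_locales (rule \<beta>_shape, rule \<beta>_sum)
  have "enat (card (good_indices n \<beta>)) \<le> dim_hilb_stratum TYPE('k) H"
    by (rule dim_hilb_stratum_ge) (simp only: H card_boxes)
  then show ?thesis by (simp add: good_indices_\<beta> card_cell_indices[OF \<beta>_shape] \<beta>_sum)
qed

text \<open>Here all values of \<open>g\<close> are at most 1, so the staircase \<open>\<beta>\<close> of the
  regular cell is \<open>(1, \<dots>, 1)\<close> and its cell has only \<open>n + 1\<close> parameters. The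
  single column \<open>(n, 0, 0, \<dots>)\<close> has the same Hilbert function and the
  \<open>n + 2\<close> parameters of a line and a divisor of degree \<open>n\<close> on it.\<close>

lemma dim_ge_line:
  assumes H: "\<And>N. H N = (\<Sum>i\<le>N. g i)" and g1: "g (Suc 0) \<le> Suc 0" and n: "2 \<le> n"
  shows "enat (n + 2) \<le> dim_hilb_stratum TYPE('k::field) H"
proof -
  have g1': "g i \<le> 1" for i
  proof (cases i)
    case 0
    then show ?thesis using g_le[of 0] by simp
  next
    case (Suc j)
    then show ?thesis using g_anti[OF g1, of i] by simp
  qed
  have g_eq: "g i = (if i < n then 1 else 0)" for i
  proof (cases "i < n")
    case True
    have "g i = 1"
    proof (rule ccontr)
      assume "g i \<noteq> 1"
      then have gi: "g i \<le> 0" using g1'[of i] by simp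
      have "g j = 0" if "i \<le> j" for j using g_anti[OF gi _ that] by simp
      then have "(\<Sum>j<n. g j) = (\<Sum>j<i. g j)" using True by (intro sum.mono_neutral_right) auto
      also have "\<dots> \<le> (\<Sum>j<i. 1)" by (intro sum_mono g1')
      finally show False using g_sum[of n] True by simp
    qed
    then show ?thesis using True by simp
  qed (simp add: g_zero)
  define \<gamma> where "\<gamma> l = (if l = 0 then n else 0)" for l :: nat
  have sh: "cell_shape n \<gamma>" using n by (auto simp: cell_shape_def \<gamma>_def)
  have sum: "(\<Sum>l<n. \<gamma> l) = n" unfolding \<gamma>_def using n by (simp add: sum.delta)
  interpret cell_stratum n \<gamma> by unfold_locales (rule sh, rule sum)
  have "card {(l, s) \<in> boxes \<gamma>. l + s \<le> N} = (\<Sum>i\<le>N. g i)" for N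
  proof -
    have "{(l, s) \<in> boxes \<gamma>. l + s \<le> N} = Pair 0 ` ({..N} \<inter> {..<n})" by (auto simp: boxes_def \<gamma>_def split: if_splits)
    then have "card {(l, s) \<in> boxes \<gamma>. l + s \<le> N} = card ({..N} \<inter> {..<n})" by (simp add: card_image inj_on_def)
    also have "\<dots> = (\<Sum>i\<in>{..N} \<inter> {..<n}. 1)" by simp
    also have "\<dots> = (\<Sum>i\<le>N. g i)" by (intro sum.mono_neutral_cong_left) (auto simp: g_eq)
    finally show ?thesis .
  qed
  then have "enat (card (good_indices n \<gamma>)) \<le> dim_hilb_stratum TYPE('k) H"
    by (intro dim_hilb_stratum_ge) (simp only: H)
  moreover have "good_indices n \<gamma> = (\<lambda>s. (0, Suc 0, s)) ` {..<n} \<union> {(0, 0, 0), (0, 0, 1)}"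
    using n by (auto simp: good_indices_def cell_indices_def \<gamma>_def le_Suc_eq split: if_splits)
  then have "card (good_indices n \<gamma>) = n + 2"
  proof -
    assume e: "good_indices n \<gamma> = (\<lambda>s. (0, Suc 0, s)) ` {..<n} \<union> {(0, 0, 0), (0, 0, 1)}"
    let ?S = "(\<lambda>s :: nat. (0 :: nat, Suc 0, s)) ` {..<n}" and ?T = "{(0 :: nat, 0 :: nat, 0 :: nat), (0, 0, 1)}"
    have "card ?S = n" by (simp add: card_image inj_on_def)
    moreover have "card ?T = 2" by simp
    moreover have "card (?S \<union> ?T) = card ?S + card ?T" by (rule card_Un_disjoint) auto
    ultimately show ?thesis unfolding e by (simp only:)
  qed
  ultimately show ?thesis by simp
qed

lemma dim_ge:
  assumes H: "\<And>N. H N = (\<Sum>i\<le>N. g i)" and n: "2 \<le> n"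
  shows "enat (max (n + (num_generators (Lex (\<lambda>i. int (g i)) :: (2, 'k::field) mpoly set) - 1)) (n + 2)) \<le> dim_hilb_stratum TYPE('k) H"
proof -
  let ?t = "num_generators (Lex (\<lambda>i. int (g i)) :: (2, 'k) mpoly set) - 1"
  have t: "?t \<le> d" if "g d \<le> d" for d
    using num_generators_Lex[OF that, where 'k = 'k] by simp
  have t\<beta>: "?t \<le> \<beta> 0" using \<beta>_le[of 0] by (intro t) simp
  have "\<beta> 0 \<noteq> 0"
  proof
    assume "\<beta> 0 = 0"
    then have "g 0 \<le> 0" using \<beta>_le[of 0] by simp
    then have "g N = 0" for N using g_anti[of 0 0 N] by simp
    then show False using g_sum[of n] n by simp
  qed
  then consider "2 \<le> \<beta> 0" | "\<beta> 0 = 1" by linarith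
  then show ?thesis
  proof cases
    case 1
    then have "enat (max (n + ?t) (n + 2)) \<le> enat (n + \<beta> 0)" using t\<beta> by simp
    also have "\<dots> \<le> dim_hilb_stratum TYPE('k) H" by (rule dim_ge_regular[OF H])
    finally show ?thesis .
  next
    case 2
    have "max (n + ?t) (n + 2) = n + 2" using t\<beta> 2 by simp
    then have "enat (max (n + ?t) (n + 2)) = enat (n + 2)" by (rule arg_cong)
    also have "\<dots> \<le> dim_hilb_stratum TYPE('k) H"
      by (rule dim_ge_line[OF H _ n]) (use \<beta>_le[of 0] 2 in simp)
    finally show ?thesis .
  qed
qed

end

section \<open>The dimension of a Hilbert function stratum\<close>

lemma bounded_sums_eventually_zero:
  fixes g :: "nat \<Rightarrow> nat"
  assumes "\<And>N. (\<Sum>i\<le>N. g i) \<le> b"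
  shows "\<exists>M. \<forall>N\<ge>M. g N = 0"
proof -
  have "finite {i. g i \<noteq> 0}"
  proof (rule ccontr)
    assume "infinite {i. g i \<noteq> 0}"
    then obtain F where F: "F \<subseteq> {i. g i \<noteq> 0}" "finite F" "card F = Suc b"
      using infinite_arbitrarily_large by metis
    have "Suc b = (\<Sum>i\<in>F. 1)" using F(3) by simp
    also have "\<dots> \<le> (\<Sum>i\<in>F. g i)" using F(1) by (intro sum_mono) auto
    also have "\<dots> \<le> (\<Sum>i\<le>Max F. g i)" using F(2) by (intro sum_mono2) auto
    finally show False using assms[of "Max F"] by simp
  qed
  then have "\<exists>M. \<forall>i\<in>{i. g i \<noteq> 0}. i < M" using finite_nat_set_iff_bounded by blast
  then obtain M where "\<forall>i\<in>{i. g i \<noteq> 0}. i < M" ..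
  then show ?thesis by (intro exI[of _ M]) (auto simp: not_less[symmetric])
qed

text \<open>A nonzerodivisor among the linear forms is found over the algebraic closure, since
  \<open>K\<close> may be finite.\<close>

lemma hilbert_function_shape:
  fixes I :: "(3, 'k::field) mpoly set"
  assumes I: "homogeneous_ideal I" "saturated_ideal I" "defines_zero_dimensional I"
  shows "\<exists>g n. hshape g n \<and> (\<forall>N. hilbert_function I N = (\<Sum>i\<le>N. g i))"
proof -
  let ?H = "hilbert_function I"
  have "krull_dim (proj_space I) = 0" using I(3) by (simp add: defines_zero_dimensional_def)
  from zero_dimensional_bounded[OF I(1) this] obtain b where b: "\<forall>N. ?H N \<le> b" by (elim exE)
  let ?J = "ext_ideal I"
  have J: "homogeneous_ideal ?J" "saturated_ideal ?J" "hilbert_function ?J = ?H"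
    using I by (simp_all add: ext_ideal_homogeneous ext_ideal_saturated hilbert_function_ext_ideal)
  obtain A :: "'k alg_closure set" where A: "finite A" "card A = Suc (2 * b)"
    using infinite_arbitrarily_large[OF infinite_UNIV_alg_closed] by blast
  have "\<forall>\<^sub>F i in sequentially. hilbert_function ?J i \<le> b" using b J(3) by simp
  from exists_nonzerodivisor[OF J(1,2) this A(1)] obtain a where a: "\<forall>f. lin a * f \<in> ?J \<longrightarrow> f \<in> ?J"
    using A(2) by auto
  define g where "g = hilbert_function (add_gen ?J (lin a))"
  have H: "?H N = (\<Sum>i\<le>N. g i)" for N
    using hf_sum[OF J(1), of a N] a J(3) by (simp add: g_def)
  have "(\<Sum>i\<le>N. g i) \<le> b" for N using b[rule_format, of N] unfolding H .
  from bounded_sums_eventually_zero[OF this] obtain M where M: "\<forall>N\<ge>M. g N = 0" by (elim exE)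
  have "hshape g (\<Sum>i<M. g i)"
  proof
    show "g N \<le> Suc N" for N unfolding g_def by (rule hf_hyperplane_shape(1)[OF J(1)]) (use a in blast)
    show "g (Suc N) \<le> g N" if "g N \<le> N" for N
      using that unfolding g_def by (rule hf_hyperplane_shape(2)[OF J(1), rotated]) (use a in blast)
    show "\<exists>M'. (\<forall>N\<ge>M'. g N = 0) \<and> (\<Sum>i<M'. g i) = (\<Sum>i<M. g i)" using M by (intro exI[of _ M]) simp
  qed
  then show ?thesis using H by (intro exI conjI allI)
qed

theorem corollary4p2:
  fixes I :: "(3, 'k::field) mpoly set"
    and L :: "(2, 'k) mpoly set"
    and H :: "nat \<Rightarrow> nat" and h :: "nat \<Rightarrow> int" and n t :: nat
  assumes "homogeneous_ideal I" and "saturated_ideal I" and "defines_zero_dimensional I"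
    and "H = hilbert_function I"
    and "h = first_difference H"
    and "CHAR('k) = 0 \<or> CHAR('k) > Max {j. h j \<noteq> 0}"
    and "L = Lex h"
    and "n = quot_dim UNIV L"
    and "t = num_generators L - 1"
    and "n \<ge> 2"
  shows "enat (max (n + t) (n + 2)) \<le> dim_hilb_stratum TYPE('k) H
    \<and> dim_hilb_stratum TYPE('k) H \<le> enat (2 * n)"
proof -
  obtain g n' where g: "hshape g n'" and H: "\<forall>N. H N = (\<Sum>i\<le>N. g i)"
    using hilbert_function_shape[OF assms(1-3)] assms(4) by auto
  interpret hshape g n' by (rule g)
  have h: "h = (\<lambda>i. int (g i))"
  proof
    fix i show "h i = int (g i)" unfolding assms(5) first_difference_def by (cases i) (simp_all add: H)
  qed
  have n: "n = n'" unfolding assms(8,7) h by (rule quot_dim_Lex)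
  have Hn: "H N = n" if "n \<le> N" for N
    using g_sum[of "Suc N"] that by (simp add: H n lessThan_Suc_atMost)
  have "num_points H = n" by (rule num_points_eqI[OF Hn])
  then have "dim_hilb_stratum TYPE('k) H \<le> enat (2 * n)"
    by (rule dim_hilb_stratum_le) (simp add: Hn)
  moreover have "enat (max (n + t) (n + 2)) \<le> dim_hilb_stratum TYPE('k) H"
    using dim_ge[OF H[rule_format], where 'k = 'k] assms(10) unfolding assms(9,7) h n by simp
  ultimately show ?thesis by blast
qed

end
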